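(* Let $F,G\in\mathcal{E}^d$ be such that $\mathcal{Q}_q(F)+\mathcal{Q}_q(G)<\infty$ for every $q\in\mathbb{N}=\{0,1,2,\dots\}$. Then for every $k\in\mathbb{N}$, every multi-index $\alpha=(\alpha_1,\dots,\alpha_m)\in\{1,\dots,d\}^m$ and every $\varepsilon\in(0,1)$ there exist constants $C$ and $q$ (depending on $\varepsilon$, $k$ and $m$, and on the fixed dimension $d$ and super kernel) such that for every $f\in C_b^\infty(\mathbb{R}^d)$ $$\left|\mathbb{E}(\partial^\alpha f(F))-\mathbb{E}(\partial^\alpha f(G))\right|\le C\,d_k(F,G)^{1-\varepsilon}\,\|f\|_\infty\,(\mathcal{Q}_q(F)+\mathcal{Q}_q(G))^{\varepsilon}.$$ In particular, if $p_F$ and $p_G$ are the density functions of $F$ and $G$ respectively, then for every $x\in\mathbb{R}^d$ $$\left|\partial^\alpha p_F(x)-\partial^\alpha p_G(x)\right|\le C\,d_k(F,G)^{1-\varepsilon}\,(\mathcal{Q}_q(F)+\mathcal{Q}_q(G))^{\varepsilon}.$$ The same estimates hold with $d_k(F,G)^{1-\varepsilon}$ replaced by $d_{CF}(F,G)^{1-\varepsilon}$.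
   Context: Abstract framework. $(\Omega,\mathcal{F},\mathbb{P})$ is a probability space and $\mathcal{E}\subset\bigcap_{p>1}L^p(\Omega;\mathbb{R})$. $C_p^\infty(\mathbb{R}^d)$ denotes smooth functions which, with all their derivatives, have polynomial growth. It is assumed that $\phi(F)\in\mathcal{E}$ for every $d$, $\phi\in C_p^\infty(\mathbb{R}^d)$, $F\in\mathcal{E}^d$ (so $\mathcal{E}$ is an algebra). There are a symmetric bilinear $\Gamma:\mathcal{E}\times\mathcal{E}\to\mathcal{E}$ with $\Gamma(F,F)\ge0$, and $\Gamma(F,F)=0$ iff $F$ is a.s. constant, and a linear operator $L:\mathcal{E}\to\mathcal{E}$, satisfying: (chain rule) $\Gamma(\phi(F),G)=\sum_{i=1}^d\partial_i\phi(F)\Gamma(F_i,G)$ for $\phi\in C_p^\infty(\mathbb{R}^d)$, $F\in\mathcal{E}^d$, $G\in\mathcal{E}$; (duality) $\mathbb{E}(\Gamma(F,G))=\mathbb{E}(F\,LG)=\mathbb{E}(G\,LF)$ for $F,G\in\mathcal{E}$. There are a separable Hilbert space $\mathcal{H}$ and a linear map $D:\mathcal{E}\to\bigcap_{p>1}L^p(\Omega;\mathcal{H})$ with $\Gamma(F,G)=\langle DF,DG\rangle_{\mathcal{H}}$, $D_hF:=\langle DF,h\rangle\in\mathcal{E}$ for $h\in\mathcal{H}$, and $D\phi(F)=\sum_i\partial_i\phi(F)DF_i$. Higher derivatives $D^k:\mathcal{E}\to\bigcap_{p>1}L^p(\Omega;\mathcal{H}^{\otimes k})$ are given by $\langle D^kF,h_1\otimes\cdots\otimes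 h_k\rangle=D_{h_k}\cdots D_{h_1}F$. Norms. For $F\in\mathcal{E}$: $|F|_{1,k}=\sum_{i=1}^k|D^iF|_{\mathcal{H}^{\otimes i}}$, $|F|_k=|F|+|F|_{1,k}$; for $F\in\mathcal{E}^d$ these are summed over components, and $LF=(LF_1,\dots,LF_d)$. The Malliavin covariance matrix of $F\in\mathcal{E}^d$ is $\sigma_F^{i,j}=\Gamma(F_i,F_j)$. Set $\mathcal{C}_n(F)=(|F|_{1,n+1}+|LF|_n)^n(1+|F|_{1,n+1})^{4dn}$, $\mathcal{C}_{n,p}(F)=\|\mathcal{C}_n(F)\|_{L^p(\Omega)}$, and $\mathcal{Q}_l(F)=\mathcal{C}_{l,2}(F)\,\big(\mathbb{E}[(\det\sigma_F)^{-2l}]\big)^{1/2}$. Super kernel. A super kernel $\phi:\mathbb{R}^d\to\mathbb{R}$ is a Schwartz function with $\int\phi=1$, $\int y^\alpha\phi(y)dy=0$ for all $|\alpha|\ge1$, and $\int|y|^m|\partial_\beta\phi(y)|dy<\infty$ for all $m,\beta$; one is fixed once and for all. Distances. $d_k(F,G)=\sup\{|\mathbb{E}(f(F))-\mathbb{E}(f(G))|:\sum_{|\alpha|=k}\|\partial^\alpha f\|_\infty\le1\}\in[0,\infty]$, over $f\in C^k(\mathbb{R}^d)$; for $k=0$ the test functions are just measurable with $\|f\|_\infty\le1$. $d_{CF}(F,G)=\sup_{\vartheta\in\mathbb{R}^d}|\mathbb{E}(e^{\mathbf{i}\langle\vartheta,F\rangle})-\mathbb{E}(e^{\mathbf{i}\langle\vartheta,G\rangle})|$.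 For $\alpha=(\alpha_1,\dots,\alpha_m)$, $\partial^\alpha=\partial_{\alpha_1}\cdots\partial_{\alpha_m}$. $C_b^\infty(\mathbb{R}^d)$: smooth functions bounded with all derivatives.
   Formalization: In the estimate of expectations with d_CF, the constant C may also depend on an upper bound for the r-th absolute moments of F and G (r depending on ε, k, m, d, super kernel); with C independent of F and G that estimate is false. The other three estimates are as stated. *)

theory Defs
  imports "HOL-Probability.Probability"
begin

section \<open>Smooth functions on Euclidean space\<close>

definition pd :: "'d::finite \<Rightarrow> (real^'d \<Rightarrow> real) \<Rightarrow> real^'d \<Rightarrow> real" where
  "pd i f = (\<lambda>x. frechet_derivative f (at x) (axis i 1))"

text \<open>A multi-index is the list of the directions of differentiation, as in
  \<open>\<partial>\<^sup>\<alpha> = \<partial>\<^bsub>\<alpha>\<^sub>1\<^esub> \<dots> \<partial>\<^bsub>\<alpha>\<^sub>m\<^esub>\<close>; its order is the length of the list.\<close>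

definition pds :: "'d::finite list \<Rightarrow> (real^'d \<Rightarrow> real) \<Rightarrow> real^'d \<Rightarrow> real" where
  "pds \<alpha> f = foldr pd \<alpha> f"

definition C_k :: "nat \<Rightarrow> (real^'d::finite \<Rightarrow> real) set" where
  "C_k k = {f. (\<forall>\<alpha>. length \<alpha> < k \<longrightarrow> pds \<alpha> f differentiable_on UNIV) \<and>
               (\<forall>\<alpha>. length \<alpha> \<le> k \<longrightarrow> continuous_on UNIV (pds \<alpha> f))}"

definition C_infty :: "(real^'d::finite \<Rightarrow> real) set" where
  "C_infty = {f. \<forall>\<alpha>. pds \<alpha> f differentiable_on UNIV}"

definition C_b_infty :: "(real^'d::finite \<Rightarrow> real) set" where
  "C_b_infty = {f \<in> C_infty. \<forall>\<alpha>. bounded (range (pds \<alpha> f))}"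

definition schwartz :: "(real^'d::finite \<Rightarrow> real) set" where
  "schwartz = {f \<in> C_infty. \<forall>\<alpha> n. bounded (range (\<lambda>x. norm x ^ n * pds \<alpha> f x))}"

definition super_kernel :: "(real^'d::finite \<Rightarrow> real) \<Rightarrow> bool" where
  "super_kernel \<phi> \<longleftrightarrow>
     \<phi> \<in> schwartz \<and>
     (\<integral>y. \<phi> y \<partial>lborel) = 1 \<and>
     (\<forall>\<alpha>. \<alpha> \<noteq> [] \<longrightarrow> (\<integral>y. (\<Prod>i\<leftarrow>\<alpha>. y $ i) * \<phi> y \<partial>lborel) = 0) \<and>
     (\<forall>m \<beta>. integrable lborel (\<lambda>y. norm y ^ m * \<bar>pds \<beta> \<phi> y\<bar>))"

definition supnorm :: "(real^'d::finite \<Rightarrow> real) \<Rightarrow> ennreal" where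
  "supnorm f = (SUP x. ennreal \<bar>f x\<bar>)"

text \<open>The exponents used below are positive, so that \<open>\<infinity>\<close> to the power \<open>a\<close> is \<open>\<infinity>\<close>.\<close>

definition epowr :: "ennreal \<Rightarrow> real \<Rightarrow> ennreal" where
  "epowr x a = (if x = \<infinity> then \<infinity> else ennreal (enn2real x powr a))"

section \<open>Smooth functions of polynomial growth in any number of variables\<close>

text \<open>The chain rule of the framework quantifies over all dimensions \<open>n\<close>, hence inside a formula.
  A function on \<open>\<real>\<^sup>n\<close> is therefore represented here by a function of sequences that depends on the
  coordinates below \<open>n\<close> only; for such functions, continuity in the product topology is continuity
  on \<open>\<real>\<^sup>n\<close>.\<close>

definition seq_pd :: "nat \<Rightarrow> ((nat \<Rightarrow> real) \<Rightarrow> real) \<Rightarrow> (nat \<Rightarrow> real) \<Rightarrow> real" where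
  "seq_pd i \<phi> = (\<lambda>x. deriv (\<lambda>t. \<phi> (x(i := t))) (x i))"

definition C_p_infty :: "nat \<Rightarrow> ((nat \<Rightarrow> real) \<Rightarrow> real) set" where
  "C_p_infty n = {\<phi>.
     (\<forall>x y. (\<forall>i<n. x i = y i) \<longrightarrow> \<phi> x = \<phi> y) \<and>
     (\<forall>\<alpha>. set \<alpha> \<subseteq> {..<n} \<longrightarrow>
        continuous_on UNIV (foldr seq_pd \<alpha> \<phi>) \<and>
        (\<forall>i<n. \<forall>x. (\<lambda>t. foldr seq_pd \<alpha> \<phi> (x(i := t))) differentiable (at (x i))) \<and>
        (\<exists>K p. \<forall>x. \<bar>foldr seq_pd \<alpha> \<phi> x\<bar> \<le> K * (1 + (\<Sum>i<n. \<bar>x i\<bar>)) ^ p))}"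

section \<open>The abstract framework\<close>

definition all_Lp :: "'w measure \<Rightarrow> ('w \<Rightarrow> 'b::real_normed_vector) set" where
  "all_Lp M = {X \<in> borel_measurable M. \<forall>p>1. integrable M (\<lambda>\<omega>. norm (X \<omega>) powr p)}"

text \<open>The Hilbert tensor powers of \<open>'h\<close> are realised inside a Hilbert space \<open>'t\<close>, where
  \<open>tens [h\<^sub>1, \<dots>, h\<^sub>k]\<close> stands for \<open>h\<^sub>1 \<otimes> \<dots> \<otimes> h\<^sub>k\<close>. The inner products of the elementary tensors
  force multilinearity, and together with density of their span they determine the \<open>k\<close>-th tensor
  power up to a unique isometry. Nothing is required about tensors of different orders (\<open>'t\<close> may be
  the Fock space over \<open>'h\<close>).\<close>

definition tensor_map :: "('h::real_inner list \<Rightarrow> 't::real_inner) \<Rightarrow> bool" where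
  "tensor_map tens \<longleftrightarrow>
     (\<forall>hs gs. length hs = length gs \<longrightarrow>
        inner (tens hs) (tens gs) = (\<Prod>i<length hs. inner (hs ! i) (gs ! i)))"

definition tensor_power :: "('h::real_inner list \<Rightarrow> 't::real_inner) \<Rightarrow> nat \<Rightarrow> 't set" where
  "tensor_power tens k = closure (span (tens ` {hs. length hs = k}))"

definition dir_deriv :: "(('w \<Rightarrow> real) \<Rightarrow> 'w \<Rightarrow> 'h::real_inner) \<Rightarrow> 'h \<Rightarrow> ('w \<Rightarrow> real) \<Rightarrow> 'w \<Rightarrow> real" where
  "dir_deriv D h F = (\<lambda>\<omega>. inner (D F \<omega>) h)"

text \<open>The elements of the spaces \<open>L\<^sup>p\<close> are classes of random variables modulo a.s. equality. Here \<open>E\<close>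
  is the set of all representatives of its classes, the operators act on representatives compatibly
  with a.s. equality, and identities between random variables hold almost surely.
  \<open>DD k\<close> is the \<open>k\<close>-th iterated derivative; only \<open>k \<ge> 1\<close> is constrained.\<close>

locale malliavin_framework = prob_space M
  for M :: "'w measure"
    and E :: "('w \<Rightarrow> real) set"
    and \<Gamma> :: "('w \<Rightarrow> real) \<Rightarrow> ('w \<Rightarrow> real) \<Rightarrow> 'w \<Rightarrow> real"
    and L :: "('w \<Rightarrow> real) \<Rightarrow> 'w \<Rightarrow> real"
    and tens :: "'h::{real_inner, polish_space} list \<Rightarrow> 't::{real_inner, polish_space}"
    and D :: "('w \<Rightarrow> real) \<Rightarrow> 'w \<Rightarrow> 'h"
    and DD :: "nat \<Rightarrow> ('w \<Rightarrow> real) \<Rightarrow> 'w \<Rightarrow> 't" +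
  assumes E_Lp: "E \<subseteq> all_Lp M"
    and E_AE: "\<And>F F'. F \<in> E \<Longrightarrow> F' \<in> borel_measurable M \<Longrightarrow> (AE \<omega> in M. F \<omega> = F' \<omega>) \<Longrightarrow> F' \<in> E"
    and E_smooth: "\<And>n \<phi> F. \<phi> \<in> C_p_infty n \<Longrightarrow> (\<And>i. i < n \<Longrightarrow> F i \<in> E) \<Longrightarrow>
          (\<lambda>\<omega>. \<phi> (\<lambda>i. F i \<omega>)) \<in> E"

    and \<Gamma>_in: "\<And>F G. F \<in> E \<Longrightarrow> G \<in> E \<Longrightarrow> \<Gamma> F G \<in> E"
    and \<Gamma>_AE: "\<And>F F' G. F \<in> E \<Longrightarrow> F' \<in> E \<Longrightarrow> G \<in> E \<Longrightarrow> (AE \<omega> in M. F \<omega> = F' \<omega>) \<Longrightarrow>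
          AE \<omega> in M. \<Gamma> F G \<omega> = \<Gamma> F' G \<omega>"
    and \<Gamma>_sym: "\<And>F G. F \<in> E \<Longrightarrow> G \<in> E \<Longrightarrow> AE \<omega> in M. \<Gamma> F G \<omega> = \<Gamma> G F \<omega>"
    and \<Gamma>_linear: "\<And>a b F G H. F \<in> E \<Longrightarrow> G \<in> E \<Longrightarrow> H \<in> E \<Longrightarrow>
          AE \<omega> in M. \<Gamma> (\<lambda>\<omega>. a * F \<omega> + b * G \<omega>) H \<omega> = a * \<Gamma> F H \<omega> + b * \<Gamma> G H \<omega>"
    and \<Gamma>_nonneg: "\<And>F. F \<in> E \<Longrightarrow> AE \<omega> in M. 0 \<le> \<Gamma> F F \<omega>"
    and \<Gamma>_eq_0_iff: "\<And>F. F \<in> E \<Longrightarrow>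
          (AE \<omega> in M. \<Gamma> F F \<omega> = 0) \<longleftrightarrow> (\<exists>c. AE \<omega> in M. F \<omega> = c)"
    and \<Gamma>_chain: "\<And>n \<phi> F G. \<phi> \<in> C_p_infty n \<Longrightarrow> (\<And>i. i < n \<Longrightarrow> F i \<in> E) \<Longrightarrow> G \<in> E \<Longrightarrow>
          AE \<omega> in M. \<Gamma> (\<lambda>\<omega>. \<phi> (\<lambda>i. F i \<omega>)) G \<omega> =
            (\<Sum>i<n. seq_pd i \<phi> (\<lambda>j. F j \<omega>) * \<Gamma> (F i) G \<omega>)"

    and L_in: "\<And>F. F \<in> E \<Longrightarrow> L F \<in> E"
    and L_AE: "\<And>F F'. F \<in> E \<Longrightarrow> F' \<in> E \<Longrightarrow> (AE \<omega> in M. F \<omega> = F' \<omega>) \<Longrightarrow>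
          AE \<omega> in M. L F \<omega> = L F' \<omega>"
    and L_linear: "\<And>a b F G. F \<in> E \<Longrightarrow> G \<in> E \<Longrightarrow>
          AE \<omega> in M. L (\<lambda>\<omega>. a * F \<omega> + b * G \<omega>) \<omega> = a * L F \<omega> + b * L G \<omega>"
    and duality1: "\<And>F G. F \<in> E \<Longrightarrow> G \<in> E \<Longrightarrow>
          (\<integral>\<omega>. \<Gamma> F G \<omega> \<partial>M) = (\<integral>\<omega>. F \<omega> * L G \<omega> \<partial>M)"
    and duality2: "\<And>F G. F \<in> E \<Longrightarrow> G \<in> E \<Longrightarrow>
          (\<integral>\<omega>. \<Gamma> F G \<omega> \<partial>M) = (\<integral>\<omega>. G \<omega> * L F \<omega> \<partial>M)"

    and D_Lp: "\<And>F. F \<in> E \<Longrightarrow> D F \<in> all_Lp M"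
    and D_AE: "\<And>F F'. F \<in> E \<Longrightarrow> F' \<in> E \<Longrightarrow> (AE \<omega> in M. F \<omega> = F' \<omega>) \<Longrightarrow>
          AE \<omega> in M. D F \<omega> = D F' \<omega>"
    and D_linear: "\<And>a b F G. F \<in> E \<Longrightarrow> G \<in> E \<Longrightarrow>
          AE \<omega> in M. D (\<lambda>\<omega>. a * F \<omega> + b * G \<omega>) \<omega> = a *\<^sub>R D F \<omega> + b *\<^sub>R D G \<omega>"
    and \<Gamma>_eq_inner: "\<And>F G. F \<in> E \<Longrightarrow> G \<in> E \<Longrightarrow> AE \<omega> in M. \<Gamma> F G \<omega> = inner (D F \<omega>) (D G \<omega>)"
    and dir_deriv_in: "\<And>F h. F \<in> E \<Longrightarrow> dir_deriv D h F \<in> E"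
    and D_chain: "\<And>n \<phi> F. \<phi> \<in> C_p_infty n \<Longrightarrow> (\<And>i. i < n \<Longrightarrow> F i \<in> E) \<Longrightarrow>
          AE \<omega> in M. D (\<lambda>\<omega>. \<phi> (\<lambda>i. F i \<omega>)) \<omega> =
            (\<Sum>i<n. seq_pd i \<phi> (\<lambda>j. F j \<omega>) *\<^sub>R D (F i) \<omega>)"

    and tens: "tensor_map tens"
    and DD_Lp: "\<And>k F. 1 \<le> k \<Longrightarrow> F \<in> E \<Longrightarrow> DD k F \<in> all_Lp M"
    and DD_tensor: "\<And>k F. 1 \<le> k \<Longrightarrow> F \<in> E \<Longrightarrow> AE \<omega> in M. DD k F \<omega> \<in> tensor_power tens k"
    and DD_inner: "\<And>hs F. hs \<noteq> [] \<Longrightarrow> F \<in> E \<Longrightarrow>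
          AE \<omega> in M. inner (DD (length hs) F \<omega>) (tens hs) = fold (dir_deriv D) hs F \<omega>"

section \<open>Norms and the non-degeneracy functional\<close>

text \<open>A random vector is given by the family of its components; \<open>rvec F\<close> takes values in \<open>real^'d\<close>.\<close>

definition rvec :: "('d::finite \<Rightarrow> 'w \<Rightarrow> real) \<Rightarrow> 'w \<Rightarrow> real^'d" where
  "rvec F \<omega> = (\<chi> i. F i \<omega>)"

definition norm1k :: "(nat \<Rightarrow> ('w \<Rightarrow> real) \<Rightarrow> 'w \<Rightarrow> 't::real_inner) \<Rightarrow> nat \<Rightarrow> ('w \<Rightarrow> real) \<Rightarrow> 'w \<Rightarrow> real" where
  "norm1k DD k F \<omega> = (\<Sum>i=1..k. norm (DD i F \<omega>))"

definition normk :: "(nat \<Rightarrow> ('w \<Rightarrow> real) \<Rightarrow> 'w \<Rightarrow> 't::real_inner) \<Rightarrow> nat \<Rightarrow> ('w \<Rightarrow> real) \<Rightarrow> 'w \<Rightarrow> real" where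
  "normk DD k F \<omega> = \<bar>F \<omega>\<bar> + norm1k DD k F \<omega>"

definition malliavin_cov ::
  "(('w \<Rightarrow> real) \<Rightarrow> ('w \<Rightarrow> real) \<Rightarrow> 'w \<Rightarrow> real) \<Rightarrow> ('d::finite \<Rightarrow> 'w \<Rightarrow> real) \<Rightarrow> 'w \<Rightarrow> real^'d^'d" where
  "malliavin_cov \<Gamma> F \<omega> = (\<chi> i j. \<Gamma> (F i) (F j) \<omega>)"

definition C_n ::
  "(('w \<Rightarrow> real) \<Rightarrow> 'w \<Rightarrow> real) \<Rightarrow> (nat \<Rightarrow> ('w \<Rightarrow> real) \<Rightarrow> 'w \<Rightarrow> 't::real_inner) \<Rightarrow> nat \<Rightarrow>
   ('d::finite \<Rightarrow> 'w \<Rightarrow> real) \<Rightarrow> 'w \<Rightarrow> real" where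
  "C_n L DD n F \<omega> =
     ((\<Sum>i\<in>UNIV. norm1k DD (n + 1) (F i) \<omega>) + (\<Sum>i\<in>UNIV. normk DD n (L (F i)) \<omega>)) ^ n
     * (1 + (\<Sum>i\<in>UNIV. norm1k DD (n + 1) (F i) \<omega>)) ^ (4 * CARD('d) * n)"

definition C_np ::
  "'w measure \<Rightarrow> (('w \<Rightarrow> real) \<Rightarrow> 'w \<Rightarrow> real) \<Rightarrow> (nat \<Rightarrow> ('w \<Rightarrow> real) \<Rightarrow> 'w \<Rightarrow> 't::real_inner) \<Rightarrow>
   nat \<Rightarrow> real \<Rightarrow> ('d::finite \<Rightarrow> 'w \<Rightarrow> real) \<Rightarrow> ennreal" where
  "C_np M L DD n p F = epowr (\<integral>\<^sup>+\<omega>. ennreal (C_n L DD n F \<omega> powr p) \<partial>M) (1 / p)"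

text \<open>In \<^typ>\<open>ennreal\<close>, \<open>inverse 0 = \<infinity>\<close>, so a determinant vanishing on a set of positive
  probability gives an infinite moment when \<open>l \<ge> 1\<close>.\<close>

definition det_neg_moment ::
  "'w measure \<Rightarrow> (('w \<Rightarrow> real) \<Rightarrow> ('w \<Rightarrow> real) \<Rightarrow> 'w \<Rightarrow> real) \<Rightarrow> nat \<Rightarrow> ('d::finite \<Rightarrow> 'w \<Rightarrow> real) \<Rightarrow> ennreal" where
  "det_neg_moment M \<Gamma> l F = (\<integral>\<^sup>+\<omega>. inverse (ennreal (det (malliavin_cov \<Gamma> F \<omega>) ^ (2 * l))) \<partial>M)"

text \<open>The case distinction rules out the convention \<open>0 * \<infinity> = 0\<close> of the library, under which an
  a.s. constant (hence degenerate) \<open>F\<close> would have a finite value.\<close>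

definition Q_l ::
  "'w measure \<Rightarrow> (('w \<Rightarrow> real) \<Rightarrow> ('w \<Rightarrow> real) \<Rightarrow> 'w \<Rightarrow> real) \<Rightarrow> (('w \<Rightarrow> real) \<Rightarrow> 'w \<Rightarrow> real) \<Rightarrow>
   (nat \<Rightarrow> ('w \<Rightarrow> real) \<Rightarrow> 'w \<Rightarrow> 't::real_inner) \<Rightarrow> nat \<Rightarrow> ('d::finite \<Rightarrow> 'w \<Rightarrow> real) \<Rightarrow> ennreal" where
  "Q_l M \<Gamma> L DD l F =
     (if det_neg_moment M \<Gamma> l F = \<infinity> then \<infinity>
      else C_np M L DD l 2 F * epowr (det_neg_moment M \<Gamma> l F) (1 / 2))"

section \<open>Distances between laws and smooth densities\<close>

definition test_functions :: "nat \<Rightarrow> (real^'d::finite \<Rightarrow> real) set" where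
  "test_functions k =
     {f \<in> (if k = 0 then borel_measurable borel else C_k k).
        (\<Sum>\<alpha>\<in>{\<alpha>. length \<alpha> = k}. supnorm (pds \<alpha> f)) \<le> 1}"

definition d_k :: "'w measure \<Rightarrow> nat \<Rightarrow> ('w \<Rightarrow> real^'d::finite) \<Rightarrow> ('w \<Rightarrow> real^'d) \<Rightarrow> ennreal" where
  "d_k M k X Y = (SUP f\<in>test_functions k.
     ennreal \<bar>(\<integral>\<omega>. f (X \<omega>) \<partial>M) - (\<integral>\<omega>. f (Y \<omega>) \<partial>M)\<bar>)"

text \<open>Unlike \<open>d\<^sub>0\<close>, this distance does not control bounded test functions uniformly: laws with smooth
  densities spread over \<open>[0, R]\<close> that differ by an oscillation at unit scale with pseudo-random signs
  have total variation distance bounded below, distance \<open>d_CF\<close> of order \<open>R\<close> to the power \<open>-1/2\<close>, and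
  can be realised with \<open>Q_l\<close> bounded in \<open>R\<close>. The estimate of expectations by \<open>d_CF\<close> therefore has a
  constant that also depends on a bound for moments of the random vectors.\<close>

definition d_CF :: "'w measure \<Rightarrow> ('w \<Rightarrow> real^'d::finite) \<Rightarrow> ('w \<Rightarrow> real^'d) \<Rightarrow> ennreal" where
  "d_CF M X Y = (SUP \<theta>. ennreal (cmod
     ((\<integral>\<omega>. exp (\<i> * complex_of_real (inner \<theta> (X \<omega>))) \<partial>M)
      - (\<integral>\<omega>. exp (\<i> * complex_of_real (inner \<theta> (Y \<omega>))) \<partial>M))))"

text \<open>Such a version of the density is unique, since two continuous versions agree everywhere.\<close>

definition smooth_density :: "'w measure \<Rightarrow> ('w \<Rightarrow> real^'d::finite) \<Rightarrow> (real^'d \<Rightarrow> real) \<Rightarrow> bool" where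
  "smooth_density M X p \<longleftrightarrow>
     p \<in> C_infty \<and> (\<forall>x. 0 \<le> p x) \<and> distributed M lborel X (\<lambda>x. ennreal (p x))"

end

theory Submission
  imports Defs
begin

text \<open>
  Let \<open>d\<close> be the dimension and let \<open>f\<close> stand for test functions in \<open>C_b_infty\<close>. Say that a random
  vector \<open>X\<close> admits integration by parts of order \<open>n\<close> with bound \<open>b\<close> if
  \<open>\<bar>E (\<partial>\<^sup>\<alpha> f(X))\<bar> \<le> b \<parallel>f\<parallel>\<close> for all \<open>f\<close> and all \<open>\<alpha>\<close> of length at most \<open>n\<close> (\<open>ibp_upto\<close>). The abstract
  framework enters the proof through such bounds, with \<open>b\<close> a constant multiple of \<open>Q_q(F)\<close> for some
  large \<open>q\<close> (\<open>derivative_expectation_le\<close>), and otherwise only through the finiteness of moments and a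
  lower bound for \<open>Q_q\<close> (\<open>framework_random_vector\<close>). The rest is about two random vectors with a common bound.

  Integration by parts starts from the chain rule \<open>\<Gamma>(g(F), F\<^sub>l) = \<Sum>\<^sub>i \<partial>\<^sub>i g(F) \<sigma>\<^sup>i\<^sup>l\<close>. Multiplying by the cofactors of
  \<open>\<sigma>\<close> and summing over \<open>l\<close> leaves \<open>\<partial>\<^sub>k g(F) det \<sigma>\<close>. After division by \<open>det \<sigma>\<close>, duality moves the derivative
  from \<open>g(F)\<close> onto a weight, which is a polynomial in \<open>1 / det \<sigma>\<close>, \<open>\<sigma>\<close>, \<open>LF\<close> and their derivatives
  (\<open>ibp_step\<close>). Since \<open>1 / det \<sigma>\<close> need not belong to \<open>E\<close>, it is replaced by \<open>det \<sigma> / ((det \<sigma>)\<^sup>2 + \<eta>)\<close>, and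
  \<open>\<eta>\<close> tends to \<open>0\<close> only after the estimates. The weights are estimated pointwise: \<open>T k W\<close> is the sum of the
  squares of all derivatives of \<open>W\<close> of order at most \<open>k\<close> along an orthonormal sequence, it satisfies a
  Leibniz inequality (\<open>T_mult\<close>), and every weight that arises satisfies \<open>T j W \<le> Y\<^sup>a\<close> for one and the same
  random variable \<open>Y\<close>. The critical case is \<open>W = \<Gamma>(F, G)\<close>, an infinite series of products of directional
  derivatives, because it has to be differentiated term by term. This is possible because duality makes
  \<open>D\<close> closable on \<open>E\<close> (\<open>D_closable\<close>, \<open>T_Gamma\<close>). Finally \<open>Y\<close> is a power of the quotient whose \<open>q\<close>-th moment
  is at most \<open>Q_q(F)\<close> by Cauchy-Schwarz (\<open>X_moment_le_Q\<close>). Powers of \<open>Y\<close> are absorbed by a large \<open>q\<close>,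
  which is why the final estimate is linear in \<open>Q_q(F)\<close>.

  Densities are obtained by Fourier inversion. Inserting the waves \<open>cos (\<langle>\<theta>, x\<rangle> + t)\<close> as test
  functions turns integration by parts into decay of the characteristic function faster than every power of \<open>1 + \<bar>\<theta>\<bar>\<close> (\<open>chf_decay\<close>), so
  the inversion integral converges with all its derivatives (\<open>smooth_density_dens\<close>).

  Each of the four estimates balances a bound by the distance against a bound by \<open>b\<close>.
  For expectations and \<open>d\<^sub>k\<close>, replace \<open>f\<close> by its convolution with the super kernel at scale \<open>\<delta>\<close>. The
  derivatives of order \<open>k + m\<close> of the convolution are of size \<open>\<delta>\<close> to the power \<open>-(k + m)\<close>. Because all
  moments of the kernel vanish and \<open>z \<mapsto> E (\<partial>\<^sup>\<alpha> f(X + z))\<close> has derivatives bounded by \<open>b \<parallel>f\<parallel>\<close>, the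
  replacement costs only \<open>\<delta>\<^sup>N b \<parallel>f\<parallel>\<close> (\<open>mollification_error\<close>). With \<open>N\<close> large compared with
  \<open>(k + m) / \<epsilon>\<close>, the optimal \<open>\<delta>\<close> gives the exponents \<open>1 - \<epsilon>\<close> and \<open>\<epsilon>\<close> (\<open>expectation_difference_le\<close>).
  For densities, the difference of the characteristic functions is at most a multiple of
  \<open>d\<^sub>k (1 + \<bar>\<theta>\<bar>)\<^sup>k\<close> (or at most \<open>d_CF\<close>) and decays faster than every power, with constant proportional
  to \<open>b\<close>; the geometric mean of the two bounds with weights \<open>1 - \<epsilon>\<close> and \<open>\<epsilon>\<close> is integrable
  (\<open>density_difference_le\<close>).
  For expectations and \<open>d_CF\<close>, the uniform distance of the densities controls the laws inside a ball and
  the moments control them outside, so an optimal radius bounds the total variation distance \<open>d\<^sub>0\<close>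
  (\<open>d_0_le_density_difference\<close>), to which the estimate for \<open>k = 0\<close> applies. Three losses occur, so each is
  allotted \<open>\<epsilon> / 3\<close>. The exponents come out at least as favourable as \<open>1 - \<epsilon>\<close> and \<open>\<epsilon>\<close>, and can be replaced
  by these because \<open>d_CF \<le> 2\<close> and \<open>Q_q\<close> is bounded below by a positive constant (\<open>Q_ge\<close>).
\<close>

section \<open>Partial derivatives\<close>

lemma pd_eqI: "(f has_derivative f') (at x) \<Longrightarrow> pd i f x = f' (axis i 1)"
  unfolding pd_def using frechet_derivative_at by metis

lemma sum_scaleR_axis: "(\<Sum>i\<in>UNIV. (x$i) *\<^sub>R axis i 1) = (x::real^'n)"
  using basis_expansion[of x] by (simp add: scalar_mult_eq_scaleR)

lemma has_derivative_pd:
  fixes f :: "real^'d::finite \<Rightarrow> real"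
  assumes "f differentiable (at x)"
  shows "(f has_derivative (\<lambda>h. \<Sum>i\<in>UNIV. h$i * pd i f x)) (at x)"
proof -
  let ?D = "frechet_derivative f (at x)"
  have D: "(f has_derivative ?D) (at x)" using assms frechet_derivative_works by blast
  have lin: "linear ?D" using assms linear_frechet_derivative by blast
  have "?D h = (\<Sum>i\<in>UNIV. h$i * pd i f x)" for h
  proof -
    have "?D h = ?D (\<Sum>i\<in>UNIV. (h$i) *\<^sub>R axis i 1)" by (simp add: sum_scaleR_axis)
    also have "\<dots> = (\<Sum>i\<in>UNIV. h$i * pd i f x)"
      by (simp add: linear_sum[OF lin] linear_cmul[OF lin] pd_def)
    finally show ?thesis .
  qed
  then have "?D = (\<lambda>h. \<Sum>i\<in>UNIV. h$i * pd i f x)" by auto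
  with D show ?thesis by simp
qed

lemma has_derivative_pd_compose:
  fixes f :: "real^'d::finite \<Rightarrow> real"
  assumes "f differentiable (at (u x))" "(u has_derivative u') (at x within s)"
  shows "((\<lambda>x. f (u x)) has_derivative (\<lambda>h. \<Sum>i\<in>UNIV. u' h $ i * pd i f (u x))) (at x within s)"
  using has_derivative_compose[OF assms(2) has_derivative_pd[OF assms(1)]] .

lemma pds_Nil [simp]: "pds [] f = f"
  and pds_Cons [simp]: "pds (i # \<alpha>) f = pd i (pds \<alpha> f)"
  and pds_append: "pds (\<alpha> @ \<beta>) f = pds \<alpha> (pds \<beta> f)"
  by (simp_all add: pds_def)

lemma pd_translate:
  assumes "f differentiable (at (x + z))"
  shows "pd i (\<lambda>x. f (x + z)) x = pd i f (x + z)"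
proof -
  have "((\<lambda>x. f (x + z)) has_derivative (\<lambda>h. \<Sum>j\<in>UNIV. h$j * pd j f (x + z))) (at x)"
    by (rule has_derivative_pd_compose[of f "\<lambda>x. x + z" x "\<lambda>h. h"]) (auto intro!: derivative_eq_intros assms)
  from pd_eqI[OF this, of i] pd_eqI[OF has_derivative_pd[OF assms], of i] show ?thesis by simp
qed

lemma pd_cmult:
  assumes "f differentiable (at x)"
  shows "pd i (\<lambda>x. c * f x) x = c * pd i f x"
proof -
  have "((\<lambda>x. c * f x) has_derivative (\<lambda>h. c * (\<Sum>j\<in>UNIV. h$j * pd j f x))) (at x)"
    by (rule has_derivative_mult_right[OF has_derivative_pd[OF assms]])
  from pd_eqI[OF this, of i] pd_eqI[OF has_derivative_pd[OF assms], of i] show ?thesis by simp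
qed

lemma pd_mult:
  assumes "f differentiable (at x)" "g differentiable (at x)"
  shows "pd i (\<lambda>x. f x * g x) x = f x * pd i g x + pd i f x * g x"
proof -
  have "((\<lambda>x. f x * g x) has_derivative (\<lambda>h. f x * (\<Sum>j\<in>UNIV. h$j * pd j g x) + (\<Sum>j\<in>UNIV. h$j * pd j f x) * g x)) (at x)"
    by (intro has_derivative_mult has_derivative_pd assms)
  from pd_eqI[OF this, of i] pd_eqI[OF has_derivative_pd[OF assms(1)], of i]
    pd_eqI[OF has_derivative_pd[OF assms(2)], of i] show ?thesis by simp
qed

subsection \<open>Smooth functions\<close>

lemma C_inftyI:
  assumes "f \<in> S" "\<And>g x. g \<in> S \<Longrightarrow> g differentiable (at x)" "\<And>g i. g \<in> S \<Longrightarrow> pd i g \<in> S"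
  shows "f \<in> C_infty"
proof -
  have "pds \<alpha> f \<in> S" for \<alpha> using assms(1,3) by (induction \<alpha>) auto
  then show ?thesis using assms(2)
    by (auto simp: C_infty_def differentiable_on_def intro: differentiable_at_withinI)
qed

text \<open>Infinitely many derivatives are handled at once by exhibiting a set of functions that is closed
  under \<open>pd\<close>.\<close>

lemma C_b_inftyI:
  assumes "f \<in> S" "\<And>g x. g \<in> S \<Longrightarrow> g differentiable (at x)" "\<And>g. g \<in> S \<Longrightarrow> bounded (range g)"
    "\<And>g i. g \<in> S \<Longrightarrow> pd i g \<in> S"
  shows "f \<in> C_b_infty"
proof -
  have "pds \<alpha> f \<in> S" for \<alpha> using assms(1,4) by (induction \<alpha>) auto
  then show ?thesis using assms(2,3) C_inftyI[OF assms(1,2,4)]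
    by (auto simp: C_b_infty_def)
qed

lemma C_infty_differentiable: "f \<in> C_infty \<Longrightarrow> f differentiable (at x)"
  unfolding C_infty_def differentiable_on_def by (metis (mono_tags, lifting) UNIV_I mem_Collect_eq pds_Nil)

lemma C_infty_pds: "f \<in> C_infty \<Longrightarrow> pds \<alpha> f \<in> C_infty"
  unfolding C_infty_def by (auto simp flip: pds_append)

lemma C_infty_pd: "f \<in> C_infty \<Longrightarrow> pd i f \<in> C_infty"
  using C_infty_pds[of f "[i]"] by simp

lemma C_infty_continuous: "f \<in> C_infty \<Longrightarrow> continuous_on UNIV f"
  by (meson C_infty_differentiable continuous_at_imp_continuous_on differentiable_imp_continuous_within)

lemma C_infty_measurable: "f \<in> C_infty \<Longrightarrow> f \<in> borel_measurable borel"
  by (simp add: C_infty_continuous borel_measurable_continuous_onI)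

lemma C_b_infty_C_infty: "f \<in> C_b_infty \<Longrightarrow> f \<in> C_infty"
  by (simp add: C_b_infty_def)

lemma C_b_infty_pds: "f \<in> C_b_infty \<Longrightarrow> pds \<alpha> f \<in> C_b_infty"
  by (auto simp: C_b_infty_def C_infty_pds simp flip: pds_append)

lemma C_b_infty_pd: "f \<in> C_b_infty \<Longrightarrow> pd i f \<in> C_b_infty"
  using C_b_infty_pds[of f "[i]"] by simp

lemma C_b_infty_bound:
  assumes "f \<in> C_b_infty" obtains K where "\<And>x. \<bar>f x\<bar> \<le> K" "K > 0"
proof -
  have "bounded (range f)" using assms unfolding C_b_infty_def by (metis (mono_tags, lifting) mem_Collect_eq pds_Nil)
  then obtain K where "\<And>x. norm (f x) \<le> K" "K > 0" by (auto simp: bounded_pos)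
  then show ?thesis using that by auto
qed

lemmas C_b_infty_differentiable = C_infty_differentiable[OF C_b_infty_C_infty]
lemmas C_b_infty_measurable = C_infty_measurable[OF C_b_infty_C_infty]

lemma pds_translate:
  assumes "f \<in> C_infty" shows "pds \<alpha> (\<lambda>x. f (x + z)) = (\<lambda>x. pds \<alpha> f (x + z))"
  by (induction \<alpha>) (auto simp: pd_translate C_infty_differentiable C_infty_pds assms)

lemma pds_cmult:
  assumes "f \<in> C_infty" shows "pds \<alpha> (\<lambda>x. c * f x) = (\<lambda>x. c * pds \<alpha> f x)"
  by (induction \<alpha>) (auto simp: pd_cmult C_infty_differentiable C_infty_pds assms)

lemma C_b_infty_translate:
  assumes "f \<in> C_b_infty" shows "(\<lambda>x. f (x + z)) \<in> C_b_infty"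
proof (rule C_b_inftyI[where S = "(\<lambda>f x. f (x + z)) ` C_b_infty"])
  show "(\<lambda>x. f (x + z)) \<in> (\<lambda>f x. f (x + z)) ` C_b_infty" using assms by auto
  fix g assume "g \<in> (\<lambda>f x. f (x + z)) ` C_b_infty"
  then obtain h where h: "h \<in> C_b_infty" "g = (\<lambda>x. h (x + z))" by auto
  show "g differentiable (at x)" for x unfolding h
    using differentiable_chain_at[of "\<lambda>x. x + z" x h] C_b_infty_differentiable[OF h(1)]
    by (auto simp: o_def)
  show "bounded (range g)" using C_b_infty_bound[OF h(1)] unfolding h by (auto simp: bounded_iff) metis
  show "pd i g \<in> (\<lambda>f x. f (x + z)) ` C_b_infty" for i
    using pd_translate[OF C_b_infty_differentiable[OF h(1)], where z = z and i = i] C_b_infty_pd[OF h(1), of i]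
    unfolding h by auto
qed

lemma C_b_infty_cmult:
  assumes "f \<in> C_b_infty" shows "(\<lambda>x. c * f x) \<in> C_b_infty"
proof (rule C_b_inftyI[where S = "(\<lambda>f x. c * f x) ` C_b_infty"])
  show "(\<lambda>x. c * f x) \<in> (\<lambda>f x. c * f x) ` C_b_infty" using assms by auto
  fix g assume "g \<in> (\<lambda>f x. c * f x) ` C_b_infty"
  then obtain h where h: "h \<in> C_b_infty" "g = (\<lambda>x. c * h x)" by auto
  show "g differentiable (at x)" for x unfolding h
    using C_b_infty_differentiable[OF h(1)] by (auto intro!: differentiable_mult)
  obtain K where K: "\<And>x. \<bar>h x\<bar> \<le> K" using C_b_infty_bound[OF h(1)] by metis
  show "bounded (range g)" unfolding h bounded_iff
    by (rule exI[of _ "\<bar>c\<bar> * K"]) (auto simp: abs_mult intro!: mult_left_mono K)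
  show "pd i g \<in> (\<lambda>f x. c * f x) ` C_b_infty" for i
    using pd_cmult[OF C_b_infty_differentiable[OF h(1)], where i = i and c = c] C_b_infty_pd[OF h(1), of i]
    unfolding h by auto
qed

lemma wave_has_derivative:
  "((\<lambda>x. c * cos (inner \<theta> x + t)) has_derivative (\<lambda>h. c * (inner \<theta> h * cos (inner \<theta> x + t + pi/2)))) (at x)"
  by (auto intro!: derivative_eq_intros simp: cos_add sin_add algebra_simps)

lemma pd_wave:
  "pd i (\<lambda>x. c * cos (inner \<theta> x + t)) = (\<lambda>x. (\<theta>$i * c) * cos (inner \<theta> x + (t + pi/2)))"
  by (rule ext, subst pd_eqI[OF wave_has_derivative]) (auto simp: inner_axis algebra_simps)

text \<open>Differentiation shifts the phase of a wave by a quarter turn, so waves with a phase give real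
  Fourier analysis without the cosine and sine cases.\<close>

lemma pds_wave:
  "pds \<alpha> (\<lambda>x. cos (inner \<theta> x + t)) = (\<lambda>x. (\<Prod>i\<leftarrow>\<alpha>. \<theta>$i) * cos (inner \<theta> x + (t + real (length \<alpha>) * (pi/2))))"
proof (induction \<alpha>)
  case (Cons i \<alpha>)
  have "(t + real (length \<alpha>) * (pi/2)) + pi/2 = t + real (length (i # \<alpha>)) * (pi/2)" by (simp add: algebra_simps)
  then show ?case by (simp only: pds_Cons Cons pd_wave) (simp add: mult.assoc)
qed auto

lemma wave_C_b_infty: "(\<lambda>x. cos (inner \<theta> x + t)) \<in> C_b_infty"
proof (rule C_b_inftyI[where S = "{\<lambda>x. c * cos (inner \<theta> x + t) |c t. True}"])
  show "(\<lambda>x. cos (inner \<theta> x + t)) \<in> {\<lambda>x. c * cos (inner \<theta> x + t) |c t. True}"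
    by (intro CollectI exI[of _ 1] exI[of _ t]) simp
  fix g :: "real^'a \<Rightarrow> real" assume "g \<in> {\<lambda>x. c * cos (inner \<theta> x + t) |c t. True}"
  then obtain c t where g: "g = (\<lambda>x. c * cos (inner \<theta> x + t))" by auto
  show "g differentiable (at x)" for x unfolding g using wave_has_derivative differentiable_def by blast
  show "bounded (range g)" unfolding g bounded_iff
    by (rule exI[of _ "\<bar>c\<bar>"]) (auto simp: abs_mult intro!: mult_left_le)
  show "pd i g \<in> {\<lambda>x. c * cos (inner \<theta> x + t) |c t. True}" for i unfolding g pd_wave by blast
qed

subsection \<open>Taylor expansion\<close>

lemma finite_multi_indices [simp]: "finite {\<beta>::'d::finite list. length \<beta> = n}"
  using finite_lists_length_eq[of "UNIV::'d set" n] by simp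

lemma sum_multi_indices_Suc:
  fixes g :: "'d::finite list \<Rightarrow> 'b::comm_monoid_add"
  shows "(\<Sum>\<beta> | length \<beta> = Suc n. g \<beta>) = (\<Sum>i\<in>UNIV. \<Sum>\<beta> | length \<beta> = n. g (i # \<beta>))"
proof -
  have eq: "{\<beta>::'d list. length \<beta> = Suc n} = (\<lambda>(i, \<beta>). i # \<beta>) ` (UNIV \<times> {\<beta>. length \<beta> = n})"
    by (auto simp: length_Suc_conv image_iff)
  have inj: "inj_on (\<lambda>(i, \<beta>). i # \<beta>) (UNIV \<times> {\<beta>::'d list. length \<beta> = n})" by (auto simp: inj_on_def)
  show ?thesis
    unfolding eq sum.reindex[OF inj] by (simp add: sum.cartesian_product o_def case_prod_beta)
qed

lemma line_has_field_derivative: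
  assumes "f \<in> C_infty"
  shows "((\<lambda>t. f (x + t *\<^sub>R z)) has_field_derivative (\<Sum>i\<in>UNIV. z$i * pd i f (x + t *\<^sub>R z))) (at t)"
proof -
  have "((\<lambda>t. f (x + t *\<^sub>R z)) has_derivative (\<lambda>s. \<Sum>i\<in>UNIV. (s *\<^sub>R z)$i * pd i f (x + t *\<^sub>R z))) (at t)"
    by (rule has_derivative_pd_compose[of f "\<lambda>t. x + t *\<^sub>R z" t "\<lambda>s. s *\<^sub>R z"])
       (auto intro!: derivative_eq_intros C_infty_differentiable assms)
  moreover have "(\<lambda>s. \<Sum>i\<in>UNIV. (s *\<^sub>R z)$i * pd i f (x + t *\<^sub>R z)) = (*) (\<Sum>i\<in>UNIV. z$i * pd i f (x + t *\<^sub>R z))"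
    by (rule ext) (simp add: sum_distrib_left sum_distrib_right mult_ac)
  ultimately show ?thesis by (simp add: has_field_derivative_def)
qed

text \<open>The sum is over words instead of unordered multi-indices, so every mixed derivative occurs once
  for each order of its directions and no multinomial coefficients are needed. The proof is the
  one-dimensional expansion of \<open>t \<mapsto> f (x + t z)\<close>.\<close>

lemma taylor_multi_index:
  assumes "f \<in> C_infty"
  shows "\<exists>t. \<bar>t\<bar> \<le> 1 \<and> f (x + z) =
     (\<Sum>n<N. (1 / fact n) * (\<Sum>\<beta> | length \<beta> = n. (\<Prod>i\<leftarrow>\<beta>. z$i) * pds \<beta> f x))
     + (1 / fact N) * (\<Sum>\<beta> | length \<beta> = N. (\<Prod>i\<leftarrow>\<beta>. z$i) * pds \<beta> f (x + t *\<^sub>R z))"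
proof -
  define diff where "diff n t = (\<Sum>\<beta> | length \<beta> = n. (\<Prod>i\<leftarrow>\<beta>. z$i) * pds \<beta> f (x + t *\<^sub>R z))" for n t
  have d: "DERIV (diff m) t :> diff (Suc m) t" for m t
  proof -
    have "DERIV (diff m) t :> (\<Sum>\<beta> | length \<beta> = m. (\<Prod>i\<leftarrow>\<beta>. z$i) * (\<Sum>i\<in>UNIV. z$i * pd i (pds \<beta> f) (x + t *\<^sub>R z)))"
      unfolding diff_def
      by (intro DERIV_sum DERIV_cmult line_has_field_derivative C_infty_pds assms)
    moreover have "(\<Sum>\<beta> | length \<beta> = m. (\<Prod>i\<leftarrow>\<beta>. z$i) * (\<Sum>i\<in>UNIV. z$i * pd i (pds \<beta> f) (x + t *\<^sub>R z))) = diff (Suc m) t"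
      unfolding diff_def sum_multi_indices_Suc
      by (subst sum.swap) (simp add: sum_distrib_left mult_ac)
    ultimately show ?thesis by simp
  qed
  have "diff 0 = (\<lambda>t. f (x + t *\<^sub>R z))" by (simp add: diff_def fun_eq_iff)
  then have "\<exists>t. \<bar>t\<bar> \<le> 1 \<and> f (x + z) = (\<Sum>m<N. diff m 0 / fact m) + diff N t / fact N"
    using Maclaurin_all_le[where diff = diff and f = "\<lambda>t. f (x + t *\<^sub>R z)" and x = 1 and n = N] d by simp
  then obtain t where
    "\<bar>t\<bar> \<le> 1" "f (x + z) = (\<Sum>m<N. diff m 0 / fact m) + diff N t / fact N" by blast
  then show ?thesis by (intro exI[of _ t]) (simp add: diff_def)
qed

lemma abs_prod_component_le: "\<bar>\<Prod>i\<leftarrow>\<beta>. z$i\<bar> \<le> norm z ^ length \<beta>"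
proof (induction \<beta>)
  case (Cons i \<beta>)
  then show ?case by (auto simp: abs_mult intro!: mult_mono component_le_norm_cart)
qed auto

lemma C_b_infty_quadratic_remainder:
  assumes "f \<in> C_b_infty"
  obtains C where "\<And>x h. \<bar>f (x + h) - f x - (\<Sum>i\<in>UNIV. h$i * pd i f x)\<bar> \<le> C * (norm h)^2"
proof -
  have "\<exists>K. \<forall>x. \<bar>pds \<beta> f x\<bar> \<le> K" for \<beta> using C_b_infty_bound[OF C_b_infty_pds[OF assms]] by metis
  then obtain K where K: "\<And>\<beta> x. \<bar>pds \<beta> f x\<bar> \<le> K \<beta>" by metis
  let ?C = "(\<Sum>\<beta> | length \<beta> = 2. K \<beta>)"
  have "\<bar>f (x + h) - f x - (\<Sum>i\<in>UNIV. h$i * pd i f x)\<bar> \<le> ?C * (norm h)^2" for x h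
  proof -
    have e2: "2 = Suc (Suc 0)" by simp
    have z: "{\<beta>::'a list. length \<beta> = 0} = {[]}" by auto
    obtain t where t: "f (x + h) =
     (\<Sum>n<2. (1 / fact n) * (\<Sum>\<beta> | length \<beta> = n. (\<Prod>i\<leftarrow>\<beta>. h$i) * pds \<beta> f x))
     + (1 / fact 2) * (\<Sum>\<beta> | length \<beta> = 2. (\<Prod>i\<leftarrow>\<beta>. h$i) * pds \<beta> f (x + t *\<^sub>R h))"
      using taylor_multi_index[OF C_b_infty_C_infty[OF assms], of x h 2] by auto
    have "(\<Sum>n<2. (1 / fact n) * (\<Sum>\<beta> | length \<beta> = n. (\<Prod>i\<leftarrow>\<beta>. h$i) * pds \<beta> f x)) = f x + (\<Sum>i\<in>UNIV. h$i * pd i f x)"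
      unfolding e2 by (simp only: sum.lessThan_Suc sum_multi_indices_Suc) (simp add: z)
    with t have "f (x + h) - f x - (\<Sum>i\<in>UNIV. h$i * pd i f x) = (1/2) * (\<Sum>\<beta> | length \<beta> = 2. (\<Prod>i\<leftarrow>\<beta>. h$i) * pds \<beta> f (x + t *\<^sub>R h))"
      by simp
    also have "\<bar>\<dots>\<bar> \<le> 1 * \<bar>\<Sum>\<beta> | length \<beta> = 2. (\<Prod>i\<leftarrow>\<beta>. h$i) * pds \<beta> f (x + t *\<^sub>R h)\<bar>"
      by (simp add: abs_mult)
    also have "\<dots> \<le> 1 * (\<Sum>\<beta> | length \<beta> = 2. (norm h)^2 * K \<beta>)"
    proof (intro mult_left_mono order_trans[OF sum_abs] sum_mono)
      fix \<beta> :: "'a list" assume "\<beta> \<in> {\<beta>. length \<beta> = 2}"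
      then show "\<bar>(\<Prod>i\<leftarrow>\<beta>. h$i) * pds \<beta> f (x + t *\<^sub>R h)\<bar> \<le> (norm h)^2 * K \<beta>"
        using abs_prod_component_le[of h \<beta>] K[of \<beta>] by (auto simp: abs_mult intro!: mult_mono)
    qed auto
    finally show ?thesis by (simp add: sum_distrib_left sum_distrib_right mult_ac)
  qed
  then show ?thesis using that by blast
qed

text \<open>A remainder that is quadratic uniformly in the point survives integration over a parameter. This
  is how functions defined by integrals are differentiated below.\<close>

lemma has_derivative_quadraticI:
  fixes f :: "real^'d::finite \<Rightarrow> real"
  assumes "\<And>h. \<bar>f (x + h) - f x - (\<Sum>i\<in>UNIV. h$i * c i)\<bar> \<le> C * (norm h)^2"
  shows "(f has_derivative (\<lambda>h. \<Sum>i\<in>UNIV. h$i * c i)) (at x)"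
proof -
  have bl: "bounded_linear (\<lambda>h::real^'d. \<Sum>i\<in>UNIV. h$i * c i)"
    by (intro bounded_linear_sum bounded_linear_mult_const bounded_linear_vec_nth)
  have "((\<lambda>y. norm (f y - f x - (\<Sum>i\<in>UNIV. (y - x)$i * c i)) / norm (y - x)) \<longlongrightarrow> 0) (at x)"
  proof (rule Lim_null_comparison)
    show "((\<lambda>y. C * norm (y - x)) \<longlongrightarrow> 0) (at x)" by (auto intro!: tendsto_eq_intros)
    have "norm (norm (f y - f x - (\<Sum>i\<in>UNIV. (y - x)$i * c i)) / norm (y - x)) \<le> C * norm (y - x)" if "y \<noteq> x" for y
      using assms[of "y - x"] that by (simp add: divide_le_eq power2_eq_square mult.assoc)
    then show "\<forall>\<^sub>F y in at x. norm (norm (f y - f x - (\<Sum>i\<in>UNIV. (y - x)$i * c i)) / norm (y - x)) \<le> C * norm (y - x)"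
      by (auto simp: eventually_at_filter)
  qed
  with bl show ?thesis by (auto simp: has_derivative_iff_norm)
qed

subsection \<open>Averages of translates\<close>

lemma integrable_translate_mult:
  assumes "f \<in> C_b_infty" and "integrable \<mu> \<psi>" and "Z \<in> borel_measurable \<mu>"
  shows "integrable \<mu> (\<lambda>\<omega>. \<psi> \<omega> * f (x + Z \<omega> :: real^'d::finite))"
proof -
  obtain K where K: "\<And>x. \<bar>f x\<bar> \<le> K" using C_b_infty_bound[OF assms(1)] by metis
  have [measurable]: "f \<in> borel_measurable borel" "\<psi> \<in> borel_measurable \<mu>" using assms C_b_infty_measurable by auto
  note [measurable] = assms(3)
  show ?thesis
    by (rule Bochner_Integration.integrable_bound[where f = "\<lambda>\<omega>. K * \<psi> \<omega>"])
       (use assms K in \<open>auto simp: abs_mult mult.commute[of K] intro!: mult_mono order_trans[OF K abs_ge_self] AE_I2\<close>)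
qed

text \<open>A finite signed measure convolved with a smooth bounded function. The measure is given as the
  image of \<open>\<psi> d\<mu>\<close> under \<open>Z\<close>, so that both convolution with a kernel on \<open>\<real>\<^sup>d\<close> and the function
  \<open>z \<mapsto> E (f(z + X))\<close> are instances.\<close>

lemma average_of_translates_aux:
  assumes "f \<in> C_b_infty" and "integrable \<mu> \<psi>" and "Z \<in> borel_measurable \<mu>"
  shows "(\<lambda>x. \<integral>\<omega>. \<psi> \<omega> * f (x + Z \<omega>) \<partial>\<mu>) differentiable (at x)" (is "?h differentiable _")
    and "pd i (\<lambda>x. \<integral>\<omega>. \<psi> \<omega> * f (x + Z \<omega>) \<partial>\<mu>) x = (\<integral>\<omega>. \<psi> \<omega> * pd i f (x + Z \<omega> :: real^'d::finite) \<partial>\<mu>)"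
    and "\<And>K. (\<And>x. \<bar>f x\<bar> \<le> K) \<Longrightarrow> \<bar>\<integral>\<omega>. \<psi> \<omega> * f (x + Z \<omega>) \<partial>\<mu>\<bar> \<le> (\<integral>\<omega>. \<bar>\<psi> \<omega>\<bar> \<partial>\<mu>) * K"
proof -
  have int: "integrable \<mu> (\<lambda>\<omega>. \<psi> \<omega> * f (x + Z \<omega>))" if "f \<in> C_b_infty" for f x
    by (rule integrable_translate_mult[OF that assms(2,3)])
  obtain C where C: "\<And>x h. \<bar>f (x + h) - f x - (\<Sum>i\<in>UNIV. h$i * pd i f x)\<bar> \<le> C * (norm h)^2"
    using C_b_infty_quadratic_remainder[OF assms(1)] by blast
  have D: "(?h has_derivative (\<lambda>h. \<Sum>i\<in>UNIV. h$i * (\<integral>\<omega>. \<psi> \<omega> * pd i f (x + Z \<omega>) \<partial>\<mu>))) (at x)"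
  proof (rule has_derivative_quadraticI[where C = "(\<integral>\<omega>. \<bar>\<psi> \<omega>\<bar> \<partial>\<mu>) * C"])
    fix h
    let ?R = "\<lambda>\<omega>. f (x + Z \<omega> + h) - f (x + Z \<omega>) - (\<Sum>i\<in>UNIV. h$i * pd i f (x + Z \<omega>))"
    have e: "\<psi> \<omega> * ?R \<omega> = \<psi> \<omega> * f (x + h + Z \<omega>) - \<psi> \<omega> * f (x + Z \<omega>) - (\<Sum>i\<in>UNIV. h$i * (\<psi> \<omega> * pd i f (x + Z \<omega>)))" for \<omega>
      by (simp add: algebra_simps sum_distrib_left)
    have "(\<integral>\<omega>. \<psi> \<omega> * ?R \<omega> \<partial>\<mu>) = ?h (x + h) - ?h x - (\<Sum>i\<in>UNIV. h$i * (\<integral>\<omega>. \<psi> \<omega> * pd i f (x + Z \<omega>) \<partial>\<mu>))"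
      unfolding e by (simp add: int assms(1) C_b_infty_pd integral_sum integrable_sum)
    moreover have "\<bar>\<integral>\<omega>. \<psi> \<omega> * ?R \<omega> \<partial>\<mu>\<bar> \<le> (\<integral>\<omega>. \<bar>\<psi> \<omega>\<bar> * (C * (norm h)^2) \<partial>\<mu>)"
    proof (rule order_trans[OF integral_abs_bound], rule integral_mono)
      show "integrable \<mu> (\<lambda>\<omega>. \<bar>\<psi> \<omega> * ?R \<omega>\<bar>)" unfolding e
        by (intro integrable_abs Bochner_Integration.integrable_diff Bochner_Integration.integrable_sum
              integrable_mult_right int assms C_b_infty_pd)
      show "integrable \<mu> (\<lambda>\<omega>. \<bar>\<psi> \<omega>\<bar> * (C * (norm h)^2))" using assms by auto
      show "\<bar>\<psi> \<omega> * ?R \<omega>\<bar> \<le> \<bar>\<psi> \<omega>\<bar> * (C * (norm h)^2)" for \<omega>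
        using C[of "x + Z \<omega>" h] by (auto simp: abs_mult intro!: mult_left_mono)
    qed
    ultimately show "\<bar>?h (x + h) - ?h x - (\<Sum>i\<in>UNIV. h$i * (\<integral>\<omega>. \<psi> \<omega> * pd i f (x + Z \<omega>) \<partial>\<mu>))\<bar> \<le> (\<integral>\<omega>. \<bar>\<psi> \<omega>\<bar> \<partial>\<mu>) * C * (norm h)^2"
      by (simp add: mult.assoc)
  qed
  show "?h differentiable (at x)" using D differentiable_def by blast
  show "pd i ?h x = (\<integral>\<omega>. \<psi> \<omega> * pd i f (x + Z \<omega>) \<partial>\<mu>)"
    using pd_eqI[OF D, of i] by (simp add: axis_def if_distrib[of "\<lambda>x. x * _"] cong: if_cong)
  show "\<bar>\<integral>\<omega>. \<psi> \<omega> * f (x + Z \<omega>) \<partial>\<mu>\<bar> \<le> (\<integral>\<omega>. \<bar>\<psi> \<omega>\<bar> \<partial>\<mu>) * K" if K: "\<And>x. \<bar>f x\<bar> \<le> K" for K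
  proof -
    have "\<bar>\<integral>\<omega>. \<psi> \<omega> * f (x + Z \<omega>) \<partial>\<mu>\<bar> \<le> (\<integral>\<omega>. \<bar>\<psi> \<omega>\<bar> * K \<partial>\<mu>)"
    proof (rule order_trans[OF integral_abs_bound], rule integral_mono)
      show "integrable \<mu> (\<lambda>\<omega>. \<bar>\<psi> \<omega> * f (x + Z \<omega>)\<bar>)" by (intro integrable_abs int assms)
      show "integrable \<mu> (\<lambda>\<omega>. \<bar>\<psi> \<omega>\<bar> * K)" using assms by auto
    qed (auto simp: abs_mult intro!: mult_left_mono K)
    then show ?thesis by simp
  qed
qed

lemma average_of_translates:
  assumes "f \<in> C_b_infty" and "integrable \<mu> \<psi>" and "Z \<in> borel_measurable \<mu>"
  defines "h \<equiv> (\<lambda>x. \<integral>\<omega>. \<psi> \<omega> * f (x + Z \<omega> :: real^'d::finite) \<partial>\<mu>)"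
  shows "h \<in> C_b_infty" and "pds \<beta> h x = (\<integral>\<omega>. \<psi> \<omega> * pds \<beta> f (x + Z \<omega>) \<partial>\<mu>)"
proof -
  let ?A = "\<lambda>f x. \<integral>\<omega>. \<psi> \<omega> * f (x + Z \<omega>) \<partial>\<mu>"
  note aux = average_of_translates_aux[OF _ assms(2,3)]
  show "h \<in> C_b_infty"
  proof (rule C_b_inftyI[where S = "?A ` C_b_infty"])
    show "h \<in> ?A ` C_b_infty" unfolding h_def using assms by blast
    fix g assume "g \<in> ?A ` C_b_infty"
    then obtain f where f: "f \<in> C_b_infty" "g = ?A f" by auto
    show "g differentiable (at x)" for x unfolding f by (rule aux(1)[OF f(1)])
    obtain K where K: "\<And>x. \<bar>f x\<bar> \<le> K" using C_b_infty_bound[OF f(1)] by metis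
    show "bounded (range g)" unfolding f bounded_iff using aux(3)[OF f(1) K] by auto
    show "pd i g \<in> ?A ` C_b_infty" for i
      unfolding f using aux(2)[OF f(1), where i = i] C_b_infty_pd[OF f(1), of i] by auto
  qed
  have "pds \<beta> h = ?A (pds \<beta> f)" for \<beta>
  proof (induction \<beta>)
    case (Cons i \<beta>)
    then show ?case using aux(2)[OF C_b_infty_pds[OF assms(1), of \<beta>], where i = i] by auto
  qed (simp add: h_def)
  then show "pds \<beta> h x = (\<integral>\<omega>. \<psi> \<omega> * pds \<beta> f (x + Z \<omega>) \<partial>\<mu>)" by simp
qed

subsection \<open>The integral of a partial derivative vanishes\<close>

text \<open>Integrate \<open>h (y + e\<^sub>i) - h y = \<integral>\<^sub>0\<^sup>1 \<partial>\<^sub>i h (y + s e\<^sub>i) ds\<close> over \<open>y\<close>: the left side vanishes by translation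
  invariance, and the right side is the integral of \<open>\<partial>\<^sub>i h\<close> by Fubini.\<close>

lemma integral_pd_eq_0:
  fixes h :: "real^'d::finite \<Rightarrow> real"
  assumes diff: "\<And>x. h differentiable (at x)" and cont: "continuous_on UNIV (pd i h)"
    and int: "integrable lborel h" and int': "integrable lborel (pd i h)"
  shows "(\<integral>x. pd i h x \<partial>lborel) = 0"
proof -
  let ?e = "axis i 1 :: real^'d"
  have tr: "(\<integral>x. g (c + x) \<partial>lborel) = (\<integral>x. g x \<partial>lborel)" "integrable lborel (\<lambda>x. g (c + x))"
    if "integrable lborel g" for g :: "real^'d \<Rightarrow> real" and c
  proof -
    have [measurable]: "g \<in> borel_measurable borel" using that by auto
    show "(\<integral>x. g (c + x) \<partial>lborel) = (\<integral>x. g x \<partial>lborel)"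
      by (subst (2) lborel_distr_plus[of c, symmetric]) (auto simp: integral_distr)
    have "integrable (distr lborel borel ((+) c)) g" using that by (simp add: lborel_distr_plus)
    then show "integrable lborel (\<lambda>x. g (c + x))" by (subst (asm) integrable_distr_eq) auto
  qed
  have [measurable]: "pd i h \<in> borel_measurable borel" using int' by auto
  let ?f = "\<lambda>(s::real, y). indicator {0..1} s * pd i h (s *\<^sub>R ?e + y)"
  have fint: "integrable (lborel \<Otimes>\<^sub>M lborel) ?f"
  proof (rule lborel_pair.Fubini_integrable)
    show "?f \<in> borel_measurable (lborel \<Otimes>\<^sub>M lborel)" by measurable
    have "(\<integral>y. norm (?f (s, y)) \<partial>lborel) = indicator {0..1} s * (\<integral>y. \<bar>pd i h y\<bar> \<partial>lborel)" for s
      using tr(1)[of "\<lambda>y. \<bar>pd i h y\<bar>" "s *\<^sub>R ?e"] int' by (simp add: abs_mult)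
    then show "integrable lborel (\<lambda>s. \<integral>y. norm (?f (s, y)) \<partial>lborel)" by auto
    show "AE s in lborel. integrable lborel (\<lambda>y. ?f (s, y))"
      using tr(2)[OF int'] by (auto intro!: AE_I2 integrable_mult_right)
  qed
  have ftc: "(\<integral>s. ?f (s, y) \<partial>lborel) = h (y + ?e) - h y" for y
  proof -
    have "((\<lambda>s. h (y + s *\<^sub>R ?e)) has_vector_derivative pd i h (y + s *\<^sub>R ?e)) (at s within {0..1})" for s
    proof -
      have "((\<lambda>s. h (y + s *\<^sub>R ?e)) has_derivative (\<lambda>r. \<Sum>j\<in>UNIV. (r *\<^sub>R ?e)$j * pd j h (y + s *\<^sub>R ?e))) (at s within {0..1})"
        by (rule has_derivative_pd_compose[of h "\<lambda>s. y + s *\<^sub>R ?e" s "\<lambda>s. s *\<^sub>R ?e"])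
           (auto intro!: derivative_eq_intros diff)
      then show ?thesis
        by (simp add: has_vector_derivative_def axis_def if_distrib[of "\<lambda>x. x * _"] if_distrib[of "\<lambda>x. _ * x"] cong: if_cong)
    qed
    then have "(\<integral>s. indicator {0..1} s *\<^sub>R pd i h (y + s *\<^sub>R ?e) \<partial>lborel) = h (y + 1 *\<^sub>R ?e) - h (y + 0 *\<^sub>R ?e)"
      by (intro integral_FTC_Icc continuous_on_compose2[OF cont]) (auto intro!: continuous_intros)
    then show ?thesis by (simp add: add.commute)
  qed
  have "(\<integral>y. h (y + ?e) - h y \<partial>lborel) = 0"
    using tr[OF int, of ?e] int by (simp add: add.commute)
  then have "0 = (\<integral>y. \<integral>s. ?f (s, y) \<partial>lborel \<partial>lborel)" by (simp only: ftc)
  also have "\<dots> = (\<integral>s. \<integral>y. ?f (s, y) \<partial>lborel \<partial>lborel)"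
    using lborel_pair.Fubini_integral[of "\<lambda>s y. ?f (s, y)"] fint by simp
  also have "\<dots> = (\<integral>s. indicator {0..1::real} s * (\<integral>y. pd i h y \<partial>lborel) \<partial>lborel)"
    using tr(1)[OF int'] by simp
  also have "\<dots> = (\<integral>y. pd i h y \<partial>lborel)" by simp
  finally show ?thesis by simp
qed

section \<open>Functions of polynomial growth\<close>

text \<open>A relational version of \<open>seq_pd\<close>, which is compatible with sums and products and carries
  differentiability along.\<close>

definition has_seq_pd :: "nat \<Rightarrow> ((nat \<Rightarrow> real) \<Rightarrow> real) \<Rightarrow> ((nat \<Rightarrow> real) \<Rightarrow> real) \<Rightarrow> bool" where
  "has_seq_pd i \<phi> \<phi>' \<longleftrightarrow> (\<forall>x. ((\<lambda>t. \<phi> (x(i := t))) has_field_derivative \<phi>' x) (at (x i)))"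

lemma seq_pd_eqI: "has_seq_pd i \<phi> \<phi>' \<Longrightarrow> seq_pd i \<phi> = \<phi>'"
  by (auto simp: has_seq_pd_def seq_pd_def fun_eq_iff intro: DERIV_imp_deriv)

text \<open>Membership for all iterated derivatives is reduced to a set that is closed under differentiation,
  as for \<open>C_b_inftyI\<close>.\<close>

lemma C_p_inftyI:
  assumes "\<phi> \<in> S" and local: "\<And>x y. (\<And>i. i < n \<Longrightarrow> x i = y i) \<Longrightarrow> \<phi> x = \<phi> y"
    and cont: "\<And>g. g \<in> S \<Longrightarrow> continuous_on UNIV g"
    and diff: "\<And>g i. g \<in> S \<Longrightarrow> i < n \<Longrightarrow> \<exists>g'\<in>S. has_seq_pd i g g'"
    and growth: "\<And>g. g \<in> S \<Longrightarrow> \<exists>K p. \<forall>x. \<bar>g x\<bar> \<le> K * (1 + (\<Sum>i<n. \<bar>x i\<bar>)) ^ p"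
  shows "\<phi> \<in> C_p_infty n"
proof -
  have S: "foldr seq_pd \<alpha> \<phi> \<in> S" if "set \<alpha> \<subseteq> {..<n}" for \<alpha>
    using that
  proof (induction \<alpha>)
    case (Cons i \<alpha>)
    then obtain g' where "g' \<in> S" "has_seq_pd i (foldr seq_pd \<alpha> \<phi>) g'" using diff[of "foldr seq_pd \<alpha> \<phi>" i] by auto
    then show ?case using seq_pd_eqI by simp
  qed (simp add: assms)
  have "(\<lambda>t. g (x(i := t))) differentiable (at (x i))" if "g \<in> S" "i < n" for g i x
    using diff[OF that] unfolding has_seq_pd_def real_differentiable_def by blast
  then show ?thesis unfolding C_p_infty_def using S local cont growth by blast
qed

text \<open>The functions that are inserted into the chain rule: polynomials, reciprocals of \<open>t\<^sup>2 + \<eta>\<close>, and smooth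
  bounded functions of some of the coordinates, with all their sums and products. This algebra is
  closed under partial derivatives and consists of functions of polynomial growth.\<close>

inductive_set growth_algebra :: "nat \<Rightarrow> ('d::finite \<Rightarrow> nat) \<Rightarrow> real \<Rightarrow> ((nat \<Rightarrow> real) \<Rightarrow> real) set"
  for n :: nat and idx :: "'d \<Rightarrow> nat" and \<eta> :: real where
  const: "(\<lambda>x. c) \<in> growth_algebra n idx \<eta>"
| coord: "i < n \<Longrightarrow> (\<lambda>x. x i) \<in> growth_algebra n idx \<eta>"
| inv: "i < n \<Longrightarrow> 0 < \<eta> \<Longrightarrow> (\<lambda>x. 1 / ((x i)\<^sup>2 + \<eta>)) \<in> growth_algebra n idx \<eta>"
| comp: "f \<in> C_b_infty \<Longrightarrow> (\<And>j. idx j < n) \<Longrightarrow> (\<lambda>x. f (\<chi> j. x (idx j))) \<in> growth_algebra n idx \<eta>"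
| add: "g \<in> growth_algebra n idx \<eta> \<Longrightarrow> h \<in> growth_algebra n idx \<eta> \<Longrightarrow> (\<lambda>x. g x + h x) \<in> growth_algebra n idx \<eta>"
| mult: "g \<in> growth_algebra n idx \<eta> \<Longrightarrow> h \<in> growth_algebra n idx \<eta> \<Longrightarrow> (\<lambda>x. g x * h x) \<in> growth_algebra n idx \<eta>"

lemma growth_algebra_sum:
  "finite I \<Longrightarrow> (\<And>i. i \<in> I \<Longrightarrow> g i \<in> growth_algebra n idx \<eta>) \<Longrightarrow> (\<lambda>x. \<Sum>i\<in>I. g i x) \<in> growth_algebra n idx \<eta>"
  by (induction rule: finite_induct) (auto intro: growth_algebra.intros)

lemma has_seq_pd_comp:
  fixes f :: "real^'d::finite \<Rightarrow> real"
  assumes "f \<in> C_b_infty"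
  shows "has_seq_pd k (\<lambda>x. f (\<chi> j. x (idx j))) (\<lambda>x. \<Sum>j\<in>UNIV. (if idx j = k then 1 else 0) * pd j f (\<chi> j. x (idx j)))"
  unfolding has_seq_pd_def
proof
  fix x :: "nat \<Rightarrow> real"
  let ?u = "\<lambda>t. \<chi> j. (x(k := t)) (idx j) :: real^'d"
  have u: "?u (x k) = (\<chi> j. x (idx j))" by simp
  have single: "((\<lambda>t. if idx j = k then t else x (idx j)) has_derivative (\<lambda>h. if idx j = k then h else 0)) (at (x k))" for j
    by (cases "idx j = k") auto
  have "?u = (\<lambda>t. \<Sum>j\<in>UNIV. (if idx j = k then t else x (idx j)) *\<^sub>R axis j 1)"
    by (auto simp: fun_eq_iff vec_eq_iff axis_def if_distrib[of "\<lambda>x. _ * x"] cong: if_cong)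
  moreover have "((\<lambda>t. \<Sum>j\<in>UNIV. (if idx j = k then t else x (idx j)) *\<^sub>R axis j 1) has_derivative
      (\<lambda>h. \<Sum>j\<in>UNIV. (if idx j = k then h else 0) *\<^sub>R axis j 1 :: real^'d)) (at (x k))"
    by (intro has_derivative_sum has_derivative_scaleR_left single)
  moreover have "(\<lambda>h. \<Sum>j\<in>UNIV. (if idx j = k then h else 0) *\<^sub>R axis j 1) = (\<lambda>h. (\<chi> j. if idx j = k then h else 0) :: real^'d)"
    by (auto simp: fun_eq_iff vec_eq_iff axis_def if_distrib[of "\<lambda>x. _ * x"] cong: if_cong)
  ultimately have "(?u has_derivative (\<lambda>h. \<chi> j. if idx j = k then h else 0)) (at (x k))" by simp
  then have "((\<lambda>t. f (?u t)) has_derivative (\<lambda>h. \<Sum>i\<in>UNIV. (\<chi> j. if idx j = k then h else 0) $ i * pd i f (?u (x k)))) (at (x k))"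
    by (intro has_derivative_pd_compose C_b_infty_differentiable assms)
  then show "((\<lambda>t. f (?u t)) has_field_derivative (\<Sum>j\<in>UNIV. (if idx j = k then 1 else 0) * pd j f (\<chi> j. x (idx j)))) (at (x k))"
    unfolding u has_field_derivative_def
    by (rule has_derivative_eq_rhs) (auto simp: fun_eq_iff sum_distrib_right intro!: sum.cong)
qed

lemma growth_algebra_deriv:
  assumes "g \<in> growth_algebra n idx \<eta>"
  shows "\<exists>g'\<in>growth_algebra n idx \<eta>. has_seq_pd k g g'"
  using assms
proof induction
  case (const c)
  show ?case by (rule bexI[of _ "\<lambda>_. 0"]) (auto simp: has_seq_pd_def intro: growth_algebra.const)
next
  case (coord i)
  show ?case by (rule bexI[of _ "\<lambda>_. if i = k then 1 else 0"])
    (auto simp: has_seq_pd_def intro: growth_algebra.const)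
next
  case (inv i)
  let ?v = "\<lambda>x::nat \<Rightarrow> real. 1 / ((x i)\<^sup>2 + \<eta>)"
  let ?d = "\<lambda>x. (if i = k then -2 else 0) * x i * (?v x * ?v x)"
  have p: "(t::real)\<^sup>2 + \<eta> > 0" for t using inv by (simp add: add_nonneg_pos)
  have "((\<lambda>t. 1 / (t\<^sup>2 + \<eta>)) has_field_derivative -2 * s * (1 / (s\<^sup>2 + \<eta>) * (1 / (s\<^sup>2 + \<eta>)))) (at s)" for s
    using p[of s] by (auto intro!: derivative_eq_intros simp: power2_eq_square divide_simps)
  then have "has_seq_pd k ?v ?d"
    by (cases "i = k") (auto simp: has_seq_pd_def)
  moreover have "?d \<in> growth_algebra n idx \<eta>"
    by (intro growth_algebra.mult growth_algebra.const growth_algebra.coord growth_algebra.inv inv)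
  ultimately show ?case by blast
next
  case (comp f)
  have "(\<lambda>x. \<Sum>j\<in>UNIV. (if idx j = k then 1 else 0) * pd j f (\<chi> j. x (idx j))) \<in> growth_algebra n idx \<eta>"
    by (intro growth_algebra_sum growth_algebra.mult growth_algebra.const growth_algebra.comp C_b_infty_pd comp finite)
  then show ?case using has_seq_pd_comp[OF comp(1)] by blast
next
  case (add g h)
  then obtain g' h' where "g' \<in> growth_algebra n idx \<eta>" "h' \<in> growth_algebra n idx \<eta>" "has_seq_pd k g g'" "has_seq_pd k h h'" by blast
  then show ?case
    by (intro bexI[of _ "\<lambda>x. g' x + h' x"]) (auto simp: has_seq_pd_def intro: growth_algebra.add DERIV_add)
next
  case (mult g h)
  then obtain g' h' where g: "g' \<in> growth_algebra n idx \<eta>" "h' \<in> growth_algebra n idx \<eta>" "has_seq_pd k g g'" "has_seq_pd k h h'" by blast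
  have "has_seq_pd k (\<lambda>x. g x * h x) (\<lambda>x. g' x * h x + h' x * g x)"
    unfolding has_seq_pd_def
  proof
    fix x
    have "((\<lambda>t. g (x(k := t)) * h (x(k := t))) has_field_derivative (g' x * h (x(k := x k)) + h' x * g (x(k := x k)))) (at (x k))"
      by (rule DERIV_mult) (use g in \<open>auto simp: has_seq_pd_def\<close>)
    then show "((\<lambda>t. g (x(k := t)) * h (x(k := t))) has_field_derivative (g' x * h x + h' x * g x)) (at (x k))" by simp
  qed
  moreover have "(\<lambda>x. g' x * h x + h' x * g x) \<in> growth_algebra n idx \<eta>"
    by (intro growth_algebra.add growth_algebra.mult g mult)
  ultimately show ?case by blast
qed

lemma growth_algebra_local:
  assumes "g \<in> growth_algebra n idx \<eta>" "\<And>i. i < n \<Longrightarrow> x i = y i"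
  shows "g x = g y"
  using assms(1) by induction (auto simp: assms(2))

lemma growth_algebra_continuous:
  assumes "g \<in> growth_algebra n idx \<eta>"
  shows "continuous_on UNIV g"
  using assms
proof induction
  case (inv i)
  have p: "(t::real)\<^sup>2 + \<eta> \<noteq> 0" for t using inv by (metis add_nonneg_pos less_irrefl zero_le_power2)
  show ?case by (intro continuous_intros continuous_on_product_coordinates ballI p)
next
  case (comp f)
  show ?case
    by (rule continuous_on_compose2[OF C_infty_continuous[OF C_b_infty_C_infty[OF comp(1)]]])
       (auto intro!: continuous_on_vec_lambda continuous_on_product_coordinates)
qed (auto intro!: continuous_intros continuous_on_product_coordinates)

lemma growth_algebra_growth:
  assumes "g \<in> growth_algebra n idx \<eta>"
  shows "\<exists>K p. \<forall>x. \<bar>g x\<bar> \<le> K * (1 + (\<Sum>i<n. \<bar>x i\<bar>)) ^ p"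
  using assms
proof induction
  case (const c)
  show ?case by (rule exI[of _ "\<bar>c\<bar>"], rule exI[of _ 0]) simp
next
  case (coord i)
  have "\<bar>x i\<bar> \<le> (\<Sum>i<n. \<bar>x i\<bar>)" for x :: "nat \<Rightarrow> real" using coord by (intro member_le_sum) auto
  then show ?case by (intro exI[of _ 1]) (auto simp: add_increasing)
next
  case (inv i)
  have "\<bar>1 / (t\<^sup>2 + \<eta>)\<bar> \<le> 1 / \<eta>" for t :: real
  proof -
    have "t\<^sup>2 + \<eta> \<ge> \<eta>" by simp
    then have "0 < t\<^sup>2 + \<eta>" using inv by linarith
    with \<open>t\<^sup>2 + \<eta> \<ge> \<eta>\<close> inv show ?thesis by (simp add: frac_le)
  qed
  then show ?case by (intro exI[of _ "1 / \<eta>"] exI[of _ 0]) auto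
next
  case (comp f)
  obtain K where "\<And>x. \<bar>f x\<bar> \<le> K" using C_b_infty_bound[OF comp(1)] by metis
  then show ?case by (intro exI[of _ K] exI[of _ 0]) auto
next
  case (add g h)
  then obtain K p K' p' where b: "\<And>x. \<bar>g x\<bar> \<le> K * (1 + (\<Sum>i<n. \<bar>x i\<bar>)) ^ p" "\<And>x. \<bar>h x\<bar> \<le> K' * (1 + (\<Sum>i<n. \<bar>x i\<bar>)) ^ p'" by blast
  have "\<bar>g x + h x\<bar> \<le> (\<bar>K\<bar> + \<bar>K'\<bar>) * (1 + (\<Sum>i<n. \<bar>x i\<bar>)) ^ (p + p')" for x
  proof -
    let ?s = "1 + (\<Sum>i<n. \<bar>x i\<bar>)"
    have s: "?s \<ge> 1" by (simp add: sum_nonneg)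
    have "\<bar>g x\<bar> \<le> \<bar>K\<bar> * ?s ^ (p + p')"
      by (rule order_trans[OF b(1)]) (use s in \<open>auto intro!: mult_mono power_increasing\<close>)
    moreover have "\<bar>h x\<bar> \<le> \<bar>K'\<bar> * ?s ^ (p + p')"
      by (rule order_trans[OF b(2)]) (use s in \<open>auto intro!: mult_mono power_increasing\<close>)
    ultimately show ?thesis by (auto simp: distrib_right)
  qed
  then show ?case by blast
next
  case (mult g h)
  then obtain K p K' p' where b: "\<And>x. \<bar>g x\<bar> \<le> K * (1 + (\<Sum>i<n. \<bar>x i\<bar>)) ^ p" "\<And>x. \<bar>h x\<bar> \<le> K' * (1 + (\<Sum>i<n. \<bar>x i\<bar>)) ^ p'" by blast
  have "\<bar>g x * h x\<bar> \<le> (K * K') * (1 + (\<Sum>i<n. \<bar>x i\<bar>)) ^ (p + p')" for x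
  proof -
    have "\<bar>g x * h x\<bar> \<le> (K * (1 + (\<Sum>i<n. \<bar>x i\<bar>)) ^ p) * (K' * (1 + (\<Sum>i<n. \<bar>x i\<bar>)) ^ p')"
      unfolding abs_mult by (intro mult_mono b) (auto intro: order_trans[OF abs_ge_zero b(1)])
    then show ?thesis by (simp add: power_add mult_ac)
  qed
  then show ?case by blast
qed

lemma growth_algebra_C_p_infty:
  assumes "g \<in> growth_algebra n idx \<eta>" shows "g \<in> C_p_infty n"
proof (rule C_p_inftyI[where S = "growth_algebra n idx \<eta>"])
  show "g x = g y" if "\<And>i. i < n \<Longrightarrow> x i = y i" for x y by (rule growth_algebra_local[OF assms that])
qed (simp_all only: assms growth_algebra_continuous growth_algebra_deriv growth_algebra_growth)

section \<open>Orthonormal expansions\<close>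

text \<open>Since \<open>sgn 0 = 0\<close>, vectors that depend linearly on their predecessors become \<open>0\<close>. Allowing zero
  vectors avoids a case distinction on the dimension of the space.\<close>

fun gram_schmidt :: "(nat \<Rightarrow> 'h::real_inner) \<Rightarrow> nat \<Rightarrow> 'h" where
  "gram_schmidt x n = sgn (x n - (\<Sum>i<n. inner (x n) (gram_schmidt x i) *\<^sub>R gram_schmidt x i))"

declare gram_schmidt.simps [simp del]

lemma gram_schmidt_unit: "gram_schmidt x n = 0 \<or> norm (gram_schmidt x n) = 1"
proof -
  obtain r where "gram_schmidt x n = sgn r" by (rule that[OF gram_schmidt.simps])
  then show ?thesis by (simp add: norm_sgn sgn_zero_iff)
qed

lemma inner_partial_sum:
  fixes e :: "'i \<Rightarrow> 'h::real_inner"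
  assumes "finite I" "\<And>i k. i \<in> I \<Longrightarrow> k \<in> I \<Longrightarrow> i \<noteq> k \<Longrightarrow> inner (e i) (e k) = 0" "\<And>i. i \<in> I \<Longrightarrow> e i = 0 \<or> norm (e i) = 1" "j \<in> I"
  shows "inner (\<Sum>i\<in>I. inner y (e i) *\<^sub>R e i) (e j) = inner y (e j)"
proof -
  have "inner (\<Sum>i\<in>I. inner y (e i) *\<^sub>R e i) (e j) = (\<Sum>i\<in>I. if i = j then inner y (e j) else 0)"
    unfolding inner_sum_left
  proof (rule sum.cong)
    fix i assume "i \<in> I"
    then show "inner (inner y (e i) *\<^sub>R e i) (e j) = (if i = j then inner y (e j) else 0)"
      using assms(2)[of i j] assms(3)[of j] assms(4) by (auto simp: norm_eq_1)
  qed simp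
  then show ?thesis using assms by simp
qed

lemma Bessel_identity:
  fixes e :: "'i \<Rightarrow> 'h::real_inner"
  assumes "finite I" "\<And>i k. i \<in> I \<Longrightarrow> k \<in> I \<Longrightarrow> i \<noteq> k \<Longrightarrow> inner (e i) (e k) = 0" "\<And>i. i \<in> I \<Longrightarrow> e i = 0 \<or> norm (e i) = 1"
  shows "(norm (v - (\<Sum>i\<in>I. inner v (e i) *\<^sub>R e i)))\<^sup>2 = (norm v)\<^sup>2 - (\<Sum>i\<in>I. (inner v (e i))\<^sup>2)"
proof -
  let ?P = "\<Sum>i\<in>I. inner v (e i) *\<^sub>R e i"
  have "inner ?P w = (\<Sum>i\<in>I. inner v (e i) * inner (e i) w)" for w by (simp add: inner_sum_left)
  moreover have "inner (e i) ?P = inner v (e i)" if "i \<in> I" for i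
  proof -
    have "inner ?P (e i) = inner v (e i)" by (rule inner_partial_sum[OF assms(1)]) (use assms that in auto)
    then show ?thesis by (simp add: inner_commute)
  qed
  ultimately have "inner ?P ?P = (\<Sum>i\<in>I. (inner v (e i))\<^sup>2)" "inner ?P v = (\<Sum>i\<in>I. (inner v (e i))\<^sup>2)"
    by (auto simp: power2_eq_square inner_commute[of v])
  then show ?thesis
    by (simp add: power2_norm_eq_inner inner_diff_left inner_diff_right inner_commute)
qed

lemma Bessel_inequality:
  fixes e :: "'i \<Rightarrow> 'h::real_inner"
  assumes "finite I" "\<And>i k. i \<in> I \<Longrightarrow> k \<in> I \<Longrightarrow> i \<noteq> k \<Longrightarrow> inner (e i) (e k) = 0" "\<And>i. i \<in> I \<Longrightarrow> e i = 0 \<or> norm (e i) = 1"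
  shows "(\<Sum>i\<in>I. (inner v (e i))\<^sup>2) \<le> (norm v)\<^sup>2"
proof -
  have "(norm (v - (\<Sum>i\<in>I. inner v (e i) *\<^sub>R e i)))\<^sup>2 = (norm v)\<^sup>2 - (\<Sum>i\<in>I. (inner v (e i))\<^sup>2)"
    by (rule Bessel_identity) (use assms in auto)
  then show ?thesis using zero_le_power2[of "norm (v - (\<Sum>i\<in>I. inner v (e i) *\<^sub>R e i))"] by linarith
qed

lemma gram_schmidt_orthogonal_less: "i < n \<Longrightarrow> inner (gram_schmidt x n) (gram_schmidt x i) = 0"
proof (induction n arbitrary: i rule: less_induct)
  case (less n)
  let ?e = "gram_schmidt x"
  have "inner (\<Sum>i<n. inner (x n) (?e i) *\<^sub>R ?e i) (?e i) = inner (x n) (?e i)"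
  proof (rule inner_partial_sum)
    fix a b assume "a \<in> {..<n}" "b \<in> {..<n}" "a \<noteq> b"
    then show "inner (?e a) (?e b) = 0"
      using less.IH[of a b] less.IH[of b a] by (cases "a < b") (auto simp: inner_commute)
  qed (use gram_schmidt_unit less.prems in auto)
  then have "inner (x n - (\<Sum>i<n. inner (x n) (?e i) *\<^sub>R ?e i)) (?e i) = 0" by (simp only: inner_diff_left)
  moreover have "?e n = sgn (x n - (\<Sum>i<n. inner (x n) (?e i) *\<^sub>R ?e i))" by (rule gram_schmidt.simps)
  ultimately show ?case by (simp only: sgn_div_norm inner_scaleR_left mult_zero_right)
qed

lemma gram_schmidt_orthogonal:
  assumes "i \<noteq> j" shows "inner (gram_schmidt x i) (gram_schmidt x j) = 0"
proof (cases "i < j")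
  case True
  show ?thesis by (subst inner_commute) (rule gram_schmidt_orthogonal_less[OF True])
next
  case False
  with assms have "j < i" by simp
  then show ?thesis by (rule gram_schmidt_orthogonal_less)
qed

text \<open>The vectors are recovered from the orthonormalised ones, because the remainder that is normalised
  is the component of \<open>x n\<close> along \<open>gram_schmidt x n\<close>.\<close>

lemma gram_schmidt_expansion:
  fixes x :: "nat \<Rightarrow> 'h::real_inner"
  shows "x n = (\<Sum>i<Suc n. inner (x n) (gram_schmidt x i) *\<^sub>R gram_schmidt x i)"
proof -
  let ?e = "gram_schmidt x" let ?P = "\<Sum>i<n. inner (x n) (?e i) *\<^sub>R ?e i"
  let ?r = "x n - ?P"
  have unit: "r = norm r *\<^sub>R sgn r" for r :: 'h by (cases "r = 0") (simp_all add: sgn_div_norm)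
  have e: "?e n = sgn ?r" by (rule gram_schmidt.simps)
  have r: "?r = norm ?r *\<^sub>R ?e n" unfolding e by (rule unit)
  have "inner ?P (?e n) = 0" by (simp add: inner_sum_left gram_schmidt_orthogonal)
  then have "inner (x n) (?e n) = inner ?r (?e n)" by (simp add: inner_diff_left)
  also have "\<dots> = norm ?r * inner (?e n) (?e n)" by (subst r) simp
  finally have "inner (x n) (?e n) *\<^sub>R ?e n = norm ?r *\<^sub>R ?e n"
    using gram_schmidt_unit[of x n] by (auto simp: norm_eq_1)
  also have "\<dots> = ?r" by (rule r[symmetric])
  finally have "inner (x n) (?e n) *\<^sub>R ?e n = ?r" .
  then show ?thesis by simp
qed

text \<open>An orthonormal basis, possibly padded with zero vectors.\<close>

definition parseval_sequence :: "(nat \<Rightarrow> 'h::real_inner) \<Rightarrow> bool" where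
  "parseval_sequence e \<longleftrightarrow> (\<forall>i j. i \<noteq> j \<longrightarrow> inner (e i) (e j) = 0) \<and> (\<forall>i. e i = 0 \<or> norm (e i) = 1) \<and>
     (\<forall>v w. (\<lambda>i. inner v (e i) * inner w (e i)) sums inner v w)"

text \<open>Orthonormalise a countable dense set. The remainders of the partial expansions
  depend on the vector by contractions and eventually vanish on every member of the dense set, so they
  tend to \<open>0\<close> everywhere.\<close>

lemma parseval_sequence_exists: "\<exists>e :: nat \<Rightarrow> 'h::{real_inner, second_countable_topology}. parseval_sequence e"
proof -
  from countable_dense_exists[where 'a = 'h] obtain S :: "'h set"
    where "countable S \<and> (\<forall>X. open X \<longrightarrow> X \<noteq> {} \<longrightarrow> (\<exists>d\<in>S. d \<in> X))" ..
  then have S: "countable S" "\<And>X. open X \<Longrightarrow> X \<noteq> {} \<Longrightarrow> \<exists>d\<in>S. d \<in> X" by simp_all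
  have "S \<noteq> {}" using S(2)[of UNIV] by auto
  define x where "x = from_nat_into S"
  define e where "e = gram_schmidt x"
  have orth: "\<And>i j. i \<noteq> j \<Longrightarrow> inner (e i) (e j) = 0" and unit: "\<And>i. e i = 0 \<or> norm (e i) = 1"
    unfolding e_def using gram_schmidt_orthogonal gram_schmidt_unit by blast+
  define P where "P n v = (\<Sum>i<n. inner v (e i) *\<^sub>R e i)" for n v
  have contraction: "norm (v - P n v) \<le> norm v" for n v
  proof -
    have "(norm (v - P n v))\<^sup>2 \<le> (norm v)\<^sup>2"
      unfolding P_def using Bessel_identity[of "{..<n}" e v] orth unit by (simp add: sum_nonneg)
    then show ?thesis by (rule power2_le_imp_le) simp
  qed
  have Px: "P n (x m) = x m" if "m < n" for n m
  proof -
    have "inner (x m) (e i) = 0" if "m < i" for i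
    proof -
      have "inner (x m) (e i) = (\<Sum>j<Suc m. inner (inner (x m) (e j) *\<^sub>R e j) (e i))"
        by (subst gram_schmidt_expansion[of x m, folded e_def]) (rule inner_sum_left)
      also have "\<dots> = 0" using that by (intro sum.neutral) (auto simp: orth)
      finally show ?thesis .
    qed
    then have "P n (x m) = (\<Sum>i<Suc m. inner (x m) (e i) *\<^sub>R e i)"
      unfolding P_def by (intro sum.mono_neutral_right) (use that in auto)
    also have "\<dots> = x m" by (rule gram_schmidt_expansion[of x m, symmetric, folded e_def])
    finally show ?thesis .
  qed
  have Pdiff: "P n (v - w) = P n v - P n w" for n v w
    by (simp add: P_def inner_diff_left scaleR_left_diff_distrib sum_subtractf)
  have lim: "(\<lambda>n. P n v) \<longlonglongrightarrow> v" for v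
    unfolding lim_sequentially
  proof (intro allI impI)
    fix r :: real assume "r > 0"
    then obtain d where d: "d \<in> S" "dist v d < r" using S(2)[of "ball v r"] by auto
    then obtain m where m: "d = x m" unfolding x_def using S(1) \<open>S \<noteq> {}\<close> by (metis from_nat_into_surj)
    have "dist (P n v) v < r" if "n \<ge> Suc m" for n
    proof -
      have "v - P n v = (v - d) - P n (v - d)" using Px[of m n] that by (simp add: Pdiff m)
      then have "norm (v - P n v) = norm ((v - d) - P n (v - d))" by (rule arg_cong)
      also have "\<dots> \<le> norm (v - d)" by (rule contraction)
      also have "\<dots> < r" using d(2) by (simp only: dist_norm)
      finally show ?thesis by (simp only: dist_norm norm_minus_commute)
    qed
    then show "\<exists>no. \<forall>n\<ge>no. dist (P n v) v < r" by (intro exI[of _ "Suc m"]) simp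
  qed
  have pars: "(\<lambda>i. inner v (e i) * inner w (e i)) sums inner v w" for v w
  proof -
    have "(\<lambda>n. inner (P n v) w) \<longlonglongrightarrow> inner v w" by (intro tendsto_intros lim)
    moreover have "inner (P n v) w = (\<Sum>i<n. inner v (e i) * inner w (e i))" for n
      by (simp only: P_def inner_sum_left inner_scaleR_left inner_commute[of w])
    ultimately show ?thesis by (simp only: sums_def)
  qed
  show ?thesis unfolding parseval_sequence_def by (intro exI[of _ e] conjI allI impI orth unit pars)
qed

section \<open>Sobolev calculus in the abstract framework\<close>

text \<open>The constant in the Leibniz inequality for \<open>T k\<close>; the recursion is the one that comes out of
  \<open>T_sum_mult\<close>.\<close>

primrec leibniz_const :: "nat \<Rightarrow> nat" where
  "leibniz_const 0 = 1"
| "leibniz_const (Suc k) = 1 + 4 * leibniz_const k"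

lemma ennreal_power2_add_le: "ennreal ((a + b)\<^sup>2) \<le> 2 * ennreal (a\<^sup>2) + 2 * ennreal (b\<^sup>2)"
proof -
  have "(a + b)\<^sup>2 \<le> 2 * a\<^sup>2 + 2 * b\<^sup>2"
    using sum_squares_bound[of a b] by (simp add: power2_sum)
  then have "ennreal ((a + b)\<^sup>2) \<le> ennreal (2 * a\<^sup>2 + 2 * b\<^sup>2)" by (rule ennreal_leI)
  then show ?thesis by (simp add: ennreal_mult)
qed

lemma all_Lp_integrable: "X \<in> all_Lp M \<Longrightarrow> p > 1 \<Longrightarrow> integrable M (\<lambda>\<omega>. norm (X \<omega>) powr p)"
  unfolding all_Lp_def by blast

text \<open>A fixed orthonormal sequence in \<open>'h\<close> replaces the tensor-valued derivatives by iterated directional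
  derivatives, which take \<open>E\<close> into itself.\<close>

locale malliavin_basis = malliavin_framework M E \<Gamma> L tens D DD
  for M :: "'w measure"
    and E :: "('w \<Rightarrow> real) set"
    and \<Gamma> :: "('w \<Rightarrow> real) \<Rightarrow> ('w \<Rightarrow> real) \<Rightarrow> 'w \<Rightarrow> real"
    and L :: "('w \<Rightarrow> real) \<Rightarrow> 'w \<Rightarrow> real"
    and tens :: "'h::{real_inner, polish_space} list \<Rightarrow> 't::{real_inner, polish_space}"
    and D :: "('w \<Rightarrow> real) \<Rightarrow> 'w \<Rightarrow> 'h"
    and DD :: "nat \<Rightarrow> ('w \<Rightarrow> real) \<Rightarrow> 'w \<Rightarrow> 't" +
  fixes e :: "nat \<Rightarrow> 'h"
  assumes e: "parseval_sequence e"
begin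

subsection \<open>The algebra\<close>

lemma E_measurable [measurable]: "F \<in> E \<Longrightarrow> F \<in> borel_measurable M"
  using E_Lp by (auto simp: all_Lp_def)

lemma E_const: "(\<lambda>\<omega>. c) \<in> E"
  using E_smooth[OF growth_algebra_C_p_infty[OF growth_algebra.const[of c 0 "\<lambda>_::unit. 0" 1]], of "\<lambda>_ _. 0"] by simp

definition pair_seq :: "('w \<Rightarrow> real) \<Rightarrow> ('w \<Rightarrow> real) \<Rightarrow> nat \<Rightarrow> 'w \<Rightarrow> real" where
  "pair_seq F G i = (if i = 0 then F else G)"

lemma affine_C_p_infty: "(\<lambda>x. a * x 0 + b * x 1) \<in> C_p_infty 2"
  by (rule growth_algebra_C_p_infty[of _ _ "\<lambda>_::unit. 0" 1], intro growth_algebra.intros) auto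

lemma mult_C_p_infty: "(\<lambda>x. x 0 * x 1) \<in> C_p_infty 2"
  by (rule growth_algebra_C_p_infty[of _ _ "\<lambda>_::unit. 0" 1], intro growth_algebra.intros) auto

lemma E_lin: "F \<in> E \<Longrightarrow> G \<in> E \<Longrightarrow> (\<lambda>\<omega>. a * F \<omega> + b * G \<omega>) \<in> E"
  using E_smooth[OF affine_C_p_infty[of a b], of "pair_seq F G"] by (simp add: pair_seq_def)

lemma E_add: "F \<in> E \<Longrightarrow> G \<in> E \<Longrightarrow> (\<lambda>\<omega>. F \<omega> + G \<omega>) \<in> E"
  using E_lin[of F G 1 1] by simp

lemma E_diff: "F \<in> E \<Longrightarrow> G \<in> E \<Longrightarrow> (\<lambda>\<omega>. F \<omega> - G \<omega>) \<in> E"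
  using E_lin[of F G 1 "-1"] by simp

lemma E_mult: "F \<in> E \<Longrightarrow> G \<in> E \<Longrightarrow> (\<lambda>\<omega>. F \<omega> * G \<omega>) \<in> E"
  using E_smooth[OF mult_C_p_infty, of "pair_seq F G"] by (simp add: pair_seq_def)

lemma E_cmult: "F \<in> E \<Longrightarrow> (\<lambda>\<omega>. c * F \<omega>) \<in> E"
  by (rule E_mult[OF E_const])

lemma E_sum: "(\<And>i. i \<in> I \<Longrightarrow> u i \<in> E) \<Longrightarrow> (\<lambda>\<omega>. \<Sum>i\<in>I. u i \<omega>) \<in> E"
  by (induction I rule: infinite_finite_induct) (auto intro: E_const E_add)

lemma E_prod: "(\<And>i. i \<in> I \<Longrightarrow> u i \<in> E) \<Longrightarrow> (\<lambda>\<omega>. \<Prod>i\<in>I. u i \<omega>) \<in> E"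
  by (induction I rule: infinite_finite_induct) (auto intro: E_const E_mult)

lemma E_integrable:
  assumes "F \<in> E" shows "integrable M F"
proof -
  have "integrable M (\<lambda>\<omega>. norm (F \<omega>) powr 2)"
    by (rule all_Lp_integrable[of F]) (use E_Lp assms in auto)
  moreover have "norm x powr 2 = x\<^sup>2" for x :: real by (simp add: powr_numeral)
  ultimately have i: "integrable M (\<lambda>\<omega>. 1 + (F \<omega>)\<^sup>2)" by simp
  have "\<bar>x\<bar> \<le> 1 + x\<^sup>2" for x :: real
  proof -
    have "2 * (\<bar>x\<bar> * 1) \<le> \<bar>x\<bar>\<^sup>2 + 1\<^sup>2" using sum_squares_bound[of "\<bar>x\<bar>" 1] by simp
    then show ?thesis by (simp add: power2_eq_square)
  qed
  then show ?thesis
    by (intro Bochner_Integration.integrable_bound[OF i]) (use E_measurable[OF assms] in auto)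
qed

lemma E_integrable_mult: "F \<in> E \<Longrightarrow> G \<in> E \<Longrightarrow> integrable M (\<lambda>\<omega>. F \<omega> * G \<omega>)"
  by (intro E_integrable E_mult)

lemma D_const: "AE \<omega> in M. D (\<lambda>\<omega>. c) \<omega> = 0"
  using D_chain[OF growth_algebra_C_p_infty[OF growth_algebra.const[of c 0 "\<lambda>_::unit. 0" 1]], of "\<lambda>_ _. 0"] by simp

lemma D_mult:
  assumes "F \<in> E" "G \<in> E"
  shows "AE \<omega> in M. D (\<lambda>\<omega>. F \<omega> * G \<omega>) \<omega> = F \<omega> *\<^sub>R D G \<omega> + G \<omega> *\<^sub>R D F \<omega>"
proof -
  have s: "seq_pd 0 (\<lambda>x. x 0 * x (Suc 0)) = (\<lambda>x. x (Suc 0))" "seq_pd (Suc 0) (\<lambda>x. x 0 * x (Suc 0)) = (\<lambda>x. x 0)"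
    by (intro seq_pd_eqI; auto simp: has_seq_pd_def intro!: derivative_eq_intros)+
  have e2: "{..<2::nat} = {0, Suc 0}" by auto
  have "AE \<omega> in M. D (\<lambda>\<omega>. (\<lambda>x. x 0 * x 1) (\<lambda>i. pair_seq F G i \<omega>)) \<omega> =
      (\<Sum>i<2. seq_pd i (\<lambda>x. x 0 * x 1) (\<lambda>j. pair_seq F G j \<omega>) *\<^sub>R D (pair_seq F G i) \<omega>)"
    by (rule D_chain[OF mult_C_p_infty]) (use assms in \<open>auto simp: pair_seq_def\<close>)
  then show ?thesis unfolding e2 by (simp add: s) (simp add: pair_seq_def add.commute)
qed

text \<open>The function \<open>t \<mapsto> 1 / (t\<^sup>2 + \<eta>)\<close> is smooth with bounded derivatives, in contrast to \<open>t \<mapsto> 1 / t\<close>. It is the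
  admissible substitute for the reciprocal of the determinant.\<close>

lemma D_recip:
  assumes "F \<in> E" "\<eta> > 0"
  shows "(\<lambda>\<omega>. 1 / ((F \<omega>)\<^sup>2 + \<eta>)) \<in> E"
    and "AE \<omega> in M. D (\<lambda>\<omega>. 1 / ((F \<omega>)\<^sup>2 + \<eta>)) \<omega> = (-2 * F \<omega> * (1 / ((F \<omega>)\<^sup>2 + \<eta>))\<^sup>2) *\<^sub>R D F \<omega>"
proof -
  have c: "(\<lambda>x. 1 / ((x 0)\<^sup>2 + \<eta>)) \<in> C_p_infty 1"
    by (rule growth_algebra_C_p_infty[of _ _ "\<lambda>_::unit. 0" \<eta>], intro growth_algebra.intros) (auto simp: assms)
  show "(\<lambda>\<omega>. 1 / ((F \<omega>)\<^sup>2 + \<eta>)) \<in> E" using E_smooth[OF c, of "\<lambda>_. F"] assms by simp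
  have p: "(t::real)\<^sup>2 + \<eta> > 0" for t using assms by (simp add: add_nonneg_pos)
  have "((\<lambda>t. 1 / (t\<^sup>2 + \<eta>)) has_field_derivative -2 * s * (1 / (s\<^sup>2 + \<eta>))\<^sup>2) (at s)" for s
    using p[of s] by (auto intro!: derivative_eq_intros simp: power2_eq_square divide_simps)
  then have s: "seq_pd 0 (\<lambda>x. 1 / ((x 0)\<^sup>2 + \<eta>)) = (\<lambda>x. -2 * x 0 * (1 / ((x 0)\<^sup>2 + \<eta>))\<^sup>2)"
    by (intro seq_pd_eqI) (simp add: has_seq_pd_def)
  have e1: "{..<1::nat} = {0}" by auto
  show "AE \<omega> in M. D (\<lambda>\<omega>. 1 / ((F \<omega>)\<^sup>2 + \<eta>)) \<omega> = (-2 * F \<omega> * (1 / ((F \<omega>)\<^sup>2 + \<eta>))\<^sup>2) *\<^sub>R D F \<omega>"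
    using D_chain[OF c, of "\<lambda>_. F"] assms unfolding e1 by (simp add: s)
qed

text \<open>The chain rule is stated for sequences; an enumeration of the finite index type transports it to
  functions on \<open>real^'d\<close>.\<close>

lemma D_smooth:
  fixes F :: "'d::finite \<Rightarrow> 'w \<Rightarrow> real"
  assumes "f \<in> C_b_infty" "\<And>i. F i \<in> E"
  shows "(\<lambda>\<omega>. f (rvec F \<omega>)) \<in> E"
    and "AE \<omega> in M. D (\<lambda>\<omega>. f (rvec F \<omega>)) \<omega> = (\<Sum>i\<in>UNIV. pd i f (rvec F \<omega>) *\<^sub>R D (F i) \<omega>)"
proof -
  let ?n = "CARD('d)"
  obtain idx :: "'d \<Rightarrow> nat" where idx: "bij_betw idx UNIV {..<?n}"
    using ex_bij_betw_finite_nat[of "UNIV :: 'd set"] by (auto simp: atLeast0LessThan)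
  have inj: "inj idx" using idx by (simp add: bij_betw_def)
  let ?G = "\<lambda>i. F (inv idx i)"
  let ?\<phi> = "\<lambda>x. f (\<chi> j. x (idx j))"
  have c: "?\<phi> \<in> C_p_infty ?n"
    by (rule growth_algebra_C_p_infty[of _ _ idx 1], intro growth_algebra.intros) (use idx assms in \<open>auto simp: bij_betw_def\<close>)
  have r: "(\<chi> j. ?G (idx j) \<omega>) = rvec F \<omega>" for \<omega> by (simp add: rvec_def inv_f_f[OF inj])
  show "(\<lambda>\<omega>. f (rvec F \<omega>)) \<in> E" using E_smooth[OF c, of ?G] assms by (simp add: r)
  have s: "seq_pd (idx k) ?\<phi> (\<lambda>i. ?G i \<omega>) = pd k f (rvec F \<omega>)" for k \<omega>
    using seq_pd_eqI[OF has_seq_pd_comp[OF assms(1), of "idx k" idx]] inj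
    by (simp add: inj_eq if_distrib[of "\<lambda>x. x * _"] rvec_def cong: if_cong)
  have "AE \<omega> in M. D (\<lambda>\<omega>. ?\<phi> (\<lambda>i. ?G i \<omega>)) \<omega> = (\<Sum>i<?n. seq_pd i ?\<phi> (\<lambda>j. ?G j \<omega>) *\<^sub>R D (?G i) \<omega>)"
    by (rule D_chain[OF c]) (use assms in auto)
  moreover have "(\<Sum>i<?n. seq_pd i ?\<phi> (\<lambda>j. ?G j \<omega>) *\<^sub>R D (?G i) \<omega>) = (\<Sum>i\<in>UNIV. pd i f (rvec F \<omega>) *\<^sub>R D (F i) \<omega>)" for \<omega>
    by (subst sum.reindex_bij_betw[OF idx, symmetric]) (simp add: s inv_f_f[OF inj])
  ultimately show "AE \<omega> in M. D (\<lambda>\<omega>. f (rvec F \<omega>)) \<omega> = (\<Sum>i\<in>UNIV. pd i f (rvec F \<omega>) *\<^sub>R D (F i) \<omega>)"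
    by (simp add: r)
qed

subsection \<open>Coordinate derivatives and squared Sobolev norms\<close>

abbreviation dd :: "nat \<Rightarrow> ('w \<Rightarrow> real) \<Rightarrow> 'w \<Rightarrow> real" where
  "dd i \<equiv> dir_deriv D (e i)"

lemma dd_in: "F \<in> E \<Longrightarrow> dd i F \<in> E"
  by (rule dir_deriv_in)

lemma dd_cong:
  assumes "F \<in> E" "F' \<in> E" "AE \<omega> in M. F \<omega> = F' \<omega>"
  shows "AE \<omega> in M. dd i F \<omega> = dd i F' \<omega>"
  using D_AE[OF assms] by eventually_elim (simp add: dir_deriv_def)

lemma dd_lin:
  assumes "F \<in> E" "G \<in> E"
  shows "AE \<omega> in M. dd i (\<lambda>\<omega>. a * F \<omega> + b * G \<omega>) \<omega> = a * dd i F \<omega> + b * dd i G \<omega>"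
  using D_linear[OF assms, of a b] by eventually_elim (simp add: dir_deriv_def inner_add_left)

lemma dd_mult:
  assumes "F \<in> E" "G \<in> E"
  shows "AE \<omega> in M. dd i (\<lambda>\<omega>. F \<omega> * G \<omega>) \<omega> = dd i F \<omega> * G \<omega> + F \<omega> * dd i G \<omega>"
  using D_mult[OF assms] by eventually_elim (simp add: dir_deriv_def inner_add_left mult.commute)

lemma dd_const: "AE \<omega> in M. dd i (\<lambda>\<omega>. c) \<omega> = 0"
  using D_const[of c] by eventually_elim (simp add: dir_deriv_def)

lemma dd_sum_mult:
  fixes u v :: "nat \<Rightarrow> 'w \<Rightarrow> real"
  assumes "\<And>j. u j \<in> E" "\<And>j. v j \<in> E"
  shows "AE \<omega> in M. dd i (\<lambda>\<omega>. \<Sum>j<n. u j \<omega> * v j \<omega>) \<omega> = (\<Sum>j<n. dd i (u j) \<omega> * v j \<omega>) + (\<Sum>j<n. u j \<omega> * dd i (v j) \<omega>)"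
proof (induction n)
  case 0
  then show ?case using dd_const[of i 0] by simp
next
  case (Suc n)
  have "(\<lambda>\<omega>. \<Sum>j<n. u j \<omega> * v j \<omega>) \<in> E" "(\<lambda>\<omega>. u n \<omega> * v n \<omega>) \<in> E" by (intro E_sum E_mult assms)+
  from dd_lin[OF this, of i 1 1] Suc dd_mult[OF assms(1)[of n] assms(2)[of n], of i] show ?case
    by eventually_elim (simp add: algebra_simps)
qed

text \<open>The sum of the squares of all iterated directional derivatives of order at most \<open>k\<close> along \<open>e\<close>. Squares
  are used because \<open>T (Suc k)\<close> is then, up to the term of order \<open>0\<close>, a sum of \<open>T k\<close> over directions, which turns every estimate into
  an induction on \<open>k\<close>. The values are extended reals, so no convergence question arises.\<close>

primrec T :: "nat \<Rightarrow> ('w \<Rightarrow> real) \<Rightarrow> 'w \<Rightarrow> ennreal" where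
  "T 0 F = (\<lambda>\<omega>. ennreal ((F \<omega>)\<^sup>2))"
| "T (Suc k) F = (\<lambda>\<omega>. ennreal ((F \<omega>)\<^sup>2) + (\<Sum>i. T k (dd i F) \<omega>))"

text \<open>The part of \<open>T (Suc k)\<close> without the order \<open>0\<close>, which corresponds to \<open>norm1k\<close>.\<close>

definition T' :: "nat \<Rightarrow> ('w \<Rightarrow> real) \<Rightarrow> 'w \<Rightarrow> ennreal" where
  "T' k F \<omega> = (\<Sum>i. T k (dd i F) \<omega>)"

lemma T_Suc: "T (Suc k) F \<omega> = ennreal ((F \<omega>)\<^sup>2) + T' k F \<omega>"
  by (simp add: T'_def)

declare T.simps(2) [simp del]

lemma T_measurable [measurable]: "F \<in> E \<Longrightarrow> T k F \<in> borel_measurable M"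
proof (induction k arbitrary: F)
  case (Suc k)
  have [measurable]: "F \<in> borel_measurable M" "\<And>i. T k (dd i F) \<in> borel_measurable M"
    using Suc dd_in by auto
  show ?case unfolding T.simps by measurable
qed simp

lemma T'_measurable [measurable]: "F \<in> E \<Longrightarrow> T' k F \<in> borel_measurable M"
  unfolding T'_def[abs_def] by (intro borel_measurable_suminf_order T_measurable dd_in)

lemma T_ge: "ennreal ((F \<omega>)\<^sup>2) \<le> T k F \<omega>"
  by (cases k) (auto simp: T_Suc)

lemma T'_le_T: "T' k F \<omega> \<le> T (Suc k) F \<omega>"
  by (simp add: T_Suc)

lemma T_mono_Suc: "T k F \<omega> \<le> T (Suc k) F \<omega>"
proof (induction k arbitrary: F)
  case (Suc k)
  then show ?case by (auto simp: T_Suc T'_def intro!: add_left_mono suminf_le)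
qed (simp add: T_Suc)

lemma T_mono: "j \<le> k \<Longrightarrow> T j F \<omega> \<le> T k F \<omega>"
  by (rule lift_Suc_mono_le[of "\<lambda>k. T k F \<omega>"]) (rule T_mono_Suc)

lemma T'_mono: "j \<le> k \<Longrightarrow> T' j F \<omega> \<le> T' k F \<omega>"
  unfolding T'_def by (intro suminf_le T_mono) auto

lemma T_cong:
  assumes "F \<in> E" "F' \<in> E" "AE \<omega> in M. F \<omega> = F' \<omega>"
  shows "AE \<omega> in M. T k F \<omega> = T k F' \<omega>"
  using assms
proof (induction k arbitrary: F F')
  case 0
  from 0(3) show ?case by eventually_elim simp
next
  case (Suc k)
  have "AE \<omega> in M. \<forall>i. T k (dd i F) \<omega> = T k (dd i F') \<omega>"
    unfolding AE_all_countable using Suc by (intro allI Suc.IH dd_in dd_cong)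
  with Suc.prems(3) show ?case by eventually_elim (simp add: T.simps)
qed

lemma T_SucI:
  assumes "AE \<omega> in M. ennreal ((F \<omega>)\<^sup>2) \<le> a \<omega>" "\<And>i. AE \<omega> in M. T k (dd i F) \<omega> \<le> g i \<omega>"
  shows "AE \<omega> in M. T (Suc k) F \<omega> \<le> a \<omega> + (\<Sum>i. g i \<omega>)"
proof -
  have "AE \<omega> in M. \<forall>i. T k (dd i F) \<omega> \<le> g i \<omega>"
    unfolding AE_all_countable using assms by blast
  with assms(1) show ?thesis by eventually_elim (auto simp: T.simps intro!: add_mono suminf_le)
qed

lemma T_add:
  assumes "F \<in> E" "G \<in> E"
  shows "AE \<omega> in M. T k (\<lambda>\<omega>. F \<omega> + G \<omega>) \<omega> \<le> 2 * T k F \<omega> + 2 * T k G \<omega>"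
  using assms
proof (induction k arbitrary: F G)
  case 0
  show ?case by (auto intro!: ennreal_power2_add_le)
next
  case (Suc k)
  have "AE \<omega> in M. T k (dd i (\<lambda>\<omega>. F \<omega> + G \<omega>)) \<omega> \<le> 2 * T k (dd i F) \<omega> + 2 * T k (dd i G) \<omega>" for i
  proof -
    have "AE \<omega> in M. T k (dd i (\<lambda>\<omega>. F \<omega> + G \<omega>)) \<omega> = T k (\<lambda>\<omega>. dd i F \<omega> + dd i G \<omega>) \<omega>"
      using dd_lin[OF Suc.prems, of i 1 1] by (intro T_cong dd_in E_add Suc.prems) simp
    with Suc.IH[OF dd_in dd_in, OF Suc.prems, of i i] show ?thesis by eventually_elim simp
  qed
  then have "AE \<omega> in M. T (Suc k) (\<lambda>\<omega>. F \<omega> + G \<omega>) \<omega> \<le> (2 * ennreal ((F \<omega>)\<^sup>2) + 2 * ennreal ((G \<omega>)\<^sup>2)) + (\<Sum>i. 2 * T k (dd i F) \<omega> + 2 * T k (dd i G) \<omega>)"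
    by (intro T_SucI[OF AE_I2[OF ennreal_power2_add_le]])
  then show ?case
    by eventually_elim (simp add: T_Suc T'_def suminf_add[symmetric] distrib_left add_ac)
qed

lemma T_cmult:
  assumes "F \<in> E"
  shows "AE \<omega> in M. T k (\<lambda>\<omega>. c * F \<omega>) \<omega> = ennreal (c\<^sup>2) * T k F \<omega>"
  using assms
proof (induction k arbitrary: F)
  case 0
  show ?case by (auto simp: power_mult_distrib ennreal_mult)
next
  case (Suc k)
  have "AE \<omega> in M. \<forall>i. T k (dd i (\<lambda>\<omega>. c * F \<omega>)) \<omega> = ennreal (c\<^sup>2) * T k (dd i F) \<omega>"
    unfolding AE_all_countable
  proof
    fix i
    have "AE \<omega> in M. T k (dd i (\<lambda>\<omega>. c * F \<omega>)) \<omega> = T k (\<lambda>\<omega>. c * dd i F \<omega>) \<omega>"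
      using dd_lin[OF Suc.prems Suc.prems, of i c 0] by (intro T_cong dd_in E_cmult Suc.prems) simp
    with Suc.IH[OF dd_in[OF Suc.prems], of i] show "AE \<omega> in M. T k (dd i (\<lambda>\<omega>. c * F \<omega>)) \<omega> = ennreal (c\<^sup>2) * T k (dd i F) \<omega>"
      by eventually_elim simp
  qed
  then show ?case
    by eventually_elim (simp add: T.simps distrib_left power_mult_distrib ennreal_mult)
qed

lemma T_const: "AE \<omega> in M. T k (\<lambda>\<omega>. c) \<omega> = ennreal (c\<^sup>2)"
proof (induction k arbitrary: c)
  case (Suc k)
  have "AE \<omega> in M. \<forall>i. T k (dd i (\<lambda>\<omega>. c)) \<omega> = 0"
    unfolding AE_all_countable
  proof
    fix i
    have "AE \<omega> in M. T k (dd i (\<lambda>\<omega>. c)) \<omega> = T k (\<lambda>\<omega>. 0) \<omega>"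
      by (intro T_cong dd_in E_const dd_const)
    with Suc[of 0] show "AE \<omega> in M. T k (dd i (\<lambda>\<omega>. c)) \<omega> = 0" by eventually_elim simp
  qed
  then show ?case by eventually_elim (simp add: T.simps)
qed simp

text \<open>Leibniz and Cauchy-Schwarz combined. A version for finite sums is needed, with a constant that does
  not depend on the number of terms, because \<open>\<Gamma>\<close> is a limit of such sums.\<close>

lemma T_sum_mult:
  fixes u v :: "nat \<Rightarrow> 'w \<Rightarrow> real"
  assumes "\<And>j. u j \<in> E" "\<And>j. v j \<in> E"
  shows "AE \<omega> in M. T k (\<lambda>\<omega>. \<Sum>j<n. u j \<omega> * v j \<omega>) \<omega> \<le> of_nat (leibniz_const k) * (\<Sum>j<n. T k (u j) \<omega>) * (\<Sum>j<n. T k (v j) \<omega>)"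
  using assms
proof (induction k arbitrary: u v)
  case 0
  have "ennreal ((\<Sum>j<n. u j \<omega> * v j \<omega>)\<^sup>2) \<le> (\<Sum>j<n. ennreal ((u j \<omega>)\<^sup>2)) * (\<Sum>j<n. ennreal ((v j \<omega>)\<^sup>2))" for \<omega>
    using Cauchy_Schwarz_ineq_sum[of "\<lambda>j. u j \<omega>" "\<lambda>j. v j \<omega>" "{..<n}"]
    by (simp add: ennreal_mult[symmetric] sum_nonneg ennreal_leI)
  then show ?case by simp
next
  case (Suc k)
  let ?c = "of_nat (leibniz_const k) :: ennreal"
  define U where "U \<omega> = (\<Sum>j<n. T k (u j) \<omega>)" for \<omega>
  define V where "V \<omega> = (\<Sum>j<n. T k (v j) \<omega>)" for \<omega>
  define dU where "dU i \<omega> = (\<Sum>j<n. T k (dd i (u j)) \<omega>)" for i \<omega>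
  define dV where "dV i \<omega> = (\<Sum>j<n. T k (dd i (v j)) \<omega>)" for i \<omega>
  let ?U = "\<lambda>\<omega>. \<Sum>j<n. T (Suc k) (u j) \<omega>" let ?V = "\<lambda>\<omega>. \<Sum>j<n. T (Suc k) (v j) \<omega>"
  have UU: "U \<omega> \<le> ?U \<omega>" "V \<omega> \<le> ?V \<omega>" for \<omega> unfolding U_def V_def by (auto intro!: sum_mono T_mono_Suc)
  have dUU: "(\<Sum>i. dU i \<omega>) \<le> ?U \<omega>" "(\<Sum>i. dV i \<omega>) \<le> ?V \<omega>" for \<omega>
    unfolding dU_def dV_def
    by (auto simp: suminf_sum[OF summableI] T'_def[symmetric] intro!: sum_mono T'_le_T)
  have step: "AE \<omega> in M. T k (dd i (\<lambda>\<omega>. \<Sum>j<n. u j \<omega> * v j \<omega>)) \<omega> \<le> 2 * (?c * dU i \<omega> * V \<omega>) + 2 * (?c * U \<omega> * dV i \<omega>)" for i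
  proof -
    let ?A = "\<lambda>\<omega>. \<Sum>j<n. dd i (u j) \<omega> * v j \<omega>" let ?B = "\<lambda>\<omega>. \<Sum>j<n. u j \<omega> * dd i (v j) \<omega>"
    have AB: "?A \<in> E" "?B \<in> E" by (intro E_sum E_mult dd_in Suc.prems)+
    have "AE \<omega> in M. T k (dd i (\<lambda>\<omega>. \<Sum>j<n. u j \<omega> * v j \<omega>)) \<omega> = T k (\<lambda>\<omega>. ?A \<omega> + ?B \<omega>) \<omega>"
      by (intro T_cong dd_sum_mult dd_in E_sum E_mult E_add AB Suc.prems)
    moreover note T_add[OF AB, of k]
    moreover have "AE \<omega> in M. T k ?A \<omega> \<le> ?c * dU i \<omega> * V \<omega>" unfolding dU_def V_def by (intro Suc.IH dd_in Suc.prems)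
    moreover have "AE \<omega> in M. T k ?B \<omega> \<le> ?c * U \<omega> * dV i \<omega>" unfolding dV_def U_def by (intro Suc.IH dd_in Suc.prems)
    ultimately show ?thesis
      by eventually_elim (auto elim!: order_trans intro!: add_mono mult_left_mono)
  qed
  have zero: "AE \<omega> in M. ennreal ((\<Sum>j<n. u j \<omega> * v j \<omega>)\<^sup>2) \<le> ?U \<omega> * ?V \<omega>"
  proof (intro AE_I2)
    fix \<omega>
    have "ennreal ((\<Sum>j<n. u j \<omega> * v j \<omega>)\<^sup>2) \<le> (\<Sum>j<n. ennreal ((u j \<omega>)\<^sup>2)) * (\<Sum>j<n. ennreal ((v j \<omega>)\<^sup>2))"
      using Cauchy_Schwarz_ineq_sum[of "\<lambda>j. u j \<omega>" "\<lambda>j. v j \<omega>" "{..<n}"]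
      by (simp add: ennreal_mult[symmetric] sum_nonneg ennreal_leI)
    also have "\<dots> \<le> ?U \<omega> * ?V \<omega>" by (intro mult_mono sum_mono T_ge) auto
    finally show "ennreal ((\<Sum>j<n. u j \<omega> * v j \<omega>)\<^sup>2) \<le> ?U \<omega> * ?V \<omega>" .
  qed
  from T_SucI[OF zero step] show ?case
  proof eventually_elim
    case (elim \<omega>)
    note elim
    also have "(\<Sum>i. 2 * (?c * dU i \<omega> * V \<omega>) + 2 * (?c * U \<omega> * dV i \<omega>))
        = 2 * (?c * (\<Sum>i. dU i \<omega>) * V \<omega>) + 2 * (?c * U \<omega> * (\<Sum>i. dV i \<omega>))"
      by (simp add: suminf_add[symmetric])
    also have "?U \<omega> * ?V \<omega> + \<dots> \<le> ?U \<omega> * ?V \<omega> + (2 * (?c * ?U \<omega> * ?V \<omega>) + 2 * (?c * ?U \<omega> * ?V \<omega>))"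
      by (intro add_mono mult_mono order_refl UU dUU) auto
    also have "\<dots> = of_nat (leibniz_const (Suc k)) * ?U \<omega> * ?V \<omega>"
    proof -
      have "x + (2 * (c * x') + 2 * (c * x')) = x + 4 * (c * x')" for x c x' :: ennreal
        by (simp flip: distrib_right)
      then show ?thesis by (simp add: distrib_right mult.assoc)
    qed
    finally show ?case .
  qed
qed

lemma T_mult:
  assumes "F \<in> E" "G \<in> E"
  shows "AE \<omega> in M. T k (\<lambda>\<omega>. F \<omega> * G \<omega>) \<omega> \<le> of_nat (leibniz_const k) * T k F \<omega> * T k G \<omega>"
  using T_sum_mult[of "\<lambda>_. F" "\<lambda>_. G" k "Suc 0"] assms by (simp only: sum.lessThan_Suc lessThan_0 sum.empty add_0_left)

end

subsection \<open>Bessel's inequality for the higher derivatives\<close>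

primrec itsum :: "nat \<Rightarrow> (nat list \<Rightarrow> ennreal) \<Rightarrow> ennreal" where
  "itsum 0 g = g []"
| "itsum (Suc j) g = (\<Sum>i. itsum j (\<lambda>l. g (i # l)))"

lemma sum_words_Suc:
  "(\<Sum>l\<in>{l. set l \<subseteq> {..<N::nat} \<and> length l = Suc j}. g l :: ennreal) = (\<Sum>i<N. \<Sum>l\<in>{l. set l \<subseteq> {..<N} \<and> length l = j}. g (i # l))"
proof -
  have eq: "{l. set l \<subseteq> {..<N} \<and> length l = Suc j} = (\<lambda>(i, l). i # l) ` ({..<N} \<times> {l. set l \<subseteq> {..<N} \<and> length l = j})"
    by (auto simp: length_Suc_conv image_iff)
  have inj: "inj_on (\<lambda>(i, l). i # l) ({..<N} \<times> {l. set l \<subseteq> {..<N} \<and> length l = j})" by (auto simp: inj_on_def)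
  show ?thesis unfolding eq sum.reindex[OF inj] by (simp add: sum.cartesian_product o_def case_prod_beta)
qed

text \<open>Iterated sums are compared with sums over words in finitely many letters, to which the finite form of
  Bessel's inequality applies.\<close>

lemma itsum_le_SUP: "itsum j g \<le> (SUP N. \<Sum>l\<in>{l. set l \<subseteq> {..<N} \<and> length l = j}. g l)"
proof (induction j arbitrary: g)
  case 0
  have "{l. set l \<subseteq> {..<N::nat} \<and> length l = 0} = {[]}" for N by auto
  then show ?case by simp
next
  case (Suc j)
  let ?S = "\<lambda>N j. {l. set l \<subseteq> {..<N::nat} \<and> length l = j}"
  have inc: "incseq (\<lambda>N. \<Sum>l\<in>?S N j. g l)" for g :: "nat list \<Rightarrow> ennreal" and j
    by (intro incseq_SucI sum_mono2) (auto simp: finite_lists_length_eq less_Suc_eq)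
  have part: "(\<Sum>i<M. itsum j (\<lambda>l. g (i # l))) \<le> (SUP N. \<Sum>l\<in>?S N (Suc j). g l)" for M
  proof -
    have "(\<Sum>i<M. itsum j (\<lambda>l. g (i # l))) \<le> (\<Sum>i<M. SUP N. \<Sum>l\<in>?S N j. g (i # l))"
      by (intro sum_mono Suc)
    also have "\<dots> = (SUP N. \<Sum>i<M. \<Sum>l\<in>?S N j. g (i # l))"
      by (rule ennreal_SUP_sum[symmetric]) (rule inc)
    also have "\<dots> \<le> (SUP N. \<Sum>l\<in>?S N (Suc j). g l)"
    proof (rule SUP_mono)
      fix N
      have "(\<Sum>i<M. \<Sum>l\<in>?S N j. g (i # l)) \<le> (\<Sum>i<max M N. \<Sum>l\<in>?S (max M N) j. g (i # l))"
        by (intro order_trans[OF sum_mono[OF incseqD[OF inc, of N "max M N"]]] sum_mono2) auto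
      then show "\<exists>N'\<in>UNIV. (\<Sum>i<M. \<Sum>l\<in>?S N j. g (i # l)) \<le> (\<Sum>l\<in>?S N' (Suc j). g l)"
        by (auto simp: sum_words_Suc)
    qed
    finally show ?thesis .
  qed
  show ?case unfolding itsum.simps by (rule suminf_le_const[OF summableI part])
qed

lemma sum_power2_le: "finite I \<Longrightarrow> (\<And>i. i \<in> I \<Longrightarrow> 0 \<le> a i) \<Longrightarrow> (\<Sum>i\<in>I. (a i)\<^sup>2) \<le> (\<Sum>i\<in>I. a i :: real)\<^sup>2"
proof (induction I rule: finite_induct)
  case (insert i I)
  have "0 \<le> 2 * (a i * (\<Sum>i\<in>I. a i))" using insert by (simp add: sum_nonneg)
  then show ?case using insert by (simp add: power2_sum mult.assoc)
qed simp

context malliavin_basis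
begin

text \<open>The part of \<open>T\<close> of exact order \<open>j\<close>.\<close>

primrec NN :: "nat \<Rightarrow> ('w \<Rightarrow> real) \<Rightarrow> 'w \<Rightarrow> ennreal" where
  "NN 0 F = (\<lambda>\<omega>. ennreal ((F \<omega>)\<^sup>2))"
| "NN (Suc j) F = (\<lambda>\<omega>. \<Sum>i. NN j (dd i F) \<omega>)"

lemma T_eq_sum_NN: "T k F \<omega> = (\<Sum>j\<le>k. NN j F \<omega>)"
proof (induction k arbitrary: F)
  case (Suc k)
  then show ?case
    by (simp only: T.simps sum.atMost_Suc_shift NN.simps) (simp add: suminf_sum[OF summableI])
qed simp

lemma T'_eq_sum_NN: "T' k F \<omega> = (\<Sum>j=1..Suc k. NN j F \<omega>)"
proof -
  have "T' k F \<omega> = (\<Sum>j\<le>k. NN (Suc j) F \<omega>)"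
    unfolding T'_def T_eq_sum_NN by (simp add: suminf_sum[OF summableI])
  also have "\<dots> = (\<Sum>j=1..Suc k. NN j F \<omega>)"
    using sum.shift_bounds_cl_Suc_ivl[of "\<lambda>j. NN j F \<omega>" 0 k] by (simp add: atMost_atLeast0)
  finally show ?thesis .
qed

lemma NN_eq_itsum: "NN j F \<omega> = itsum j (\<lambda>l. ennreal ((fold (dir_deriv D) (map e l) F \<omega>)\<^sup>2))"
  by (induction j arbitrary: F) auto

text \<open>Elementary tensors of the \<open>e\<^sub>i\<close> are orthonormal up to zeros, since the inner product of elementary
  tensors is the product of the inner products.\<close>

lemma tens_orthonormal:
  assumes "length l = j" "length l' = j"
  shows "l \<noteq> l' \<Longrightarrow> inner (tens (map e l)) (tens (map e l')) = 0"
    and "tens (map e l) = 0 \<or> norm (tens (map e l)) = 1"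
proof -
  have i: "inner (tens (map e l)) (tens (map e l')) = (\<Prod>i<j. inner (e (l ! i)) (e (l' ! i)))"
    if "length l = j" "length l' = j" for l l'
    using tens that unfolding tensor_map_def by (auto intro!: prod.cong)
  show "inner (tens (map e l)) (tens (map e l')) = 0" if neq: "l \<noteq> l'"
  proof -
    obtain i where "i < j" "l ! i \<noteq> l' ! i" using neq assms by (metis nth_equalityI)
    then have "\<exists>i\<in>{..<j}. inner (e (l ! i)) (e (l' ! i)) = 0"
      using e unfolding parseval_sequence_def by auto
    then show ?thesis unfolding i[OF assms] by (simp add: prod_zero_iff)
  qed
  have u: "inner (e k) (e k) = 0 \<or> inner (e k) (e k) = 1" for k
  proof -
    have "e k = 0 \<or> norm (e k) = 1" using e unfolding parseval_sequence_def by blast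
    then show ?thesis by (auto simp: norm_eq_1)
  qed
  have "(\<Prod>i<j. inner (e (l ! i)) (e (l ! i))) = 0 \<or> (\<Prod>i<j. inner (e (l ! i)) (e (l ! i))) = 1"
  proof (induction j)
    case (Suc j)
    then show ?case using u[of "l ! j"] by (simp only: prod.lessThan_Suc) (elim disjE; simp)
  qed simp
  then show "tens (map e l) = 0 \<or> norm (tens (map e l)) = 1"
    unfolding i[OF assms(1) assms(1), symmetric] by (auto simp: norm_eq_1)
qed

text \<open>Bessel's inequality for \<open>DD j F\<close> and the orthonormal elementary tensors: the norms that define \<open>Q_l\<close>
  dominate the coordinate quantities.\<close>

lemma NN_le:
  assumes "1 \<le> j" "F \<in> E"
  shows "AE \<omega> in M. NN j F \<omega> \<le> ennreal ((norm (DD j F \<omega>))\<^sup>2)"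
proof -
  have "AE \<omega> in M. \<forall>l. length l = j \<longrightarrow> inner (DD j F \<omega>) (tens (map e l)) = fold (dir_deriv D) (map e l) F \<omega>"
    unfolding AE_all_countable
  proof
    fix l
    show "AE \<omega> in M. length l = j \<longrightarrow> inner (DD j F \<omega>) (tens (map e l)) = fold (dir_deriv D) (map e l) F \<omega>"
    proof (cases "length l = j")
      case True
      then have "map e l \<noteq> []" using assms by auto
      from DD_inner[OF this assms(2)] True show ?thesis by simp
    qed simp
  qed
  then show ?thesis
  proof eventually_elim
    case (elim \<omega>)
    have "(\<Sum>l\<in>{l. set l \<subseteq> {..<N} \<and> length l = j}. ennreal ((fold (dir_deriv D) (map e l) F \<omega>)\<^sup>2)) \<le> ennreal ((norm (DD j F \<omega>))\<^sup>2)" for N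
    proof -
      let ?S = "{l. set l \<subseteq> {..<N} \<and> length l = j}"
      have "(\<Sum>l\<in>?S. ennreal ((fold (dir_deriv D) (map e l) F \<omega>)\<^sup>2)) = (\<Sum>l\<in>?S. ennreal ((inner (DD j F \<omega>) (tens (map e l)))\<^sup>2))"
        using elim by (intro sum.cong) auto
      also have "\<dots> = ennreal (\<Sum>l\<in>?S. (inner (DD j F \<omega>) (tens (map e l)))\<^sup>2)" by simp
      also have "\<dots> \<le> ennreal ((norm (DD j F \<omega>))\<^sup>2)"
      proof (intro ennreal_leI Bessel_inequality)
        show "finite ?S" by (simp add: finite_lists_length_eq)
        fix l assume l: "l \<in> ?S"
        show "tens (map e l) = 0 \<or> norm (tens (map e l)) = 1" using tens_orthonormal(2)[of l j l] l by simp
        fix l' assume "l' \<in> ?S" "l \<noteq> l'"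
        then show "inner (tens (map e l)) (tens (map e l')) = 0" using tens_orthonormal(1)[of l j l'] l by simp
      qed
      finally show ?thesis .
    qed
    then show ?case
      unfolding NN_eq_itsum by (intro order_trans[OF itsum_le_SUP] SUP_least)
  qed
qed

lemma sum_NN_le:
  assumes "F \<in> E"
  shows "AE \<omega> in M. (\<Sum>j=1..k. NN j F \<omega>) \<le> ennreal ((norm1k DD k F \<omega>)\<^sup>2)"
proof -
  have "AE \<omega> in M. \<forall>j. 1 \<le> j \<longrightarrow> NN j F \<omega> \<le> ennreal ((norm (DD j F \<omega>))\<^sup>2)"
    unfolding AE_all_countable using NN_le[OF _ assms] by (intro allI AE_impI)
  then show ?thesis
  proof eventually_elim
    case (elim \<omega>)
    have "(\<Sum>j=1..k. NN j F \<omega>) \<le> (\<Sum>j=1..k. ennreal ((norm (DD j F \<omega>))\<^sup>2))"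
      using elim by (intro sum_mono) auto
    also have "\<dots> = ennreal (\<Sum>j=1..k. (norm (DD j F \<omega>))\<^sup>2)" by simp
    also have "\<dots> \<le> ennreal ((norm1k DD k F \<omega>)\<^sup>2)"
      unfolding norm1k_def by (intro ennreal_leI sum_power2_le) auto
    finally show ?case .
  qed
qed

lemma T'_le_norm1k:
  assumes "F \<in> E" shows "AE \<omega> in M. T' k F \<omega> \<le> ennreal ((norm1k DD (Suc k) F \<omega>)\<^sup>2)"
  unfolding T'_eq_sum_NN by (rule sum_NN_le[OF assms])

lemma norm1k_nonneg: "0 \<le> norm1k DD k F \<omega>"
  unfolding norm1k_def by (simp add: sum_nonneg)

lemma T_le_normk:
  assumes "F \<in> E" shows "AE \<omega> in M. T k F \<omega> \<le> ennreal ((normk DD k F \<omega>)\<^sup>2)"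
  using sum_NN_le[OF assms, of k]
proof eventually_elim
  case (elim \<omega>)
  have "T k F \<omega> = NN 0 F \<omega> + (\<Sum>j=1..k. NN j F \<omega>)"
    unfolding T_eq_sum_NN by (simp only: atMost_atLeast0 sum.atLeast_Suc_atMost[OF le0] One_nat_def)
  also have "\<dots> \<le> ennreal ((F \<omega>)\<^sup>2) + ennreal ((norm1k DD k F \<omega>)\<^sup>2)" using elim by (simp add: add_left_mono)
  also have "\<dots> = ennreal ((F \<omega>)\<^sup>2 + (norm1k DD k F \<omega>)\<^sup>2)" by simp
  also have "\<dots> \<le> ennreal ((normk DD k F \<omega>)\<^sup>2)"
    unfolding normk_def using norm1k_nonneg[of k F \<omega>] by (intro ennreal_leI) (simp add: power2_sum)
  finally show ?case .
qed

lemma norm1k_measurable [measurable]: "F \<in> E \<Longrightarrow> norm1k DD k F \<in> borel_measurable M"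
  unfolding norm1k_def[abs_def]
proof (intro borel_measurable_sum)
  fix i assume "F \<in> E" "i \<in> {1..k}"
  then have [measurable]: "DD i F \<in> borel_measurable M" using DD_Lp[of i F] by (simp add: all_Lp_def)
  show "(\<lambda>\<omega>. norm (DD i F \<omega>)) \<in> borel_measurable M" by measurable
qed

lemma norm1k_power4_integrable:
  assumes "F \<in> E" shows "integrable M (\<lambda>\<omega>. (norm1k DD k F \<omega>) ^ 4)"
proof (induction k)
  case 0
  then show ?case by (simp add: norm1k_def)
next
  case (Suc k)
  have DD: "DD (Suc k) F \<in> all_Lp M" using DD_Lp assms by simp
  then have [measurable]: "DD (Suc k) F \<in> borel_measurable M" by (simp add: all_Lp_def)
  have "integrable M (\<lambda>\<omega>. norm (DD (Suc k) F \<omega>) powr 4)" by (rule all_Lp_integrable[OF DD]) simp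
  then have i: "integrable M (\<lambda>\<omega>. norm (DD (Suc k) F \<omega>) ^ 4)" by (simp add: powr_numeral)
  have b: "(x + y) ^ 4 \<le> 8 * x ^ 4 + 8 * y ^ 4" for x y :: real
  proof -
    have s: "(a + b)\<^sup>2 \<le> 2 * a\<^sup>2 + 2 * b\<^sup>2" for a b :: real
      using sum_squares_bound[of a b] by (simp add: power2_sum)
    have "(x + y) ^ 4 = ((x + y)\<^sup>2)\<^sup>2" by simp
    also have "\<dots> \<le> (2 * x\<^sup>2 + 2 * y\<^sup>2)\<^sup>2" by (intro power_mono s) auto
    also have "\<dots> \<le> 2 * (2 * x\<^sup>2)\<^sup>2 + 2 * (2 * y\<^sup>2)\<^sup>2" by (rule s)
    finally show ?thesis by simp
  qed
  show ?case
  proof (rule Bochner_Integration.integrable_bound)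
    show "integrable M (\<lambda>\<omega>. 8 * (norm1k DD k F \<omega>) ^ 4 + 8 * norm (DD (Suc k) F \<omega>) ^ 4)"
      using Suc i by simp
    show "AE \<omega> in M. norm ((norm1k DD (Suc k) F \<omega>) ^ 4) \<le> norm (8 * (norm1k DD k F \<omega>) ^ 4 + 8 * norm (DD (Suc k) F \<omega>) ^ 4)"
      using b by (auto simp: norm1k_def)
  qed (use assms in measurable)
qed

lemma T'_prod_finite:
  assumes "F \<in> E" "G \<in> E"
  shows "(\<integral>\<^sup>+\<omega>. T' k F \<omega> * T' k G \<omega> \<partial>M) < \<infinity>"
proof -
  have "(\<integral>\<^sup>+\<omega>. T' k F \<omega> * T' k G \<omega> \<partial>M) \<le> (\<integral>\<^sup>+\<omega>. ennreal ((norm1k DD (Suc k) F \<omega>) ^ 4 + (norm1k DD (Suc k) G \<omega>) ^ 4) \<partial>M)"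
    using T'_le_norm1k[OF assms(1), of k] T'_le_norm1k[OF assms(2), of k]
  proof (intro nn_integral_mono_AE, eventually_elim)
    case (elim \<omega>)
    let ?a = "norm1k DD (Suc k) F \<omega>" let ?b = "norm1k DD (Suc k) G \<omega>"
    have "T' k F \<omega> * T' k G \<omega> \<le> ennreal (?a\<^sup>2) * ennreal (?b\<^sup>2)" using elim by (intro mult_mono) auto
    also have "\<dots> = ennreal (?a\<^sup>2 * ?b\<^sup>2)" by (simp add: ennreal_mult)
    also have "\<dots> \<le> ennreal (?a ^ 4 + ?b ^ 4)"
    proof (rule ennreal_leI)
      have "2 * ?a\<^sup>2 * ?b\<^sup>2 \<le> (?a\<^sup>2)\<^sup>2 + (?b\<^sup>2)\<^sup>2" by (rule sum_squares_bound)
      moreover have "0 \<le> ?a\<^sup>2 * ?b\<^sup>2" by simp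
      moreover have "(?a\<^sup>2)\<^sup>2 = ?a ^ 4" "(?b\<^sup>2)\<^sup>2 = ?b ^ 4" by simp_all
      ultimately show "?a\<^sup>2 * ?b\<^sup>2 \<le> ?a ^ 4 + ?b ^ 4" by linarith
    qed
    finally show ?case .
  qed
  also have "\<dots> < \<infinity>"
    using norm1k_power4_integrable[OF assms(1), of "Suc k"] norm1k_power4_integrable[OF assms(2), of "Suc k"]
    by (subst nn_integral_eq_integral) auto
  finally show ?thesis .
qed

subsection \<open>Closability\<close>

lemma Gamma_integral_le:
  assumes "F \<in> E" "G \<in> E"
  shows "\<bar>\<integral>\<omega>. \<Gamma> F G \<omega> \<partial>M\<bar> \<le> ((\<integral>\<omega>. \<Gamma> F F \<omega> \<partial>M) + (\<integral>\<omega>. \<Gamma> G G \<omega> \<partial>M)) / 2"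
proof -
  note i = E_integrable[OF \<Gamma>_in]
  have "AE \<omega> in M. \<bar>\<Gamma> F G \<omega>\<bar> \<le> (\<Gamma> F F \<omega> + \<Gamma> G G \<omega>) / 2"
    using \<Gamma>_eq_inner[OF assms] \<Gamma>_eq_inner[OF assms(1) assms(1)] \<Gamma>_eq_inner[OF assms(2) assms(2)]
  proof eventually_elim
    case (elim \<omega>)
    have "\<bar>inner (D F \<omega>) (D G \<omega>)\<bar> \<le> norm (D F \<omega>) * norm (D G \<omega>)" by (rule Cauchy_Schwarz_ineq2)
    then show ?case using elim sum_squares_bound[of "norm (D F \<omega>)" "norm (D G \<omega>)"]
      by (simp add: power2_norm_eq_inner)
  qed
  then have "(\<integral>\<omega>. \<bar>\<Gamma> F G \<omega>\<bar> \<partial>M) \<le> (\<integral>\<omega>. (\<Gamma> F F \<omega> + \<Gamma> G G \<omega>) / 2 \<partial>M)"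
    using i assms by (intro integral_mono_AE) auto
  also have "\<dots> = ((\<integral>\<omega>. \<Gamma> F F \<omega> \<partial>M) + (\<integral>\<omega>. \<Gamma> G G \<omega> \<partial>M)) / 2" using i assms by simp
  finally show ?thesis using integral_abs_bound[of M "\<Gamma> F G"] by linarith
qed

text \<open>Instead of the Cauchy-Schwarz inequality for integrals, the elementary bound \<open>\<bar>xy\<bar> \<le> t x\<^sup>2 + y\<^sup>2 / t\<close> with a
  free parameter is used.\<close>

lemma tendsto_0_weighted:
  fixes a b :: "nat \<Rightarrow> real"
  assumes "a \<longlonglongrightarrow> 0" "\<And>m t. t > 0 \<Longrightarrow> \<bar>b m\<bar> \<le> t * a m + c / t"
  shows "b \<longlonglongrightarrow> 0"
proof (rule LIMSEQ_I)
  fix r :: real assume r: "r > 0"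
  define t where "t = 2 * (\<bar>c\<bar> + 1) / r"
  have t: "t > 0" using r by (simp add: t_def)
  have "c / t \<le> (\<bar>c\<bar> + 1) / t" using t by (intro divide_right_mono) auto
  also have "\<dots> = r / 2" using r by (simp add: t_def field_simps)
  finally have ct: "c / t \<le> r / 2" .
  have "(\<lambda>m. t * a m) \<longlonglongrightarrow> t * 0" by (intro tendsto_intros assms)
  then have "(\<lambda>m. t * a m) \<longlonglongrightarrow> 0" by simp
  then obtain N where N: "\<And>m. m \<ge> N \<Longrightarrow> \<bar>t * a m\<bar> < r / 2" using r LIMSEQ_D[of _ 0 "r/2"] by (metis half_gt_zero real_norm_def diff_zero)
  have "norm (b m - 0) < r" if "m \<ge> N" for m
    using assms(2)[OF t, of m] ct N[OF that] abs_ge_self[of "t * a m"] unfolding real_norm_def diff_zero by linarith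
  then show "\<exists>N. \<forall>m\<ge>N. norm (b m - 0) < r" by blast
qed

text \<open>If \<open>s\<^sub>n \<rightarrow> 0\<close> in \<open>L\<^sup>2\<close> and \<open>D s\<^sub>n\<close> is Cauchy in \<open>L\<^sup>2\<close>, then \<open>D s\<^sub>n \<rightarrow> 0\<close>. By duality
  \<open>E \<Gamma>(s\<^sub>n, s\<^sub>m) = E (s\<^sub>m L s\<^sub>n)\<close>, which tends to \<open>0\<close> as \<open>m \<rightarrow> \<infinity>\<close> for fixed \<open>n\<close>. The difference to
  \<open>E \<Gamma>(s\<^sub>n, s\<^sub>n)\<close> is controlled by \<open>E \<Gamma>(s\<^sub>n - s\<^sub>m, s\<^sub>n - s\<^sub>m)\<close>, which is small by the Cauchy property.\<close>

lemma D_closable: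
  assumes E: "\<And>n. s n \<in> E" and s0: "(\<lambda>n. \<integral>\<omega>. (s n \<omega>)\<^sup>2 \<partial>M) \<longlonglongrightarrow> 0"
    and Cauchy: "\<And>\<epsilon>::real. \<epsilon> > 0 \<Longrightarrow> \<exists>N. \<forall>n\<ge>N. \<forall>m\<ge>N. (\<integral>\<omega>. \<Gamma> (\<lambda>\<omega>. s n \<omega> - s m \<omega>) (\<lambda>\<omega>. s n \<omega> - s m \<omega>) \<omega> \<partial>M) \<le> \<epsilon>"
  shows "(\<lambda>n. \<integral>\<omega>. \<Gamma> (s n) (s n) \<omega> \<partial>M) \<longlonglongrightarrow> 0"
proof -
  define q where "q F = (\<integral>\<omega>. \<Gamma> F F \<omega> \<partial>M)" for F
  define b where "b n m = (\<integral>\<omega>. \<Gamma> (s n) (s m) \<omega> \<partial>M)" for n m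
  have q_nonneg: "0 \<le> q F" if "F \<in> E" for F unfolding q_def using \<Gamma>_nonneg[OF that] by (rule integral_nonneg_AE)
  \<comment> \<open>for fixed \<open>n\<close>, duality bounds \<open>b n m\<close> by the \<open>L\<^sup>2\<close> norms of \<open>s m\<close> and \<open>L (s n)\<close>\<close>
  have b0: "(\<lambda>m. b n m) \<longlonglongrightarrow> 0" for n
  proof (rule tendsto_0_weighted[OF s0])
    fix m and t :: real assume t: "t > 0"
    have i: "integrable M (\<lambda>\<omega>. (s m \<omega>)\<^sup>2)" "integrable M (\<lambda>\<omega>. (L (s n) \<omega>)\<^sup>2)" "integrable M (\<lambda>\<omega>. s m \<omega> * L (s n) \<omega>)"
      unfolding power2_eq_square by (intro E_integrable_mult L_in E)+
    have "\<bar>b n m\<bar> = \<bar>\<integral>\<omega>. s m \<omega> * L (s n) \<omega> \<partial>M\<bar>" unfolding b_def using duality2[OF E E] by simp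
    also have "\<dots> \<le> (\<integral>\<omega>. \<bar>s m \<omega> * L (s n) \<omega>\<bar> \<partial>M)" by (rule integral_abs_bound)
    also have "\<dots> \<le> (\<integral>\<omega>. t * (s m \<omega>)\<^sup>2 + (L (s n) \<omega>)\<^sup>2 / t \<partial>M)"
    proof (rule integral_mono)
      fix \<omega>
      let ?x = "s m \<omega>" let ?y = "L (s n) \<omega>"
      have "2 * (t * \<bar>?x\<bar>) * \<bar>?y\<bar> \<le> (t * \<bar>?x\<bar>)\<^sup>2 + \<bar>?y\<bar>\<^sup>2" by (rule sum_squares_bound)
      moreover have "(t * \<bar>?x\<bar>) * \<bar>?y\<bar> \<le> 2 * (t * \<bar>?x\<bar>) * \<bar>?y\<bar>" using t by simp
      ultimately have "(t * \<bar>?x\<bar>) * \<bar>?y\<bar> \<le> (t * \<bar>?x\<bar>)\<^sup>2 + \<bar>?y\<bar>\<^sup>2" by (rule order_trans[rotated])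
      also have "\<dots> = t * (t * ?x\<^sup>2 + ?y\<^sup>2 / t)"
        using t by (simp add: power_mult_distrib distrib_left power2_eq_square)
      finally have "t * (\<bar>?x\<bar> * \<bar>?y\<bar>) \<le> t * (t * ?x\<^sup>2 + ?y\<^sup>2 / t)" by (simp only: mult.assoc)
      then show "\<bar>?x * ?y\<bar> \<le> t * ?x\<^sup>2 + ?y\<^sup>2 / t" using t by (simp add: abs_mult)
    qed (use i in auto)
    also have "\<dots> = t * (\<integral>\<omega>. (s m \<omega>)\<^sup>2 \<partial>M) + (\<integral>\<omega>. (L (s n) \<omega>)\<^sup>2 \<partial>M) / t" using i by simp
    finally show "\<bar>b n m\<bar> \<le> t * (\<integral>\<omega>. (s m \<omega>)\<^sup>2 \<partial>M) + (\<integral>\<omega>. (L (s n) \<omega>)\<^sup>2 \<partial>M) / t" .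
  qed
  have split: "q (s n) \<le> q (\<lambda>\<omega>. s n \<omega> - s m \<omega>) + 2 * \<bar>b n m\<bar>" for n m
  proof -
    let ?d = "\<lambda>\<omega>. s n \<omega> - s m \<omega>"
    have d: "?d \<in> E" by (intro E_diff E)
    have "AE \<omega> in M. \<Gamma> (s n) (s n) \<omega> = \<Gamma> (s n) ?d \<omega> + \<Gamma> (s n) (s m) \<omega>"
      using \<Gamma>_eq_inner[OF E[of n] E[of n]] \<Gamma>_eq_inner[OF E[of n] d] \<Gamma>_eq_inner[OF E[of n] E[of m]] D_linear[OF E[of n] E[of m], of 1 "-1"]
      by eventually_elim (simp add: inner_diff_right)
    then have "q (s n) = (\<integral>\<omega>. \<Gamma> (s n) ?d \<omega> + \<Gamma> (s n) (s m) \<omega> \<partial>M)"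
      unfolding q_def using \<Gamma>_in[OF E E] \<Gamma>_in[OF E d] by (intro integral_cong_AE) auto
    also have "\<dots> = (\<integral>\<omega>. \<Gamma> (s n) ?d \<omega> \<partial>M) + b n m"
      unfolding b_def by (intro Bochner_Integration.integral_add E_integrable \<Gamma>_in E d)
    finally have "q (s n) = (\<integral>\<omega>. \<Gamma> (s n) ?d \<omega> \<partial>M) + b n m" .
    moreover have "\<bar>\<integral>\<omega>. \<Gamma> (s n) ?d \<omega> \<partial>M\<bar> \<le> (q (s n) + q ?d) / 2"
      unfolding q_def by (rule Gamma_integral_le[OF E[of n] d])
    ultimately show ?thesis by (auto simp: abs_le_iff abs_if split: if_splits)
  qed
  show ?thesis
  proof (rule LIMSEQ_I)
    fix r :: real assume r: "r > 0"
    then obtain N where N: "\<And>n m. n \<ge> N \<Longrightarrow> m \<ge> N \<Longrightarrow> q (\<lambda>\<omega>. s n \<omega> - s m \<omega>) \<le> r / 2"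
      using Cauchy[of "r / 2"] unfolding q_def by fastforce
    have "q (s n) \<le> r / 2" if n: "n \<ge> N" for n
    proof (rule LIMSEQ_le_const)
      have "(\<lambda>m. r / 2 + 2 * \<bar>b n m\<bar>) \<longlonglongrightarrow> r / 2 + 2 * \<bar>0\<bar>" by (intro tendsto_intros b0)
      then show "(\<lambda>m. r / 2 + 2 * \<bar>b n m\<bar>) \<longlonglongrightarrow> r / 2" by simp
      have "q (s n) \<le> r / 2 + 2 * \<bar>b n m\<bar>" if "m \<ge> N" for m
        using split[of n m] N[OF n that] by linarith
      then show "\<exists>N. \<forall>m\<ge>N. q (s n) \<le> r / 2 + 2 * \<bar>b n m\<bar>" by blast
    qed
    then show "\<exists>N. \<forall>n\<ge>N. norm ((\<integral>\<omega>. \<Gamma> (s n) (s n) \<omega> \<partial>M) - 0) < r"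
      using r q_nonneg[OF E] unfolding q_def[symmetric] by (intro exI[of _ N]) fastforce
  qed
qed

end

lemma ennreal_le_suminf: "f i \<le> (\<Sum>i. f i :: ennreal)"
  using sum_le_suminf[OF summableI, of "{i}" f] by simp

context malliavin_basis
begin

text \<open>Parseval's identity.\<close>

lemma suminf_dd_squared:
  assumes "F \<in> E"
  shows "AE \<omega> in M. (\<Sum>i. ennreal ((dd i F \<omega>)\<^sup>2)) = ennreal (\<Gamma> F F \<omega>)"
  using \<Gamma>_eq_inner[OF assms assms]
proof eventually_elim
  case (elim \<omega>)
  have "(\<lambda>i. inner (D F \<omega>) (e i) * inner (D F \<omega>) (e i)) sums inner (D F \<omega>) (D F \<omega>)"
    using e unfolding parseval_sequence_def by blast
  then have "(\<lambda>i. (dd i F \<omega>)\<^sup>2) sums \<Gamma> F F \<omega>" using elim by (simp add: dir_deriv_def power2_eq_square)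
  then show ?case by (intro suminf_ennreal_eq) auto
qed

lemma Gamma_le_T':
  assumes "F \<in> E" shows "AE \<omega> in M. ennreal (\<Gamma> F F \<omega>) \<le> T' k F \<omega>"
  using suminf_dd_squared[OF assms]
proof eventually_elim
  case (elim \<omega>)
  have "(\<Sum>i. ennreal ((dd i F \<omega>)\<^sup>2)) \<le> T' k F \<omega>" unfolding T'_def by (intro suminf_le T_ge) auto
  then show ?case using elim by simp
qed

text \<open>Closability of the derivatives of all orders, by induction on the order: \<open>D_closable\<close> shows that every
  directional derivative tends to \<open>0\<close> in \<open>L\<^sup>2\<close>, so the induction hypothesis applies to it. The infinitely
  many directions are treated together by comparing \<open>s\<^sub>n\<close> with a far member \<open>s\<^sub>m\<close> of the Cauchy sequence.\<close>

lemma T_zero_limit: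
  assumes E: "\<And>n. s n \<in> E" and s0: "(\<lambda>n. \<integral>\<omega>. (s n \<omega>)\<^sup>2 \<partial>M) \<longlonglongrightarrow> 0"
    and Cauchy: "\<And>\<epsilon>::real. \<epsilon> > 0 \<Longrightarrow> \<exists>N. \<forall>n\<ge>N. \<forall>m\<ge>N. (\<integral>\<^sup>+\<omega>. T k (\<lambda>\<omega>. s n \<omega> - s m \<omega>) \<omega> \<partial>M) \<le> ennreal \<epsilon>"
    and eps: "(\<epsilon>::real) > 0"
  shows "\<exists>N. \<forall>n\<ge>N. (\<integral>\<^sup>+\<omega>. T k (s n) \<omega> \<partial>M) \<le> ennreal \<epsilon>"
  using assms
proof (induction k arbitrary: s \<epsilon>)
  case 0
  have i: "integrable M (\<lambda>\<omega>. (s n \<omega>)\<^sup>2)" for n unfolding power2_eq_square by (intro E_integrable_mult 0)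
  obtain N where "\<And>n. n \<ge> N \<Longrightarrow> \<bar>\<integral>\<omega>. (s n \<omega>)\<^sup>2 \<partial>M\<bar> < \<epsilon>" using LIMSEQ_D[OF 0(2) 0(4)] by auto
  note N = this
  have "(\<integral>\<^sup>+\<omega>. T 0 (s n) \<omega> \<partial>M) \<le> ennreal \<epsilon>" if "n \<ge> N" for n
  proof -
    have "(\<integral>\<^sup>+\<omega>. T 0 (s n) \<omega> \<partial>M) = ennreal (\<integral>\<omega>. (s n \<omega>)\<^sup>2 \<partial>M)"
      unfolding T.simps by (rule nn_integral_eq_integral[OF i]) simp
    also have "\<dots> \<le> ennreal \<epsilon>" using N[OF that] by (intro ennreal_leI) linarith
    finally show ?thesis .
  qed
  then show ?case by blast
next
  case (Suc k)
  note E = Suc.prems(1)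
  have dE: "(\<lambda>\<omega>. s n \<omega> - s m \<omega>) \<in> E" for n m by (intro E_diff E)
  have T'_le: "(\<integral>\<^sup>+\<omega>. T' k F \<omega> \<partial>M) \<le> (\<integral>\<^sup>+\<omega>. T (Suc k) F \<omega> \<partial>M)" for F
    by (intro nn_integral_mono T'_le_T)
  have q_le: "ennreal (\<integral>\<omega>. \<Gamma> F F \<omega> \<partial>M) \<le> (\<integral>\<^sup>+\<omega>. T (Suc k) F \<omega> \<partial>M)" if F: "F \<in> E" for F
  proof -
    have "ennreal (\<integral>\<omega>. \<Gamma> F F \<omega> \<partial>M) = (\<integral>\<^sup>+\<omega>. ennreal (\<Gamma> F F \<omega>) \<partial>M)"
      by (rule nn_integral_eq_integral[symmetric]) (use E_integrable[OF \<Gamma>_in[OF F F]] \<Gamma>_nonneg[OF F] in auto)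
    also have "\<dots> \<le> (\<integral>\<^sup>+\<omega>. T' k F \<omega> \<partial>M)" by (intro nn_integral_mono_AE Gamma_le_T' F)
    also note T'_le
    finally show ?thesis .
  qed
  have Cauchy: "\<exists>N. \<forall>n\<ge>N. \<forall>m\<ge>N. (\<integral>\<^sup>+\<omega>. T (Suc k) (\<lambda>\<omega>. s n \<omega> - s m \<omega>) \<omega> \<partial>M) \<le> ennreal \<epsilon>" if "\<epsilon> > 0" for \<epsilon>
    by (rule Suc.prems(3)[OF that])
  have q0: "(\<lambda>n. \<integral>\<omega>. \<Gamma> (s n) (s n) \<omega> \<partial>M) \<longlonglongrightarrow> 0"
  proof (rule D_closable[OF E Suc.prems(2)])
    fix \<epsilon> :: real assume "\<epsilon> > 0"
    from Cauchy[OF this] obtain N where N: "\<And>n m. n \<ge> N \<Longrightarrow> m \<ge> N \<Longrightarrow> (\<integral>\<^sup>+\<omega>. T (Suc k) (\<lambda>\<omega>. s n \<omega> - s m \<omega>) \<omega> \<partial>M) \<le> ennreal \<epsilon>" by blast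
    have "(\<integral>\<omega>. \<Gamma> (\<lambda>\<omega>. s n \<omega> - s m \<omega>) (\<lambda>\<omega>. s n \<omega> - s m \<omega>) \<omega> \<partial>M) \<le> \<epsilon>" if "n \<ge> N" "m \<ge> N" for n m
      using order_trans[OF q_le[OF dE] N[OF that]] \<open>\<epsilon> > 0\<close> by (simp add: ennreal_le_iff)
    then show "\<exists>N. \<forall>n\<ge>N. \<forall>m\<ge>N. (\<integral>\<omega>. \<Gamma> (\<lambda>\<omega>. s n \<omega> - s m \<omega>) (\<lambda>\<omega>. s n \<omega> - s m \<omega>) \<omega> \<partial>M) \<le> \<epsilon>" by blast
  qed
  have dd_diff: "AE \<omega> in M. dd i (\<lambda>\<omega>. s n \<omega> - s m \<omega>) \<omega> = dd i (s n) \<omega> - dd i (s m) \<omega>" for i n m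
    using dd_lin[OF E E, of i 1 n "-1" m] by simp
  have T_dd_diff: "(\<integral>\<^sup>+\<omega>. T k (\<lambda>\<omega>. dd i (s n) \<omega> - dd i (s m) \<omega>) \<omega> \<partial>M) = (\<integral>\<^sup>+\<omega>. T k (dd i (\<lambda>\<omega>. s n \<omega> - s m \<omega>)) \<omega> \<partial>M)" for i n m
  proof (rule nn_integral_cong_AE, rule T_cong)
    show "AE \<omega> in M. dd i (s n) \<omega> - dd i (s m) \<omega> = dd i (\<lambda>\<omega>. s n \<omega> - s m \<omega>) \<omega>" using dd_diff[of i n m] by eventually_elim (rule sym)
  qed (intro E_diff dd_in E dE)+
  have T_dd_le: "(\<integral>\<^sup>+\<omega>. T k (dd i F) \<omega> \<partial>M) \<le> (\<integral>\<^sup>+\<omega>. T (Suc k) F \<omega> \<partial>M)" for i F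
  proof (rule nn_integral_mono)
    fix \<omega>
    have "T k (dd i F) \<omega> \<le> T' k F \<omega>" unfolding T'_def by (rule ennreal_le_suminf)
    then show "T k (dd i F) \<omega> \<le> T (Suc k) F \<omega>" using T'_le_T order_trans by blast
  qed
  have coord: "\<exists>N. \<forall>n\<ge>N. (\<integral>\<^sup>+\<omega>. T k (dd i (s n)) \<omega> \<partial>M) \<le> ennreal \<epsilon>" if "\<epsilon> > 0" for i \<epsilon>
  proof (rule Suc.IH[OF dd_in[OF E] _ _ that])
    show "(\<lambda>n. \<integral>\<omega>. (dd i (s n) \<omega>)\<^sup>2 \<partial>M) \<longlonglongrightarrow> 0"
    proof (rule tendsto_sandwich[OF _ _ tendsto_const q0])
      show "\<forall>\<^sub>F n in sequentially. 0 \<le> (\<integral>\<omega>. (dd i (s n) \<omega>)\<^sup>2 \<partial>M)" by simp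
      have "(\<integral>\<omega>. (dd i (s n) \<omega>)\<^sup>2 \<partial>M) \<le> (\<integral>\<omega>. \<Gamma> (s n) (s n) \<omega> \<partial>M)" for n
      proof (rule integral_mono_AE)
        show "integrable M (\<lambda>\<omega>. (dd i (s n) \<omega>)\<^sup>2)" unfolding power2_eq_square by (intro E_integrable_mult dd_in E)
        show "integrable M (\<Gamma> (s n) (s n))" by (intro E_integrable \<Gamma>_in E)
        show "AE \<omega> in M. (dd i (s n) \<omega>)\<^sup>2 \<le> \<Gamma> (s n) (s n) \<omega>"
          using suminf_dd_squared[OF E[of n]] \<Gamma>_nonneg[OF E[of n]]
        proof eventually_elim
          case (elim \<omega>)
          have "ennreal ((dd i (s n) \<omega>)\<^sup>2) \<le> (\<Sum>i. ennreal ((dd i (s n) \<omega>)\<^sup>2))"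
            by (rule ennreal_le_suminf)
          then have "ennreal ((dd i (s n) \<omega>)\<^sup>2) \<le> ennreal (\<Gamma> (s n) (s n) \<omega>)" by (simp only: elim(1))
          then show ?case using elim(2) by (simp only: ennreal_le_iff)
        qed
      qed
      then show "\<forall>\<^sub>F n in sequentially. (\<integral>\<omega>. (dd i (s n) \<omega>)\<^sup>2 \<partial>M) \<le> (\<integral>\<omega>. \<Gamma> (s n) (s n) \<omega> \<partial>M)" by simp
    qed
    fix \<epsilon> :: real assume "\<epsilon> > 0"
    from Cauchy[OF this] obtain N where N: "\<And>n m. n \<ge> N \<Longrightarrow> m \<ge> N \<Longrightarrow> (\<integral>\<^sup>+\<omega>. T (Suc k) (\<lambda>\<omega>. s n \<omega> - s m \<omega>) \<omega> \<partial>M) \<le> ennreal \<epsilon>" by blast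
    then show "\<exists>N. \<forall>n\<ge>N. \<forall>m\<ge>N. (\<integral>\<^sup>+\<omega>. T k (\<lambda>\<omega>. dd i (s n) \<omega> - dd i (s m) \<omega>) \<omega> \<partial>M) \<le> ennreal \<epsilon>"
      unfolding T_dd_diff using T_dd_le order_trans by blast
  qed
  have e8: "\<epsilon> / 8 > 0" "\<epsilon> / 2 > 0" using Suc.prems(4) by auto
  from Cauchy[OF e8(1)] obtain N where N: "\<And>n m. n \<ge> N \<Longrightarrow> m \<ge> N \<Longrightarrow> (\<integral>\<^sup>+\<omega>. T (Suc k) (\<lambda>\<omega>. s n \<omega> - s m \<omega>) \<omega> \<partial>M) \<le> ennreal (\<epsilon> / 8)" by blast
  \<comment> \<open>the index \<open>m\<close> is chosen depending on \<open>I\<close>, but \<open>N\<close> and the bound are not, so \<open>I\<close> may tend to infinity afterwards\<close>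
  have partial: "(\<Sum>i<I. \<integral>\<^sup>+\<omega>. T k (dd i (s n)) \<omega> \<partial>M) \<le> ennreal (\<epsilon> / 2)" if n: "n \<ge> N" for n I
  proof -
    \<comment> \<open>a share of \<open>\<epsilon>\<close> for each of the \<open>I\<close> directions\<close>
    let ?d = "\<epsilon> / (8 * (real I + 1))"
    have d: "?d > 0" using Suc.prems(4) by simp
    have "\<forall>i. \<exists>N. \<forall>n\<ge>N. (\<integral>\<^sup>+\<omega>. T k (dd i (s n)) \<omega> \<partial>M) \<le> ennreal ?d" using coord[OF d] by blast
    then obtain Nf where Nf: "\<And>i n. n \<ge> Nf i \<Longrightarrow> (\<integral>\<^sup>+\<omega>. T k (dd i (s n)) \<omega> \<partial>M) \<le> ennreal ?d" by metis
    define m where "m = N + (\<Sum>i<I. Nf i)"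
    have m: "m \<ge> N" "\<And>i. i < I \<Longrightarrow> m \<ge> Nf i"
      unfolding m_def using member_le_sum[of _ "{..<I}" Nf] by (auto simp: trans_le_add2)
    have one: "(\<integral>\<^sup>+\<omega>. T k (dd i (s n)) \<omega> \<partial>M) \<le> 2 * (\<integral>\<^sup>+\<omega>. T k (dd i (\<lambda>\<omega>. s n \<omega> - s m \<omega>)) \<omega> \<partial>M) + 2 * ennreal ?d" if i: "i < I" for i
    proof -
      let ?a = "dd i (\<lambda>\<omega>. s n \<omega> - s m \<omega>)"
      have aE: "?a \<in> E" "dd i (s m) \<in> E" by (intro dd_in dE E)+
      have "AE \<omega> in M. T k (dd i (s n)) \<omega> = T k (\<lambda>\<omega>. ?a \<omega> + dd i (s m) \<omega>) \<omega>"
        using dd_diff[of i n m] by (intro T_cong dd_in E E_add aE) auto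
      then have "AE \<omega> in M. T k (dd i (s n)) \<omega> \<le> 2 * T k ?a \<omega> + 2 * T k (dd i (s m)) \<omega>"
        using T_add[OF aE, of k] by eventually_elim simp
      then have "(\<integral>\<^sup>+\<omega>. T k (dd i (s n)) \<omega> \<partial>M) \<le> (\<integral>\<^sup>+\<omega>. 2 * T k ?a \<omega> + 2 * T k (dd i (s m)) \<omega> \<partial>M)" by (rule nn_integral_mono_AE)
      also have "\<dots> = 2 * (\<integral>\<^sup>+\<omega>. T k ?a \<omega> \<partial>M) + 2 * (\<integral>\<^sup>+\<omega>. T k (dd i (s m)) \<omega> \<partial>M)"
        using aE by (simp add: nn_integral_add nn_integral_cmult)
      also have "\<dots> \<le> 2 * (\<integral>\<^sup>+\<omega>. T k ?a \<omega> \<partial>M) + 2 * ennreal ?d"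
        using Nf[OF m(2)[OF i]] by (intro add_left_mono mult_left_mono) auto
      finally show ?thesis .
    qed
    have "(\<Sum>i<I. \<integral>\<^sup>+\<omega>. T k (dd i (s n)) \<omega> \<partial>M) \<le> (\<Sum>i<I. 2 * (\<integral>\<^sup>+\<omega>. T k (dd i (\<lambda>\<omega>. s n \<omega> - s m \<omega>)) \<omega> \<partial>M) + 2 * ennreal ?d)"
      using one by (intro sum_mono) auto
    also have "\<dots> = 2 * (\<integral>\<^sup>+\<omega>. (\<Sum>i<I. T k (dd i (\<lambda>\<omega>. s n \<omega> - s m \<omega>)) \<omega>) \<partial>M) + of_nat I * (2 * ennreal ?d)"
      by (simp add: sum.distrib sum_distrib_left[symmetric] nn_integral_sum dd_in dE)
    also have "\<dots> \<le> 2 * (\<integral>\<^sup>+\<omega>. T (Suc k) (\<lambda>\<omega>. s n \<omega> - s m \<omega>) \<omega> \<partial>M) + of_nat I * (2 * ennreal ?d)"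
    proof (intro add_right_mono mult_left_mono nn_integral_mono)
      fix \<omega> show "(\<Sum>i<I. T k (dd i (\<lambda>\<omega>. s n \<omega> - s m \<omega>)) \<omega>) \<le> T (Suc k) (\<lambda>\<omega>. s n \<omega> - s m \<omega>) \<omega>"
        using T'_le_T unfolding T'_def by (rule order_trans[OF sum_le_suminf[OF summableI], rotated 2]) auto
    qed auto
    also have "\<dots> \<le> 2 * ennreal (\<epsilon> / 8) + of_nat I * (2 * ennreal ?d)"
      by (intro add_right_mono mult_left_mono N n m) auto
    also have "\<dots> = ennreal (2 * (\<epsilon> / 8) + real I * (2 * ?d))"
    proof -
      have c: "2 * ennreal x = ennreal (2 * x)" if "0 \<le> x" for x using that by (subst ennreal_mult) auto
      have c': "of_nat I * ennreal x = ennreal (real I * x)" if "0 \<le> x" for x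
        using that by (subst ennreal_mult) (auto simp: ennreal_of_nat_eq_real_of_nat)
      have "0 \<le> \<epsilon> / 8" "0 \<le> ?d" "0 \<le> 2 * ?d" "0 \<le> 2 * (\<epsilon> / 8)" "0 \<le> real I * (2 * ?d)" using Suc.prems(4) d by simp_all
      then show ?thesis by (simp only: c c' ennreal_plus)
    qed
    also have "\<dots> \<le> ennreal (\<epsilon> / 2)"
    proof (rule ennreal_leI)
      have "real I * (2 * ?d) = (real I / (real I + 1)) * (\<epsilon> / 4)" by (simp add: divide_simps)
      also have "\<dots> \<le> 1 * (\<epsilon> / 4)" using Suc.prems(4) by (intro mult_right_mono) auto
      finally show "2 * (\<epsilon> / 8) + real I * (2 * ?d) \<le> \<epsilon> / 2" by linarith
    qed
    finally show ?thesis .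
  qed
  have i: "integrable M (\<lambda>\<omega>. (s n \<omega>)\<^sup>2)" for n unfolding power2_eq_square by (intro E_integrable_mult E)
  obtain N2 where N2: "\<And>n. n \<ge> N2 \<Longrightarrow> \<bar>\<integral>\<omega>. (s n \<omega>)\<^sup>2 \<partial>M\<bar> < \<epsilon> / 2" using LIMSEQ_D[OF Suc.prems(2) e8(2)] by auto
  have "(\<integral>\<^sup>+\<omega>. T (Suc k) (s n) \<omega> \<partial>M) \<le> ennreal \<epsilon>" if n: "n \<ge> max N N2" for n
  proof -
    have "(\<integral>\<^sup>+\<omega>. T (Suc k) (s n) \<omega> \<partial>M) = (\<integral>\<^sup>+\<omega>. ennreal ((s n \<omega>)\<^sup>2) \<partial>M) + (\<Sum>i. \<integral>\<^sup>+\<omega>. T k (dd i (s n)) \<omega> \<partial>M)"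
      unfolding T.simps using E[of n] dd_in[OF E, of _ n]
      by (subst nn_integral_add) (auto simp: nn_integral_suminf)
    also have "\<dots> \<le> ennreal (\<epsilon> / 2) + ennreal (\<epsilon> / 2)"
    proof (rule add_mono)
      show "(\<integral>\<^sup>+\<omega>. ennreal ((s n \<omega>)\<^sup>2) \<partial>M) \<le> ennreal (\<epsilon> / 2)"
        using nn_integral_eq_integral[OF i, of n] N2[of n] n by (auto intro!: ennreal_leI)
      show "(\<Sum>i. \<integral>\<^sup>+\<omega>. T k (dd i (s n)) \<omega> \<partial>M) \<le> ennreal (\<epsilon> / 2)"
        using partial[of n] n by (intro suminf_le_const[OF summableI]) auto
    qed
    also have "\<dots> = ennreal \<epsilon>" using Suc.prems(4) by (simp add: ennreal_plus[symmetric] del: ennreal_plus)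
    finally show ?thesis .
  qed
  then show ?case by blast
qed

lemma ennreal_suminf_tail_tendsto_0:
  fixes f :: "nat \<Rightarrow> ennreal"
  assumes "(\<Sum>i. f i) < \<infinity>"
  shows "(\<lambda>m. \<Sum>i. f (m + i)) \<longlonglongrightarrow> 0"
proof -
  have fin: "f i < \<infinity>" for i using ennreal_suminf_lessD[of f \<infinity> i] assms by simp
  define g where "g i = enn2real (f i)" for i
  have fg: "f i = ennreal (g i)" "g i \<ge> 0" for i using fin[of i] by (auto simp: g_def)
  have sg: "summable g"
    by (rule summable_suminf_not_top) (use assms fg in auto)
  have "(\<Sum>i. f (m + i)) = ennreal (\<Sum>i. g (i + m))" for m
  proof (rule suminf_ennreal_eq[of "\<lambda>i. g (i + m)", unfolded fg(1)[symmetric], simplified add.commute[of _ m]])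
    show "0 \<le> g (m + i)" for i by (rule fg(2))
    have "summable (\<lambda>i. g (i + m))" using sg by (simp add: summable_iff_shift)
    then show "(\<lambda>i. g (m + i)) sums (\<Sum>i. g (i + m))" by (simp add: summable_sums add.commute)
  qed
  moreover have "(\<lambda>m. ennreal (\<Sum>i. g (i + m))) \<longlonglongrightarrow> ennreal 0"
    by (intro tendsto_ennrealI suminf_exist_split2 sg)
  ultimately show ?thesis by simp
qed

subsection \<open>The norms of the carre du champ\<close>

lemma T'_finite:
  assumes "F \<in> E" shows "AE \<omega> in M. T' k F \<omega> < \<infinity>"
  using T'_le_norm1k[OF assms, of k] by eventually_elim (rule le_less_trans, assumption, simp)

text \<open>By Parseval, \<open>\<Gamma>(F, G)\<close> is the limit of the partial sums of the products \<open>D\<^sub>j F D\<^sub>j G\<close>, each of which satisfies the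
  inequality by \<open>T_sum_mult\<close>. The same lemma bounds differences of partial sums by the tails of
  \<open>T' k F\<close> and \<open>T' k G\<close>, so the partial sums are Cauchy, and \<open>T_zero_limit\<close> excludes that the derivatives
  converge to anything but those of \<open>\<Gamma>(F, G)\<close>. The factor \<open>2\<close> comes from \<open>T_add\<close>.\<close>

lemma T_Gamma:
  assumes F: "F \<in> E" and G: "G \<in> E"
  shows "AE \<omega> in M. T k (\<Gamma> F G) \<omega> \<le> 2 * (of_nat (leibniz_const k) * T' k F \<omega> * T' k G \<omega>)"
proof -
  let ?c = "of_nat (leibniz_const k) :: ennreal"
  define K where "K \<omega> = ?c * T' k F \<omega> * T' k G \<omega>" for \<omega>
  define s where "s n \<omega> = (\<Sum>j<n. dd j F \<omega> * dd j G \<omega>)" for n \<omega>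
  \<comment> \<open>the sequence \<open>r\<close> tends to \<open>0\<close> in \<open>L\<^sup>2\<close>, and its differences are those of \<open>s\<close>\<close>
  define r where "r n \<omega> = s n \<omega> - \<Gamma> F G \<omega>" for n \<omega>
  define tl where "tl m F \<omega> = (\<Sum>i. T k (dd (m + i) F) \<omega>)" for m F \<omega>
  have sE: "s n \<in> E" for n unfolding s_def[abs_def] by (intro E_sum E_mult dd_in F G)
  have rE: "r n \<in> E" for n unfolding r_def[abs_def] by (intro E_diff sE \<Gamma>_in F G)
  have tl_le: "tl m H \<omega> \<le> T' k H \<omega>" for m H \<omega>
    unfolding T'_def by (subst suminf_offset[OF summableI, of _ m]) (simp add: tl_def add.commute)
  have tl_meas [measurable]: "tl m H \<in> borel_measurable M" if "H \<in> E" for m H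
    unfolding tl_def[abs_def] by (intro borel_measurable_suminf_order T_measurable dd_in that)
  note FF = E_mult[OF \<Gamma>_in[OF F F] \<Gamma>_in[OF G G]]
  have r0: "(\<lambda>n. \<integral>\<omega>. (r n \<omega>)\<^sup>2 \<partial>M) \<longlonglongrightarrow> (\<integral>\<omega>. 0 \<partial>M)"
  proof (rule integral_dominated_convergence)
    show "(\<lambda>\<omega>. (r n \<omega>)\<^sup>2) \<in> borel_measurable M" for n using rE[of n] by measurable
    show "integrable M (\<lambda>\<omega>. 4 * (\<Gamma> F F \<omega> * \<Gamma> G G \<omega>))" using E_integrable[OF FF] by simp
    have pars: "(\<lambda>i. inner v (e i) * inner w (e i)) sums inner v w" for v w :: 'h
      using e unfolding parseval_sequence_def by blast
    show "AE \<omega> in M. (\<lambda>n. (r n \<omega>)\<^sup>2) \<longlonglongrightarrow> 0"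
      using \<Gamma>_eq_inner[OF F G]
    proof eventually_elim
      case (elim \<omega>)
      have "(\<lambda>n. s n \<omega>) \<longlonglongrightarrow> \<Gamma> F G \<omega>"
        using pars[of "D F \<omega>" "D G \<omega>"] unfolding sums_def s_def elim by (simp add: dir_deriv_def)
      then have "(\<lambda>n. (r n \<omega>)\<^sup>2) \<longlonglongrightarrow> (\<Gamma> F G \<omega> - \<Gamma> F G \<omega>)\<^sup>2" unfolding r_def by (intro tendsto_intros)
      then show ?case by simp
    qed
    show "AE \<omega> in M. norm ((r n \<omega>)\<^sup>2) \<le> 4 * (\<Gamma> F F \<omega> * \<Gamma> G G \<omega>)" for n
      using \<Gamma>_eq_inner[OF F G] \<Gamma>_eq_inner[OF F F] \<Gamma>_eq_inner[OF G G]
    proof eventually_elim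
      case (elim \<omega>)
      have part: "(\<Sum>j<n. (inner v (e j))\<^sup>2) \<le> inner v v" for v :: 'h
      proof -
        have "(\<lambda>i. (inner v (e i))\<^sup>2) sums inner v v" using pars[of v v] by (simp add: power2_eq_square)
        then show ?thesis using sum_le_suminf[of "\<lambda>i. (inner v (e i))\<^sup>2" "{..<n}"] by (auto simp: sums_iff)
      qed
      have "(s n \<omega>)\<^sup>2 \<le> (\<Sum>j<n. (dd j F \<omega>)\<^sup>2) * (\<Sum>j<n. (dd j G \<omega>)\<^sup>2)"
        unfolding s_def by (rule Cauchy_Schwarz_ineq_sum)
      also have "\<dots> \<le> \<Gamma> F F \<omega> * \<Gamma> G G \<omega>"
        unfolding elim dir_deriv_def by (intro mult_mono part sum_nonneg) auto
      finally have 1: "(s n \<omega>)\<^sup>2 \<le> \<Gamma> F F \<omega> * \<Gamma> G G \<omega>" .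
      have 2: "(\<Gamma> F G \<omega>)\<^sup>2 \<le> \<Gamma> F F \<omega> * \<Gamma> G G \<omega>"
        unfolding elim by (rule Cauchy_Schwarz_ineq)
      have "(r n \<omega>)\<^sup>2 \<le> 2 * (s n \<omega>)\<^sup>2 + 2 * (\<Gamma> F G \<omega>)\<^sup>2"
        unfolding r_def using zero_le_power2[of "s n \<omega> + \<Gamma> F G \<omega>"] by (simp add: power2_sum power2_diff)
      with 1 2 show ?case by simp
    qed
  qed simp_all
  have diff_le: "AE \<omega> in M. T k (\<lambda>\<omega>. s n \<omega> - s m \<omega>) \<omega> \<le> ?c * tl m F \<omega> * tl m G \<omega>" if "m \<le> n" for n m
  proof -
    have "s n \<omega> - s m \<omega> = (\<Sum>j<n - m. dd (m + j) F \<omega> * dd (m + j) G \<omega>)" for \<omega>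
    proof -
      have "s n \<omega> = s m \<omega> + (\<Sum>j=m..<n. dd j F \<omega> * dd j G \<omega>)"
        unfolding s_def using that by (simp add: sum.atLeastLessThan_concat lessThan_atLeast0)
      moreover have "(\<Sum>j=m..<n. dd j F \<omega> * dd j G \<omega>) = (\<Sum>j<n - m. dd (m + j) F \<omega> * dd (m + j) G \<omega>)"
        using sum.shift_bounds_nat_ivl[of "\<lambda>j. dd j F \<omega> * dd j G \<omega>" 0 m "n - m"] that
        by (simp add: lessThan_atLeast0 add.commute)
      ultimately show ?thesis by simp
    qed
    then have "AE \<omega> in M. T k (\<lambda>\<omega>. s n \<omega> - s m \<omega>) \<omega> \<le> ?c * (\<Sum>j<n - m. T k (dd (m + j) F) \<omega>) * (\<Sum>j<n - m. T k (dd (m + j) G) \<omega>)"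
      using T_sum_mult[of "\<lambda>j. dd (m + j) F" "\<lambda>j. dd (m + j) G" k "n - m"] dd_in F G by simp
    then show ?thesis
      unfolding tl_def
      by eventually_elim (auto elim!: order_trans intro!: mult_mono sum_le_suminf)
  qed
  have swap: "AE \<omega> in M. T k (\<lambda>\<omega>. s n \<omega> - s m \<omega>) \<omega> = T k (\<lambda>\<omega>. s m \<omega> - s n \<omega>) \<omega>" for n m
    using T_cmult[OF E_diff[OF sE[of m] sE[of n]], of k "-1"] by simp
  have tail0: "(\<lambda>m. \<integral>\<^sup>+\<omega>. ?c * (tl m F \<omega> * tl m G \<omega>) \<partial>M) \<longlonglongrightarrow> (\<integral>\<^sup>+\<omega>. 0 \<partial>M)"
  proof (rule nn_integral_dominated_convergence)
    show "(\<integral>\<^sup>+\<omega>. ?c * (T' k F \<omega> * T' k G \<omega>) \<partial>M) < \<infinity>"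
      using T'_prod_finite[OF F G, of k] F G by (simp add: nn_integral_cmult ennreal_mult_less_top of_nat_less_top)
    show "AE \<omega> in M. ?c * (tl j F \<omega> * tl j G \<omega>) \<le> ?c * (T' k F \<omega> * T' k G \<omega>)" for j
      by (intro AE_I2 mult_left_mono mult_mono tl_le) auto
    show "AE \<omega> in M. (\<lambda>m. ?c * (tl m F \<omega> * tl m G \<omega>)) \<longlonglongrightarrow> 0"
      using T'_finite[OF F, of k] T'_finite[OF G, of k]
    proof eventually_elim
      case (elim \<omega>)
      have t: "(\<lambda>m. tl m F \<omega>) \<longlonglongrightarrow> 0" "(\<lambda>m. tl m G \<omega>) \<longlonglongrightarrow> 0"
        using elim unfolding tl_def T'_def by (intro ennreal_suminf_tail_tendsto_0; simp)+
      have "(\<lambda>m. tl m F \<omega> * tl m G \<omega>) \<longlonglongrightarrow> 0 * 0" by (intro tendsto_mult_ennreal t) auto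
      then have "(\<lambda>m. ?c * (tl m F \<omega> * tl m G \<omega>)) \<longlonglongrightarrow> ?c * (0 * 0)"
        by (intro ennreal_tendsto_cmult) (auto simp: of_nat_less_top)
      then show ?case by simp
    qed
  qed (use F G in measurable)
  have lim: "\<exists>N. \<forall>n\<ge>N. (\<integral>\<^sup>+\<omega>. T k (r n) \<omega> \<partial>M) \<le> ennreal \<epsilon>" if eps: "\<epsilon> > 0" for \<epsilon> :: real
  proof (rule T_zero_limit[OF rE _ _ eps])
    show "(\<lambda>n. \<integral>\<omega>. (r n \<omega>)\<^sup>2 \<partial>M) \<longlonglongrightarrow> 0" using r0 by simp
    fix \<epsilon> :: real assume "\<epsilon> > 0"
    then have "\<forall>\<^sub>F m in sequentially. (\<integral>\<^sup>+\<omega>. ?c * (tl m F \<omega> * tl m G \<omega>) \<partial>M) < ennreal \<epsilon>"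
      using order_tendstoD(2)[OF tail0, of "ennreal \<epsilon>"] by simp
    then obtain N where N: "\<And>m. m \<ge> N \<Longrightarrow> (\<integral>\<^sup>+\<omega>. ?c * (tl m F \<omega> * tl m G \<omega>) \<partial>M) < ennreal \<epsilon>"
      unfolding eventually_sequentially by blast
    have le: "(\<integral>\<^sup>+\<omega>. T k (\<lambda>\<omega>. s n \<omega> - s m \<omega>) \<omega> \<partial>M) \<le> ennreal \<epsilon>" if "m \<ge> N" "m \<le> n" for n m
    proof -
      have "(\<integral>\<^sup>+\<omega>. T k (\<lambda>\<omega>. s n \<omega> - s m \<omega>) \<omega> \<partial>M) \<le> (\<integral>\<^sup>+\<omega>. ?c * (tl m F \<omega> * tl m G \<omega>) \<partial>M)"
        using diff_le[OF that(2)] by (intro nn_integral_mono_AE) (simp add: mult.assoc)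
      then show ?thesis using N[OF that(1)] by simp
    qed
    have le': "(\<integral>\<^sup>+\<omega>. T k (\<lambda>\<omega>. s n \<omega> - s m \<omega>) \<omega> \<partial>M) \<le> ennreal \<epsilon>" if "m \<ge> N" "n \<ge> N" for n m
    proof (cases "m \<le> n")
      case False
      then show ?thesis using le[of n m] that nn_integral_cong_AE[OF swap[of n m]] by simp
    qed (use le that in auto)
    have "(\<lambda>\<omega>. r n \<omega> - r m \<omega>) = (\<lambda>\<omega>. s n \<omega> - s m \<omega>)" for n m by (auto simp: r_def)
    then show "\<exists>N. \<forall>n\<ge>N. \<forall>m\<ge>N. (\<integral>\<^sup>+\<omega>. T k (\<lambda>\<omega>. r n \<omega> - r m \<omega>) \<omega> \<partial>M) \<le> ennreal \<epsilon>"
      using le' by (intro exI[of _ N] allI impI) simp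
  qed
  have bound: "AE \<omega> in M. T k (\<Gamma> F G) \<omega> - 2 * K \<omega> \<le> 2 * T k (r n) \<omega>" for n
  proof -
    have eq: "(\<lambda>\<omega>. s n \<omega> + (- 1 * r n \<omega>)) = \<Gamma> F G" by (auto simp: r_def)
    have "AE \<omega> in M. T k (s n) \<omega> \<le> K \<omega>"
      using diff_le[of 0 n, OF le0]
    proof eventually_elim
      case (elim \<omega>)
      have "?c * tl 0 F \<omega> * tl 0 G \<omega> = K \<omega>" by (simp add: K_def tl_def T'_def)
      then show ?case using elim by (simp add: s_def[of 0])
    qed
    moreover have "AE \<omega> in M. T k (\<lambda>\<omega>. - 1 * r n \<omega>) \<omega> = T k (r n) \<omega>" using T_cmult[OF rE[of n], of k "-1"] by simp
    moreover have "AE \<omega> in M. T k (\<lambda>\<omega>. s n \<omega> + (- 1 * r n \<omega>)) \<omega> \<le> 2 * T k (s n) \<omega> + 2 * T k (\<lambda>\<omega>. - 1 * r n \<omega>) \<omega>"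
      by (intro T_add sE E_cmult rE)
    moreover have "AE \<omega> in M. K \<omega> < \<infinity>"
      using T'_finite[OF F, of k] T'_finite[OF G, of k]
      by eventually_elim (simp add: K_def ennreal_mult_less_top of_nat_less_top)
    ultimately show ?thesis
      unfolding eq
    proof eventually_elim
      case (elim \<omega>)
      have "T k (\<Gamma> F G) \<omega> \<le> 2 * K \<omega> + 2 * T k (r n) \<omega>"
        by (rule order_trans[OF elim(3)]) (simp only: elim(2), intro add_right_mono mult_left_mono elim(1), simp)
      moreover have "2 * K \<omega> < \<infinity>" using elim(4) by (simp add: ennreal_mult_less_top)
      ultimately show ?case by (auto simp: ennreal_minus_le_iff)
    qed
  qed
  have Kmeas [measurable]: "K \<in> borel_measurable M" unfolding K_def[abs_def] using F G by measurable
  have [measurable]: "T k (\<Gamma> F G) \<in> borel_measurable M" by (intro T_measurable \<Gamma>_in F G)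
  have "(\<integral>\<^sup>+\<omega>. T k (\<Gamma> F G) \<omega> - 2 * K \<omega> \<partial>M) \<le> ennreal \<epsilon>" if eps: "\<epsilon> > 0" for \<epsilon> :: real
  proof -
    obtain n where n: "(\<integral>\<^sup>+\<omega>. T k (r n) \<omega> \<partial>M) \<le> ennreal (\<epsilon> / 2)" using lim[of "\<epsilon> / 2"] eps by auto
    have "(\<integral>\<^sup>+\<omega>. T k (\<Gamma> F G) \<omega> - 2 * K \<omega> \<partial>M) \<le> (\<integral>\<^sup>+\<omega>. 2 * T k (r n) \<omega> \<partial>M)" by (intro nn_integral_mono_AE bound)
    also have "\<dots> \<le> 2 * ennreal (\<epsilon> / 2)" using n rE[of n] by (simp add: nn_integral_cmult mult_left_mono)
    also have "\<dots> = ennreal (\<epsilon> / 2) + ennreal (\<epsilon> / 2)" by (rule mult_2)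
    also have "\<dots> = ennreal \<epsilon>" using eps by (simp add: ennreal_plus[symmetric] del: ennreal_plus)
    finally show ?thesis .
  qed
  then have "(\<integral>\<^sup>+\<omega>. T k (\<Gamma> F G) \<omega> - 2 * K \<omega> \<partial>M) \<le> 0" by - (rule ennreal_le_epsilon, simp)
  then have "AE \<omega> in M. T k (\<Gamma> F G) \<omega> - 2 * K \<omega> = 0" by (simp add: nn_integral_0_iff_AE)
  then show ?thesis unfolding K_def by eventually_elim (simp add: diff_eq_0_iff_ennreal)
qed

end

section \<open>Integration by parts\<close>

text \<open>This and the next definitions count the powers of \<open>Y\<close> that the construction of the weights produces.
  What matters is that they depend only on the dimension, the order and the exponent of the previous
  weight. This one is for determinants with entries in \<open>cls j 3\<close>.\<close>

definition det_exp :: "nat \<Rightarrow> nat" where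
  "det_exp d = fact d * (4 * d + 2)"

primrec recip_exp :: "nat \<Rightarrow> nat \<Rightarrow> nat" where
  "recip_exp d 0 = 2"
| "recip_exp d (Suc k) = 2 * det_exp d + 2 * recip_exp d k + 7"

definition weight_exp :: "nat \<Rightarrow> nat \<Rightarrow> nat \<Rightarrow> nat" where
  "weight_exp d k a = (det_exp d + recip_exp d k + 1) + a + 1 + det_exp d + 1"

primrec ibp_exp :: "nat \<Rightarrow> nat \<Rightarrow> nat \<Rightarrow> nat" where
  "ibp_exp d 0 a = a"
| "ibp_exp d (Suc m) a = ibp_exp d m (d * (2 * weight_exp d (Suc m) a + 7))"

lemma leibniz_const_mono: "j \<le> k \<Longrightarrow> leibniz_const j \<le> leibniz_const k"
  by (rule lift_Suc_mono_le) auto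

text \<open>All weights are compared with powers of a single random variable \<open>Y\<close>. The lower bound on \<open>Y\<close> allows
  numerical constants to be absorbed into powers of \<open>Y\<close>.\<close>

locale dominated_vector = malliavin_basis M E \<Gamma> L tens D DD e
  for M :: "'w measure"
    and E :: "('w \<Rightarrow> real) set"
    and \<Gamma> :: "('w \<Rightarrow> real) \<Rightarrow> ('w \<Rightarrow> real) \<Rightarrow> 'w \<Rightarrow> real"
    and L :: "('w \<Rightarrow> real) \<Rightarrow> 'w \<Rightarrow> real"
    and tens :: "'h::{real_inner, polish_space} list \<Rightarrow> 't::{real_inner, polish_space}"
    and D :: "('w \<Rightarrow> real) \<Rightarrow> 'w \<Rightarrow> 'h"
    and DD :: "nat \<Rightarrow> ('w \<Rightarrow> real) \<Rightarrow> 'w \<Rightarrow> 't"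
    and e :: "nat \<Rightarrow> 'h" +
  fixes F :: "'d::finite \<Rightarrow> 'w \<Rightarrow> real" and n :: nat and Y :: "'w \<Rightarrow> real"
  assumes FE: "\<And>i. F i \<in> E"
    and Y_measurable [measurable]: "Y \<in> borel_measurable M"
    and Y_const: "AE \<omega> in M. real (4 * leibniz_const n) \<le> Y \<omega>"
    and Y_T': "\<And>i. AE \<omega> in M. T' n (F i) \<omega> \<le> ennreal (Y \<omega>)"
    and Y_T: "\<And>i. AE \<omega> in M. T n (L (F i)) \<omega> \<le> ennreal (Y \<omega>)"
    and Y_det: "AE \<omega> in M. det (malliavin_cov \<Gamma> F \<omega>) \<noteq> 0 \<and> 1 / (det (malliavin_cov \<Gamma> F \<omega>))\<^sup>2 \<le> Y \<omega>"
begin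

lemma Y_ge: "AE \<omega> in M. 4 \<le> Y \<omega> \<and> 1 \<le> Y \<omega> \<and> (\<forall>j\<le>n. real (2 * leibniz_const j) \<le> Y \<omega>)"
  using Y_const
proof eventually_elim
  case (elim \<omega>)
  have "1 \<le> leibniz_const n" using leibniz_const_mono[of 0 n] by simp
  moreover have "real (2 * leibniz_const j) \<le> Y \<omega>" if "j \<le> n" for j
  proof -
    have "real (2 * leibniz_const j) \<le> real (4 * leibniz_const n)" using leibniz_const_mono[OF that] by simp
    then show ?thesis using elim by linarith
  qed
  ultimately show ?case using elim by auto
qed

text \<open>Classes of weights, graded by the exponent \<open>a\<close>. Sums, products, \<open>\<Gamma>\<close> and regularised reciprocals of the determinant stay
  within these classes, at the price of a larger exponent (and, for \<open>\<Gamma>\<close>, of one derivative).\<close>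

definition cls :: "nat \<Rightarrow> nat \<Rightarrow> ('w \<Rightarrow> real) set" where
  "cls j a = {W \<in> E. AE \<omega> in M. T j W \<omega> \<le> ennreal (Y \<omega> ^ a)}"

lemma cls_E: "W \<in> cls j a \<Longrightarrow> W \<in> E"
  by (simp add: cls_def)

lemma cls_mono:
  assumes "W \<in> cls j a" "i \<le> j" "a \<le> b" shows "W \<in> cls i b"
proof -
  have "AE \<omega> in M. T j W \<omega> \<le> ennreal (Y \<omega> ^ a)" using assms by (simp add: cls_def)
  with Y_ge have "AE \<omega> in M. T i W \<omega> \<le> ennreal (Y \<omega> ^ b)"
  proof eventually_elim
    case (elim \<omega>)
    have "T i W \<omega> \<le> T j W \<omega>" by (rule T_mono[OF assms(2)])
    also have "\<dots> \<le> ennreal (Y \<omega> ^ a)" using elim by simp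
    also have "\<dots> \<le> ennreal (Y \<omega> ^ b)" using elim assms(3) by (intro ennreal_leI power_increasing) auto
    finally show ?case .
  qed
  then show ?thesis using assms by (simp add: cls_def)
qed

lemma cls_mult:
  assumes "j \<le> n" "W \<in> cls j a" "V \<in> cls j b"
  shows "(\<lambda>\<omega>. W \<omega> * V \<omega>) \<in> cls j (a + b + 1)"
proof -
  have W: "W \<in> E" "AE \<omega> in M. T j W \<omega> \<le> ennreal (Y \<omega> ^ a)" and V: "V \<in> E" "AE \<omega> in M. T j V \<omega> \<le> ennreal (Y \<omega> ^ b)"
    using assms by (auto simp: cls_def)
  have "AE \<omega> in M. T j (\<lambda>\<omega>. W \<omega> * V \<omega>) \<omega> \<le> ennreal (Y \<omega> ^ (a + b + 1))"
    using T_mult[OF W(1) V(1), of j] W(2) V(2) Y_ge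
  proof eventually_elim
    case (elim \<omega>)
    have l: "real (leibniz_const j) \<le> Y \<omega>" using elim(4) assms(1) by (auto intro: order_trans[of _ "2 * real (leibniz_const j)"])
    have "T j (\<lambda>\<omega>. W \<omega> * V \<omega>) \<omega> \<le> of_nat (leibniz_const j) * T j W \<omega> * T j V \<omega>" by (rule elim)
    also have "\<dots> \<le> ennreal (Y \<omega>) * ennreal (Y \<omega> ^ a) * ennreal (Y \<omega> ^ b)"
      using l by (intro mult_mono elim) (auto simp: ennreal_of_nat_eq_real_of_nat ennreal_leI)
    also have "\<dots> = ennreal (Y \<omega> ^ (a + b + 1))" using elim(4) by (simp add: ennreal_mult[symmetric] power_add mult_ac)
    finally show ?case .
  qed
  then show ?thesis using E_mult[OF W(1) V(1)] by (simp add: cls_def)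
qed

lemma cls_add:
  assumes "j \<le> n" "W \<in> cls j a" "V \<in> cls j b"
  shows "(\<lambda>\<omega>. W \<omega> + V \<omega>) \<in> cls j (a + b + 1)"
proof -
  have W: "W \<in> E" "AE \<omega> in M. T j W \<omega> \<le> ennreal (Y \<omega> ^ a)" and V: "V \<in> E" "AE \<omega> in M. T j V \<omega> \<le> ennreal (Y \<omega> ^ b)"
    using assms by (auto simp: cls_def)
  have "AE \<omega> in M. T j (\<lambda>\<omega>. W \<omega> + V \<omega>) \<omega> \<le> ennreal (Y \<omega> ^ (a + b + 1))"
    using T_add[OF W(1) V(1), of j] W(2) V(2) Y_ge
  proof eventually_elim
    case (elim \<omega>)
    let ?y = "Y \<omega>"
    have y: "4 \<le> ?y" "1 \<le> ?y" using elim(4) by auto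
    have "T j (\<lambda>\<omega>. W \<omega> + V \<omega>) \<omega> \<le> 2 * T j W \<omega> + 2 * T j V \<omega>" by (rule elim)
    also have "\<dots> \<le> ennreal 2 * ennreal (?y ^ a) + ennreal 2 * ennreal (?y ^ b)"
      using elim(2,3) by (auto intro!: add_mono mult_left_mono)
    also have "\<dots> = ennreal (2 * ?y ^ a + 2 * ?y ^ b)" using y by (simp add: ennreal_mult)
    also have "\<dots> \<le> ennreal (?y ^ (a + b + 1))"
    proof (rule ennreal_leI)
      have "?y ^ a \<le> ?y ^ (a + b)" "?y ^ b \<le> ?y ^ (a + b)" using y by (auto intro!: power_increasing)
      then have "2 * ?y ^ a + 2 * ?y ^ b \<le> 4 * ?y ^ (a + b)" by simp
      also have "\<dots> \<le> ?y * ?y ^ (a + b)" using y by (intro mult_right_mono) auto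
      finally show "2 * ?y ^ a + 2 * ?y ^ b \<le> ?y ^ (a + b + 1)" by simp
    qed
    finally show ?case .
  qed
  then show ?thesis using E_add[OF W(1) V(1)] by (simp add: cls_def)
qed

lemma cls_const:
  assumes "\<bar>c\<bar> \<le> 1" shows "(\<lambda>\<omega>. c) \<in> cls j 0"
proof -
  have "c\<^sup>2 \<le> 1" using assms by (simp add: abs_square_le_1)
  then have le: "ennreal (c\<^sup>2) \<le> ennreal (Y \<omega> ^ 0)" for \<omega> by (intro ennreal_leI) simp
  have "AE \<omega> in M. T j (\<lambda>\<omega>. c) \<omega> \<le> ennreal (Y \<omega> ^ 0)"
    using T_const[of j c] by eventually_elim (simp only: le)
  then show ?thesis using E_const by (simp add: cls_def)
qed

lemma cls_scale:
  assumes "\<bar>c\<bar> \<le> 2" "W \<in> cls j a" shows "(\<lambda>\<omega>. c * W \<omega>) \<in> cls j (a + 1)"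
proof -
  have W: "W \<in> E" "AE \<omega> in M. T j W \<omega> \<le> ennreal (Y \<omega> ^ a)" using assms by (auto simp: cls_def)
  have c: "c\<^sup>2 \<le> 4" using power_mono[OF assms(1), of 2] by simp
  have "AE \<omega> in M. T j (\<lambda>\<omega>. c * W \<omega>) \<omega> \<le> ennreal (Y \<omega> ^ (a + 1))"
    using T_cmult[OF W(1), of j c] W(2) Y_ge
  proof eventually_elim
    case (elim \<omega>)
    have "T j (\<lambda>\<omega>. c * W \<omega>) \<omega> \<le> ennreal (Y \<omega>) * ennreal (Y \<omega> ^ a)"
      unfolding elim(1) using elim c by (intro mult_mono ennreal_leI) auto
    also have "\<dots> = ennreal (Y \<omega> ^ (a + 1))" using elim(3) by (simp add: ennreal_mult)
    finally show ?case .
  qed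
  then show ?thesis using E_cmult[OF W(1)] by (simp add: cls_def)
qed

lemma cls_sum:
  assumes "j \<le> n" "finite I" "\<And>i. i \<in> I \<Longrightarrow> u i \<in> cls j (a i)"
  shows "(\<lambda>\<omega>. \<Sum>i\<in>I. u i \<omega>) \<in> cls j (\<Sum>i\<in>I. a i + 1)"
  using assms(2,3)
proof (induction I rule: finite_induct)
  case empty
  show ?case using cls_const[of 0 j] by simp
next
  case (insert i I)
  from cls_add[OF assms(1), of "u i" "a i" "\<lambda>\<omega>. \<Sum>i\<in>I. u i \<omega>" "\<Sum>i\<in>I. a i + 1"] insert
  show ?case by (simp add: add_ac)
qed

lemma cls_prod:
  assumes "j \<le> n" "finite I" "\<And>i. i \<in> I \<Longrightarrow> u i \<in> cls j (a i)"
  shows "(\<lambda>\<omega>. \<Prod>i\<in>I. u i \<omega>) \<in> cls j (\<Sum>i\<in>I. a i + 1)"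
  using assms(2,3)
proof (induction I rule: finite_induct)
  case empty
  show ?case using cls_const[of 1 j] by simp
next
  case (insert i I)
  from cls_mult[OF assms(1), of "u i" "a i" "\<lambda>\<omega>. \<Prod>i\<in>I. u i \<omega>" "\<Sum>i\<in>I. a i + 1"] insert
  show ?case by (simp add: add_ac)
qed

lemma cls_Gamma:
  assumes j: "Suc j \<le> n" and V: "V \<in> cls (Suc j) a"
  shows "\<Gamma> V (F i) \<in> cls j (a + 2)"
proof -
  have V': "V \<in> E" "AE \<omega> in M. T (Suc j) V \<omega> \<le> ennreal (Y \<omega> ^ a)" using V by (auto simp: cls_def)
  have "AE \<omega> in M. T j (\<Gamma> V (F i)) \<omega> \<le> ennreal (Y \<omega> ^ (a + 2))"
    using T_Gamma[OF V'(1) FE[of i], of j] V'(2) Y_T'[of i] Y_ge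
  proof eventually_elim
    case (elim \<omega>)
    have "T j (\<Gamma> V (F i)) \<omega> \<le> of_nat (2 * leibniz_const j) * T' j V \<omega> * T' j (F i) \<omega>"
      using elim(1) by (simp add: mult.assoc)
    also have "\<dots> \<le> ennreal (Y \<omega>) * ennreal (Y \<omega> ^ a) * ennreal (Y \<omega>)"
    proof (intro mult_mono)
      show "of_nat (2 * leibniz_const j) \<le> ennreal (Y \<omega>)"
        using elim(4) j unfolding ennreal_of_nat_eq_real_of_nat by (intro ennreal_leI) auto
      show "T' j V \<omega> \<le> ennreal (Y \<omega> ^ a)" using order_trans[OF T'_le_T elim(2)] .
      show "T' j (F i) \<omega> \<le> ennreal (Y \<omega>)" using order_trans[OF T'_mono elim(3)] j by simp
    qed auto
    also have "\<dots> = ennreal (Y \<omega> ^ (a + 2))" using elim(4) by (simp add: ennreal_mult[symmetric] power_add power2_eq_square mult_ac)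
    finally show ?case .
  qed
  then show ?thesis using \<Gamma>_in[OF V'(1) FE] by (simp add: cls_def)
qed

lemma cls_cov:
  assumes j: "j \<le> n"
  shows "\<Gamma> (F i) (F k) \<in> cls j 3"
proof -
  have "AE \<omega> in M. T j (\<Gamma> (F i) (F k)) \<omega> \<le> ennreal (Y \<omega> ^ 3)"
    using T_Gamma[OF FE[of i] FE[of k], of j] Y_T'[of i] Y_T'[of k] Y_ge
  proof eventually_elim
    case (elim \<omega>)
    have "T j (\<Gamma> (F i) (F k)) \<omega> \<le> of_nat (2 * leibniz_const j) * T' j (F i) \<omega> * T' j (F k) \<omega>"
      using elim(1) by (simp add: mult.assoc)
    also have "\<dots> \<le> ennreal (Y \<omega>) * ennreal (Y \<omega>) * ennreal (Y \<omega>)"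
    proof (intro mult_mono)
      show "of_nat (2 * leibniz_const j) \<le> ennreal (Y \<omega>)"
        using elim(4) j unfolding ennreal_of_nat_eq_real_of_nat by (intro ennreal_leI) auto
      show "T' j (F i) \<omega> \<le> ennreal (Y \<omega>)" using order_trans[OF T'_mono elim(2)] j by simp
      show "T' j (F k) \<omega> \<le> ennreal (Y \<omega>)" using order_trans[OF T'_mono elim(3)] j by simp
    qed auto
    also have "\<dots> = ennreal (Y \<omega> ^ 3)" using elim(4) by (simp add: ennreal_mult[symmetric] power3_eq_cube)
    finally show ?case .
  qed
  then show ?thesis using \<Gamma>_in[OF FE FE] by (simp add: cls_def)
qed

lemma cls_L: "j \<le> n \<Longrightarrow> L (F i) \<in> cls j 1"
  by (rule cls_mono[of _ n 1]) (use Y_T L_in FE in \<open>auto simp: cls_def\<close>)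

lemma cls_det:
  fixes A :: "'w \<Rightarrow> real^'d^'d"
  assumes j: "j \<le> n" and A: "\<And>i k. (\<lambda>\<omega>. A \<omega> $ i $ k) \<in> cls j 3"
  shows "(\<lambda>\<omega>. det (A \<omega>)) \<in> cls j (det_exp CARD('d))"
proof -
  let ?P = "{p. p permutes (UNIV :: 'd set)}"
  have "(\<lambda>\<omega>. \<Sum>p\<in>?P. of_int (sign p) * (\<Prod>i\<in>UNIV. A \<omega> $ i $ p i)) \<in> cls j (\<Sum>p\<in>?P. (4 * CARD('d) + 1) + 1)"
  proof (rule cls_sum[OF j])
    fix p assume "p \<in> ?P"
    have "(\<lambda>\<omega>. \<Prod>i\<in>UNIV. A \<omega> $ i $ p i) \<in> cls j (\<Sum>i\<in>(UNIV :: 'd set). 3 + 1)"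
      by (rule cls_prod[OF j]) (use A in auto)
    then have "(\<lambda>\<omega>. \<Prod>i\<in>UNIV. A \<omega> $ i $ p i) \<in> cls j (4 * CARD('d))" by (simp add: mult.commute)
    then show "(\<lambda>\<omega>. of_int (sign p) * (\<Prod>i\<in>UNIV. A \<omega> $ i $ p i)) \<in> cls j (4 * CARD('d) + 1)"
      by (rule cls_scale[rotated]) (simp add: sign_def)
  qed (simp add: finite_permutations)
  moreover have "(\<Sum>p\<in>?P. (4 * CARD('d) + 1) + 1) = det_exp CARD('d)"
    by (simp add: det_exp_def card_permutations[OF refl])
  ultimately show ?thesis by (simp add: det_def)
qed

definition \<delta> :: "'w \<Rightarrow> real" where
  "\<delta> \<omega> = det (malliavin_cov \<Gamma> F \<omega>)"

text \<open>An entry of the adjugate matrix of \<open>malliavin_cov\<close>, as a determinant with one row replaced by a unit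
  vector.\<close>

definition cofactor :: "'d \<Rightarrow> 'd \<Rightarrow> 'w \<Rightarrow> real" where
  "cofactor l k \<omega> = det (\<chi> r. if r = k then axis l 1 else malliavin_cov \<Gamma> F \<omega> $ r)"

lemma cls_delta: "j \<le> n \<Longrightarrow> \<delta> \<in> cls j (det_exp CARD('d))"
  unfolding \<delta>_def[abs_def] by (rule cls_det) (auto simp: malliavin_cov_def intro: cls_cov)

lemma cls_cofactor: "j \<le> n \<Longrightarrow> cofactor l k \<in> cls j (det_exp CARD('d))"
  unfolding cofactor_def[abs_def]
proof (rule cls_det)
  fix i m assume j: "j \<le> n"
  have c: "(\<lambda>\<omega>. c) \<in> cls j 3" if "\<bar>c\<bar> \<le> 1" for c
    by (rule cls_mono[OF cls_const[OF that]]) auto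
  show "(\<lambda>\<omega>. (\<chi> r. if r = k then axis l 1 else malliavin_cov \<Gamma> F \<omega> $ r) $ i $ m) \<in> cls j 3"
    by (cases "i = k") (auto simp: malliavin_cov_def axis_def intro: cls_cov[OF j] c)
qed

text \<open>Cramer's rule: the sum is the determinant in which row \<open>k\<close> is replaced by row \<open>i\<close>.\<close>

lemma cofactor_expansion:
  "(\<Sum>l\<in>UNIV. \<Gamma> (F i) (F l) \<omega> * cofactor l k \<omega>) = (if i = k then \<delta> \<omega> else 0)"
proof -
  let ?A = "malliavin_cov \<Gamma> F \<omega>"
  have "(\<Sum>l\<in>UNIV. \<Gamma> (F i) (F l) \<omega> * cofactor l k \<omega>) = (\<Sum>l\<in>UNIV. det (\<chi> r. if r = k then ?A $ i $ l *s axis l 1 else ?A $ r))"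
    unfolding cofactor_def by (simp add: det_row_mul malliavin_cov_def)
  also have "\<dots> = det (\<chi> r. if r = k then (\<Sum>l\<in>UNIV. ?A $ i $ l *s axis l 1) else ?A $ r)"
    by (simp add: det_linear_row_sum)
  also have "\<dots> = det (\<chi> r. if r = k then ?A $ i else ?A $ r)" by (simp only: basis_expansion)
  also have "\<dots> = (if i = k then \<delta> \<omega> else 0)"
  proof (cases "i = k")
    case True
    then have "(\<chi> r. if r = k then ?A $ i else ?A $ r) = ?A" by (simp add: vec_eq_iff)
    then show ?thesis using True by (simp add: \<delta>_def)
  next
    case False
    have "det (\<chi> r. if r = k then ?A $ i else ?A $ r) = 0"
      by (rule det_identical_rows[of k i]) (use False in \<open>auto simp: row_def vec_eq_iff\<close>)
    then show ?thesis using False by simp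
  qed
  finally show ?thesis .
qed

text \<open>\<open>\<delta>\<^sup>2 w \<eta>\<close> increases to \<open>1\<close> as \<open>\<eta>\<close> decreases to \<open>0\<close>, as long as the determinant \<open>\<delta>\<close> does not vanish.\<close>

definition w :: "real \<Rightarrow> 'w \<Rightarrow> real" where
  "w \<eta> \<omega> = 1 / ((\<delta> \<omega>)\<^sup>2 + \<eta>)"

lemma delta_E: "\<delta> \<in> E" using cls_delta[of n] cls_E by simp

text \<open>The point is that the exponent does not depend on \<open>\<eta>\<close>. The identity \<open>D w = -2 \<delta> w\<^sup>2 D \<delta>\<close> expresses the
  derivatives of \<open>w\<close> by those of lower order, and at order \<open>0\<close> one has \<open>w \<le> 1 / \<delta>\<^sup>2 \<le> Y\<close>.\<close>

lemma cls_w: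
  assumes eta: "\<eta> > 0" and k: "k \<le> n"
  shows "w \<eta> \<in> cls k (recip_exp CARD('d) k)"
  using k
proof (induction k)
  case 0
  have "AE \<omega> in M. T 0 (w \<eta>) \<omega> \<le> ennreal (Y \<omega> ^ 2)"
    using Y_det
  proof eventually_elim
    case (elim \<omega>)
    have "w \<eta> \<omega> \<le> 1 / (\<delta> \<omega>)\<^sup>2" unfolding w_def using elim eta by (intro divide_left_mono) (auto simp: \<delta>_def add_pos_pos)
    also have "\<dots> \<le> Y \<omega>" using elim by (simp add: \<delta>_def)
    finally have "w \<eta> \<omega> \<le> Y \<omega>" .
    moreover have "0 \<le> w \<eta> \<omega>" unfolding w_def using eta by simp
    ultimately show ?case by (auto intro!: ennreal_leI power_mono)
  qed
  then show ?case using D_recip(1)[OF delta_E eta] by (simp add: cls_def w_def[abs_def])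
next
  case (Suc k)
  let ?N = "det_exp CARD('d)" let ?r = "recip_exp CARD('d) k"
  have k: "k \<le> n" using Suc.prems by simp
  have wE: "w \<eta> \<in> E" using D_recip(1)[OF delta_E eta] by (simp add: w_def[abs_def])
  let ?P = "\<lambda>\<omega>. - 2 * (\<delta> \<omega> * (w \<eta> \<omega> * w \<eta> \<omega>))"
  have P: "?P \<in> cls k (?N + (?r + ?r + 1) + 1 + 1)"
    by (intro cls_scale cls_mult[OF k] Suc.IH cls_delta k) simp
  have PE: "?P \<in> E" by (rule cls_E[OF P])
  have "AE \<omega> in M. \<forall>i. T k (dd i (w \<eta>)) \<omega> \<le> of_nat (leibniz_const k) * T k ?P \<omega> * T k (dd i \<delta>) \<omega>"
    unfolding AE_all_countable
  proof
    fix i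
    have "AE \<omega> in M. dd i (w \<eta>) \<omega> = ?P \<omega> * dd i \<delta> \<omega>"
      using D_recip(2)[OF delta_E eta] unfolding w_def[symmetric, abs_def] w_def[symmetric]
      by eventually_elim (simp add: dir_deriv_def power2_eq_square)
    then have "AE \<omega> in M. T k (dd i (w \<eta>)) \<omega> = T k (\<lambda>\<omega>. ?P \<omega> * dd i \<delta> \<omega>) \<omega>"
      by (intro T_cong dd_in wE E_mult PE delta_E)
    with T_mult[OF PE dd_in[OF delta_E], of k i] show "AE \<omega> in M. T k (dd i (w \<eta>)) \<omega> \<le> of_nat (leibniz_const k) * T k ?P \<omega> * T k (dd i \<delta>) \<omega>"
      by eventually_elim simp
  qed
  moreover have "AE \<omega> in M. T k ?P \<omega> \<le> ennreal (Y \<omega> ^ (?N + (?r + ?r + 1) + 1 + 1))" using P by (simp add: cls_def)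
  moreover have "AE \<omega> in M. T (Suc k) \<delta> \<omega> \<le> ennreal (Y \<omega> ^ ?N)" using cls_delta[OF Suc.prems] by (simp add: cls_def)
  moreover have "AE \<omega> in M. T k (w \<eta>) \<omega> \<le> ennreal (Y \<omega> ^ ?r)" using Suc.IH[OF k] by (simp add: cls_def)
  ultimately have "AE \<omega> in M. T (Suc k) (w \<eta>) \<omega> \<le> ennreal (Y \<omega> ^ recip_exp CARD('d) (Suc k))"
    using Y_ge
  proof eventually_elim
    case (elim \<omega>)
    let ?y = "Y \<omega>" let ?b = "?N + (?r + ?r + 1) + 1 + 1"
    have y: "4 \<le> ?y" "1 \<le> ?y" "real (leibniz_const k) \<le> ?y"
      using elim(5) k by (auto intro: order_trans[of _ "2 * real (leibniz_const k)"])
    have "T' k (w \<eta>) \<omega> \<le> (\<Sum>i. of_nat (leibniz_const k) * T k ?P \<omega> * T k (dd i \<delta>) \<omega>)"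
      unfolding T'_def using elim(1) by (intro suminf_le) auto
    also have "\<dots> = of_nat (leibniz_const k) * T k ?P \<omega> * T' k \<delta> \<omega>" by (simp add: T'_def)
    also have "\<dots> \<le> ennreal ?y * ennreal (?y ^ ?b) * ennreal (?y ^ ?N)"
      using y elim(2) order_trans[OF T'_le_T elim(3)]
      by (intro mult_mono) (auto simp: ennreal_of_nat_eq_real_of_nat ennreal_leI)
    also have "\<dots> = ennreal (?y ^ (?b + ?N + 1))" using y by (simp add: ennreal_mult[symmetric] power_add mult_ac)
    finally have 1: "T' k (w \<eta>) \<omega> \<le> ennreal (?y ^ (?b + ?N + 1))" .
    have 2: "ennreal ((w \<eta> \<omega>)\<^sup>2) \<le> ennreal (?y ^ ?r)" by (rule order_trans[OF T_ge elim(4)])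
    have "T (Suc k) (w \<eta>) \<omega> \<le> ennreal (?y ^ ?r) + ennreal (?y ^ (?b + ?N + 1))"
      unfolding T_Suc by (rule add_mono[OF 2 1])
    also have "\<dots> = ennreal (?y ^ ?r + ?y ^ (?b + ?N + 1))" using y by (simp add: ennreal_plus[symmetric] del: ennreal_plus)
    also have "\<dots> \<le> ennreal (?y ^ recip_exp CARD('d) (Suc k))"
    proof (rule ennreal_leI)
      have "?y ^ ?r \<le> ?y ^ (?b + ?N + 1)" using y by (intro power_increasing) auto
      moreover have "0 \<le> ?y ^ (?b + ?N + 1)" using y by simp
      ultimately have "?y ^ ?r + ?y ^ (?b + ?N + 1) \<le> 4 * ?y ^ (?b + ?N + 1)" by linarith
      also have "\<dots> \<le> ?y * ?y ^ (?b + ?N + 1)" using y by (intro mult_right_mono) auto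
      also have "\<dots> = ?y ^ (?b + ?N + 2)" by simp
      also have "\<dots> \<le> ?y ^ recip_exp CARD('d) (Suc k)" using y by (intro power_increasing) auto
      finally show "?y ^ ?r + ?y ^ (?b + ?N + 1) \<le> ?y ^ recip_exp CARD('d) (Suc k)" .
    qed
    finally show ?case .
  qed
  then show ?case using wE by (simp add: cls_def)
qed

text \<open>The multiplier of \<open>\<Gamma>(g(F), F\<^sub>l)\<close> for the \<open>k\<close>-th partial derivative, and below the resulting weight \<open>R\<close> after
  one integration by parts.\<close>

definition U :: "real \<Rightarrow> ('w \<Rightarrow> real) \<Rightarrow> 'd \<Rightarrow> 'd \<Rightarrow> 'w \<Rightarrow> real" where
  "U \<eta> W k l \<omega> = (\<delta> \<omega> * w \<eta> \<omega>) * W \<omega> * cofactor l k \<omega>"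

definition R :: "real \<Rightarrow> ('w \<Rightarrow> real) \<Rightarrow> 'd \<Rightarrow> 'w \<Rightarrow> real" where
  "R \<eta> W k \<omega> = (\<Sum>l\<in>UNIV. U \<eta> W k l \<omega> * L (F l) \<omega> + (- 1) * \<Gamma> (U \<eta> W k l) (F l) \<omega>)"

lemma cls_U:
  assumes "\<eta> > 0" "j \<le> n" "W \<in> cls j a"
  shows "U \<eta> W k l \<in> cls j (weight_exp CARD('d) j a)"
  unfolding U_def[abs_def] weight_exp_def
  by (intro cls_mult[OF assms(2)] cls_delta cls_w cls_cofactor assms)

lemma cls_R:
  assumes "\<eta> > 0" "Suc j \<le> n" "W \<in> cls (Suc j) a"
  shows "R \<eta> W k \<in> cls j (CARD('d) * (2 * weight_exp CARD('d) (Suc j) a + 7))"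
proof -
  let ?b = "weight_exp CARD('d) (Suc j) a"
  have j: "j \<le> n" using assms by simp
  have U: "U \<eta> W k l \<in> cls (Suc j) ?b" for l by (rule cls_U[OF assms])
  have "R \<eta> W k \<in> cls j (\<Sum>l\<in>(UNIV::'d set). ((?b + 1 + 1) + (?b + 2 + 1) + 1) + 1)"
    unfolding R_def[abs_def]
  proof (rule cls_sum[OF j])
    fix l
    show "(\<lambda>\<omega>. U \<eta> W k l \<omega> * L (F l) \<omega> + (- 1) * \<Gamma> (U \<eta> W k l) (F l) \<omega>) \<in> cls j ((?b + 1 + 1) + (?b + 2 + 1) + 1)"
    proof (rule cls_add[OF j])
      show "(\<lambda>\<omega>. U \<eta> W k l \<omega> * L (F l) \<omega>) \<in> cls j (?b + 1 + 1)"
        by (rule cls_mult[OF j cls_mono[OF U] cls_L[OF j]]) auto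
      show "(\<lambda>\<omega>. - 1 * \<Gamma> (U \<eta> W k l) (F l) \<omega>) \<in> cls j (?b + 2 + 1)"
        by (rule cls_scale[OF _ cls_Gamma[OF assms(2) U]]) simp
    qed
  qed simp
  then show ?thesis by (rule cls_mono) (auto simp: algebra_simps)
qed

text \<open>Duality applied to the product \<open>V H\<close>, together with the Leibniz rule for \<open>\<Gamma>\<close>.\<close>

lemma ibp_single:
  assumes V: "V \<in> E" and H: "H \<in> E" and G: "G \<in> E"
  shows "(\<integral>\<omega>. H \<omega> * \<Gamma> V G \<omega> \<partial>M) = (\<integral>\<omega>. V \<omega> * (H \<omega> * L G \<omega> + (- 1) * \<Gamma> H G \<omega>) \<partial>M)"
proof -
  note VH = E_mult[OF V H]
  note i = E_integrable_mult
  have "AE \<omega> in M. \<Gamma> (\<lambda>\<omega>. V \<omega> * H \<omega>) G \<omega> = V \<omega> * \<Gamma> H G \<omega> + H \<omega> * \<Gamma> V G \<omega>"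
    using \<Gamma>_eq_inner[OF VH G] \<Gamma>_eq_inner[OF V G] \<Gamma>_eq_inner[OF H G] D_mult[OF V H]
    by eventually_elim (simp add: inner_add_left)
  then have "(\<integral>\<omega>. \<Gamma> (\<lambda>\<omega>. V \<omega> * H \<omega>) G \<omega> \<partial>M) = (\<integral>\<omega>. V \<omega> * \<Gamma> H G \<omega> + H \<omega> * \<Gamma> V G \<omega> \<partial>M)"
    using E_measurable[OF \<Gamma>_in[OF VH G]] E_measurable[OF \<Gamma>_in[OF V G]] E_measurable[OF \<Gamma>_in[OF H G]] E_measurable[OF V] E_measurable[OF H]
    by (intro integral_cong_AE) auto
  also have "\<dots> = (\<integral>\<omega>. V \<omega> * \<Gamma> H G \<omega> \<partial>M) + (\<integral>\<omega>. H \<omega> * \<Gamma> V G \<omega> \<partial>M)"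
    by (intro Bochner_Integration.integral_add i V H \<Gamma>_in G)
  finally have 1: "(\<integral>\<omega>. V \<omega> * \<Gamma> H G \<omega> \<partial>M) + (\<integral>\<omega>. H \<omega> * \<Gamma> V G \<omega> \<partial>M) = (\<integral>\<omega>. V \<omega> * H \<omega> * L G \<omega> \<partial>M)"
    using duality1[OF VH G] by simp
  have "(\<integral>\<omega>. V \<omega> * (H \<omega> * L G \<omega> + (- 1) * \<Gamma> H G \<omega>) \<partial>M) = (\<integral>\<omega>. V \<omega> * H \<omega> * L G \<omega> - V \<omega> * \<Gamma> H G \<omega> \<partial>M)"
    by (intro Bochner_Integration.integral_cong) (auto simp: algebra_simps)
  also have "\<dots> = (\<integral>\<omega>. V \<omega> * H \<omega> * L G \<omega> \<partial>M) - (\<integral>\<omega>. V \<omega> * \<Gamma> H G \<omega> \<partial>M)"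
    by (intro Bochner_Integration.integral_diff i E_mult V H \<Gamma>_in L_in G)
  finally show ?thesis using 1 by simp
qed

text \<open>One derivative is removed from \<open>g\<close>, and the weight \<open>W\<close> is replaced by \<open>R \<eta> W k\<close>. The factor
  \<open>\<delta>\<^sup>2 w \<eta>\<close> on the left remains from the regularised division by the determinant.\<close>

lemma ibp_step:
  assumes eta: "\<eta> > 0" and W: "W \<in> E" and g: "g \<in> C_b_infty"
  shows "(\<integral>\<omega>. pd k g (rvec F \<omega>) * (((\<delta> \<omega>)\<^sup>2 * w \<eta> \<omega>) * W \<omega>) \<partial>M) = (\<integral>\<omega>. g (rvec F \<omega>) * R \<eta> W k \<omega> \<partial>M)"
proof -
  let ?V = "\<lambda>\<omega>. g (rvec F \<omega>)"
  have V: "?V \<in> E" by (rule D_smooth(1)[OF g FE])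
  have wE: "w \<eta> \<in> E" using D_recip(1)[OF delta_E eta] by (simp add: w_def[abs_def])
  have cE: "cofactor l k \<in> E" for l k using cls_cofactor[of n] cls_E by blast
  have UE: "U \<eta> W k l \<in> E" for l unfolding U_def[abs_def] by (intro E_mult delta_E wE W cE)
  have pE: "(\<lambda>\<omega>. pd i g (rvec F \<omega>)) \<in> E" for i by (rule D_smooth(1)[OF C_b_infty_pd[OF g] FE])
  have "AE \<omega> in M. \<forall>l. \<Gamma> ?V (F l) \<omega> = (\<Sum>i\<in>UNIV. pd i g (rvec F \<omega>) * \<Gamma> (F i) (F l) \<omega>)"
    unfolding AE_all_countable
  proof
    fix l
    have "AE \<omega> in M. \<forall>i. \<Gamma> (F i) (F l) \<omega> = inner (D (F i) \<omega>) (D (F l) \<omega>)"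
      unfolding AE_all_countable using \<Gamma>_eq_inner[OF FE FE] by blast
    moreover have "AE \<omega> in M. D ?V \<omega> = (\<Sum>i\<in>UNIV. pd i g (rvec F \<omega>) *\<^sub>R D (F i) \<omega>)"
      by (rule D_smooth(2)[OF g FE])
    moreover note \<Gamma>_eq_inner[OF V FE[of l]]
    ultimately
    show "AE \<omega> in M. \<Gamma> ?V (F l) \<omega> = (\<Sum>i\<in>UNIV. pd i g (rvec F \<omega>) * \<Gamma> (F i) (F l) \<omega>)"
      by eventually_elim (simp add: inner_sum_left)
  qed
  then have AE: "AE \<omega> in M. pd k g (rvec F \<omega>) * (((\<delta> \<omega>)\<^sup>2 * w \<eta> \<omega>) * W \<omega>) = (\<Sum>l\<in>UNIV. U \<eta> W k l \<omega> * \<Gamma> ?V (F l) \<omega>)"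
  proof eventually_elim
    case (elim \<omega>)
    have "(\<Sum>l\<in>UNIV. U \<eta> W k l \<omega> * \<Gamma> ?V (F l) \<omega>) = (\<Sum>l\<in>UNIV. \<Sum>i\<in>UNIV. (\<delta> \<omega> * w \<eta> \<omega> * W \<omega>) * (pd i g (rvec F \<omega>) * (\<Gamma> (F i) (F l) \<omega> * cofactor l k \<omega>)))"
      using elim by (simp add: U_def sum_distrib_left mult_ac)
    also have "\<dots> = (\<Sum>i\<in>UNIV. (\<delta> \<omega> * w \<eta> \<omega> * W \<omega>) * (pd i g (rvec F \<omega>) * (\<Sum>l\<in>UNIV. \<Gamma> (F i) (F l) \<omega> * cofactor l k \<omega>)))"
      by (subst sum.swap) (simp add: sum_distrib_left)
    also have "\<dots> = (\<delta> \<omega> * w \<eta> \<omega> * W \<omega>) * (pd k g (rvec F \<omega>) * \<delta> \<omega>)"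
      unfolding cofactor_expansion by (simp add: if_distrib[of "\<lambda>x. _ * x"] cong: if_cong)
    finally show ?case by (simp add: power2_eq_square mult_ac)
  qed
  have "(\<integral>\<omega>. pd k g (rvec F \<omega>) * (((\<delta> \<omega>)\<^sup>2 * w \<eta> \<omega>) * W \<omega>) \<partial>M) = (\<integral>\<omega>. (\<Sum>l\<in>UNIV. U \<eta> W k l \<omega> * \<Gamma> ?V (F l) \<omega>) \<partial>M)"
  proof (rule integral_cong_AE[OF _ _ AE])
    show "(\<lambda>\<omega>. pd k g (rvec F \<omega>) * (((\<delta> \<omega>)\<^sup>2 * w \<eta> \<omega>) * W \<omega>)) \<in> borel_measurable M"
      unfolding power2_eq_square by (intro E_measurable E_mult pE delta_E wE W)
    show "(\<lambda>\<omega>. \<Sum>l\<in>UNIV. U \<eta> W k l \<omega> * \<Gamma> ?V (F l) \<omega>) \<in> borel_measurable M"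
      by (intro E_measurable E_sum E_mult UE \<Gamma>_in V FE)
  qed
  also have "\<dots> = (\<Sum>l\<in>UNIV. \<integral>\<omega>. U \<eta> W k l \<omega> * \<Gamma> ?V (F l) \<omega> \<partial>M)"
    by (intro Bochner_Integration.integral_sum E_integrable_mult UE \<Gamma>_in V FE)
  also have "\<dots> = (\<Sum>l\<in>UNIV. \<integral>\<omega>. ?V \<omega> * (U \<eta> W k l \<omega> * L (F l) \<omega> + (- 1) * \<Gamma> (U \<eta> W k l) (F l) \<omega>) \<partial>M)"
    by (intro sum.cong refl ibp_single UE V FE)
  also have "\<dots> = (\<integral>\<omega>. (\<Sum>l\<in>UNIV. ?V \<omega> * (U \<eta> W k l \<omega> * L (F l) \<omega> + (- 1) * \<Gamma> (U \<eta> W k l) (F l) \<omega>)) \<partial>M)"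
    by (intro Bochner_Integration.integral_sum[symmetric] E_integrable_mult E_add E_cmult E_mult UE \<Gamma>_in L_in V FE)
  finally show ?thesis by (simp add: R_def sum_distrib_left)
qed

text \<open>All derivatives are removed one after the other. The limit \<open>\<eta> \<rightarrow> 0\<close> is taken in every step, while the
  bound on the right does not depend on \<open>\<eta>\<close>.\<close>

lemma ibp_estimate:
  assumes f: "f \<in> C_b_infty" and s: "\<And>x. \<bar>f x\<bar> \<le> s"
  shows "length \<alpha> \<le> n \<Longrightarrow> W \<in> cls (length \<alpha>) a \<Longrightarrow>
    ennreal \<bar>\<integral>\<omega>. pds \<alpha> f (rvec F \<omega>) * W \<omega> \<partial>M\<bar> \<le> ennreal s * (\<integral>\<^sup>+\<omega>. ennreal (Y \<omega> ^ ibp_exp CARD('d) (length \<alpha>) a) \<partial>M)"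
proof (induction \<alpha> arbitrary: W a)
  case Nil
  have s0: "0 \<le> s" using s[of 0] by simp
  have W: "W \<in> E" "AE \<omega> in M. ennreal ((W \<omega>)\<^sup>2) \<le> ennreal (Y \<omega> ^ a)" using Nil by (auto simp: cls_def)
  have fE: "(\<lambda>\<omega>. f (rvec F \<omega>)) \<in> E" by (rule D_smooth(1)[OF f FE])
  have "ennreal \<bar>\<integral>\<omega>. f (rvec F \<omega>) * W \<omega> \<partial>M\<bar> \<le> (\<integral>\<^sup>+\<omega>. norm (f (rvec F \<omega>) * W \<omega>) \<partial>M)"
    using integral_norm_bound_ennreal[OF E_integrable_mult[OF fE W(1)]] by simp
  also have "\<dots> \<le> (\<integral>\<^sup>+\<omega>. ennreal s * ennreal (Y \<omega> ^ a) \<partial>M)"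
    using W(2) Y_ge
  proof (intro nn_integral_mono_AE, eventually_elim)
    case (elim \<omega>)
    let ?y = "Y \<omega> ^ a"
    have y: "1 \<le> ?y" using elim by (auto intro: one_le_power)
    then have "0 \<le> ?y" by linarith
    then have "(W \<omega>)\<^sup>2 \<le> ?y" using elim by simp
    also have "\<dots> \<le> ?y\<^sup>2" using y by (simp add: power2_eq_square mult_left_mono[of 1])
    finally have "\<bar>W \<omega>\<bar>\<^sup>2 \<le> ?y\<^sup>2" by (simp only: power2_abs)
    then have "\<bar>W \<omega>\<bar> \<le> ?y" by (rule power2_le_imp_le) (use y in linarith)
    then have "\<bar>f (rvec F \<omega>) * W \<omega>\<bar> \<le> s * ?y" unfolding abs_mult by (intro mult_mono s s0) auto
    then show ?case using s0 y by (simp add: ennreal_mult[symmetric] ennreal_leI)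
  qed
  also have "\<dots> = ennreal s * (\<integral>\<^sup>+\<omega>. ennreal (Y \<omega> ^ a) \<partial>M)" by (rule nn_integral_cmult) measurable
  finally show ?case by simp
next
  case (Cons k \<alpha>)
  let ?g = "pds \<alpha> f" let ?b = "CARD('d) * (2 * weight_exp CARD('d) (Suc (length \<alpha>)) a + 7)"
  let ?B = "ennreal s * (\<integral>\<^sup>+\<omega>. ennreal (Y \<omega> ^ ibp_exp CARD('d) (length (k # \<alpha>)) a) \<partial>M)"
  have g: "?g \<in> C_b_infty" by (rule C_b_infty_pds[OF f])
  have WE: "W \<in> E" by (rule cls_E[OF Cons.prems(2)])
  define \<eta> where "\<eta> N = 1 / real (Suc N)" for N
  have eta: "\<eta> N > 0" for N by (simp add: \<eta>_def)
  have eta0: "\<eta> \<longlonglongrightarrow> 0" unfolding \<eta>_def by (rule LIMSEQ_Suc[OF lim_const_over_n])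
  have wE: "w (\<eta> N) \<in> E" for N using D_recip(1)[OF delta_E eta] by (simp add: w_def[abs_def])
  have pE: "(\<lambda>\<omega>. pd k ?g (rvec F \<omega>)) \<in> E" by (rule D_smooth(1)[OF C_b_infty_pd[OF g] FE])
  let ?h = "\<lambda>N \<omega>. pd k ?g (rvec F \<omega>) * (((\<delta> \<omega>)\<^sup>2 * w (\<eta> N) \<omega>) * W \<omega>)"
  have "(\<lambda>N. \<integral>\<omega>. ?h N \<omega> \<partial>M) \<longlonglongrightarrow> (\<integral>\<omega>. pd k ?g (rvec F \<omega>) * W \<omega> \<partial>M)"
  proof (rule integral_dominated_convergence)
    show "(\<lambda>\<omega>. pd k ?g (rvec F \<omega>) * W \<omega>) \<in> borel_measurable M" by (intro E_measurable E_mult pE WE)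
    show "?h N \<in> borel_measurable M" for N
      unfolding power2_eq_square by (intro E_measurable E_mult pE WE delta_E wE)
    show "integrable M (\<lambda>\<omega>. \<bar>pd k ?g (rvec F \<omega>) * W \<omega>\<bar>)" by (intro integrable_abs E_integrable_mult pE WE)
    show "AE \<omega> in M. (\<lambda>N. ?h N \<omega>) \<longlonglongrightarrow> pd k ?g (rvec F \<omega>) * W \<omega>"
      using Y_det
    proof eventually_elim
      case (elim \<omega>)
      then have d: "(\<delta> \<omega>)\<^sup>2 + 0 \<noteq> 0" by (simp add: \<delta>_def)
      have "(\<lambda>N. ?h N \<omega>) \<longlonglongrightarrow> pd k ?g (rvec F \<omega>) * (((\<delta> \<omega>)\<^sup>2 * (1 / ((\<delta> \<omega>)\<^sup>2 + 0))) * W \<omega>)"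
        unfolding w_def by (intro tendsto_intros eta0 d)
      then show ?case using d by simp
    qed
    show "AE \<omega> in M. norm (?h N \<omega>) \<le> \<bar>pd k ?g (rvec F \<omega>) * W \<omega>\<bar>" for N
    proof (intro AE_I2)
      fix \<omega>
      have p: "(\<delta> \<omega>)\<^sup>2 + \<eta> N > 0" using eta[of N] by (simp add: add_nonneg_pos)
      have "0 \<le> (\<delta> \<omega>)\<^sup>2 * w (\<eta> N) \<omega>" "(\<delta> \<omega>)\<^sup>2 * w (\<eta> N) \<omega> \<le> 1"
        unfolding w_def using p eta[of N] by (auto simp: divide_simps)
      then have "\<bar>(\<delta> \<omega>)\<^sup>2 * w (\<eta> N) \<omega>\<bar> * \<bar>W \<omega>\<bar> \<le> 1 * \<bar>W \<omega>\<bar>" by (intro mult_right_mono) auto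
      then show "norm (?h N \<omega>) \<le> \<bar>pd k ?g (rvec F \<omega>) * W \<omega>\<bar>"
        by (simp only: real_norm_def abs_mult) (intro mult_left_mono; simp)
    qed
  qed
  then have lim: "(\<lambda>N. ennreal \<bar>\<integral>\<omega>. ?h N \<omega> \<partial>M\<bar>) \<longlonglongrightarrow> ennreal \<bar>\<integral>\<omega>. pd k ?g (rvec F \<omega>) * W \<omega> \<partial>M\<bar>"
    by (intro tendsto_ennrealI tendsto_rabs)
  have "ennreal \<bar>\<integral>\<omega>. ?h N \<omega> \<partial>M\<bar> \<le> ?B" for N
  proof -
    have "R (\<eta> N) W k \<in> cls (length \<alpha>) ?b"
      by (rule cls_R[OF eta]) (use Cons.prems in auto)
    from Cons.IH[OF _ this] Cons.prems(1) show ?thesis unfolding ibp_step[OF eta WE g] by simp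
  qed
  then show ?case using LIMSEQ_le_const2[OF lim] by auto
qed

end

subsection \<open>The non-degeneracy functional dominates the weights\<close>

text \<open>For \<open>a\<close> and \<open>b\<close> the two norms in \<open>C_n\<close> (with and without \<open>LF\<close>) and \<open>\<Delta> = det \<sigma>\<^sub>F\<close>, this is the quantity whose \<open>n\<close>-th power
  is the product of the two factors whose \<open>L\<^sup>2\<close> norms are multiplied in \<open>Q_l\<close> for \<open>l = n\<close>.\<close>

definition ratio :: "nat \<Rightarrow> real \<Rightarrow> real \<Rightarrow> real \<Rightarrow> real" where
  "ratio d a b \<Delta> = a * (1 + b) ^ (4 * d) / \<bar>\<Delta>\<bar>"

text \<open>Since the determinant is at most a multiple of \<open>b\<^sup>2\<^sup>d\<close>, the ratio dominates separately the constant \<open>1\<close>, the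
  norms, and (through its square) the reciprocal of the determinant.\<close>

lemma ratio_bounds:
  assumes d: "d > 0" and ab: "0 \<le> b" "b \<le> a" and D: "\<Delta> \<noteq> 0" and c: "1 \<le> c" and le: "\<bar>\<Delta>\<bar> \<le> c * b ^ (2 * d)"
  shows "1 \<le> c * ratio d a b \<Delta>" "a \<le> c * ratio d a b \<Delta>" "1 / \<bar>\<Delta>\<bar> \<le> c * (ratio d a b \<Delta>)\<^sup>2"
proof -
  let ?p = "(1 + b) ^ (4 * d)"
  have p: "1 \<le> ?p" using ab by simp
  have D0: "\<bar>\<Delta>\<bar> > 0" using D by simp
  have c0: "0 \<le> c" using c by simp
  have b1: "b ^ k \<le> ?p" if "k \<le> 4 * d" for k
  proof -
    have "b ^ k \<le> (1 + b) ^ k" using ab by (intro power_mono) auto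
    also have "\<dots> \<le> ?p" using ab that by (intro power_increasing) auto
    finally show ?thesis .
  qed
  have "b ^ (2 * d) = b * b ^ (2 * d - 1)" using d by (metis One_nat_def Suc_pred mult_pos_pos power_Suc zero_less_numeral)
  also have "\<dots> \<le> a * ?p" using ab b1[of "2 * d - 1"] by (intro mult_mono) auto
  finally have "c * b ^ (2 * d) \<le> c * (a * ?p)" using c0 by (rule mult_left_mono)
  then have "\<bar>\<Delta>\<bar> \<le> c * (a * ?p)" using le by linarith
  then show "1 \<le> c * ratio d a b \<Delta>" unfolding ratio_def using D0 by (simp add: pos_le_divide_eq)
  have "\<bar>\<Delta>\<bar> \<le> c * ?p" by (rule order_trans[OF le]) (intro mult_left_mono b1 c0, simp)
  then have "a * \<bar>\<Delta>\<bar> \<le> a * (c * ?p)" using ab by (intro mult_left_mono) auto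
  then show "a \<le> c * ratio d a b \<Delta>" unfolding ratio_def using D0 by (simp add: pos_le_divide_eq mult_ac)
  have "b ^ (2 * d) = b\<^sup>2 * b ^ (2 * d - 2)" using d by (metis le_add_diff_inverse mult_le_mono2 nat_mult_1_right One_nat_def Suc_leI power_add)
  also have "\<dots> \<le> a\<^sup>2 * ?p" using ab b1[of "2 * d - 2"] by (intro mult_mono power_mono) auto
  also have "\<dots> \<le> a\<^sup>2 * (?p * ?p)" using p mult_left_mono[of 1 ?p ?p] by (intro mult_left_mono) auto
  finally have "c * b ^ (2 * d) \<le> c * (a\<^sup>2 * (?p * ?p))" using c0 by (rule mult_left_mono)
  then have "\<bar>\<Delta>\<bar> \<le> c * (a * ?p)\<^sup>2" using le by (simp add: power2_eq_square mult_ac)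
  then have "\<bar>\<Delta>\<bar> * \<bar>\<Delta>\<bar> \<le> c * (a * ?p)\<^sup>2 * \<bar>\<Delta>\<bar>" by (rule mult_right_mono) simp
  then show "1 / \<bar>\<Delta>\<bar> \<le> c * (ratio d a b \<Delta>)\<^sup>2"
    unfolding ratio_def power_divide using D0 by (simp add: divide_simps power2_eq_square mult_ac)
qed

lemma ennreal_power2_le_imp_le:
  assumes "(x::ennreal)\<^sup>2 \<le> y\<^sup>2" shows "x \<le> y"
proof (rule ccontr)
  assume "\<not> x \<le> y"
  then have yx: "y < x" by simp
  show False
  proof (cases x)
    case top
    then have "y < \<infinity>" using yx by simp
    then have "y\<^sup>2 < \<infinity>" by (simp add: power_less_top_ennreal)
    then show False using assms top by (simp add: ennreal_top_mult power2_eq_square top_unique)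
  next
    case (real r)
    then obtain s where s: "y = ennreal s" "0 \<le> s" using yx by (cases y) auto
    have "s < r" using yx real s by (simp add: ennreal_less_iff)
    then have "s\<^sup>2 < r\<^sup>2" using s by (intro power_strict_mono) auto
    moreover have "ennreal (r\<^sup>2) \<le> ennreal (s\<^sup>2)" using assms real s by (simp only: ennreal_power)
    ultimately show False using ennreal_le_iff[of "s\<^sup>2" "r\<^sup>2"] by simp
  qed
qed

lemma epowr_half_power2: "(epowr x (1/2))\<^sup>2 = x"
proof (cases x)
  case (real r)
  then show ?thesis
    by (simp add: epowr_def ennreal_power) (simp add: powr_half_sqrt)
qed (simp add: epowr_def power2_eq_square ennreal_top_mult)

context malliavin_basis
begin

definition normA :: "('d::finite \<Rightarrow> 'w \<Rightarrow> real) \<Rightarrow> nat \<Rightarrow> 'w \<Rightarrow> real" where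
  "normA F n \<omega> = (\<Sum>i\<in>UNIV. norm1k DD (n + 1) (F i) \<omega>) + (\<Sum>i\<in>UNIV. normk DD n (L (F i)) \<omega>)"

definition normB :: "('d::finite \<Rightarrow> 'w \<Rightarrow> real) \<Rightarrow> nat \<Rightarrow> 'w \<Rightarrow> real" where
  "normB F n \<omega> = (\<Sum>i\<in>UNIV. norm1k DD (n + 1) (F i) \<omega>)"

definition X :: "('d::finite \<Rightarrow> 'w \<Rightarrow> real) \<Rightarrow> nat \<Rightarrow> 'w \<Rightarrow> real" where
  "X F n \<omega> = ratio CARD('d) (normA F n \<omega>) (normB F n \<omega>) (det (malliavin_cov \<Gamma> F \<omega>))"

lemma normk_nonneg: "0 \<le> normk DD k G \<omega>"
  unfolding normk_def using norm1k_nonneg[of k G \<omega>] by simp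

lemma normB_nonneg: "0 \<le> normB F n \<omega>" and normB_le_normA: "normB F n \<omega> \<le> normA F n \<omega>"
  unfolding normA_def normB_def by (auto intro!: sum_nonneg norm1k_nonneg normk_nonneg)

lemma norm1k_le_normB: "norm1k DD (Suc n) (F i) \<omega> \<le> normB F n \<omega>"
  unfolding normB_def by (simp, rule member_le_sum) (auto intro: norm1k_nonneg)

lemma normk_le_normA: "normk DD n (L (F i)) \<omega> \<le> normA F n \<omega>"
proof -
  have "normk DD n (L (F i)) \<omega> \<le> (\<Sum>i\<in>UNIV. normk DD n (L (F i)) \<omega>)"
    by (rule member_le_sum) (auto intro: normk_nonneg)
  then show ?thesis using normB_nonneg[of F n \<omega>] unfolding normA_def normB_def by linarith
qed

lemma det_measurable [measurable]:
  assumes "\<And>i. F i \<in> E" shows "(\<lambda>\<omega>. det (malliavin_cov \<Gamma> F \<omega>)) \<in> borel_measurable M"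
  unfolding det_def malliavin_cov_def
  by (simp, intro borel_measurable_sum borel_measurable_times borel_measurable_prod borel_measurable_const E_measurable \<Gamma>_in assms)

lemma normk_measurable [measurable]: "G \<in> E \<Longrightarrow> normk DD k G \<in> borel_measurable M"
  unfolding normk_def[abs_def] by measurable

lemma X_measurable [measurable]:
  assumes "\<And>i. F i \<in> E" shows "X F n \<in> borel_measurable M"
proof -
  note [measurable] = det_measurable[OF assms] norm1k_measurable[OF assms] normk_measurable[OF L_in[OF assms]]
  show ?thesis unfolding X_def[abs_def] ratio_def normA_def normB_def by measurable
qed

text \<open>Cauchy-Schwarz: \<open>Q_l\<close> is a product of two \<open>L\<^sup>2\<close> norms.\<close>

lemma X_moment_le_Q:
  assumes F: "\<And>i. F i \<in> E"
  shows "(\<integral>\<^sup>+\<omega>. ennreal (X F n \<omega> ^ n) \<partial>M) \<le> Q_l M \<Gamma> L DD n F"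
proof (cases "det_neg_moment M \<Gamma> n F = \<infinity>")
  case False
  let ?\<Delta> = "\<lambda>\<omega>. det (malliavin_cov \<Gamma> F \<omega>)"
  let ?C = "C_n L DD n F"
  note [measurable] = det_measurable[OF F] norm1k_measurable[OF F] normk_measurable[OF L_in[OF F]]
  have Cn: "?C \<omega> = (normA F n \<omega> * (1 + normB F n \<omega>) ^ (4 * CARD('a))) ^ n" for \<omega>
    unfolding C_n_def normA_def normB_def by (simp add: power_mult_distrib power_mult)
  have C_nonneg: "0 \<le> ?C \<omega>" for \<omega> unfolding Cn using normB_nonneg[of F n \<omega>] normB_le_normA[of F n \<omega>] by (intro zero_le_power mult_nonneg_nonneg) auto
  have Cmeas [measurable]: "?C \<in> borel_measurable M" unfolding C_n_def[abs_def] by measurable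
  have le: "(\<integral>\<^sup>+\<omega>. ennreal (X F n \<omega> ^ n) \<partial>M) \<le> (\<integral>\<^sup>+\<omega>. ennreal (?C \<omega>) * inverse (ennreal (\<bar>?\<Delta> \<omega>\<bar> ^ n)) \<partial>M)"
  proof (rule nn_integral_mono)
    fix \<omega>
    show "ennreal (X F n \<omega> ^ n) \<le> ennreal (?C \<omega>) * inverse (ennreal (\<bar>?\<Delta> \<omega>\<bar> ^ n))"
    proof (cases "?\<Delta> \<omega> = 0 \<and> n > 0")
      case True
      then show ?thesis by (simp add: X_def ratio_def zero_power)
    next
      case False
      then have p: "\<bar>?\<Delta> \<omega>\<bar> ^ n > 0" by (cases "n = 0") auto
      have "X F n \<omega> ^ n = ?C \<omega> * inverse (\<bar>?\<Delta> \<omega>\<bar> ^ n)"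
        unfolding Cn X_def ratio_def by (simp only: power_divide divide_inverse power_mult_distrib power_inverse)
      then show ?thesis using p C_nonneg[of \<omega>] by (simp add: ennreal_mult inverse_ennreal)
    qed
  qed
  have cs: "(\<integral>\<^sup>+\<omega>. ennreal (?C \<omega>) * inverse (ennreal (\<bar>?\<Delta> \<omega>\<bar> ^ n)) \<partial>M)\<^sup>2 \<le>
      (\<integral>\<^sup>+\<omega>. (ennreal (?C \<omega>))\<^sup>2 \<partial>M) * (\<integral>\<^sup>+\<omega>. (inverse (ennreal (\<bar>?\<Delta> \<omega>\<bar> ^ n)))\<^sup>2 \<partial>M)"
    by (rule Cauchy_Schwarz_nn_integral) measurable
  have eqC: "(\<integral>\<^sup>+\<omega>. (ennreal (?C \<omega>))\<^sup>2 \<partial>M) = (\<integral>\<^sup>+\<omega>. ennreal (?C \<omega> powr 2) \<partial>M)"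
    using C_nonneg by (intro nn_integral_cong) (simp add: ennreal_power)
  have eqinv: "(inverse (ennreal (\<bar>x\<bar> ^ n)))\<^sup>2 = inverse (ennreal (x ^ (2 * n)))" for x :: real
  proof -
    have "inverse (ennreal y) ^ 2 = inverse (ennreal (y\<^sup>2))" if "0 \<le> y" for y
    proof (cases "y = 0")
      case False
      then have p: "0 < y" "0 \<le> inverse y" "0 < y\<^sup>2" using that by auto
      show ?thesis by (simp only: inverse_ennreal[OF p(1)] inverse_ennreal[OF p(3)] ennreal_power[OF p(2)] power_inverse)
    qed (simp add: power2_eq_square ennreal_top_mult)
    from this[of "\<bar>x\<bar> ^ n"] show ?thesis by (simp add: power_mult[symmetric] mult.commute[of n] power_even_abs)
  qed
  have "(\<integral>\<^sup>+\<omega>. ennreal (X F n \<omega> ^ n) \<partial>M)\<^sup>2 \<le> (\<integral>\<^sup>+\<omega>. ennreal (?C \<omega>) * inverse (ennreal (\<bar>?\<Delta> \<omega>\<bar> ^ n)) \<partial>M)\<^sup>2"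
    by (rule power_mono[OF le zero_le])
  also note cs
  also have "(\<integral>\<^sup>+\<omega>. (ennreal (?C \<omega>))\<^sup>2 \<partial>M) * (\<integral>\<^sup>+\<omega>. (inverse (ennreal (\<bar>?\<Delta> \<omega>\<bar> ^ n)))\<^sup>2 \<partial>M) =
      (\<integral>\<^sup>+\<omega>. ennreal (?C \<omega> powr 2) \<partial>M) * det_neg_moment M \<Gamma> n F"
    by (simp only: det_neg_moment_def eqC eqinv)
  also have "\<dots> = (Q_l M \<Gamma> L DD n F)\<^sup>2"
    using False unfolding Q_l_def C_np_def by (simp add: power_mult_distrib epowr_half_power2)
  finally show ?thesis by (rule ennreal_power2_le_imp_le)
qed (simp add: Q_l_def)

lemma det_nonzero:
  assumes F: "\<And>i. F i \<in> E" and n: "n \<ge> 1" and Q: "Q_l M \<Gamma> L DD n F < \<infinity>"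
  shows "AE \<omega> in M. det (malliavin_cov \<Gamma> F \<omega>) \<noteq> 0"
proof -
  note [measurable] = det_measurable[OF F]
  have "det_neg_moment M \<Gamma> n F \<noteq> \<infinity>" using Q unfolding Q_l_def by (auto split: if_splits)
  then have "AE \<omega> in M. inverse (ennreal (det (malliavin_cov \<Gamma> F \<omega>) ^ (2 * n))) \<noteq> \<infinity>"
    unfolding det_neg_moment_def by (intro nn_integral_PInf_AE) measurable
  then show ?thesis by eventually_elim (use n in auto)
qed

text \<open>Leibniz' formula with \<open>\<bar>\<Gamma>(F\<^sub>i, F\<^sub>j)\<bar> \<le> \<bar>D F\<^sub>i\<bar> \<bar>D F\<^sub>j\<bar>\<close>.\<close>

lemma det_le:
  fixes F :: "'d::finite \<Rightarrow> 'w \<Rightarrow> real"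
  assumes F: "\<And>i. F i \<in> E"
  shows "AE \<omega> in M. \<bar>det (malliavin_cov \<Gamma> F \<omega>)\<bar> \<le> fact CARD('d) * normB F n \<omega> ^ (2 * CARD('d))"
proof -
  have "AE \<omega> in M. \<forall>i. norm (D (F i) \<omega>) \<le> normB F n \<omega>"
    unfolding AE_all_countable
  proof
    fix i
    show "AE \<omega> in M. norm (D (F i) \<omega>) \<le> normB F n \<omega>"
      using Gamma_le_T'[OF F[of i], of n] T'_le_norm1k[OF F[of i], of n] \<Gamma>_eq_inner[OF F[of i] F[of i]]
    proof eventually_elim
      case (elim \<omega>)
      have "ennreal ((norm (D (F i) \<omega>))\<^sup>2) \<le> ennreal ((norm1k DD (Suc n) (F i) \<omega>)\<^sup>2)"
        using order_trans[OF elim(1,2)] elim(3) by (simp add: power2_norm_eq_inner)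
      then have "(norm (D (F i) \<omega>))\<^sup>2 \<le> (norm1k DD (Suc n) (F i) \<omega>)\<^sup>2" by simp
      then have "norm (D (F i) \<omega>) \<le> norm1k DD (Suc n) (F i) \<omega>" by (rule power2_le_imp_le) (rule norm1k_nonneg)
      then show ?case using norm1k_le_normB[where n = n and F = F and i = i and \<omega> = \<omega>] by linarith
    qed
  qed
  moreover have "AE \<omega> in M. \<forall>i j. \<Gamma> (F i) (F j) \<omega> = inner (D (F i) \<omega>) (D (F j) \<omega>)"
    unfolding AE_all_countable using \<Gamma>_eq_inner[OF F F] by blast
  ultimately show ?thesis
  proof eventually_elim
    case (elim \<omega>)
    let ?B = "normB F n \<omega>" let ?P = "{p. p permutes (UNIV :: 'd set)}"
    have entry: "\<bar>\<Gamma> (F i) (F j) \<omega>\<bar> \<le> ?B\<^sup>2" for i j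
    proof -
      have "\<bar>inner (D (F i) \<omega>) (D (F j) \<omega>)\<bar> \<le> norm (D (F i) \<omega>) * norm (D (F j) \<omega>)" by (rule Cauchy_Schwarz_ineq2)
      also have "\<dots> \<le> ?B * ?B" using elim(1) normB_nonneg[of F n \<omega>] by (intro mult_mono) auto
      finally show ?thesis using elim(2) by (simp add: power2_eq_square)
    qed
    have "\<bar>det (malliavin_cov \<Gamma> F \<omega>)\<bar> \<le> (\<Sum>p\<in>?P. \<bar>of_int (sign p) * (\<Prod>i\<in>UNIV. \<Gamma> (F i) (F (p i)) \<omega>)\<bar>)"
      unfolding det_def malliavin_cov_def by (simp add: sum_abs)
    also have "\<dots> \<le> (\<Sum>p\<in>?P. (?B\<^sup>2) ^ CARD('d))"
    proof (rule sum_mono)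
      fix p
      have "(\<Prod>i\<in>UNIV. \<bar>\<Gamma> (F i) (F (p i)) \<omega>\<bar>) \<le> (\<Prod>i\<in>(UNIV::'d set). ?B\<^sup>2)"
        by (intro prod_mono) (use entry in auto)
      then show "\<bar>of_int (sign p) * (\<Prod>i\<in>UNIV. \<Gamma> (F i) (F (p i)) \<omega>)\<bar> \<le> (?B\<^sup>2) ^ CARD('d)"
        by (simp add: abs_mult sign_def abs_prod)
    qed
    also have "\<dots> = fact CARD('d) * ?B ^ (2 * CARD('d))"
      by (simp add: card_permutations[OF refl] power_mult)
    finally show ?case .
  qed
qed

lemma X_bounds:
  fixes F :: "'d::finite \<Rightarrow> 'w \<Rightarrow> real"
  assumes F: "\<And>i. F i \<in> E" and n: "n \<ge> 1" and Q: "Q_l M \<Gamma> L DD n F < \<infinity>"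
  defines "c \<equiv> fact CARD('d) :: real"
  shows "AE \<omega> in M. det (malliavin_cov \<Gamma> F \<omega>) \<noteq> 0 \<and> 1 \<le> c * X F n \<omega> \<and> normA F n \<omega> \<le> c * X F n \<omega> \<and>
     1 / \<bar>det (malliavin_cov \<Gamma> F \<omega>)\<bar> \<le> c * (X F n \<omega>)\<^sup>2"
  using det_nonzero[where F = F and n = n, OF F n Q] det_le[where F = F and n = n, OF F]
proof eventually_elim
  case (elim \<omega>)
  have "1 \<le> c" unfolding c_def by simp
  from ratio_bounds[OF zero_less_card_finite normB_nonneg normB_le_normA elim(1) this elim(2)[folded c_def]]
  show ?case using elim(1) unfolding X_def by blast
qed

text \<open>By \<open>det_le\<close> the quotient \<open>X\<close> is bounded below almost surely: making \<open>F\<close> small makes \<open>det \<sigma>\<^sub>F\<close> small as well.\<close>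

lemma Q_ge:
  fixes F :: "'d::finite \<Rightarrow> 'w \<Rightarrow> real"
  assumes F: "\<And>i. F i \<in> E" and n: "n \<ge> 1" and Q: "Q_l M \<Gamma> L DD n F < \<infinity>"
  shows "ennreal ((1 / fact CARD('d)) ^ n) \<le> Q_l M \<Gamma> L DD n F"
proof -
  have "ennreal ((1 / fact CARD('d)) ^ n) = (\<integral>\<^sup>+\<omega>. ennreal ((1 / fact CARD('d)) ^ n) \<partial>M)"
    by (simp add: emeasure_space_1)
  also have "\<dots> \<le> (\<integral>\<^sup>+\<omega>. ennreal (X F n \<omega> ^ n) \<partial>M)"
  proof (rule nn_integral_mono_AE)
    show "AE \<omega> in M. ennreal ((1 / fact CARD('d)) ^ n) \<le> ennreal (X F n \<omega> ^ n)"
      using X_bounds[where F = F and n = n, OF F n Q]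
    proof eventually_elim
      case (elim \<omega>)
      then have "1 / fact CARD('d) \<le> X F n \<omega>" by (simp add: divide_le_eq mult.commute)
      then show ?case by (intro ennreal_leI power_mono) auto
    qed
  qed
  also have "\<dots> \<le> Q_l M \<Gamma> L DD n F" by (rule X_moment_le_Q[OF F])
  finally show ?thesis .
qed

text \<open>The fourth power serves to dominate \<open>1 / (det \<sigma>)\<^sup>2\<close>, as \<open>ratio_bounds\<close> controls \<open>1 / \<bar>det \<sigma>\<bar>\<close> only by a square.\<close>

definition Y :: "('d::finite \<Rightarrow> 'w \<Rightarrow> real) \<Rightarrow> nat \<Rightarrow> 'w \<Rightarrow> real" where
  "Y F n \<omega> = real (4 * leibniz_const n) * (fact CARD('d) * X F n \<omega>) ^ 4"

lemma dominated_vector_Y: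
  fixes F :: "'d::finite \<Rightarrow> 'w \<Rightarrow> real"
  assumes F: "\<And>i. F i \<in> E" and n: "n \<ge> 1" and Q: "Q_l M \<Gamma> L DD n F < \<infinity>"
  shows "dominated_vector M E \<Gamma> L tens D DD e F n (Y F n)"
proof -
  let ?\<kappa> = "real (4 * leibniz_const n)"
  have k1: "1 \<le> ?\<kappa>" using leibniz_const_mono[of 0 n] by simp
  have Xb: "AE \<omega> in M. det (malliavin_cov \<Gamma> F \<omega>) \<noteq> 0 \<and> ?\<kappa> \<le> Y F n \<omega> \<and> (normA F n \<omega>)\<^sup>2 \<le> Y F n \<omega> \<and>
     1 / (det (malliavin_cov \<Gamma> F \<omega>))\<^sup>2 \<le> Y F n \<omega>"
    using X_bounds[where F = F and n = n, OF F n Q]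
  proof eventually_elim
    case (elim \<omega>)
    let ?c = "fact CARD('d) :: real" let ?x = "?c * X F n \<omega>" let ?\<Delta> = "det (malliavin_cov \<Gamma> F \<omega>)"
    have c1: "1 \<le> ?c" by simp
    have x1: "1 \<le> ?x" using elim by simp
    have x4: "1 \<le> ?x ^ 4" using x1 by (rule one_le_power)
    have Y4: "?x ^ 4 \<le> Y F n \<omega>" unfolding Y_def using mult_right_mono[OF k1, of "?x ^ 4"] x4 by simp
    have "?\<kappa> * 1 \<le> Y F n \<omega>" unfolding Y_def using k1 x4 by (intro mult_left_mono) auto
    moreover have "(normA F n \<omega>)\<^sup>2 \<le> ?x\<^sup>2"
      using elim normB_nonneg[of F n \<omega>] normB_le_normA[of F n \<omega>] by (intro power_mono) auto
    moreover have "?x\<^sup>2 \<le> ?x ^ 4" using x1 by (intro power_increasing) auto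
    moreover have "1 / ?\<Delta>\<^sup>2 \<le> ?x ^ 4"
    proof -
      have "1 / \<bar>?\<Delta>\<bar> \<le> ?c * (X F n \<omega>)\<^sup>2" using elim by simp
      also have "\<dots> \<le> ?c * (?c * (X F n \<omega>)\<^sup>2)" using c1 mult_right_mono[OF c1, of "?c * (X F n \<omega>)\<^sup>2"] by simp
      also have "\<dots> = ?x\<^sup>2" by (simp add: power2_eq_square mult_ac)
      finally have "(1 / \<bar>?\<Delta>\<bar>)\<^sup>2 \<le> (?x\<^sup>2)\<^sup>2" by (intro power_mono) auto
      then show ?thesis by (simp add: power_divide)
    qed
    ultimately show ?case using elim Y4 by auto
  qed
  note [measurable] = X_measurable[OF F]
  show ?thesis
  proof
    show "F i \<in> E" for i by (rule F)
    show "Y F n \<in> borel_measurable M" unfolding Y_def[abs_def] by measurable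
    show "AE \<omega> in M. real (4 * leibniz_const n) \<le> Y F n \<omega>" using Xb by eventually_elim simp
    show "AE \<omega> in M. T' n (F i) \<omega> \<le> ennreal (Y F n \<omega>)" for i
      using Xb T'_le_norm1k[OF F, of n i]
    proof eventually_elim
      case (elim \<omega>)
      have "(norm1k DD (Suc n) (F i) \<omega>)\<^sup>2 \<le> (normA F n \<omega>)\<^sup>2"
        using norm1k_le_normB[where n = n and F = F and i = i and \<omega> = \<omega>] normB_le_normA[of F n \<omega>] norm1k_nonneg[of "Suc n" "F i" \<omega>] by (intro power_mono) auto
      also have "\<dots> \<le> Y F n \<omega>" using elim by simp
      finally show ?case using elim(2) ennreal_leI order_trans by blast
    qed
    show "AE \<omega> in M. T n (L (F i)) \<omega> \<le> ennreal (Y F n \<omega>)" for i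
      using Xb T_le_normk[OF L_in[OF F[of i]], of n]
    proof eventually_elim
      case (elim \<omega>)
      have "(normk DD n (L (F i)) \<omega>)\<^sup>2 \<le> (normA F n \<omega>)\<^sup>2"
        using normk_le_normA[where n = n and F = F and i = i and \<omega> = \<omega>] normk_nonneg[of n "L (F i)" \<omega>] by (intro power_mono) auto
      also have "\<dots> \<le> Y F n \<omega>" using elim by simp
      finally show ?case using elim(2) ennreal_leI order_trans by blast
    qed
    show "AE \<omega> in M. det (malliavin_cov \<Gamma> F \<omega>) \<noteq> 0 \<and> 1 / (det (malliavin_cov \<Gamma> F \<omega>))\<^sup>2 \<le> Y F n \<omega>"
      using Xb by eventually_elim simp
  qed
qed

end

text \<open>The order \<open>q\<close> must be large enough for the norms in \<open>Q_l\<close> to contain \<open>m\<close> derivatives of the weights, and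
  for its moments to contain the power of \<open>Y\<close> from \<open>ibp_estimate\<close>.\<close>

definition ibp_order :: "nat \<Rightarrow> nat \<Rightarrow> nat" where
  "ibp_order d m = Suc (m + 4 * ibp_exp d m 0)"

definition ibp_const :: "nat \<Rightarrow> nat \<Rightarrow> nat \<Rightarrow> real" where
  "ibp_const d m q = real (4 * leibniz_const q) ^ ibp_exp d m 0 * fact d ^ q"

context malliavin_basis
begin

text \<open>Integration by parts starts from the weight \<open>1\<close>, which belongs to every class with exponent \<open>0\<close>.\<close>

lemma derivative_expectation_le:
  fixes F :: "'d::finite \<Rightarrow> 'w \<Rightarrow> real"
  assumes F: "\<And>i. F i \<in> E" and q: "q \<ge> ibp_order CARD('d) (length \<alpha>)" and Q: "Q_l M \<Gamma> L DD q F < \<infinity>"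
    and f: "f \<in> C_b_infty" and s: "\<And>x. \<bar>f x\<bar> \<le> s"
  shows "\<bar>\<integral>\<omega>. pds \<alpha> f (rvec F \<omega>) \<partial>M\<bar> \<le> s * (ibp_const CARD('d) (length \<alpha>) q * enn2real (Q_l M \<Gamma> L DD q F))"
proof -
  have q1: "q \<ge> 1" and qm: "length \<alpha> \<le> q" and q4: "4 * ibp_exp CARD('d) (length \<alpha>) 0 \<le> q" using q by (auto simp: ibp_order_def)
  interpret V: dominated_vector M E \<Gamma> L tens D DD e F q "Y F q" by (rule dominated_vector_Y[where F = F and n = q, OF F q1 Q])
  let ?N = "ibp_exp CARD('d) (length \<alpha>) 0" let ?\<kappa> = "real (4 * leibniz_const q)" let ?c = "fact CARD('d) :: real"
  let ?Q = "Q_l M \<Gamma> L DD q F"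
  note [measurable] = X_measurable[OF F]
  have s0: "0 \<le> s" using s[of 0] by simp
  have "ennreal \<bar>\<integral>\<omega>. pds \<alpha> f (rvec F \<omega>) * 1 \<partial>M\<bar> \<le> ennreal s * (\<integral>\<^sup>+\<omega>. ennreal (Y F q \<omega> ^ ?N) \<partial>M)"
    by (rule V.ibp_estimate[OF f s qm]) (rule V.cls_const, simp)
  also have "(\<integral>\<^sup>+\<omega>. ennreal (Y F q \<omega> ^ ?N) \<partial>M) \<le> (\<integral>\<^sup>+\<omega>. ennreal (?\<kappa> ^ ?N * ?c ^ q) * ennreal (X F q \<omega> ^ q) \<partial>M)"
    using X_bounds[where F = F and n = q, OF F q1 Q]
  proof (intro nn_integral_mono_AE, eventually_elim)
    case (elim \<omega>)
    let ?x = "?c * X F q \<omega>"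
    have x1: "1 \<le> ?x" using elim by simp
    then have X0: "0 \<le> X F q \<omega>" by (smt (verit) fact_gt_zero mult_pos_neg)
    have "Y F q \<omega> ^ ?N = ?\<kappa> ^ ?N * ?x ^ (4 * ?N)" unfolding Y_def by (simp add: power_mult_distrib power_mult)
    also have "\<dots> \<le> ?\<kappa> ^ ?N * ?x ^ q" using x1 q4 by (intro mult_left_mono power_increasing) auto
    also have "\<dots> = (?\<kappa> ^ ?N * ?c ^ q) * X F q \<omega> ^ q" by (simp add: power_mult_distrib)
    finally show ?case using X0 by (subst ennreal_mult[symmetric]) (auto intro!: ennreal_leI)
  qed
  also have "\<dots> = ennreal (ibp_const CARD('d) (length \<alpha>) q) * (\<integral>\<^sup>+\<omega>. ennreal (X F q \<omega> ^ q) \<partial>M)"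
    unfolding ibp_const_def by (rule nn_integral_cmult) measurable
  also have "\<dots> \<le> ennreal (ibp_const CARD('d) (length \<alpha>) q) * ?Q" by (intro mult_left_mono X_moment_le_Q F) auto
  also have "?Q = ennreal (enn2real ?Q)" using Q by simp
  finally have "ennreal \<bar>\<integral>\<omega>. pds \<alpha> f (rvec F \<omega>) * 1 \<partial>M\<bar> \<le> ennreal s * (ennreal (ibp_const CARD('d) (length \<alpha>) q) * ennreal (enn2real ?Q))"
    by (simp add: mult_left_mono)
  also have "\<dots> = ennreal (s * (ibp_const CARD('d) (length \<alpha>) q * enn2real ?Q))"
    using s0 by (simp add: ennreal_mult ibp_const_def)
  finally show ?thesis using s0 by (subst (asm) ennreal_le_iff) (auto simp: ibp_const_def)
qed

end

section \<open>Smooth densities by Fourier inversion\<close>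

subsection \<open>The Gaussian kernel\<close>

lemma integral_lborel_prod:
  fixes f :: "'a::euclidean_space \<Rightarrow> real \<Rightarrow> complex"
  assumes "\<And>b. b \<in> Basis \<Longrightarrow> integrable lborel (f b)"
  shows "(\<integral>x. (\<Prod>b\<in>Basis. f b (x \<bullet> b)) \<partial>lborel) = (\<Prod>b\<in>Basis. \<integral>x. f b x \<partial>lborel)"
proof -
  interpret P: product_sigma_finite "\<lambda>_::'a. lborel :: real measure" ..
  have [measurable]: "\<And>b. b \<in> Basis \<Longrightarrow> f b \<in> borel_measurable borel" using assms by auto
  have "(\<integral>x. (\<Prod>b\<in>Basis. f b (x \<bullet> b)) \<partial>(lborel :: 'a measure)) = (\<integral>y. (\<Prod>b\<in>Basis. f b ((\<Sum>b'\<in>Basis. y b' *\<^sub>R b') \<bullet> b)) \<partial>(\<Pi>\<^sub>M b\<in>Basis. lborel))"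
    by (subst lborel_eq) (rule integral_distr; measurable)
  also have "\<dots> = (\<integral>y. (\<Prod>b\<in>Basis. f b (y b)) \<partial>(\<Pi>\<^sub>M b\<in>Basis. lborel))"
    by (intro Bochner_Integration.integral_cong refl prod.cong) (simp add: inner_sum_left_Basis)
  also have "\<dots> = (\<Prod>b\<in>Basis. \<integral>x. f b x \<partial>lborel)" by (rule P.product_integral_prod[OF finite_Basis assms])
  finally show ?thesis .
qed

definition gauss :: "'a::euclidean_space \<Rightarrow> real" where
  "gauss u = (\<Prod>b\<in>Basis. std_normal_density (u \<bullet> b))"

text \<open>The value of \<open>gauss\<close> at the origin, \<open>(2\<pi>)\<close> to the power \<open>-d/2\<close>. Its square is the constant of Fourier
  inversion.\<close>

definition gauss0 :: "'a::euclidean_space itself \<Rightarrow> real" where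
  "gauss0 _ = (1 / sqrt (2 * pi)) ^ DIM('a)"

lemma gauss_measurable [measurable]: "gauss \<in> borel_measurable borel"
  unfolding gauss_def[abs_def] by measurable

lemma gauss_nonneg: "0 \<le> gauss u"
  unfolding gauss_def by (intro prod_nonneg) auto

lemma gauss_pos0: "0 < gauss0 TYPE('a::euclidean_space)"
  unfolding gauss0_def by simp

lemma gauss_le: "gauss (u :: 'a::euclidean_space) \<le> gauss0 TYPE('a)"
proof -
  have "std_normal_density x \<le> 1 / sqrt (2 * pi)" for x
    by (simp add: std_normal_density_def divide_right_mono)
  then have "gauss u \<le> (\<Prod>b\<in>(Basis::'a set). 1 / sqrt (2 * pi))"
    unfolding gauss_def by (intro prod_mono) auto
  then show ?thesis by (simp add: gauss0_def)
qed

lemma gauss_0: "gauss (0 :: 'a::euclidean_space) = gauss0 TYPE('a)"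
  by (simp add: gauss_def gauss0_def std_normal_density_def)

lemma gauss_continuous: "continuous_on UNIV (gauss :: 'a::euclidean_space \<Rightarrow> real)"
  unfolding gauss_def std_normal_density_def by (intro continuous_intros) auto

lemma gauss_nn_integral: "(\<integral>\<^sup>+x. ennreal (gauss x) \<partial>lborel) = 1"
proof -
  have "(\<integral>\<^sup>+x. ennreal (gauss (x::'a)) \<partial>lborel) = (\<integral>\<^sup>+x. (\<Prod>b\<in>(Basis::'a set). ennreal (std_normal_density (x \<bullet> b))) \<partial>lborel)"
    unfolding gauss_def by (simp add: prod_ennreal)
  also have "\<dots> = (\<Prod>b\<in>(Basis::'a set). (\<integral>\<^sup>+x. ennreal (std_normal_density x) \<partial>lborel))"
    by (rule nn_integral_lborel_prod) auto
  also have "(\<integral>\<^sup>+x. ennreal (std_normal_density x) \<partial>lborel) = 1"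
    using prob_space.emeasure_space_1[OF prob_space_normal_density[of 1 0]] by (simp add: emeasure_density)
  finally show ?thesis by simp
qed

lemma gauss_integrable: "integrable lborel gauss"
  by (intro integrableI_nonneg) (auto simp: gauss_nonneg gauss_nn_integral)

text \<open>The Gaussian density is its own Fourier transform up to \<open>gauss0\<close>. Being even, it has a real transform,
  so the cosine suffices.\<close>

lemma gauss_fourier:
  fixes u :: "'a::euclidean_space"
  shows "gauss0 TYPE('a) * (\<integral>\<theta>. gauss \<theta> * cos (inner \<theta> u) \<partial>lborel) = gauss u"
proof -
  let ?f = "\<lambda>b x. std_normal_density x *\<^sub>R iexp ((u \<bullet> b) * x)"
  have int: "integrable lborel (?f b)" for b
  proof (rule Bochner_Integration.integrable_bound[where f = std_normal_density])
    show "integrable lborel std_normal_density" by simp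
  qed auto
  have one: "(\<integral>x. ?f b x \<partial>lborel) = complex_of_real (exp (- (u \<bullet> b)\<^sup>2 / 2))" for b
  proof -
    have "complex_of_real (exp (- (u \<bullet> b)\<^sup>2 / 2)) = char std_normal_distribution (u \<bullet> b)" by (simp only: char_std_normal_distribution)
    also have "\<dots> = (\<integral>x. ?f b x \<partial>lborel)" unfolding char_def by (subst integral_density) auto
    finally show ?thesis by simp
  qed
  have prod: "(\<Prod>b\<in>Basis. ?f b (\<theta> \<bullet> b)) = gauss \<theta> *\<^sub>R iexp (inner \<theta> u)" for \<theta>
  proof -
    have "(\<Prod>b\<in>Basis. ?f b (\<theta> \<bullet> b)) = complex_of_real (gauss \<theta>) * exp (\<Sum>b\<in>Basis. \<i> * complex_of_real ((u \<bullet> b) * (\<theta> \<bullet> b)))"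
      by (simp add: scaleR_conv_of_real prod.distrib gauss_def exp_sum)
    also have "(\<Sum>b\<in>Basis. \<i> * complex_of_real ((u \<bullet> b) * (\<theta> \<bullet> b))) = \<i> * complex_of_real (inner \<theta> u)"
      by (simp only: euclidean_inner[of \<theta> u] of_real_sum sum_distrib_left mult.commute[of "u \<bullet> _"])
    finally show ?thesis by (simp add: scaleR_conv_of_real)
  qed
  have "(\<integral>\<theta>. gauss \<theta> *\<^sub>R iexp (inner \<theta> u) \<partial>lborel) = (\<Prod>b\<in>Basis. complex_of_real (exp (- (u \<bullet> b)\<^sup>2 / 2)))"
    unfolding prod[symmetric] one[symmetric] by (rule integral_lborel_prod[OF int])
  then have "Re (\<integral>\<theta>. gauss \<theta> *\<^sub>R iexp (inner \<theta> u) \<partial>lborel) = (\<Prod>b\<in>Basis. exp (- (u \<bullet> b)\<^sup>2 / 2))"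
    by (simp flip: of_real_prod)
  moreover have "integrable lborel (\<lambda>\<theta>. gauss \<theta> *\<^sub>R iexp (inner \<theta> u))"
    by (rule Bochner_Integration.integrable_bound[OF gauss_integrable]) (auto simp: gauss_nonneg)
  then have "Re (\<integral>\<theta>. gauss \<theta> *\<^sub>R iexp (inner \<theta> u) \<partial>lborel) = (\<integral>\<theta>. gauss \<theta> * cos (inner \<theta> u) \<partial>lborel)"
    by (subst integral_Re[symmetric]) (simp_all add: Re_exp)
  ultimately have "(\<integral>\<theta>. gauss \<theta> * cos (inner \<theta> u) \<partial>lborel) = (\<Prod>b\<in>Basis. exp (- (u \<bullet> b)\<^sup>2 / 2))" by simp
  moreover have "gauss0 TYPE('a) * (\<Prod>b\<in>(Basis::'a set). exp (- (u \<bullet> b)\<^sup>2 / 2)) = gauss u"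
    unfolding gauss_def gauss0_def std_normal_density_def prod.distrib by simp
  ultimately show ?thesis by simp
qed

lemma integral_lborel_affine:
  fixes f :: "'a::euclidean_space \<Rightarrow> real" and t :: 'a
  assumes [measurable]: "f \<in> borel_measurable borel" and "c \<noteq> 0"
  shows "(\<integral>x. f x \<partial>lborel) = \<bar>c\<bar> ^ DIM('a) * (\<integral>x. f (t + c *\<^sub>R x) \<partial>lborel)"
  by (subst lborel_affine[OF assms(2), of t]) (simp add: integral_density integral_distr)

lemma nn_integral_lborel_affine:
  fixes f :: "'a::euclidean_space \<Rightarrow> ennreal" and t :: 'a
  assumes [measurable]: "f \<in> borel_measurable borel" and "c \<noteq> 0"
  shows "(\<integral>\<^sup>+x. f x \<partial>lborel) = ennreal (\<bar>c\<bar> ^ DIM('a)) * (\<integral>\<^sup>+x. f (t + c *\<^sub>R x) \<partial>lborel)"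
  by (subst lborel_affine[OF assms(2), of t]) (simp add: nn_integral_density nn_integral_distr nn_integral_cmult ennreal_power)

lemma gauss_fourier_scaled:
  fixes u :: "'a::euclidean_space"
  assumes "c > 0"
  shows "gauss0 TYPE('a) * (\<integral>\<eta>. gauss (c *\<^sub>R \<eta>) * cos (inner \<eta> u) \<partial>lborel) = (1 / c) ^ DIM('a) * gauss ((1 / c) *\<^sub>R u)"
proof -
  have "(\<integral>\<theta>. gauss \<theta> * cos (inner \<theta> ((1 / c) *\<^sub>R u)) \<partial>lborel) = \<bar>c\<bar> ^ DIM('a) * (\<integral>\<eta>. gauss (0 + c *\<^sub>R \<eta>) * cos (inner (0 + c *\<^sub>R \<eta>) ((1 / c) *\<^sub>R u)) \<partial>lborel)"
    by (rule integral_lborel_affine) (use assms in auto)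
  also have "\<dots> = c ^ DIM('a) * (\<integral>\<eta>. gauss (c *\<^sub>R \<eta>) * cos (inner \<eta> u) \<partial>lborel)" using assms by simp
  finally show ?thesis
    using gauss_fourier[of "(1 / c) *\<^sub>R u"] assms by (simp add: power_one_over field_simps)
qed

subsection \<open>Integrable weights\<close>

lemma nn_integral_Cauchy_density: "(\<integral>\<^sup>+x. ennreal (1 / (1 + x\<^sup>2)) \<partial>(lborel :: real measure)) < \<infinity>"
proof -
  let ?f = "\<lambda>x::real. 1 / (1 + x\<^sup>2)"
  have p: "1 + x\<^sup>2 > 0" for x :: real by (simp add: add_pos_nonneg)
  have half: "(\<integral>\<^sup>+x. ennreal (?f x) * indicator {0..} x \<partial>lborel) = ennreal (pi / 2 - arctan 0)"
    by (rule nn_integral_FTC_atLeast)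
       (use p in \<open>auto intro!: derivative_eq_intros tendsto_arctan_at_top simp: less_imp_le add_pos_nonneg field_simps\<close>)
  have "(\<integral>\<^sup>+x. ennreal (?f x) \<partial>lborel) \<le> (\<integral>\<^sup>+x. ennreal (?f x) * indicator {0..} x + ennreal (?f (-x)) * indicator {0..} (-x) \<partial>lborel)"
    by (intro nn_integral_mono) (auto simp: indicator_def)
  also have "\<dots> = (\<integral>\<^sup>+x. ennreal (?f x) * indicator {0..} x \<partial>lborel) + (\<integral>\<^sup>+x. ennreal (?f (-x)) * indicator {0..} (-x) \<partial>lborel)"
    by (rule nn_integral_add) auto
  also have "(\<integral>\<^sup>+x. ennreal (?f (-x)) * indicator {0..} (-x) \<partial>lborel) = (\<integral>\<^sup>+x. ennreal (?f x) * indicator {0..} x \<partial>lborel)"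
    using nn_integral_real_affine[of "\<lambda>x. ennreal (?f x) * indicator {0..} x" "-1" 0] by simp
  finally have "(\<integral>\<^sup>+x. ennreal (?f x) \<partial>lborel) \<le> ennreal (pi / 2 - arctan 0) + ennreal (pi / 2 - arctan 0)" unfolding half .
  then show ?thesis by (rule le_less_trans) simp
qed

text \<open>A product of \<open>d\<close> Cauchy densities dominates this weight, hence it is integrable.\<close>

definition decay :: "real^'d::finite \<Rightarrow> real" where
  "decay \<theta> = 1 / (1 + norm \<theta>) ^ (2 * CARD('d))"

lemma one_plus_norm_pos: "0 < 1 + norm \<theta>" "1 \<le> 1 + norm \<theta>"
  using norm_ge_zero[of \<theta>] by linarith+

lemma decay_nonneg: "0 \<le> decay \<theta>"
  unfolding decay_def by simp

lemma decay_measurable [measurable]: "decay \<in> borel_measurable borel"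
  unfolding decay_def[abs_def] by measurable

lemma decay_integrable: "integrable lborel (decay :: real^'d::finite \<Rightarrow> real)"
proof (rule integrableI_nonneg)
  have le: "decay \<theta> \<le> (\<Prod>b\<in>Basis. 1 / (1 + (\<theta> \<bullet> b)\<^sup>2))" for \<theta> :: "real^'d"
  proof -
    have "decay \<theta> = (\<Prod>b\<in>(Basis :: (real^'d) set). 1 / (1 + norm \<theta>)\<^sup>2)"
      by (simp add: decay_def power_one_over power_mult)
    also have "\<dots> \<le> (\<Prod>b\<in>Basis. 1 / (1 + (\<theta> \<bullet> b)\<^sup>2))"
    proof (rule prod_mono)
      fix b :: "real^'d" assume b: "b \<in> Basis"
      have "(\<theta> \<bullet> b)\<^sup>2 \<le> (norm \<theta>)\<^sup>2" using Basis_le_norm[OF b, of \<theta>] by (simp add: abs_le_square_iff[symmetric])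
      moreover have "1 + (norm \<theta>)\<^sup>2 \<le> (1 + norm \<theta>)\<^sup>2" by (simp add: power2_sum)
      ultimately have "1 + (\<theta> \<bullet> b)\<^sup>2 \<le> (1 + norm \<theta>)\<^sup>2" by linarith
      then show "0 \<le> 1 / (1 + norm \<theta>)\<^sup>2 \<and> 1 / (1 + norm \<theta>)\<^sup>2 \<le> 1 / (1 + (\<theta> \<bullet> b)\<^sup>2)"
        by (auto intro!: frac_le simp: add_pos_nonneg)
    qed
    finally show ?thesis .
  qed
  have "(\<integral>\<^sup>+\<theta>. ennreal (decay (\<theta> :: real^'d)) \<partial>lborel) \<le> (\<integral>\<^sup>+\<theta>. (\<Prod>b\<in>(Basis :: (real^'d) set). ennreal (1 / (1 + (\<theta> \<bullet> b)\<^sup>2))) \<partial>lborel)"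
  proof (rule nn_integral_mono)
    fix \<theta> :: "real^'d"
    have "(\<Prod>b\<in>(Basis :: (real^'d) set). ennreal (1 / (1 + (\<theta> \<bullet> b)\<^sup>2))) = ennreal (\<Prod>b\<in>(Basis :: (real^'d) set). 1 / (1 + (\<theta> \<bullet> b)\<^sup>2))"
      by (rule prod_ennreal) simp
    then show "ennreal (decay \<theta>) \<le> (\<Prod>b\<in>(Basis :: (real^'d) set). ennreal (1 / (1 + (\<theta> \<bullet> b)\<^sup>2)))" using ennreal_leI[OF le] by simp
  qed
  also have "\<dots> = (\<Prod>b\<in>(Basis :: (real^'d) set). \<integral>\<^sup>+x. ennreal (1 / (1 + x\<^sup>2)) \<partial>lborel)"
    by (rule nn_integral_lborel_prod) auto
  also have "\<dots> = (\<integral>\<^sup>+x. ennreal (1 / (1 + x\<^sup>2)) \<partial>(lborel :: real measure)) ^ CARD('d)" by simp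
  also have "\<dots> < \<infinity>" using nn_integral_Cauchy_density by (simp add: power_less_top_ennreal)
  finally show "(\<integral>\<^sup>+\<theta>. ennreal (decay (\<theta> :: real^'d)) \<partial>lborel) < \<infinity>" .
qed (auto simp: decay_nonneg)

subsection \<open>Rapidly decaying characteristic functions\<close>

locale random_vector = prob_space M for M :: "'w measure" +
  fixes X :: "'w \<Rightarrow> real^'d::finite"
  assumes X [measurable]: "X \<in> borel_measurable M"
begin

text \<open>The real part of the characteristic function multiplied by a phase. All phases together carry the same
  information as the complex function, and derivatives in the argument of the density become phase
  shifts.\<close>

definition chf :: "real^'d \<Rightarrow> real \<Rightarrow> real" where
  "chf \<theta> t = (\<integral>\<omega>. cos (inner \<theta> (X \<omega>) + t) \<partial>M)"

lemma cos_integrable: "integrable M (\<lambda>\<omega>. cos (inner \<theta> (X \<omega>) + t))"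
  by (rule integrable_const_bound[where B = 1]) auto

lemma chf_add: "chf \<theta> (s + t) = cos t * chf \<theta> s + sin t * chf \<theta> (s + pi/2)"
proof -
  have "cos (x + (s + t)) = cos t * cos (x + s) + sin t * cos (x + (s + pi/2))" for x
  proof -
    have "cos (x + (s + pi/2)) = - sin (x + s)" by (simp add: add.assoc[symmetric] cos_add)
    then show ?thesis by (simp add: add.assoc[symmetric] cos_add[of "x + s" t])
  qed
  then have "chf \<theta> (s + t) = (\<integral>\<omega>. cos t * cos (inner \<theta> (X \<omega>) + s) + sin t * cos (inner \<theta> (X \<omega>) + (s + pi/2)) \<partial>M)"
    unfolding chf_def by (intro Bochner_Integration.integral_cong) auto
  also have "\<dots> = cos t * chf \<theta> s + sin t * chf \<theta> (s + pi/2)"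
    unfolding chf_def
    by (subst Bochner_Integration.integral_add)
       (auto intro!: integrable_mult_right cos_integrable)
  finally show ?thesis .
qed

lemma chf_measurable [measurable (raw)]:
  assumes [measurable]: "f \<in> borel_measurable N" "g \<in> borel_measurable N"
  shows "(\<lambda>y. chf (f y) (g y)) \<in> borel_measurable N"
  unfolding chf_def by measurable

lemma DERIV_chf: "((\<lambda>t. chf \<theta> (s + t)) has_field_derivative chf \<theta> (s + t + pi/2)) (at t)"
proof -
  have "((\<lambda>t. cos t * chf \<theta> s + sin t * chf \<theta> (s + pi/2)) has_field_derivative (- sin t * chf \<theta> s + cos t * chf \<theta> (s + pi/2))) (at t)"
    by (auto intro!: derivative_eq_intros)
  moreover have "chf \<theta> (s + t + pi/2) = - sin t * chf \<theta> s + cos t * chf \<theta> (s + pi/2)"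
    using chf_add[of \<theta> s "t + pi/2"] by (simp add: cos_add sin_add add.assoc)
  ultimately show ?thesis unfolding chf_add[of \<theta> s, symmetric] by simp
qed

text \<open>The bound for the second derivative in the phase is again a bound for \<open>chf \<theta>\<close> itself, so fast decay in \<open>\<theta>\<close>
  is inherited by the remainder.\<close>

lemma chf_taylor:
  assumes "\<And>t. \<bar>chf \<theta> t\<bar> \<le> K"
  shows "\<bar>chf \<theta> (s + v) - chf \<theta> s - v * chf \<theta> (s + pi/2)\<bar> \<le> K * v\<^sup>2"
proof -
  define diff where "diff m t = chf \<theta> (s + real m * (pi/2) + t)" for m t
  have d: "\<forall>m t. DERIV (diff m) t :> diff (Suc m) t"
  proof (intro allI)
    fix m t
    have "s + real m * (pi/2) + t + pi/2 = s + real (Suc m) * (pi/2) + t" by (simp add: algebra_simps)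
    then have "diff (Suc m) t = chf \<theta> (s + real m * (pi/2) + t + pi/2)" by (simp only: diff_def)
    then show "DERIV (diff m) t :> diff (Suc m) t" using DERIV_chf[of \<theta> "s + real m * (pi/2)" t] by (simp only: diff_def[abs_def])
  qed
  have e2: "2 = Suc (Suc 0)" by simp
  obtain t where "diff 0 v = (\<Sum>m<2. diff m 0 / fact m * v ^ m) + diff 2 t / fact 2 * v ^ 2"
    using Maclaurin_all_le[OF refl d, of v 2] by blast
  then have "diff 0 v = diff 0 0 + diff 1 0 * v + diff 2 t / 2 * v\<^sup>2"
    unfolding e2 by (simp only: sum.lessThan_Suc) simp
  then have "chf \<theta> (s + v) - chf \<theta> s - v * chf \<theta> (s + pi/2) = (1/2) * diff 2 t * v\<^sup>2" by (simp add: diff_def)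
  also have "\<bar>\<dots>\<bar> = (1/2) * \<bar>diff 2 t\<bar> * v\<^sup>2" by (simp add: abs_mult)
  also have "\<dots> \<le> 1 * K * v\<^sup>2" unfolding diff_def by (intro mult_mono assms mult_nonneg_nonneg order_trans[OF abs_ge_zero assms]) auto
  finally show ?thesis by simp
qed

text \<open>Differentiation prepends a letter to the word \<open>\<alpha>\<close> and shifts the phase.\<close>

definition fourier :: "'d list \<Rightarrow> real \<Rightarrow> real^'d \<Rightarrow> real" where
  "fourier \<alpha> s x = (\<integral>\<theta>. (\<Prod>i\<leftarrow>\<alpha>. \<theta>$i) * chf \<theta> (s - inner \<theta> x) \<partial>lborel)"

end

lemma prod_list_component_measurable [measurable]: "(\<lambda>\<theta>::real^'d::finite. \<Prod>i\<leftarrow>\<alpha>. \<theta>$i) \<in> borel_measurable borel"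
  by (induction \<alpha>) auto

locale smooth_random_vector = random_vector M X for M :: "'w measure" and X :: "'w \<Rightarrow> real^'d::finite" +
  assumes rapid: "\<And>N. \<exists>C. \<forall>\<theta> t. \<bar>chf \<theta> t\<bar> \<le> C / (1 + norm \<theta>) ^ N"
begin

text \<open>Fast decay absorbs any polynomial factor and leaves the integrable weight \<open>decay\<close>.\<close>

lemma fourier_integrand_bound:
  obtains C where "\<And>\<theta> t. norm \<theta> ^ j * (\<bar>\<Prod>i\<leftarrow>\<alpha>. \<theta>$i\<bar> * \<bar>chf \<theta> t\<bar>) \<le> C * decay \<theta>" "0 \<le> C"
proof -
  let ?N = "j + length \<alpha> + 2 * CARD('d)"
  obtain C where C: "\<And>\<theta> t. \<bar>chf \<theta> t\<bar> \<le> C / (1 + norm \<theta>) ^ ?N" using rapid by blast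
  have C0: "0 \<le> C" using order_trans[OF abs_ge_zero C[of 0 0]] by simp
  have "norm \<theta> ^ j * (\<bar>\<Prod>i\<leftarrow>\<alpha>. \<theta>$i\<bar> * \<bar>chf \<theta> t\<bar>) \<le> C * decay \<theta>" for \<theta> t
  proof -
    let ?n = "1 + norm \<theta>"
    have n: "norm \<theta> ^ k \<le> ?n ^ k" for k by (intro power_mono) auto
    have "norm \<theta> ^ j * (\<bar>\<Prod>i\<leftarrow>\<alpha>. \<theta>$i\<bar> * \<bar>chf \<theta> t\<bar>) \<le> ?n ^ j * (?n ^ length \<alpha> * (C / ?n ^ ?N))"
      by (intro mult_mono n C order_trans[OF abs_prod_component_le n]) (auto intro!: mult_nonneg_nonneg)
    also have "\<dots> = C * decay \<theta>" using one_plus_norm_pos[of \<theta>] unfolding decay_def by (simp add: power_add field_simps)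
    finally show ?thesis .
  qed
  then show ?thesis using that C0 by blast
qed

lemma fourier_integrable: "integrable lborel (\<lambda>\<theta>. (\<Prod>i\<leftarrow>\<alpha>. \<theta>$i) * chf \<theta> (s - inner \<theta> x))"
proof -
  obtain C where C: "\<And>\<theta> t. norm \<theta> ^ 0 * (\<bar>\<Prod>i\<leftarrow>\<alpha>. \<theta>$i\<bar> * \<bar>chf \<theta> t\<bar>) \<le> C * decay \<theta>" "0 \<le> C"
    using fourier_integrand_bound by blast
  have b: "norm ((\<Prod>i\<leftarrow>\<alpha>. \<theta>$i) * chf \<theta> (s - inner \<theta> x)) \<le> norm (C * decay \<theta>)" for \<theta>
    using C(1)[of \<theta> "s - inner \<theta> x"] C(2) decay_nonneg[of \<theta>] by (simp add: abs_mult)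
  show ?thesis
    by (rule Bochner_Integration.integrable_bound[of _ "\<lambda>\<theta>. C * decay \<theta>"])
       (use b in \<open>auto intro!: integrable_mult_right decay_integrable\<close>)
qed

text \<open>Differentiation under the integral through \<open>has_derivative_quadraticI\<close>; the remainder in the phase is
  \<open>\<langle>\<theta>, h\<rangle>\<^sup>2\<close> times a rapidly decaying function of \<open>\<theta>\<close>.\<close>

lemma fourier_has_derivative:
  "(fourier \<alpha> s has_derivative (\<lambda>h. \<Sum>i\<in>UNIV. h$i * fourier (i # \<alpha>) (s - pi/2) x)) (at x)"
proof -
  obtain C where C: "\<And>\<theta> t. norm \<theta> ^ 2 * (\<bar>\<Prod>i\<leftarrow>\<alpha>. \<theta>$i\<bar> * \<bar>chf \<theta> t\<bar>) \<le> C * decay \<theta>" "0 \<le> C"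
    using fourier_integrand_bound by blast
  show ?thesis
  proof (rule has_derivative_quadraticI[where C = "\<integral>\<theta>. C * decay \<theta> \<partial>(lborel :: (real^'d) measure)"])
    fix h :: "real^'d"
    let ?m = "\<lambda>\<theta>::real^'d. \<Prod>i\<leftarrow>\<alpha>. \<theta>$i"
    let ?R = "\<lambda>\<theta>. ?m \<theta> * chf \<theta> (s - inner \<theta> (x + h)) - ?m \<theta> * chf \<theta> (s - inner \<theta> x) - (\<Sum>i\<in>UNIV. h$i * ((\<Prod>i\<leftarrow>i # \<alpha>. \<theta>$i) * chf \<theta> ((s - pi/2) - inner \<theta> x)))"
    have int: "integrable lborel ?R"
      by (intro Bochner_Integration.integrable_diff fourier_integrable Bochner_Integration.integrable_sum integrable_mult_right)
    have eq: "fourier \<alpha> s (x + h) - fourier \<alpha> s x - (\<Sum>i\<in>UNIV. h$i * fourier (i # \<alpha>) (s - pi/2) x) = (\<integral>\<theta>. ?R \<theta> \<partial>lborel)"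
      unfolding fourier_def
      by (subst Bochner_Integration.integral_diff, intro Bochner_Integration.integrable_diff fourier_integrable,
          intro Bochner_Integration.integrable_sum integrable_mult_right fourier_integrable,
          subst Bochner_Integration.integral_diff, rule fourier_integrable, rule fourier_integrable,
          subst Bochner_Integration.integral_sum, intro integrable_mult_right fourier_integrable, simp only: integral_mult_right_zero)
    have "\<bar>\<integral>\<theta>. ?R \<theta> \<partial>lborel\<bar> \<le> (\<integral>\<theta>. \<bar>?R \<theta>\<bar> \<partial>lborel)" by (rule integral_abs_bound)
    also have "\<dots> \<le> (\<integral>\<theta>. C * decay \<theta> * (norm h)\<^sup>2 \<partial>(lborel :: (real^'d) measure))"
    proof (rule integral_mono)
      show "integrable lborel (\<lambda>\<theta>. \<bar>?R \<theta>\<bar>)" using int by (rule integrable_abs)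
      show "integrable lborel (\<lambda>\<theta>::real^'d. C * decay \<theta> * (norm h)\<^sup>2)" by (intro integrable_mult_left integrable_mult_right decay_integrable)
      fix \<theta> :: "real^'d"
      let ?v = "- inner \<theta> h"
      have s: "s - inner \<theta> (x + h) = (s - inner \<theta> x) + ?v" by (simp add: inner_add_right)
      have "chf \<theta> (s - inner \<theta> x + pi/2) = - chf \<theta> ((s - pi/2) - inner \<theta> x)"
      proof -
        have "chf \<theta> ((s - pi/2 - inner \<theta> x) + pi) = - chf \<theta> (s - pi/2 - inner \<theta> x)" using chf_add[of \<theta> "s - pi/2 - inner \<theta> x" pi] by simp
        moreover have "(s - pi/2 - inner \<theta> x) + pi = s - inner \<theta> x + pi/2" by (simp add: field_simps)
        ultimately show ?thesis by simp
      qed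
      moreover have "(\<Sum>i\<in>UNIV. h$i * ((\<Prod>i\<leftarrow>i # \<alpha>. \<theta>$i) * q)) = inner \<theta> h * (?m \<theta> * q)" for q
        by (simp add: inner_vec_def sum_distrib_right sum_distrib_left mult_ac)
      ultimately have "?R \<theta> = ?m \<theta> * (chf \<theta> (s - inner \<theta> x + ?v) - chf \<theta> (s - inner \<theta> x) - ?v * chf \<theta> (s - inner \<theta> x + pi/2))"
        unfolding s by (simp only:) (simp add: algebra_simps)
      then have R: "\<bar>?R \<theta>\<bar> = \<bar>?m \<theta>\<bar> * \<bar>chf \<theta> (s - inner \<theta> x + ?v) - chf \<theta> (s - inner \<theta> x) - ?v * chf \<theta> (s - inner \<theta> x + pi/2)\<bar>" by (simp only: abs_mult)
      have v: "?v\<^sup>2 \<le> norm \<theta> ^ 2 * (norm h)\<^sup>2"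
      proof -
        have "\<bar>?v\<bar> \<le> norm \<theta> * norm h" using Cauchy_Schwarz_ineq2[of \<theta> h] by simp
        then have "\<bar>?v\<bar>\<^sup>2 \<le> (norm \<theta> * norm h)\<^sup>2" by (intro power_mono) auto
        then show ?thesis by (simp add: power_mult_distrib)
      qed
      show "\<bar>?R \<theta>\<bar> \<le> C * decay \<theta> * (norm h)\<^sup>2"
      proof (cases "norm \<theta> ^ 2 * \<bar>?m \<theta>\<bar> = 0")
        case True
        then have "\<bar>?m \<theta>\<bar> = 0 \<or> ?v = 0" by auto
        then have "\<bar>?R \<theta>\<bar> = 0" unfolding R by auto
        then show ?thesis using C(2) decay_nonneg[of \<theta>] by simp
      next
        case False
        then have p: "norm \<theta> ^ 2 * \<bar>?m \<theta>\<bar> > 0" by (simp add: zero_less_mult_iff)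
        let ?K = "C * decay \<theta> / (norm \<theta> ^ 2 * \<bar>?m \<theta>\<bar>)"
        have K: "\<bar>chf \<theta> t\<bar> \<le> ?K" for t using C(1)[of \<theta> t] p by (simp add: pos_le_divide_eq mult_ac)
        have K0: "0 \<le> ?K" using K[of 0] by linarith
        have "\<bar>?R \<theta>\<bar> \<le> \<bar>?m \<theta>\<bar> * (?K * ?v\<^sup>2)" unfolding R by (intro mult_left_mono chf_taylor K) auto
        also have "\<dots> \<le> \<bar>?m \<theta>\<bar> * (?K * (norm \<theta> ^ 2 * (norm h)\<^sup>2))" by (intro mult_left_mono v K0) auto
        also have "\<dots> = (norm \<theta> ^ 2 * \<bar>?m \<theta>\<bar>) * ?K * (norm h)\<^sup>2" by (simp only: mult_ac)
        also have "\<dots> = C * decay \<theta> * (norm h)\<^sup>2" using p by (simp only: nonzero_mult_div_cancel_left times_divide_eq_right less_imp_neq[THEN not_sym] not_False_eq_True)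
        finally show ?thesis .
      qed
    qed
    finally show "\<bar>fourier \<alpha> s (x + h) - fourier \<alpha> s x - (\<Sum>i\<in>UNIV. h$i * fourier (i # \<alpha>) (s - pi/2) x)\<bar> \<le> (\<integral>\<theta>. C * decay \<theta> \<partial>(lborel :: (real^'d) measure)) * (norm h)\<^sup>2"
      unfolding eq by simp
  qed
qed

lemma pd_fourier: "pd i (fourier \<alpha> s) = fourier (i # \<alpha>) (s - pi/2)"
  by (rule ext, subst pd_eqI[OF fourier_has_derivative]) (simp add: axis_def if_distrib[of "\<lambda>x. x * _"] cong: if_cong)

lemma fourier_C_infty: "fourier \<alpha> s \<in> C_infty"
  by (rule C_inftyI[where S = "{fourier \<alpha> s |\<alpha> s. True}"])
     (use fourier_has_derivative differentiable_def pd_fourier in blast)+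

lemma pds_fourier: "pds \<alpha> (fourier [] 0) = fourier \<alpha> (- real (length \<alpha>) * (pi/2))"
proof (induction \<alpha>)
  case (Cons i \<alpha>)
  have "- real (length \<alpha>) * (pi/2) - pi/2 = - real (length (i # \<alpha>)) * (pi/2)" by (simp add: algebra_simps)
  then show ?case by (simp only: pds_Cons Cons pd_fourier)
qed simp

end

lemma gauss0_nonneg [simp]: "0 \<le> gauss0 TYPE('a::euclidean_space)"
  unfolding gauss0_def by simp

lemma C_infty_cmult:
  assumes "f \<in> C_infty" shows "(\<lambda>x. c * f x) \<in> C_infty"
proof -
  have "(\<lambda>x. c * pds \<alpha> f x) differentiable (at x)" for \<alpha> x
    by (intro differentiable_mult differentiable_const C_infty_differentiable C_infty_pds assms)
  then show ?thesis unfolding C_infty_def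
    by (auto simp: pds_cmult[OF assms] differentiable_on_def intro: differentiable_at_withinI)
qed

context smooth_random_vector
begin

text \<open>Fourier inversion.\<close>

definition dens :: "real^'d \<Rightarrow> real" where
  "dens x = (gauss0 TYPE(real^'d))\<^sup>2 * fourier [] 0 x"

lemma dens_C_infty: "dens \<in> C_infty"
  unfolding dens_def[abs_def] by (rule C_infty_cmult[OF fourier_C_infty])

lemma pds_dens: "pds \<alpha> dens = (\<lambda>x. (gauss0 TYPE(real^'d))\<^sup>2 * fourier \<alpha> (- real (length \<alpha>) * (pi/2)) x)"
  unfolding dens_def[abs_def] by (simp only: pds_cmult[OF fourier_C_infty] pds_fourier)

text \<open>The density of a centred Gaussian vector of standard deviation \<open>c\<close>.\<close>

definition kern :: "real \<Rightarrow> real^'d \<Rightarrow> real" where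
  "kern c u = (1 / c) ^ CARD('d) * gauss ((1 / c) *\<^sub>R u)"

text \<open>Inversion of the characteristic function multiplied by a Gaussian factor, which is the density of \<open>X\<close>
  perturbed by an independent Gaussian vector of standard deviation \<open>c\<close> (\<open>reg_eq\<close>). In this form
  convergence to \<open>dens\<close> for \<open>c \<rightarrow> 0\<close> is visible, in the other form nonnegativity is.\<close>

definition reg :: "real \<Rightarrow> real^'d \<Rightarrow> real" where
  "reg c x = (gauss0 TYPE(real^'d)) * (\<integral>\<eta>. gauss (c *\<^sub>R \<eta>) * chf \<eta> (0 - inner \<eta> x) \<partial>lborel)"

lemma kern_measurable [measurable]: "kern c \<in> borel_measurable borel"
  unfolding kern_def[abs_def] by measurable

lemma reg_measurable [measurable]: "reg c \<in> borel_measurable borel"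
  unfolding reg_def[abs_def] by measurable

lemma kern_nonneg: "c > 0 \<Longrightarrow> 0 \<le> kern c u"
  unfolding kern_def by (simp add: gauss_nonneg)

lemma kern_le: "c > 0 \<Longrightarrow> kern c u \<le> (1 / c) ^ CARD('d) * (gauss0 TYPE(real^'d))"
  unfolding kern_def by (intro mult_left_mono gauss_le) simp

lemma kern_integrable: "c > 0 \<Longrightarrow> integrable M (\<lambda>\<omega>. kern c (X \<omega> - x))"
  by (rule integrable_const_bound[where B = "(1 / c) ^ CARD('d) * (gauss0 TYPE(real^'d))"]) (auto simp: kern_nonneg kern_le)

lemma gauss_scaled_integrable:
  assumes "c > 0" shows "integrable lborel (\<lambda>\<eta>::real^'d. gauss (c *\<^sub>R \<eta>))"
proof (rule integrableI_nonneg)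
  have e: "1 = ennreal (\<bar>c\<bar> ^ DIM(real^'d)) * (\<integral>\<^sup>+\<eta>. ennreal (gauss (0 + c *\<^sub>R \<eta> :: real^'d)) \<partial>lborel)"
    unfolding gauss_nn_integral[where 'a = "real^'d", symmetric] by (rule nn_integral_lborel_affine) (use assms in auto)
  have "ennreal (\<bar>c\<bar> ^ DIM(real^'d)) * (\<integral>\<^sup>+\<eta>. ennreal (gauss (0 + c *\<^sub>R \<eta> :: real^'d)) \<partial>lborel) \<noteq> \<top>"
    unfolding e[symmetric] by simp
  moreover have "ennreal (\<bar>c\<bar> ^ DIM(real^'d)) \<noteq> 0" using assms by simp
  ultimately show "(\<integral>\<^sup>+\<eta>. ennreal (gauss (c *\<^sub>R \<eta> :: real^'d)) \<partial>lborel) < \<infinity>"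
    by (simp add: ennreal_mult_eq_top_iff less_top)
qed (auto simp: gauss_nonneg)

lemma reg_eq:
  assumes c: "c > 0" shows "reg c x = (\<integral>\<omega>. kern c (X \<omega> - x) \<partial>M)"
proof -
  interpret P: pair_sigma_finite "lborel :: (real^'d) measure" M ..
  let ?f = "\<lambda>\<eta> \<omega>. gauss (c *\<^sub>R \<eta>) * cos (inner \<eta> (X \<omega>) + (0 - inner \<eta> x))"
  have dom: "integrable (lborel \<Otimes>\<^sub>M M) (\<lambda>(\<eta>::real^'d, \<omega>). gauss (c *\<^sub>R \<eta>))"
  proof (rule P.Fubini_integrable)
    show "(\<lambda>(\<eta>::real^'d, \<omega>). gauss (c *\<^sub>R \<eta>)) \<in> borel_measurable (lborel \<Otimes>\<^sub>M M)" by measurable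
    show "integrable lborel (\<lambda>\<eta>::real^'d. \<integral>\<omega>. norm (case (\<eta>, \<omega>) of (\<eta>, \<omega>) \<Rightarrow> gauss (c *\<^sub>R \<eta>)) \<partial>M)"
      using gauss_scaled_integrable[OF c] by (simp add: prob_space gauss_nonneg)
    show "AE \<eta> in lborel. integrable M (\<lambda>\<omega>. case (\<eta>::real^'d, \<omega>) of (\<eta>, \<omega>) \<Rightarrow> gauss (c *\<^sub>R \<eta>))" by simp
  qed
  have int: "integrable (lborel \<Otimes>\<^sub>M M) (\<lambda>(\<eta>, \<omega>). ?f \<eta> \<omega>)"
  proof (rule Bochner_Integration.integrable_bound[OF dom])
    show "(\<lambda>(\<eta>, \<omega>). ?f \<eta> \<omega>) \<in> borel_measurable (lborel \<Otimes>\<^sub>M M)" by measurable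
    show "AE y in lborel \<Otimes>\<^sub>M M. norm (case y of (\<eta>, \<omega>) \<Rightarrow> ?f \<eta> \<omega>) \<le> norm (case y of (\<eta>::real^'d, \<omega>) \<Rightarrow> gauss (c *\<^sub>R \<eta>))"
      by (intro AE_I2) (auto simp: abs_mult gauss_nonneg intro!: mult_left_le)
  qed
  have "reg c x = (gauss0 TYPE(real^'d)) * (\<integral>\<eta>. \<integral>\<omega>. ?f \<eta> \<omega> \<partial>M \<partial>lborel)"
    unfolding reg_def chf_def by simp
  also have "(\<integral>\<eta>. \<integral>\<omega>. ?f \<eta> \<omega> \<partial>M \<partial>lborel) = (\<integral>\<omega>. \<integral>\<eta>. ?f \<eta> \<omega> \<partial>lborel \<partial>M)"
    by (rule P.Fubini_integral[OF int, symmetric])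
  also have "(gauss0 TYPE(real^'d)) * \<dots> = (\<integral>\<omega>. (gauss0 TYPE(real^'d)) * (\<integral>\<eta>. ?f \<eta> \<omega> \<partial>lborel) \<partial>M)" by simp
  also have "\<dots> = (\<integral>\<omega>. kern c (X \<omega> - x) \<partial>M)"
  proof (rule Bochner_Integration.integral_cong[OF refl])
    fix \<omega>
    have "(\<integral>\<eta>. ?f \<eta> \<omega> \<partial>lborel) = (\<integral>\<eta>. gauss (c *\<^sub>R \<eta>) * cos (inner \<eta> (X \<omega> - x)) \<partial>lborel)" by (simp add: inner_diff_right)
    then show "(gauss0 TYPE(real^'d)) * (\<integral>\<eta>. ?f \<eta> \<omega> \<partial>lborel) = kern c (X \<omega> - x)"
      using gauss_fourier_scaled[OF c, of "X \<omega> - x"] by (simp add: kern_def)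
  qed
  finally show ?thesis .
qed

lemma reg_nonneg: "c > 0 \<Longrightarrow> 0 \<le> reg c x"
  unfolding reg_eq by (intro Bochner_Integration.integral_nonneg) (simp add: kern_nonneg)

lemma reg_bound: obtains P where "\<And>c x. \<bar>reg c x\<bar> \<le> P" "0 \<le> P"
proof -
  obtain C where C: "\<And>\<theta> t. norm \<theta> ^ 0 * (\<bar>\<Prod>i\<leftarrow>[]. \<theta>$i\<bar> * \<bar>chf \<theta> t\<bar>) \<le> C * decay \<theta>" "0 \<le> C"
    using fourier_integrand_bound by blast
  let ?P = "(gauss0 TYPE(real^'d)) * (\<integral>\<eta>. (gauss0 TYPE(real^'d)) * (C * decay \<eta>) \<partial>(lborel :: (real^'d) measure))"
  have b: "\<bar>gauss (c *\<^sub>R \<eta>) * chf \<eta> t\<bar> \<le> (gauss0 TYPE(real^'d)) * (C * decay \<eta>)" for c \<eta> t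
    unfolding abs_mult using C(1)[of \<eta> t] C(2) by (intro mult_mono) (auto simp: gauss_nonneg gauss_le decay_nonneg)
  have i: "integrable lborel (\<lambda>\<eta>::real^'d. (gauss0 TYPE(real^'d)) * (C * decay \<eta>))" by (intro integrable_mult_right decay_integrable)
  have "\<bar>reg c x\<bar> \<le> ?P" for c x
  proof -
    have ig: "integrable lborel (\<lambda>\<eta>. gauss (c *\<^sub>R \<eta>) * chf \<eta> (0 - inner \<eta> x))"
      by (rule Bochner_Integration.integrable_bound[OF i]) (use b[of c] in \<open>auto intro: order_trans[OF _ abs_ge_self]\<close>)
    have "\<bar>\<integral>\<eta>. gauss (c *\<^sub>R \<eta>) * chf \<eta> (0 - inner \<eta> x) \<partial>lborel\<bar> \<le> (\<integral>\<eta>. \<bar>gauss (c *\<^sub>R \<eta>) * chf \<eta> (0 - inner \<eta> x)\<bar> \<partial>lborel)" by (rule integral_abs_bound)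
    also have "\<dots> \<le> (\<integral>\<eta>. (gauss0 TYPE(real^'d)) * (C * decay \<eta>) \<partial>(lborel :: (real^'d) measure))"
      by (rule integral_mono[OF integrable_abs[OF ig] i b])
    finally show ?thesis unfolding reg_def abs_mult using gauss_pos0[where 'a = "real^'d"] by (simp add: mult_left_mono)
  qed
  moreover have "0 \<le> ?P" using gauss_pos0[where 'a = "real^'d"] C(2) by (intro mult_nonneg_nonneg Bochner_Integration.integral_nonneg) (auto simp: decay_nonneg)
  ultimately show ?thesis using that by blast
qed

definition scale :: "nat \<Rightarrow> real" where "scale n = 1 / real (Suc n)"

lemma scale_pos: "0 < scale n" by (simp add: scale_def)

lemma scale_lim: "scale \<longlonglongrightarrow> 0"
  unfolding scale_def by (rule LIMSEQ_Suc[OF lim_const_over_n])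

lemma reg_tendsto: "(\<lambda>n. reg (scale n) x) \<longlonglongrightarrow> dens x"
proof -
  obtain C where C: "\<And>\<theta> t. norm \<theta> ^ 0 * (\<bar>\<Prod>i\<leftarrow>[]. \<theta>$i\<bar> * \<bar>chf \<theta> t\<bar>) \<le> C * decay \<theta>" "0 \<le> C"
    using fourier_integrand_bound by blast
  have "(\<lambda>n. \<integral>\<eta>. gauss (scale n *\<^sub>R \<eta>) * chf \<eta> (0 - inner \<eta> x) \<partial>lborel) \<longlonglongrightarrow> (\<integral>\<eta>. (gauss0 TYPE(real^'d)) * chf \<eta> (0 - inner \<eta> x) \<partial>lborel)"
  proof (rule integral_dominated_convergence)
    show "integrable lborel (\<lambda>\<eta>::real^'d. (gauss0 TYPE(real^'d)) * (C * decay \<eta>))" by (intro integrable_mult_right decay_integrable)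
    show "AE \<eta> in lborel. norm (gauss (scale n *\<^sub>R \<eta>) * chf \<eta> (0 - inner \<eta> x)) \<le> (gauss0 TYPE(real^'d)) * (C * decay \<eta>)" for n
    proof (intro AE_I2)
      fix \<eta>
      show "norm (gauss (scale n *\<^sub>R \<eta>) * chf \<eta> (0 - inner \<eta> x)) \<le> (gauss0 TYPE(real^'d)) * (C * decay \<eta>)"
        unfolding real_norm_def abs_mult using C(1)[of \<eta> "0 - inner \<eta> x"] C(2) by (intro mult_mono) (auto simp: gauss_nonneg gauss_le decay_nonneg)
    qed
    show "AE \<eta> in lborel. (\<lambda>n. gauss (scale n *\<^sub>R \<eta>) * chf \<eta> (0 - inner \<eta> x)) \<longlonglongrightarrow> (gauss0 TYPE(real^'d)) * chf \<eta> (0 - inner \<eta> x)"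
    proof (intro AE_I2 tendsto_mult tendsto_const)
      fix \<eta> :: "real^'d"
      have "(\<lambda>n. scale n *\<^sub>R \<eta>) \<longlonglongrightarrow> 0 *\<^sub>R \<eta>" by (intro tendsto_intros scale_lim)
      then have l: "(\<lambda>n. scale n *\<^sub>R \<eta>) \<longlonglongrightarrow> 0" by simp
      have "isCont gauss (0 :: real^'d)" using gauss_continuous continuous_on_eq_continuous_at by blast
      from isCont_tendsto_compose[OF this l] show "(\<lambda>n. gauss (scale n *\<^sub>R \<eta>)) \<longlonglongrightarrow> (gauss0 TYPE(real^'d))" by (simp add: gauss_0)
    qed
  qed measurable
  then have "(\<lambda>n. reg (scale n) x) \<longlonglongrightarrow> (gauss0 TYPE(real^'d)) * (\<integral>\<eta>. (gauss0 TYPE(real^'d)) * chf \<eta> (0 - inner \<eta> x) \<partial>lborel)"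
    unfolding reg_def by (intro tendsto_mult tendsto_const)
  then show ?thesis by (simp add: dens_def fourier_def power2_eq_square mult.assoc)
qed

lemma dens_nonneg: "0 \<le> dens x"
  by (rule LIMSEQ_le_const[OF reg_tendsto]) (use reg_nonneg[OF scale_pos] in auto)

lemma dens_measurable [measurable]: "dens \<in> borel_measurable borel"
  by (rule C_infty_measurable[OF dens_C_infty])

text \<open>Both sides are limits of the same expression: with the regularised density the integrals converge by
  uniform boundedness, and with the Gaussian perturbation of \<open>X\<close> they converge by continuity of \<open>h\<close>.\<close>

lemma dens_test_function:
  assumes cont: "continuous_on UNIV h" and h: "\<And>x. 0 \<le> h x" "\<And>x. h x \<le> 1" and fin: "(\<integral>\<^sup>+x. ennreal (h x) \<partial>lborel) < \<infinity>"
  shows "(\<integral>\<^sup>+x. ennreal (h x) * ennreal (dens x) \<partial>lborel) = (\<integral>\<^sup>+\<omega>. ennreal (h (X \<omega>)) \<partial>M)"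
proof -
  interpret P: pair_sigma_finite "lborel :: (real^'d) measure" M ..
  have [measurable]: "h \<in> borel_measurable borel" by (rule borel_measurable_continuous_onI[OF cont])
  define A where "A n = (\<integral>\<^sup>+x. ennreal (h x) * ennreal (reg (scale n) x) \<partial>lborel)" for n
  define B where "B n = (\<integral>\<^sup>+\<omega>. (\<integral>\<^sup>+z. ennreal (h (X \<omega> + (- scale n) *\<^sub>R z)) * ennreal (gauss z) \<partial>lborel) \<partial>M)" for n
  have AB: "A n = B n" for n
  proof -
    let ?c = "scale n"
    have c: "?c > 0" by (rule scale_pos)
    have "ennreal (reg ?c x) = (\<integral>\<^sup>+\<omega>. ennreal (kern ?c (X \<omega> - x)) \<partial>M)" for x
      unfolding reg_eq[OF c] by (rule nn_integral_eq_integral[symmetric, OF kern_integrable[OF c]]) (simp add: kern_nonneg c)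
    then have "A n = (\<integral>\<^sup>+x. (\<integral>\<^sup>+\<omega>. ennreal (h x) * ennreal (kern ?c (X \<omega> - x)) \<partial>M) \<partial>lborel)"
      unfolding A_def by (simp add: nn_integral_cmult)
    also have "\<dots> = (\<integral>\<^sup>+\<omega>. (\<integral>\<^sup>+x. ennreal (h x) * ennreal (kern ?c (X \<omega> - x)) \<partial>lborel) \<partial>M)"
      by (rule P.Fubini'[symmetric]) measurable
    also have "\<dots> = B n"
      unfolding B_def
    proof (rule nn_integral_cong)
      fix \<omega>
      have "(\<integral>\<^sup>+x. ennreal (h x) * ennreal (kern ?c (X \<omega> - x)) \<partial>lborel) =
         ennreal (\<bar>- ?c\<bar> ^ DIM(real^'d)) * (\<integral>\<^sup>+z. ennreal (h (X \<omega> + (- ?c) *\<^sub>R z)) * ennreal (kern ?c (X \<omega> - (X \<omega> + (- ?c) *\<^sub>R z))) \<partial>lborel)"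
        by (rule nn_integral_lborel_affine) (use c in \<open>auto\<close>)
      also have "\<dots> = (\<integral>\<^sup>+z. ennreal (?c ^ CARD('d)) * (ennreal (h (X \<omega> + (- ?c) *\<^sub>R z)) * ennreal (kern ?c (X \<omega> - (X \<omega> + (- ?c) *\<^sub>R z)))) \<partial>lborel)"
        using c by (subst nn_integral_cmult) auto
      also have "\<dots> = (\<integral>\<^sup>+z. ennreal (h (X \<omega> + (- ?c) *\<^sub>R z)) * ennreal (gauss z) \<partial>lborel)"
      proof (rule nn_integral_cong)
        fix z :: "real^'d"
        have "?c ^ CARD('d) * kern ?c (X \<omega> - (X \<omega> + (- ?c) *\<^sub>R z)) = gauss z"
          using c by (simp add: kern_def power_one_over)
        then have "ennreal (?c ^ CARD('d)) * ennreal (kern ?c (X \<omega> - (X \<omega> + (- ?c) *\<^sub>R z))) = ennreal (gauss z)"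
          using c kern_nonneg[OF c] by (subst ennreal_mult[symmetric]) auto
        then show "ennreal (?c ^ CARD('d)) * (ennreal (h (X \<omega> + (- ?c) *\<^sub>R z)) * ennreal (kern ?c (X \<omega> - (X \<omega> + (- ?c) *\<^sub>R z)))) = ennreal (h (X \<omega> + (- ?c) *\<^sub>R z)) * ennreal (gauss z)"
          by (simp only: mult.left_commute[of "ennreal (?c ^ CARD('d))"])
      qed
      finally show "(\<integral>\<^sup>+x. ennreal (h x) * ennreal (kern ?c (X \<omega> - x)) \<partial>lborel) = (\<integral>\<^sup>+z. ennreal (h (X \<omega> + (- ?c) *\<^sub>R z)) * ennreal (gauss z) \<partial>lborel)" .
    qed
    finally show ?thesis .
  qed
  obtain P where P: "\<And>c x. \<bar>reg c x\<bar> \<le> P" "0 \<le> P" using reg_bound by blast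
  have "A \<longlonglongrightarrow> (\<integral>\<^sup>+x. ennreal (h x) * ennreal (dens x) \<partial>lborel)"
    unfolding A_def
  proof (rule nn_integral_dominated_convergence[where w = "\<lambda>x. ennreal (h x) * ennreal P"])
    show "AE x in lborel. ennreal (h x) * ennreal (reg (scale j) x) \<le> ennreal (h x) * ennreal P" for j
      by (intro AE_I2 mult_left_mono ennreal_leI order_trans[OF abs_ge_self P(1)]) simp
    show "(\<integral>\<^sup>+x. ennreal (h x) * ennreal P \<partial>lborel) < \<infinity>" using fin by (simp add: nn_integral_multc ennreal_mult_less_top)
    show "AE x in lborel. (\<lambda>i. ennreal (h x) * ennreal (reg (scale i) x)) \<longlonglongrightarrow> ennreal (h x) * ennreal (dens x)"
      by (intro AE_I2 ennreal_tendsto_cmult tendsto_ennrealI reg_tendsto) simp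
  qed measurable
  moreover have "B \<longlonglongrightarrow> (\<integral>\<^sup>+\<omega>. ennreal (h (X \<omega>)) \<partial>M)"
    unfolding B_def
  proof (rule nn_integral_dominated_convergence[where w = "\<lambda>_. 1"])
    fix j
    show "AE \<omega> in M. (\<integral>\<^sup>+z. ennreal (h (X \<omega> + (- scale j) *\<^sub>R z)) * ennreal (gauss z) \<partial>lborel) \<le> 1"
    proof (intro AE_I2)
      fix \<omega>
      have "(\<integral>\<^sup>+z. ennreal (h (X \<omega> + (- scale j) *\<^sub>R z)) * ennreal (gauss z) \<partial>lborel) \<le> (\<integral>\<^sup>+z. 1 * ennreal (gauss (z :: real^'d)) \<partial>lborel)"
        using h(2) by (intro nn_integral_mono mult_right_mono) auto
      then show "(\<integral>\<^sup>+z. ennreal (h (X \<omega> + (- scale j) *\<^sub>R z)) * ennreal (gauss z) \<partial>lborel) \<le> 1"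
        using gauss_nn_integral[where 'a = "real^'d"] by simp
    qed
  next
    show "AE \<omega> in M. (\<lambda>i. \<integral>\<^sup>+z. ennreal (h (X \<omega> + (- scale i) *\<^sub>R z)) * ennreal (gauss z) \<partial>lborel) \<longlonglongrightarrow> ennreal (h (X \<omega>))"
    proof (intro AE_I2)
      fix \<omega>
      have "(\<lambda>i. \<integral>\<^sup>+z. ennreal (h (X \<omega> + (- scale i) *\<^sub>R z)) * ennreal (gauss z) \<partial>lborel) \<longlonglongrightarrow> (\<integral>\<^sup>+z. ennreal (h (X \<omega>)) * ennreal (gauss (z :: real^'d)) \<partial>lborel)"
      proof (rule nn_integral_dominated_convergence[where w = "\<lambda>z. ennreal (gauss z)"])
        show "AE z in lborel. ennreal (h (X \<omega> + (- scale j) *\<^sub>R z)) * ennreal (gauss z) \<le> ennreal (gauss z)" for j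
        proof (intro AE_I2)
          fix z :: "real^'d"
          have "ennreal (h (X \<omega> + (- scale j) *\<^sub>R z)) * ennreal (gauss z) \<le> 1 * ennreal (gauss z)" using h(2) by (intro mult_right_mono) auto
          then show "ennreal (h (X \<omega> + (- scale j) *\<^sub>R z)) * ennreal (gauss z) \<le> ennreal (gauss z)" by simp
        qed
        show "(\<integral>\<^sup>+z. ennreal (gauss (z :: real^'d)) \<partial>lborel) < \<infinity>" by (simp add: gauss_nn_integral)
        show "AE z in lborel. (\<lambda>i. ennreal (h (X \<omega> + (- scale i) *\<^sub>R z)) * ennreal (gauss z)) \<longlonglongrightarrow> ennreal (h (X \<omega>)) * ennreal (gauss (z :: real^'d))"
        proof (intro AE_I2)
          fix z :: "real^'d"
          have "(\<lambda>i. X \<omega> + (- scale i) *\<^sub>R z) \<longlonglongrightarrow> X \<omega> + (- 0) *\<^sub>R z" by (intro tendsto_intros scale_lim)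
          then have l: "(\<lambda>i. X \<omega> + (- scale i) *\<^sub>R z) \<longlonglongrightarrow> X \<omega>" by simp
          have "isCont h (X \<omega>)" using cont continuous_on_eq_continuous_at by blast
          from isCont_tendsto_compose[OF this l] have "(\<lambda>i. h (X \<omega> + (- scale i) *\<^sub>R z) * gauss z) \<longlonglongrightarrow> h (X \<omega>) * gauss z" by (intro tendsto_mult tendsto_const)
          then have "(\<lambda>i. ennreal (h (X \<omega> + (- scale i) *\<^sub>R z) * gauss z)) \<longlonglongrightarrow> ennreal (h (X \<omega>) * gauss z)" by (rule tendsto_ennrealI)
          then show "(\<lambda>i. ennreal (h (X \<omega> + (- scale i) *\<^sub>R z)) * ennreal (gauss z)) \<longlonglongrightarrow> ennreal (h (X \<omega>)) * ennreal (gauss z)"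
            by (simp only: ennreal_mult[OF h(1) gauss_nonneg])
        qed
      qed measurable
      then show "(\<lambda>i. \<integral>\<^sup>+z. ennreal (h (X \<omega> + (- scale i) *\<^sub>R z)) * ennreal (gauss z) \<partial>lborel) \<longlonglongrightarrow> ennreal (h (X \<omega>))"
        by (simp add: nn_integral_cmult gauss_nn_integral)
    qed
  qed (auto simp: emeasure_space_1)
  ultimately show ?thesis using AB LIMSEQ_unique by (metis ext)
qed

text \<open>The indicator of an open box is the supremum of continuous functions built from the distance to its
  complement.\<close>

lemma emeasure_box_eq: "emeasure (distr M lborel X) (box a b) = emeasure (density lborel (\<lambda>x. ennreal (dens x))) (box a b)"
proof -
  let ?U = "box a b"
  \<comment> \<open>increasing to the indicator of the box\<close>
  define h where "h n x = min 1 (real n * infdist x (- ?U))" for n x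
  have ne: "- ?U \<noteq> {}" using bounded_box[of a b] not_bounded_UNIV by (metis compl_bot_eq double_complement)
  have pos: "infdist x (- ?U) > 0 \<longleftrightarrow> x \<in> ?U" for x
  proof -
    have "closed (- ?U)" by (simp add: closed_Compl open_box)
    then have "x \<in> - ?U \<longleftrightarrow> infdist x (- ?U) = 0" using in_closed_iff_infdist_zero ne by blast
    then show ?thesis using infdist_nonneg[of x "- ?U"] by auto
  qed
  have h: "continuous_on UNIV (h n)" "0 \<le> h n x" "h n x \<le> 1" for n x
    unfolding h_def by (auto intro!: continuous_intros continuous_on_infdist simp: infdist_nonneg)
  have hU: "h n x = 0" if "x \<notin> ?U" for n x
    using pos[of x] that infdist_nonneg[of x "- ?U"] by (simp add: h_def min_def)
  have [measurable]: "h n \<in> borel_measurable borel" for n by (rule borel_measurable_continuous_onI[OF h(1)])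
  have sup: "(SUP n. ennreal (h n x)) = indicator ?U x" for x
  proof (cases "x \<in> ?U")
    case True
    obtain n where "1 \<le> real n * infdist x (- ?U)"
      using reals_Archimedean3[of "infdist x (- ?U)"] pos[of x] True by (metis less_imp_le)
    then have "h n x = 1" by (simp add: h_def)
    then have ge: "1 \<le> (SUP n. ennreal (h n x))" by (metis UNIV_I SUP_upper ennreal_1)
    have le: "(SUP n. ennreal (h n x)) \<le> 1" by (rule SUP_least) (simp add: h(3))
    show ?thesis unfolding antisym[OF le ge] using True by simp
  qed (simp add: hU)
  have inc: "incseq (\<lambda>n x. ennreal (h n x))"
    by (intro incseq_SucI le_funI ennreal_leI) (auto simp: h_def infdist_nonneg min_def mult_right_mono algebra_simps intro: order_trans)
  have inc': "incseq (\<lambda>n x. ennreal (h n x) * g x)" "incseq (\<lambda>n \<omega>. ennreal (h n (Z \<omega>)))" for g :: "real^'d \<Rightarrow> ennreal" and Z :: "'w \<Rightarrow> real^'d"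
    using inc by (auto simp: incseq_def le_fun_def intro!: mult_right_mono)
  have "emeasure (distr M lborel X) ?U = (\<integral>\<^sup>+x. indicator ?U x \<partial>distr M lborel X)" by simp
  also have "\<dots> = (\<integral>\<^sup>+\<omega>. indicator ?U (X \<omega>) \<partial>M)" by (rule nn_integral_distr) auto
  also have "\<dots> = (\<integral>\<^sup>+\<omega>. (SUP n. ennreal (h n (X \<omega>))) \<partial>M)" by (simp only: sup)
  also have "\<dots> = (SUP n. \<integral>\<^sup>+\<omega>. ennreal (h n (X \<omega>)) \<partial>M)" by (rule nn_integral_monotone_convergence_SUP[OF inc'(2)]) measurable
  also have "\<dots> = (SUP n. \<integral>\<^sup>+x. ennreal (h n x) * ennreal (dens x) \<partial>lborel)"
  proof (rule SUP_cong[OF refl])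
    fix n
    have "(\<integral>\<^sup>+x. ennreal (h n x) \<partial>lborel) \<le> (\<integral>\<^sup>+x. indicator ?U x \<partial>lborel)"
      using h(3) hU by (intro nn_integral_mono) (auto simp: indicator_def)
    also have "\<dots> < \<infinity>" using emeasure_bounded_finite[OF bounded_box[of a b]] by simp
    finally show "(\<integral>\<^sup>+\<omega>. ennreal (h n (X \<omega>)) \<partial>M) = (\<integral>\<^sup>+x. ennreal (h n x) * ennreal (dens x) \<partial>lborel)"
      by (intro dens_test_function[symmetric] h)
  qed
  also have "\<dots> = (\<integral>\<^sup>+x. (SUP n. ennreal (h n x) * ennreal (dens x)) \<partial>lborel)"
    by (rule nn_integral_monotone_convergence_SUP[symmetric, OF inc'(1)]) measurable
  also have "\<dots> = (\<integral>\<^sup>+x. ennreal (dens x) * indicator ?U x \<partial>lborel)"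
    by (simp only: SUP_mult_right_ennreal[symmetric] sup mult.commute)
  also have "\<dots> = emeasure (density lborel (\<lambda>x. ennreal (dens x))) ?U" by (rule emeasure_density[symmetric]) auto
  finally show ?thesis .
qed

lemma smooth_density_dens: "smooth_density M X dens"
proof -
  have "distr M lborel X = density lborel (\<lambda>x. ennreal (dens x))"
  proof (rule measure_eqI_generator_eq)
    let ?E = "range (\<lambda>(a, b). box a b :: (real^'d) set)"
    show "Int_stable ?E" by (auto simp: Int_stable_def box_Int_box)
    show "?E \<subseteq> Pow UNIV" "sets (distr M lborel X) = sigma_sets UNIV ?E" "sets (density lborel (\<lambda>x. ennreal (dens x))) = sigma_sets UNIV ?E"
      by (simp_all add: borel_eq_box)
    let ?A = "\<lambda>n::nat. box (- (real n *\<^sub>R One)) (real n *\<^sub>R One) :: (real^'d) set"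
    show "range ?A \<subseteq> ?E" "(\<Union>i. ?A i) = UNIV" unfolding UN_box_eq_UNIV by auto
    show "emeasure (distr M lborel X) (?A i) \<noteq> \<infinity>" for i
      by (subst emeasure_distr) auto
    show "emeasure (distr M lborel X) U = emeasure (density lborel (\<lambda>x. ennreal (dens x))) U" if "U \<in> ?E" for U
      using that emeasure_box_eq by auto
  qed
  then have "distributed M lborel X (\<lambda>x. ennreal (dens x))" by (auto simp: distributed_def)
  then show ?thesis using dens_C_infty dens_nonneg by (simp add: smooth_density_def)
qed

end

text \<open>Two continuous densities agree almost everywhere, hence everywhere, as a nonempty open set is not
  negligible.\<close>

lemma smooth_density_unique:
  assumes p: "smooth_density M X p" and p': "smooth_density M X p'"
  shows "p = (p' :: real^'d::finite \<Rightarrow> real)"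
proof -
  have c: "continuous_on UNIV p" "continuous_on UNIV p'" using p p' by (auto simp: smooth_density_def C_infty_continuous)
  then have [measurable]: "p \<in> borel_measurable borel" "p' \<in> borel_measurable borel" by (auto intro: borel_measurable_continuous_onI)
  have nn: "0 \<le> p x" "0 \<le> p' x" for x using p p' by (auto simp: smooth_density_def)
  have "density lborel (\<lambda>x. ennreal (p x)) = density lborel (\<lambda>x. ennreal (p' x))"
    using p p' by (simp add: smooth_density_def distributed_def)
  then have "AE x in lborel. ennreal (p x) = ennreal (p' x)" by (subst (asm) sigma_finite_measure.density_unique_iff[OF sigma_finite_lborel]) auto
  then have ae: "AE x in lborel. p x = p' x"
    by eventually_elim (simp add: nn)
  have "open {x. p x \<noteq> p' x}" using c by (intro open_Collect_neq)
  moreover have "negligible {x. p x \<noteq> p' x}"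
  proof -
    have "{x. p x \<noteq> p' x} \<in> null_sets lborel"
    proof (subst AE_iff_null_sets)
      show "{x. p x \<noteq> p' x} \<in> sets lborel" by measurable
      show "AE x in lborel. x \<notin> {x. p x \<noteq> p' x}" using ae by simp
    qed
    then show ?thesis by (simp add: negligible_iff_null_sets null_sets_completionI)
  qed
  ultimately have "{x. p x \<noteq> p' x} = {}" using open_not_negligible by blast
  then show ?thesis by auto
qed

subsection \<open>Comparison of two densities\<close>

text \<open>Fourier inversion of the difference. A number that is at most \<open>x\<close> and at most \<open>y\<close> is at most
  \<open>x\<close> to the power \<open>1 - \<epsilon>\<close> times \<open>y\<close> to the power \<open>\<epsilon>\<close>; the condition on \<open>N\<close> makes the power of \<open>1 + \<bar>\<theta>\<bar>\<close> in this product
  compensate the factor \<open>\<theta>\<^sup>\<alpha>\<close> and still leave \<open>decay\<close>.\<close>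

lemma density_difference_le:
  assumes A: "smooth_random_vector M X" and B: "smooth_random_vector M (Y :: 'w \<Rightarrow> real^'d::finite)"
    and p: "smooth_density M X p" and p': "smooth_density M Y p'"
    and eps: "0 < \<epsilon>" "\<epsilon> < 1" and a: "0 \<le> a" and b: "0 \<le> b"
    and da: "\<And>\<theta> t. \<bar>random_vector.chf M X \<theta> t - random_vector.chf M Y \<theta> t\<bar> \<le> a * (1 + norm \<theta>) ^ k"
    and db: "\<And>\<theta> t. \<bar>random_vector.chf M X \<theta> t - random_vector.chf M Y \<theta> t\<bar> \<le> b / (1 + norm \<theta>) ^ N"
    and N: "real (length \<alpha> + k + 2 * CARD('d)) \<le> \<epsilon> * real N"
  shows "\<bar>pds \<alpha> p x - pds \<alpha> p' x\<bar> \<le> ((gauss0 TYPE(real^'d))\<^sup>2 * (\<integral>\<theta>. decay (\<theta> :: real^'d) \<partial>lborel)) * (a powr (1 - \<epsilon>) * b powr \<epsilon>)"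
proof -
  interpret A: smooth_random_vector M X by fact
  interpret B: smooth_random_vector M Y by fact
  have pe: "p = A.dens" "p' = B.dens"
    using smooth_density_unique[OF p A.smooth_density_dens] smooth_density_unique[OF p' B.smooth_density_dens] by auto
  let ?K = "a powr (1 - \<epsilon>) * b powr \<epsilon>" let ?m = "length \<alpha>" let ?s = "- real (length \<alpha>) * (pi/2)"
  let ?D = "\<lambda>\<theta>. A.chf \<theta> (?s - inner \<theta> x) - B.chf \<theta> (?s - inner \<theta> x)"
  have pt: "\<bar>(\<Prod>i\<leftarrow>\<alpha>. \<theta>$i) * ?D \<theta>\<bar> \<le> ?K * decay \<theta>" for \<theta>
  proof (cases "?D \<theta> = 0")
    case True
    then show ?thesis using decay_nonneg[of \<theta>] by simp
  next
    case False
    let ?n = "1 + norm \<theta>"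
    note n = one_plus_norm_pos[of \<theta>]
    have D0: "0 < \<bar>?D \<theta>\<bar>" using False by simp
    have "\<bar>?D \<theta>\<bar> = \<bar>?D \<theta>\<bar> powr (1 - \<epsilon>) * \<bar>?D \<theta>\<bar> powr \<epsilon>" using D0 by (simp add: powr_add[symmetric])
    also have "\<dots> \<le> (a * ?n ^ k) powr (1 - \<epsilon>) * (b / ?n ^ N) powr \<epsilon>"
      using eps D0 da[of \<theta>] db[of \<theta>] by (intro mult_mono powr_mono2) auto
    also have "\<dots> = ?K * (?n powr (real k * (1 - \<epsilon>)) * ?n powr (- (real N * \<epsilon>)))"
    proof -
      have pw: "(?n ^ j) powr r = ?n powr (real j * r)" for j r using n(1) by (simp add: powr_realpow[symmetric] powr_powr)
      have "(b / ?n ^ N) powr \<epsilon> = b powr \<epsilon> * ?n powr (- (real N * \<epsilon>))"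
      proof -
        have "(b / ?n ^ N) powr \<epsilon> = b powr \<epsilon> / (?n ^ N) powr \<epsilon>" by (rule powr_divide)
        then show ?thesis by (simp only: pw powr_minus divide_inverse)
      qed
      moreover have "(a * ?n ^ k) powr (1 - \<epsilon>) = a powr (1 - \<epsilon>) * ?n powr (real k * (1 - \<epsilon>))"
        using a n(1) pw[of k "1 - \<epsilon>"] by (simp add: powr_mult)
      ultimately show ?thesis by (simp only: mult_ac)
    qed
    also have "\<dots> = ?K * ?n powr (real k * (1 - \<epsilon>) - real N * \<epsilon>)" using n by (simp add: powr_add[symmetric])
    finally have D: "\<bar>?D \<theta>\<bar> \<le> ?K * ?n powr (real k * (1 - \<epsilon>) - real N * \<epsilon>)" .
    have "\<bar>\<Prod>i\<leftarrow>\<alpha>. \<theta>$i\<bar> \<le> ?n ^ ?m" by (rule order_trans[OF abs_prod_component_le]) (intro power_mono, auto)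
    also have "\<dots> = ?n powr real ?m" by (rule powr_realpow[OF n(1), symmetric])
    finally have m: "\<bar>\<Prod>i\<leftarrow>\<alpha>. \<theta>$i\<bar> \<le> ?n powr real ?m" .
    have "\<bar>(\<Prod>i\<leftarrow>\<alpha>. \<theta>$i) * ?D \<theta>\<bar> \<le> ?n powr real ?m * (?K * ?n powr (real k * (1 - \<epsilon>) - real N * \<epsilon>))"
      unfolding abs_mult by (intro mult_mono m D) auto
    also have "\<dots> = ?K * ?n powr (real ?m + (real k * (1 - \<epsilon>) - real N * \<epsilon>))" by (simp add: powr_add)
    also have "\<dots> \<le> ?K * ?n powr (- real (2 * CARD('d)))"
    proof (intro mult_left_mono powr_mono)
      have "real k * (1 - \<epsilon>) \<le> real k" using eps by (simp add: mult_left_le)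
      then show "real ?m + (real k * (1 - \<epsilon>) - real N * \<epsilon>) \<le> - real (2 * CARD('d))" using N by (simp add: mult.commute)
    qed (use n in auto)
    also have "\<dots> = ?K * decay \<theta>" using n unfolding decay_def by (simp only: powr_minus powr_realpow divide_inverse mult_1)
    finally show ?thesis .
  qed
  have "A.fourier \<alpha> ?s x - B.fourier \<alpha> ?s x = (\<integral>\<theta>. (\<Prod>i\<leftarrow>\<alpha>. \<theta>$i) * ?D \<theta> \<partial>lborel)"
    unfolding A.fourier_def B.fourier_def right_diff_distrib
    by (rule Bochner_Integration.integral_diff[symmetric, OF A.fourier_integrable B.fourier_integrable])
  moreover have "\<bar>\<integral>\<theta>. (\<Prod>i\<leftarrow>\<alpha>. \<theta>$i) * ?D \<theta> \<partial>lborel\<bar> \<le> (\<integral>\<theta>. ?K * decay (\<theta> :: real^'d) \<partial>lborel)"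
  proof -
    have "integrable lborel (\<lambda>\<theta>. (\<Prod>i\<leftarrow>\<alpha>. \<theta>$i) * ?D \<theta>)"
      unfolding right_diff_distrib by (intro Bochner_Integration.integrable_diff A.fourier_integrable B.fourier_integrable)
    then have i: "integrable lborel (\<lambda>\<theta>. \<bar>(\<Prod>i\<leftarrow>\<alpha>. \<theta>$i) * ?D \<theta>\<bar>)" by (rule integrable_abs)
    have "(\<integral>\<theta>. \<bar>(\<Prod>i\<leftarrow>\<alpha>. \<theta>$i) * ?D \<theta>\<bar> \<partial>lborel) \<le> (\<integral>\<theta>. ?K * decay (\<theta> :: real^'d) \<partial>lborel)"
      by (rule integral_mono[OF i integrable_mult_right[OF decay_integrable] pt])
    then show ?thesis by (rule order_trans[OF integral_abs_bound])
  qed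
  ultimately have "\<bar>A.fourier \<alpha> ?s x - B.fourier \<alpha> ?s x\<bar> \<le> ?K * (\<integral>\<theta>. decay (\<theta> :: real^'d) \<partial>lborel)" by simp
  then have "(gauss0 TYPE(real^'d))\<^sup>2 * \<bar>A.fourier \<alpha> ?s x - B.fourier \<alpha> ?s x\<bar> \<le> (gauss0 TYPE(real^'d))\<^sup>2 * (?K * (\<integral>\<theta>. decay (\<theta> :: real^'d) \<partial>lborel))"
    by (intro mult_left_mono) auto
  moreover have "\<bar>pds \<alpha> p x - pds \<alpha> p' x\<bar> = (gauss0 TYPE(real^'d))\<^sup>2 * \<bar>A.fourier \<alpha> ?s x - B.fourier \<alpha> ?s x\<bar>"
    unfolding pe A.pds_dens B.pds_dens by (simp add: right_diff_distrib[symmetric] abs_mult)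
  ultimately show ?thesis by (simp add: mult_ac)
qed

section \<open>Regularisation of test functions\<close>

text \<open>The interface between the abstract framework and the analysis of laws on \<open>\<real>\<^sup>d\<close>.\<close>

definition ibp_upto :: "'w measure \<Rightarrow> ('w \<Rightarrow> real^'d::finite) \<Rightarrow> nat \<Rightarrow> real \<Rightarrow> bool" where
  "ibp_upto M X n b \<longleftrightarrow> (\<forall>\<alpha> f s. length \<alpha> \<le> n \<longrightarrow> f \<in> C_b_infty \<longrightarrow> (\<forall>x. \<bar>f x\<bar> \<le> s) \<longrightarrow>
     \<bar>\<integral>\<omega>. pds \<alpha> f (X \<omega>) \<partial>M\<bar> \<le> s * b)"

lemma ibp_uptoD:
  "ibp_upto M X n b \<Longrightarrow> length \<alpha> \<le> n \<Longrightarrow> f \<in> C_b_infty \<Longrightarrow> (\<And>x. \<bar>f x\<bar> \<le> s) \<Longrightarrow> \<bar>\<integral>\<omega>. pds \<alpha> f (X \<omega>) \<partial>M\<bar> \<le> s * b"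
  unfolding ibp_upto_def by blast

subsection \<open>Decay of characteristic functions\<close>

lemma one_plus_norm_power_le:
  fixes \<theta> :: "real^'d::finite"
  shows "(1 + norm \<theta>) ^ N \<le> (real CARD('d) + 1) ^ N * (1 + (\<Sum>i\<in>UNIV. \<bar>\<theta>$i\<bar> ^ N))"
proof -
  obtain i where i: "\<And>j. \<bar>\<theta>$j\<bar> \<le> \<bar>\<theta>$i\<bar>"
  proof -
    have "finite (range (\<lambda>j. \<bar>\<theta>$j\<bar>))" "range (\<lambda>j. \<bar>\<theta>$j\<bar>) \<noteq> {}" by auto
    from Max_in[OF this] Max_ge[OF this(1)] show ?thesis using that by (metis (mono_tags, lifting) imageE rangeI)
  qed
  let ?\<mu> = "max 1 \<bar>\<theta>$i\<bar>"
  have "norm \<theta> \<le> (\<Sum>j\<in>UNIV. \<bar>\<theta>$j\<bar>)" by (rule norm_le_l1_cart)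
  also have "\<dots> \<le> (\<Sum>j\<in>(UNIV::'d set). ?\<mu>)" by (intro sum_mono) (use i in \<open>auto simp: le_max_iff_disj\<close>)
  finally have "1 + norm \<theta> \<le> (real CARD('d) + 1) * ?\<mu>" by (simp add: distrib_right)
  then have "(1 + norm \<theta>) ^ N \<le> ((real CARD('d) + 1) * ?\<mu>) ^ N" by (intro power_mono) auto
  also have "\<dots> = (real CARD('d) + 1) ^ N * ?\<mu> ^ N" by (rule power_mult_distrib)
  also have "\<dots> \<le> (real CARD('d) + 1) ^ N * (1 + (\<Sum>i\<in>UNIV. \<bar>\<theta>$i\<bar> ^ N))"
  proof (intro mult_left_mono)
    have s: "\<bar>\<theta>$i\<bar> ^ N \<le> (\<Sum>i\<in>UNIV. \<bar>\<theta>$i\<bar> ^ N)" by (rule member_le_sum) auto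
    show "?\<mu> ^ N \<le> 1 + (\<Sum>i\<in>UNIV. \<bar>\<theta>$i\<bar> ^ N)"
    proof (cases "\<bar>\<theta>$i\<bar> \<le> 1")
      case True
      then show ?thesis by (simp add: max_def sum_nonneg)
    next
      case False
      then show ?thesis using s by (simp add: max_def)
    qed
  qed auto
  finally show ?thesis .
qed

context random_vector
begin

text \<open>Apply the bound to waves: \<open>N\<close> derivatives in the direction \<open>i\<close> produce the factor \<open>\<theta>\<^sub>i\<^sup>N\<close>.\<close>

lemma chf_decay:
  assumes I: "ibp_upto M X n b" and N: "N \<le> n"
  shows "\<bar>chf \<theta> t\<bar> \<le> (real CARD('d) + 1) ^ (N + 1) * b / (1 + norm \<theta>) ^ N"
proof -
  have one: "\<bar>\<theta>$i\<bar> ^ j * \<bar>chf \<theta> t\<bar> \<le> b" if "j \<le> N" for i j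
  proof -
    let ?f = "\<lambda>x. cos (inner \<theta> x + (t - real j * (pi/2)))"
    have eq: "pds (replicate j i) ?f = (\<lambda>x. \<theta>$i ^ j * cos (inner \<theta> x + t))"
      unfolding pds_wave by (simp add: prod_list_replicate)
    have "\<bar>\<integral>\<omega>. pds (replicate j i) ?f (X \<omega>) \<partial>M\<bar> \<le> 1 * b"
      by (rule ibp_uptoD[OF I _ wave_C_b_infty]) (use that N in auto)
    then show ?thesis unfolding eq by (simp add: chf_def abs_mult power_abs)
  qed
  have "(1 + norm \<theta>) ^ N * \<bar>chf \<theta> t\<bar> \<le> ((real CARD('d) + 1) ^ N * (1 + (\<Sum>i\<in>UNIV. \<bar>\<theta>$i\<bar> ^ N))) * \<bar>chf \<theta> t\<bar>"
    by (intro mult_right_mono one_plus_norm_power_le) auto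
  also have "\<dots> = (real CARD('d) + 1) ^ N * (\<bar>chf \<theta> t\<bar> + (\<Sum>i\<in>UNIV. \<bar>\<theta>$i\<bar> ^ N * \<bar>chf \<theta> t\<bar>))"
    by (simp add: algebra_simps sum_distrib_left)
  also have "\<dots> \<le> (real CARD('d) + 1) ^ N * (b + (\<Sum>i\<in>(UNIV::'d set). b))"
    using one[of 0] one[of N] by (intro mult_left_mono add_mono sum_mono) auto
  also have "\<dots> = (real CARD('d) + 1) ^ (N + 1) * b" by (simp add: algebra_simps)
  finally show ?thesis using zero_less_power[OF one_plus_norm_pos(1)[of \<theta>], of N] by (simp only: pos_le_divide_eq mult.commute)
qed

lemma smooth_random_vectorI:
  assumes "\<And>n. \<exists>b. ibp_upto M X n b" shows "smooth_random_vector M X"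
proof
  show "\<exists>C. \<forall>\<theta> t. \<bar>chf \<theta> t\<bar> \<le> C / (1 + norm \<theta>) ^ N" for N
    using assms[of N] chf_decay[of N _ N] by blast
qed

end

subsection \<open>Convolution with a super kernel\<close>

text \<open>The summand \<open>1\<close> makes the constant positive without an argument that the kernel does not vanish.\<close>

definition kernel_norm :: "(real^'d::finite \<Rightarrow> real) \<Rightarrow> nat \<Rightarrow> real" where
  "kernel_norm \<phi> l = (\<Sum>\<beta> | length \<beta> = l. \<integral>y. \<bar>pds \<beta> \<phi> y\<bar> \<partial>lborel) + 1"

definition kernel_moment :: "(real^'d::finite \<Rightarrow> real) \<Rightarrow> nat \<Rightarrow> real" where
  "kernel_moment \<phi> N = (\<integral>y. norm y ^ N * \<bar>\<phi> y\<bar> \<partial>lborel)"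

definition mollify :: "(real^'d::finite \<Rightarrow> real) \<Rightarrow> real \<Rightarrow> (real^'d \<Rightarrow> real) \<Rightarrow> real^'d \<Rightarrow> real" where
  "mollify \<phi> \<delta> f x = (\<integral>y. \<phi> y * f (x + (- \<delta>) *\<^sub>R y) \<partial>lborel)"

context
  fixes \<phi> :: "real^'d::finite \<Rightarrow> real"
  assumes \<phi>: "super_kernel \<phi>"
begin

lemma kernel_C_infty: "\<phi> \<in> C_infty"
  using \<phi> by (auto simp: super_kernel_def schwartz_def)

lemma pds_kernel_measurable [measurable]: "pds \<beta> \<phi> \<in> borel_measurable borel"
  by (rule C_infty_measurable[OF C_infty_pds[OF kernel_C_infty]])

lemma kernel_measurable [measurable]: "\<phi> \<in> borel_measurable borel"
  by (rule C_infty_measurable[OF kernel_C_infty])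

lemma kernel_moment_integrable: "integrable lborel (\<lambda>y. norm y ^ N * \<bar>\<phi> y\<bar>)"
proof -
  have "\<forall>m \<beta>. integrable lborel (\<lambda>y. norm y ^ m * \<bar>pds \<beta> \<phi> y\<bar>)" using \<phi> by (simp add: super_kernel_def)
  from this[rule_format, of N "[]"] show ?thesis by simp
qed

lemma pds_kernel_integrable: "integrable lborel (pds \<beta> \<phi>)"
proof -
  have "\<forall>m \<beta>. integrable lborel (\<lambda>y. norm y ^ m * \<bar>pds \<beta> \<phi> y\<bar>)" using \<phi> by (simp add: super_kernel_def)
  from this[rule_format, of 0 \<beta>] have "integrable lborel (\<lambda>y. \<bar>pds \<beta> \<phi> y\<bar>)" by simp
  then show ?thesis by (rule integrable_abs_cancel) measurable
qed

lemma kernel_integrable: "integrable lborel \<phi>"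
  using pds_kernel_integrable[of "[]"] by simp

lemma kernel_norm_pos: "1 \<le> kernel_norm \<phi> l"
  unfolding kernel_norm_def by (simp add: sum_nonneg)

lemma kernel_moment_nonneg: "0 \<le> kernel_moment \<phi> N"
  unfolding kernel_moment_def by simp

lemma mollify:
  assumes "f \<in> C_b_infty"
  shows "mollify \<phi> \<delta> f \<in> C_b_infty" "pds \<beta> (mollify \<phi> \<delta> f) x = (\<integral>y. \<phi> y * pds \<beta> f (x + (- \<delta>) *\<^sub>R y) \<partial>lborel)"
  unfolding mollify_def[abs_def] by (rule average_of_translates[OF assms kernel_integrable]; measurable)+

lemma mollify_by_parts_step:
  assumes g: "g \<in> C_b_infty" and d: "\<delta> > 0" and \<psi>: "\<psi> = pds \<gamma> \<phi>"
  shows "(\<integral>y. \<psi> y * pd i g (x + (- \<delta>) *\<^sub>R y) \<partial>lborel) = (1 / \<delta>) * (\<integral>y. pd i \<psi> y * g (x + (- \<delta>) *\<^sub>R y) \<partial>lborel)"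
proof -
  let ?h = "\<lambda>y. \<psi> y * g (x + (- \<delta>) *\<^sub>R y)"
  have \<psi>C: "\<psi> \<in> C_infty" unfolding \<psi> by (rule C_infty_pds[OF kernel_C_infty])
  have i: "integrable lborel \<psi>" "integrable lborel (pd i \<psi>)"
    unfolding \<psi> using pds_kernel_integrable[of \<gamma>] pds_kernel_integrable[of "i # \<gamma>"] by simp_all
  have gd: "((\<lambda>y. g (x + (- \<delta>) *\<^sub>R y)) has_derivative (\<lambda>h. \<Sum>j\<in>UNIV. ((- \<delta>) *\<^sub>R h)$j * pd j g (x + (- \<delta>) *\<^sub>R y))) (at y)" for y
    by (rule has_derivative_pd_compose[OF C_b_infty_differentiable[OF g]]) (auto intro!: derivative_eq_intros)
  then have gdiff: "(\<lambda>y. g (x + (- \<delta>) *\<^sub>R y)) differentiable (at y)" for y using differentiable_def by blast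
  have gpd: "pd i (\<lambda>y. g (x + (- \<delta>) *\<^sub>R y)) y = - \<delta> * pd i g (x + (- \<delta>) *\<^sub>R y)" for y
    by (subst pd_eqI[OF gd]) (simp add: axis_def if_distrib[of "\<lambda>x. x * _"] if_distrib[of "\<lambda>x. _ * x"] sum_negf cong: if_cong)
  have pdh: "pd i ?h = (\<lambda>y. \<psi> y * (- \<delta> * pd i g (x + (- \<delta>) *\<^sub>R y)) + pd i \<psi> y * g (x + (- \<delta>) *\<^sub>R y))"
    by (rule ext) (simp only: pd_mult[OF C_infty_differentiable[OF \<psi>C] gdiff] gpd)
  have I1: "integrable lborel (\<lambda>y. \<psi> y * pd i g (x + (- \<delta>) *\<^sub>R y))"
    by (rule integrable_translate_mult[OF C_b_infty_pd[OF g] i(1)]) measurable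
  have I2: "integrable lborel (\<lambda>y. pd i \<psi> y * g (x + (- \<delta>) *\<^sub>R y))"
    by (rule integrable_translate_mult[OF g i(2)]) measurable
  have I1': "integrable lborel (\<lambda>y. \<psi> y * (- \<delta> * pd i g (x + (- \<delta>) *\<^sub>R y)))"
    using integrable_mult_right[OF I1, of "- \<delta>"] by (simp add: mult_ac)
  have "(\<integral>y. pd i ?h y \<partial>lborel) = 0"
  proof (rule integral_pd_eq_0)
    show "?h differentiable (at y)" for y by (intro differentiable_mult C_infty_differentiable[OF \<psi>C] gdiff)
    show "integrable lborel ?h" by (rule integrable_translate_mult[OF g i(1)]) measurable
    show "integrable lborel (pd i ?h)" unfolding pdh by (intro Bochner_Integration.integrable_add I1' I2)
    have cg: "continuous_on UNIV (\<lambda>y. g' (x + (- \<delta>) *\<^sub>R y))" if "g' \<in> C_b_infty" for g'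
      by (rule continuous_on_compose2[OF C_infty_continuous[OF C_b_infty_C_infty[OF that]]]) (auto intro!: continuous_intros)
    show "continuous_on UNIV (pd i ?h)" unfolding pdh
      by (intro continuous_intros cg g C_b_infty_pd C_infty_continuous C_infty_pd \<psi>C)
  qed
  then have "0 = (\<integral>y. \<psi> y * (- \<delta> * pd i g (x + (- \<delta>) *\<^sub>R y)) \<partial>lborel) + (\<integral>y. pd i \<psi> y * g (x + (- \<delta>) *\<^sub>R y) \<partial>lborel)"
    unfolding pdh by (subst (asm) Bochner_Integration.integral_add[OF I1' I2]) simp
  also have "(\<integral>y. \<psi> y * (- \<delta> * pd i g (x + (- \<delta>) *\<^sub>R y)) \<partial>lborel) = - \<delta> * (\<integral>y. \<psi> y * pd i g (x + (- \<delta>) *\<^sub>R y) \<partial>lborel)"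
    by (subst integral_mult_right_zero[symmetric]) (simp add: mult_ac)
  finally show ?thesis using d by (simp add: field_simps)
qed

text \<open>The derivatives are moved from \<open>f\<close> to the kernel, at the price of a factor \<open>1 / \<delta>\<close> each. They are taken off
  the word \<open>\<beta>\<close> from the outside and arrive at the kernel in reverse order.\<close>

lemma mollify_by_parts:
  assumes f: "f \<in> C_b_infty" and d: "\<delta> > 0"
  shows "(\<integral>y. pds \<gamma> \<phi> y * pds \<beta> f (x + (- \<delta>) *\<^sub>R y) \<partial>lborel) = (1 / \<delta>) ^ length \<beta> * (\<integral>y. pds (rev \<beta> @ \<gamma>) \<phi> y * f (x + (- \<delta>) *\<^sub>R y) \<partial>lborel)"
proof (induction \<beta> arbitrary: \<gamma>)
  case (Cons i \<beta>)
  have "(\<integral>y. pds \<gamma> \<phi> y * pds (i # \<beta>) f (x + (- \<delta>) *\<^sub>R y) \<partial>lborel) = (1 / \<delta>) * (\<integral>y. pds (i # \<gamma>) \<phi> y * pds \<beta> f (x + (- \<delta>) *\<^sub>R y) \<partial>lborel)"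
    using mollify_by_parts_step[OF C_b_infty_pds[OF f, of \<beta>] d refl, of \<gamma> i x] by simp
  also have "\<dots> = (1 / \<delta>) * ((1 / \<delta>) ^ length \<beta> * (\<integral>y. pds (rev \<beta> @ i # \<gamma>) \<phi> y * f (x + (- \<delta>) *\<^sub>R y) \<partial>lborel))"
    by (simp only: Cons)
  finally show ?case by simp
qed simp

lemma pds_mollify_le:
  assumes f: "f \<in> C_b_infty" and s: "\<And>x. \<bar>f x\<bar> \<le> s" and d: "\<delta> > 0"
  shows "\<bar>pds \<beta> (mollify \<phi> \<delta> f) x\<bar> \<le> (1 / \<delta>) ^ length \<beta> * (kernel_norm \<phi> (length \<beta>) * s)"
proof -
  have s0: "0 \<le> s" using s[of 0] by simp
  have "pds \<beta> (mollify \<phi> \<delta> f) x = (1 / \<delta>) ^ length \<beta> * (\<integral>y. pds (rev \<beta>) \<phi> y * f (x + (- \<delta>) *\<^sub>R y) \<partial>lborel)"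
    unfolding mollify(2)[OF f] using mollify_by_parts[OF f d, of "[]" \<beta> x] by simp
  moreover have "\<bar>\<integral>y. pds (rev \<beta>) \<phi> y * f (x + (- \<delta>) *\<^sub>R y) \<partial>lborel\<bar> \<le> (\<integral>y. \<bar>pds (rev \<beta>) \<phi> y\<bar> \<partial>lborel) * s"
    by (rule average_of_translates_aux(3)[OF f pds_kernel_integrable _ s]) measurable
  moreover have "(\<integral>y. \<bar>pds (rev \<beta>) \<phi> y\<bar> \<partial>lborel) \<le> kernel_norm \<phi> (length \<beta>)"
  proof -
    have "(\<integral>y. \<bar>pds (rev \<beta>) \<phi> y\<bar> \<partial>lborel) \<le> (\<Sum>\<gamma> | length \<gamma> = length \<beta>. \<integral>y. \<bar>pds \<gamma> \<phi> y\<bar> \<partial>lborel)"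
      by (rule member_le_sum[of "rev \<beta>"]) auto
    then show ?thesis by (simp add: kernel_norm_def)
  qed
  ultimately have "\<bar>\<integral>y. pds (rev \<beta>) \<phi> y * f (x + (- \<delta>) *\<^sub>R y) \<partial>lborel\<bar> \<le> kernel_norm \<phi> (length \<beta>) * s"
    "pds \<beta> (mollify \<phi> \<delta> f) x = (1 / \<delta>) ^ length \<beta> * (\<integral>y. pds (rev \<beta>) \<phi> y * f (x + (- \<delta>) *\<^sub>R y) \<partial>lborel)"
    using s0 mult_right_mono order_trans by blast+
  then show ?thesis using d by (simp add: abs_mult mult_left_mono)
qed

text \<open>Put \<open>G z = E (\<partial>\<^sup>\<alpha> f(X + z))\<close>. By integration by parts, its derivatives of order at most \<open>N\<close> are bounded by
  \<open>s b\<close>, although those of \<open>f\<close> itself may be arbitrarily large. The error is \<open>G 0 - \<integral> \<phi> y G (- \<delta> y) dy\<close>, and in the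
  Taylor expansion of \<open>G\<close> all terms of order \<open>1, \<dots>, N - 1\<close> vanish because the kernel has no moments.\<close>

lemma mollification_error:
  assumes M: "random_vector M X" and I: "ibp_upto M X n b" and n: "length \<alpha> + N \<le> n" "1 \<le> N"
    and f: "f \<in> C_b_infty" and s: "\<And>x. \<bar>f x\<bar> \<le> s" and d: "\<delta> > 0"
  shows "\<bar>(\<integral>\<omega>. pds \<alpha> f (X \<omega>) \<partial>M) - (\<integral>\<omega>. pds \<alpha> (mollify \<phi> \<delta> f) (X \<omega>) \<partial>M)\<bar> \<le> s * (real CARD('d) ^ N * kernel_moment \<phi> N * (\<delta> ^ N * b))"
proof -
  interpret random_vector M X by fact
  let ?g = "pds \<alpha> f"
  define G where "G z = (\<integral>\<omega>. 1 * ?g (z + X \<omega>) \<partial>M)" for z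
  have g: "?g \<in> C_b_infty" by (rule C_b_infty_pds[OF f])
  have GC: "G \<in> C_b_infty" and pdsG: "\<And>\<beta> z. pds \<beta> G z = (\<integral>\<omega>. 1 * pds \<beta> ?g (z + X \<omega>) \<partial>M)"
    unfolding G_def[abs_def] by (rule average_of_translates[OF g]; simp)+
  have Gb: "\<bar>pds \<beta> G z\<bar> \<le> s * b" if "length \<beta> \<le> N" for \<beta> z
  proof -
    have "pds (\<beta> @ \<alpha>) (\<lambda>x. f (x + z)) = (\<lambda>x. pds (\<beta> @ \<alpha>) f (x + z))" by (rule pds_translate[OF C_b_infty_C_infty[OF f]])
    then have "pds \<beta> G z = (\<integral>\<omega>. pds (\<beta> @ \<alpha>) (\<lambda>x. f (x + z)) (X \<omega>) \<partial>M)" unfolding pdsG by (simp add: pds_append add.commute)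
    also have "\<bar>\<dots>\<bar> \<le> s * b" by (rule ibp_uptoD[OF I _ C_b_infty_translate[OF f] s]) (use n that in auto)
    finally show ?thesis .
  qed
  have sb: "0 \<le> s * b" using Gb[of "[]" 0] by simp
  have Gm: "G \<in> borel_measurable borel" by (rule C_b_infty_measurable[OF GC])
  interpret P: pair_sigma_finite "lborel :: (real^'d) measure" M ..
  obtain K where K: "\<And>x. \<bar>?g x\<bar> \<le> K" using C_b_infty_bound[OF g] by metis
  have [measurable]: "?g \<in> borel_measurable borel" by (rule C_b_infty_measurable[OF g])
  let ?F = "\<lambda>(y, \<omega>). \<phi> y * ?g (X \<omega> + (- \<delta>) *\<^sub>R y)"
  have int: "integrable (lborel \<Otimes>\<^sub>M M) ?F"
  proof (rule Bochner_Integration.integrable_bound)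
    show "integrable (lborel \<Otimes>\<^sub>M M) (\<lambda>(y, \<omega>). K * \<phi> y)"
    proof (rule P.Fubini_integrable)
      show "integrable lborel (\<lambda>y. \<integral>\<omega>. norm (case (y, \<omega>) of (y, \<omega>) \<Rightarrow> K * \<phi> y) \<partial>M)"
        using kernel_integrable by (simp add: prob_space abs_mult)
    qed (auto simp: split_beta')
    show "?F \<in> borel_measurable (lborel \<Otimes>\<^sub>M M)" by measurable
    have "\<bar>\<phi> y * ?g x\<bar> \<le> \<bar>K * \<phi> y\<bar>" for x y
    proof -
      have "\<bar>\<phi> y\<bar> * \<bar>?g x\<bar> \<le> \<bar>\<phi> y\<bar> * \<bar>K\<bar>" using K[of x] by (intro mult_left_mono) auto
      then show ?thesis by (simp only: abs_mult mult.commute[of "\<bar>K\<bar>"])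
    qed
    then show "AE x in lborel \<Otimes>\<^sub>M M. norm (?F x) \<le> norm (case x of (y, \<omega>) \<Rightarrow> K * \<phi> y)"
      by (intro AE_I2) (auto simp: split_beta)
  qed
  have "(\<integral>\<omega>. pds \<alpha> (mollify \<phi> \<delta> f) (X \<omega>) \<partial>M) = (\<integral>\<omega>. (\<integral>y. \<phi> y * ?g (X \<omega> + (- \<delta>) *\<^sub>R y) \<partial>lborel) \<partial>M)"
    by (simp only: mollify(2)[OF f])
  also have "\<dots> = (\<integral>y. (\<integral>\<omega>. \<phi> y * ?g (X \<omega> + (- \<delta>) *\<^sub>R y) \<partial>M) \<partial>lborel)"
    using P.Fubini_integral[of "\<lambda>y \<omega>. \<phi> y * ?g (X \<omega> + (- \<delta>) *\<^sub>R y)"] int by simp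
  also have "\<dots> = (\<integral>y. \<phi> y * G (0 + (- \<delta>) *\<^sub>R y) \<partial>lborel)" by (simp add: G_def add.commute)
  finally have moll: "(\<integral>\<omega>. pds \<alpha> (mollify \<phi> \<delta> f) (X \<omega>) \<partial>M) = (\<integral>y. \<phi> y * G (0 + (- \<delta>) *\<^sub>R y) \<partial>lborel)" .
  let ?S = "\<lambda>n. {\<beta> :: 'd list. length \<beta> = n}"
  let ?mon = "\<lambda>\<beta> y. \<Prod>i\<leftarrow>\<beta>. ((- \<delta>) *\<^sub>R y)$i"
  have mon: "?mon \<beta> y = (- \<delta>) ^ length \<beta> * (\<Prod>i\<leftarrow>\<beta>. y$i)" for \<beta> and y :: "real^'d"
    by (induction \<beta>) (auto simp: mult_ac)
  have mon_int: "integrable lborel (\<lambda>y. \<phi> y * (?mon \<beta> y * c))" for \<beta> c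
  proof (rule Bochner_Integration.integrable_bound)
    show "integrable lborel (\<lambda>y. (\<delta> ^ length \<beta> * \<bar>c\<bar>) * (norm y ^ length \<beta> * \<bar>\<phi> y\<bar>))" by (intro integrable_mult_right kernel_moment_integrable)
    show "(\<lambda>y. \<phi> y * (?mon \<beta> y * c)) \<in> borel_measurable lborel" unfolding mon by measurable
    have "\<bar>\<phi> y * (?mon \<beta> y * c)\<bar> \<le> (\<delta> ^ length \<beta> * \<bar>c\<bar>) * (norm y ^ length \<beta> * \<bar>\<phi> y\<bar>)" for y
    proof -
      have "\<bar>\<phi> y * (?mon \<beta> y * c)\<bar> = (\<delta> ^ length \<beta> * \<bar>c\<bar> * \<bar>\<phi> y\<bar>) * \<bar>\<Prod>i\<leftarrow>\<beta>. y$i\<bar>"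
        unfolding mon using d by (simp add: abs_mult power_abs mult_ac)
      also have "\<dots> \<le> (\<delta> ^ length \<beta> * \<bar>c\<bar> * \<bar>\<phi> y\<bar>) * norm y ^ length \<beta>"
        using d by (intro mult_left_mono abs_prod_component_le) auto
      finally show ?thesis by (simp add: mult_ac)
    qed
    then show "AE y in lborel. norm (\<phi> y * (?mon \<beta> y * c)) \<le> norm ((\<delta> ^ length \<beta> * \<bar>c\<bar>) * (norm y ^ length \<beta> * \<bar>\<phi> y\<bar>))"
      by (intro AE_I2) (auto intro: order_trans[OF _ abs_ge_self])
  qed
  have mon0: "(\<integral>y. \<phi> y * (?mon \<beta> y * c) \<partial>lborel) = (if \<beta> = [] then c else 0)" for \<beta> c
  proof -
    have "(\<integral>y. \<phi> y * (?mon \<beta> y * c) \<partial>lborel) = (\<integral>y. (c * (- \<delta>) ^ length \<beta>) * ((\<Prod>i\<leftarrow>\<beta>. y$i) * \<phi> y) \<partial>lborel)"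
      unfolding mon by (simp add: mult_ac)
    also have "\<dots> = (c * (- \<delta>) ^ length \<beta>) * (\<integral>y. (\<Prod>i\<leftarrow>\<beta>. y$i) * \<phi> y \<partial>lborel)" by (rule integral_mult_right_zero)
    also have "\<dots> = (if \<beta> = [] then c else 0)"
      using \<phi> by (cases "\<beta> = []") (auto simp: super_kernel_def)
    finally show ?thesis .
  qed
  define Pol where "Pol y = (\<Sum>j<N. (1 / fact j) * (\<Sum>\<beta>\<in>?S j. ?mon \<beta> y * pds \<beta> G 0))" for y
  have phiPol: "\<phi> y * Pol y = (\<Sum>j<N. (1 / fact j) * (\<Sum>\<beta>\<in>?S j. \<phi> y * (?mon \<beta> y * pds \<beta> G 0)))" for y
    unfolding Pol_def by (simp only: sum_distrib_left mult.left_commute[of "\<phi> y"])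
  have Pol_int: "integrable lborel (\<lambda>y. \<phi> y * Pol y)"
    unfolding phiPol by (intro Bochner_Integration.integrable_sum integrable_mult_right mon_int)
  have "(\<integral>y. \<phi> y * Pol y \<partial>lborel) = (\<Sum>j<N. (1 / fact j) * (\<Sum>\<beta>\<in>?S j. if \<beta> = [] then pds \<beta> G 0 else 0))"
    unfolding phiPol
    by (subst Bochner_Integration.integral_sum, intro integrable_mult_right Bochner_Integration.integrable_sum mon_int,
        subst integral_mult_right_zero, subst Bochner_Integration.integral_sum, rule mon_int, simp only: mon0)
  also have "\<dots> = (\<Sum>j<N. if j = 0 then G 0 else 0)"
  proof (rule sum.cong[OF refl])
    fix j assume "j \<in> {..<N}"
    show "(1 / fact j) * (\<Sum>\<beta>\<in>?S j. if \<beta> = [] then pds \<beta> G 0 else 0) = (if j = 0 then G 0 else 0)"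
      by (cases "j = 0") (auto intro!: sum.neutral)
  qed
  also have "\<dots> = G 0" using n by simp
  finally have Pol_integral: "(\<integral>y. \<phi> y * Pol y \<partial>lborel) = G 0" .
  have G_int: "integrable lborel (\<lambda>y. \<phi> y * G (0 + (- \<delta>) *\<^sub>R y))"
    by (rule integrable_translate_mult[OF GC kernel_integrable]) measurable
  have rem: "\<bar>\<phi> y * Pol y - \<phi> y * G (0 + (- \<delta>) *\<^sub>R y)\<bar> \<le> (s * (real CARD('d) ^ N * (\<delta> ^ N * b))) * (norm y ^ N * \<bar>\<phi> y\<bar>)" for y
  proof -
    obtain t where "G (0 + (- \<delta>) *\<^sub>R y) = Pol y + (1 / fact N) * (\<Sum>\<beta>\<in>?S N. ?mon \<beta> y * pds \<beta> G (0 + t *\<^sub>R ((- \<delta>) *\<^sub>R y)))"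
      using taylor_multi_index[OF C_b_infty_C_infty[OF GC], of 0 "(- \<delta>) *\<^sub>R y" N] unfolding Pol_def by blast
    then have "\<bar>Pol y - G (0 + (- \<delta>) *\<^sub>R y)\<bar> = (1 / fact N) * \<bar>\<Sum>\<beta>\<in>?S N. ?mon \<beta> y * pds \<beta> G (0 + t *\<^sub>R ((- \<delta>) *\<^sub>R y))\<bar>"
      by (simp add: abs_mult)
    also have "\<dots> \<le> 1 * (\<Sum>\<beta>\<in>?S N. norm ((- \<delta>) *\<^sub>R y) ^ N * (s * b))"
    proof (intro mult_mono order_trans[OF sum_abs] sum_mono)
      fix \<beta> :: "'d list" assume b: "\<beta> \<in> ?S N"
      have 1: "\<bar>?mon \<beta> y\<bar> \<le> norm ((- \<delta>) *\<^sub>R y) ^ N"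
        using abs_prod_component_le[of "(- \<delta>) *\<^sub>R y" \<beta>] b by (simp only: mem_Collect_eq)
      show "\<bar>?mon \<beta> y * pds \<beta> G (0 + t *\<^sub>R ((- \<delta>) *\<^sub>R y))\<bar> \<le> norm ((- \<delta>) *\<^sub>R y) ^ N * (s * b)"
        unfolding abs_mult by (rule mult_mono[OF 1 Gb]) (use b in auto)
    qed (auto intro: sum_nonneg)
    also have "\<dots> = real CARD('d) ^ N * ((\<delta> * norm y) ^ N * (s * b))"
      using card_lists_length_eq[of "UNIV :: 'd set" N] d by simp
    finally have "\<bar>Pol y - G (0 + (- \<delta>) *\<^sub>R y)\<bar> \<le> (s * (real CARD('d) ^ N * (\<delta> ^ N * b))) * norm y ^ N" by (simp add: power_mult_distrib mult_ac)
    then have "\<bar>\<phi> y\<bar> * \<bar>Pol y - G (0 + (- \<delta>) *\<^sub>R y)\<bar> \<le> \<bar>\<phi> y\<bar> * ((s * (real CARD('d) ^ N * (\<delta> ^ N * b))) * norm y ^ N)" by (rule mult_left_mono) simp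
    then show ?thesis by (simp add: abs_mult[symmetric] right_diff_distrib mult_ac)
  qed
  have "(\<integral>\<omega>. ?g (X \<omega>) \<partial>M) = G 0" by (simp add: G_def)
  then have "(\<integral>\<omega>. ?g (X \<omega>) \<partial>M) - (\<integral>\<omega>. pds \<alpha> (mollify \<phi> \<delta> f) (X \<omega>) \<partial>M) = (\<integral>y. \<phi> y * Pol y - \<phi> y * G (0 + (- \<delta>) *\<^sub>R y) \<partial>lborel)"
    unfolding moll by (simp only: Bochner_Integration.integral_diff[OF Pol_int G_int] Pol_integral)
  moreover have "\<bar>\<integral>y. \<phi> y * Pol y - \<phi> y * G (0 + (- \<delta>) *\<^sub>R y) \<partial>lborel\<bar> \<le> (\<integral>y. \<bar>\<phi> y * Pol y - \<phi> y * G (0 + (- \<delta>) *\<^sub>R y)\<bar> \<partial>lborel)"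
    by (rule integral_abs_bound)
  moreover have "\<dots> \<le> (\<integral>y. (s * (real CARD('d) ^ N * (\<delta> ^ N * b))) * (norm y ^ N * \<bar>\<phi> y\<bar>) \<partial>lborel)"
    by (rule integral_mono[OF integrable_abs[OF Bochner_Integration.integrable_diff[OF Pol_int G_int]] integrable_mult_right[OF kernel_moment_integrable] rem])
  moreover have "\<dots> = s * (real CARD('d) ^ N * kernel_moment \<phi> N * (\<delta> ^ N * b))"
    by (simp only: integral_mult_right_zero kernel_moment_def) (simp only: mult_ac)
  ultimately show ?thesis by linarith
qed

end

subsection \<open>Test functions\<close>

lemma C_b_infty_C_k: "f \<in> C_b_infty \<Longrightarrow> f \<in> C_k k"
  using C_infty_continuous[OF C_infty_pds[OF C_b_infty_C_infty]]
  unfolding C_k_def by (auto simp: C_infty_def C_b_infty_def)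

text \<open>The test function is normalised by dividing by \<open>d\<^sup>k c\<close>, as there are \<open>d\<^sup>k\<close> words of length \<open>k\<close>. When \<open>c = 0\<close>
  this is impossible, so slightly larger bounds are used first.\<close>

lemma d_k_bound:
  fixes X Y :: "'w \<Rightarrow> real^'d::finite"
  assumes D: "d_k M k X Y \<le> ennreal D" "0 \<le> D" and f: "f \<in> C_b_infty" and c: "\<And>\<beta> x. length \<beta> = k \<Longrightarrow> \<bar>pds \<beta> f x\<bar> \<le> c"
  shows "\<bar>(\<integral>\<omega>. f (X \<omega>) \<partial>M) - (\<integral>\<omega>. f (Y \<omega>) \<partial>M)\<bar> \<le> real CARD('d) ^ k * c * D"
proof -
  have step: "\<bar>(\<integral>\<omega>. f (X \<omega>) \<partial>M) - (\<integral>\<omega>. f (Y \<omega>) \<partial>M)\<bar> \<le> real CARD('d) ^ k * c' * D"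
    if c': "c' > 0" "\<And>\<beta> x. length \<beta> = k \<Longrightarrow> \<bar>pds \<beta> f x\<bar> \<le> c'" for c'
  proof -
    let ?a = "1 / (real CARD('d) ^ k * c')"
    have a0: "real CARD('d) ^ k * c' > 0" using c' by simp
    let ?h = "\<lambda>x. ?a * f x"
    have h: "?h \<in> C_b_infty" by (rule C_b_infty_cmult[OF f])
    have "(\<Sum>\<alpha>\<in>{\<alpha>::'d list. length \<alpha> = k}. supnorm (pds \<alpha> ?h)) \<le> (\<Sum>\<alpha>\<in>{\<alpha>::'d list. length \<alpha> = k}. ennreal (1 / real CARD('d) ^ k))"
    proof (rule sum_mono)
      fix \<alpha> :: "'d list" assume "\<alpha> \<in> {\<alpha>. length \<alpha> = k}"
      then have "\<bar>?a * pds \<alpha> f x\<bar> \<le> ?a * c'" for x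
        unfolding abs_mult using c'(2)[of \<alpha> x] a0 by (intro mult_mono) auto
      moreover have "?a * c' = 1 / real CARD('d) ^ k" using c' by simp
      ultimately show "supnorm (pds \<alpha> ?h) \<le> ennreal (1 / real CARD('d) ^ k)"
        unfolding supnorm_def pds_cmult[OF C_b_infty_C_infty[OF f]] by (intro SUP_least ennreal_leI) simp
    qed
    also have "\<dots> = ennreal 1"
    proof -
      have "(\<Sum>\<alpha>\<in>{\<alpha>::'d list. length \<alpha> = k}. ennreal (1 / real CARD('d) ^ k)) = ennreal (\<Sum>\<alpha>\<in>{\<alpha>::'d list. length \<alpha> = k}. 1 / real CARD('d) ^ k)" by (rule sum_ennreal) simp
      also have "(\<Sum>\<alpha>\<in>{\<alpha>::'d list. length \<alpha> = k}. 1 / real CARD('d) ^ k) = 1" using card_lists_length_eq[of "UNIV :: 'd set" k] by simp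
      finally show ?thesis .
    qed
    finally have sum: "(\<Sum>\<alpha>\<in>{\<alpha>::'d list. length \<alpha> = k}. supnorm (pds \<alpha> ?h)) \<le> 1" by (simp only: ennreal_1)
    have "?h \<in> (if k = 0 then borel_measurable borel else C_k k)"
    proof (cases "k = 0")
      case True
      show ?thesis unfolding if_P[OF True] by (rule C_b_infty_measurable[OF h])
    next
      case False
      show ?thesis unfolding if_not_P[OF False] by (rule C_b_infty_C_k[OF h])
    qed
    with sum have "?h \<in> test_functions k" by (simp only: test_functions_def mem_Collect_eq)
    then have "ennreal \<bar>(\<integral>\<omega>. ?h (X \<omega>) \<partial>M) - (\<integral>\<omega>. ?h (Y \<omega>) \<partial>M)\<bar> \<le> d_k M k X Y"
      unfolding d_k_def by (rule SUP_upper2) simp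
    then have "\<bar>(\<integral>\<omega>. ?h (X \<omega>) \<partial>M) - (\<integral>\<omega>. ?h (Y \<omega>) \<partial>M)\<bar> \<le> D"
      using order_trans[OF _ D(1)] ennreal_le_iff[OF D(2)] by blast
    moreover have "(\<integral>\<omega>. ?h (X \<omega>) \<partial>M) - (\<integral>\<omega>. ?h (Y \<omega>) \<partial>M) = ?a * ((\<integral>\<omega>. f (X \<omega>) \<partial>M) - (\<integral>\<omega>. f (Y \<omega>) \<partial>M))"
      by (simp only: integral_mult_right_zero right_diff_distrib)
    ultimately have "?a * \<bar>(\<integral>\<omega>. f (X \<omega>) \<partial>M) - (\<integral>\<omega>. f (Y \<omega>) \<partial>M)\<bar> \<le> D" using c'(1) by (simp add: abs_mult)
    then show ?thesis using a0 by (simp add: divide_le_eq mult.commute)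
  qed
  have c0: "0 \<le> c" by (rule order_trans[OF abs_ge_zero c[of "replicate k undefined" 0]]) simp
  let ?z = "\<bar>(\<integral>\<omega>. f (X \<omega>) \<partial>M) - (\<integral>\<omega>. f (Y \<omega>) \<partial>M)\<bar>"
  have le: "?z \<le> real CARD('d) ^ k * (c + 1 / real (Suc j)) * D" for j
  proof (rule step)
    show "0 < c + 1 / real (Suc j)" using c0 by (intro add_nonneg_pos) auto
    show "\<bar>pds \<beta> f x\<bar> \<le> c + 1 / real (Suc j)" if "length \<beta> = k" for \<beta> x
      using c[OF that, of x] by (rule order_trans) simp
  qed
  have lim: "(\<lambda>j. real CARD('d) ^ k * (c + 1 / real (Suc j)) * D) \<longlonglongrightarrow> real CARD('d) ^ k * (c + 0) * D"
    by (intro tendsto_intros LIMSEQ_Suc[OF lim_const_over_n])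
  have "?z \<le> real CARD('d) ^ k * (c + 0) * D" by (rule LIMSEQ_le_const[OF lim]) (intro exI allI impI le)
  then show ?thesis by simp
qed

section \<open>Interpolation\<close>

text \<open>The optimal parameter is \<open>\<delta> = (D / b)\<close> to the power \<open>\<epsilon> / (l + 1)\<close>. Then the first term is at most
  \<open>D\<close> to the power \<open>1 - \<epsilon>\<close> times \<open>b\<close> to the power \<open>\<epsilon>\<close>, and so is the second as soon as \<open>N\<close> is large. For \<open>D \<ge> b\<close> the trivial
  bound is better than what is claimed, and for \<open>D = 0\<close> one lets \<open>\<delta> \<rightarrow> 0\<close>.\<close>

lemma interpolation_optimum:
  fixes \<Delta> :: real
  assumes b: "0 < b" and D: "0 \<le> D" and eps: "0 < \<epsilon>" "\<epsilon> < 1" and N: "1 \<le> N" "real (l + 1) \<le> \<epsilon> * real N"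
    and C: "0 \<le> C1" "0 \<le> C2" and s: "0 \<le> s"
    and le: "\<And>\<delta>. \<delta> > 0 \<Longrightarrow> \<Delta> \<le> s * (C1 * ((1 / \<delta>) ^ l * D) + C2 * (\<delta> ^ N * b))"
    and trivial: "\<Delta> \<le> 2 * (s * b)"
  shows "\<Delta> \<le> s * ((C1 + C2 + 2) * (D powr (1 - \<epsilon>) * b powr \<epsilon>))"
proof -
  let ?P = "D powr (1 - \<epsilon>) * b powr \<epsilon>"
  have P0: "0 \<le> ?P" by simp
  consider "D = 0" | "D \<ge> b" | "0 < D" "D < b" using D by linarith
  then show ?thesis
  proof cases
    case 1
    have "\<Delta> \<le> s * (C2 * ((1 / real (Suc j)) ^ N * b))" for j using le[of "1 / real (Suc j)"] 1 by simp
    moreover have "(\<lambda>j. s * (C2 * ((1 / real (Suc j)) ^ N * b))) \<longlonglongrightarrow> s * (C2 * (0 ^ N * b))"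
      by (intro tendsto_intros LIMSEQ_Suc[OF lim_const_over_n])
    ultimately have "\<Delta> \<le> s * (C2 * (0 ^ N * b))" by (intro LIMSEQ_le_const) auto
    then show ?thesis using 1 N by (simp add: power_0_left)
  next
    case 2
    have "b = b powr (1 - \<epsilon>) * b powr \<epsilon>" using b by (simp add: powr_add[symmetric])
    also have "\<dots> \<le> ?P" using 2 b eps by (intro mult_right_mono powr_mono2) auto
    finally have "b \<le> ?P" .
    then have "2 * (s * b) \<le> 2 * (s * ?P)" using s by (intro mult_left_mono) auto
    also have "\<dots> \<le> s * ((C1 + C2 + 2) * ?P)" using s C P0 mult_right_mono[of 2 "C1 + C2 + 2" "s * ?P"] by (simp add: mult_ac)
    finally show ?thesis using trivial by linarith
  next
    case 3
    define \<rho> where "\<rho> = D / b"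
    \<comment> \<open>\<open>l + 1\<close> instead of \<open>l\<close> avoids a division by zero for \<open>l = 0\<close>\<close>
    define \<delta> where "\<delta> = \<rho> powr (\<epsilon> / real (l + 1))"
    have \<rho>: "0 < \<rho>" "\<rho> < 1" using 3 b by (auto simp: \<rho>_def)
    have \<delta>: "\<delta> > 0" using \<rho> by (simp add: \<delta>_def)
    have P: "\<rho> powr (1 - \<epsilon>) * b = ?P"
    proof -
      have "\<rho> powr (1 - \<epsilon>) * b = D powr (1 - \<epsilon>) / b powr (1 - \<epsilon>) * b" using 3 b by (simp add: \<rho>_def powr_divide)
      also have "\<dots> = D powr (1 - \<epsilon>) * (b powr 1 / b powr (1 - \<epsilon>))" using b by simp
      also have "b powr 1 / b powr (1 - \<epsilon>) = b powr \<epsilon>" using b by (simp only: powr_diff[symmetric]) simp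
      finally show ?thesis .
    qed
    have "(1 / \<delta>) ^ l = \<rho> powr (- (real l * (\<epsilon> / real (l + 1))))"
      using \<rho> by (simp add: \<delta>_def power_one_over powr_realpow[symmetric] powr_powr powr_minus_divide mult.commute)
    also have "\<dots> \<le> \<rho> powr (- \<epsilon>)"
    proof (rule powr_mono')
      have "real l * (\<epsilon> / real (l + 1)) = (real l / real (l + 1)) * \<epsilon>" by simp
      also have "\<dots> \<le> 1 * \<epsilon>" using eps by (intro mult_right_mono) auto
      finally show "- \<epsilon> \<le> - (real l * (\<epsilon> / real (l + 1)))" by simp
    qed (use \<rho> in auto)
    finally have "(1 / \<delta>) ^ l * D \<le> \<rho> powr (- \<epsilon>) * D" using D by (rule mult_right_mono)
    also have "\<rho> powr (- \<epsilon>) * D = ?P"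
    proof -
      have "\<rho> powr (1 - \<epsilon>) = \<rho> * \<rho> powr (- \<epsilon>)" using \<rho> powr_add[of \<rho> 1 "- \<epsilon>"] by simp
      moreover have "D = \<rho> * b" using b by (simp add: \<rho>_def)
      ultimately show ?thesis using P by (simp only: mult_ac)
    qed
    finally have 1: "(1 / \<delta>) ^ l * D \<le> ?P" .
    have "\<delta> ^ N = \<rho> powr (real N * (\<epsilon> / real (l + 1)))" using \<rho> by (simp add: \<delta>_def powr_realpow[symmetric] powr_powr mult.commute)
    also have "\<dots> \<le> \<rho> powr (1 - \<epsilon>)"
    proof (rule powr_mono')
      have "1 \<le> (\<epsilon> * real N) / real (l + 1)" using N(2) by (subst le_divide_eq_1_pos) auto
      moreover have "real N * (\<epsilon> / real (l + 1)) = (\<epsilon> * real N) / real (l + 1)" by simp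
      ultimately show "1 - \<epsilon> \<le> real N * (\<epsilon> / real (l + 1))" using eps by linarith
    qed (use \<rho> in auto)
    finally have "\<delta> ^ N * b \<le> \<rho> powr (1 - \<epsilon>) * b" using b by (intro mult_right_mono) auto
    then have 2: "\<delta> ^ N * b \<le> ?P" unfolding P .
    have "\<Delta> \<le> s * (C1 * ((1 / \<delta>) ^ l * D) + C2 * (\<delta> ^ N * b))" by (rule le[OF \<delta>])
    also have "\<dots> \<le> s * (C1 * ?P + C2 * ?P)" using s C 1 2 by (intro mult_left_mono add_mono) auto
    also have "\<dots> \<le> s * ((C1 + C2 + 2) * ?P)" using s P0 by (intro mult_left_mono) (auto simp: distrib_right)
    finally show ?thesis .
  qed
qed

definition interpolation_const :: "(real^'d::finite \<Rightarrow> real) \<Rightarrow> nat \<Rightarrow> nat \<Rightarrow> nat \<Rightarrow> real" where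
  "interpolation_const \<phi> k m N = real CARD('d) ^ k * kernel_norm \<phi> (k + m) + 2 * (real CARD('d) ^ N * kernel_moment \<phi> N) + 2"

text \<open>The derivatives \<open>\<partial>\<^sup>\<alpha>\<close> of the mollified function form a test function for \<open>d\<^sub>k\<close> of size
  \<open>\<delta>\<close> to the power \<open>-(k + m)\<close>, and the two replacements cost a multiple of \<open>\<delta>\<^sup>N b\<close>.\<close>

lemma expectation_difference_le:
  fixes \<phi> f :: "real^'d::finite \<Rightarrow> real" and X Y :: "'w \<Rightarrow> real^'d" and \<alpha> :: "'d list"
  assumes \<phi>: "super_kernel \<phi>" and X: "random_vector M X" and Y: "random_vector M Y"
    and IX: "ibp_upto M X n b" and IY: "ibp_upto M Y n b" and b: "0 < b" and n: "length \<alpha> + N \<le> n"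
    and eps: "0 < \<epsilon>" "\<epsilon> < 1" and N: "1 \<le> N" "real (k + length \<alpha> + 1) \<le> \<epsilon> * real N"
    and D: "d_k M k X Y \<le> ennreal D" "0 \<le> D" and f: "f \<in> C_b_infty" and s: "\<And>x. \<bar>f x\<bar> \<le> s"
  shows "\<bar>(\<integral>\<omega>. pds \<alpha> f (X \<omega>) \<partial>M) - (\<integral>\<omega>. pds \<alpha> f (Y \<omega>) \<partial>M)\<bar> \<le> s * (interpolation_const \<phi> k (length \<alpha>) N * (D powr (1 - \<epsilon>) * b powr \<epsilon>))"
  unfolding interpolation_const_def
proof (rule interpolation_optimum[OF b D(2) eps N])
  show "0 \<le> s" using s[of 0] by simp
  show "0 \<le> real CARD('d) ^ k * kernel_norm \<phi> (k + length \<alpha>)" using kernel_norm_pos[OF \<phi>, of "k + length \<alpha>"] by simp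
  show "0 \<le> 2 * (real CARD('d) ^ N * kernel_moment \<phi> N)" using kernel_moment_nonneg[OF \<phi>, of N] by simp
  have "\<bar>\<integral>\<omega>. pds \<alpha> f (X \<omega>) \<partial>M\<bar> \<le> s * b" "\<bar>\<integral>\<omega>. pds \<alpha> f (Y \<omega>) \<partial>M\<bar> \<le> s * b"
    using ibp_uptoD[OF IX _ f s, of \<alpha>] ibp_uptoD[OF IY _ f s, of \<alpha>] n by auto
  then show "\<bar>(\<integral>\<omega>. pds \<alpha> f (X \<omega>) \<partial>M) - (\<integral>\<omega>. pds \<alpha> f (Y \<omega>) \<partial>M)\<bar> \<le> 2 * (s * b)" by linarith
  fix \<delta> :: real assume d: "\<delta> > 0"
  let ?h = "pds \<alpha> (mollify \<phi> \<delta> f)"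
  let ?e = "s * (real CARD('d) ^ N * kernel_moment \<phi> N * (\<delta> ^ N * b))"
  have h: "?h \<in> C_b_infty" by (rule C_b_infty_pds[OF mollify(1)[OF \<phi> f]])
  have "\<bar>(\<integral>\<omega>. ?h (X \<omega>) \<partial>M) - (\<integral>\<omega>. ?h (Y \<omega>) \<partial>M)\<bar> \<le> real CARD('d) ^ k * ((1 / \<delta>) ^ (k + length \<alpha>) * (kernel_norm \<phi> (k + length \<alpha>) * s)) * D"
  proof (rule d_k_bound[OF D h])
    fix \<beta> :: "'d list" and x assume "length \<beta> = k"
    then show "\<bar>pds \<beta> ?h x\<bar> \<le> (1 / \<delta>) ^ (k + length \<alpha>) * (kernel_norm \<phi> (k + length \<alpha>) * s)"
      using pds_mollify_le[OF \<phi> f s d, of "\<beta> @ \<alpha>" x] by (simp add: pds_append)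
  qed
  moreover have "\<bar>(\<integral>\<omega>. pds \<alpha> f (X \<omega>) \<partial>M) - (\<integral>\<omega>. ?h (X \<omega>) \<partial>M)\<bar> \<le> ?e" by (rule mollification_error[OF \<phi> X IX n N(1) f s d])
  moreover have "\<bar>(\<integral>\<omega>. pds \<alpha> f (Y \<omega>) \<partial>M) - (\<integral>\<omega>. ?h (Y \<omega>) \<partial>M)\<bar> \<le> ?e" by (rule mollification_error[OF \<phi> Y IY n N(1) f s d])
  ultimately have "\<bar>(\<integral>\<omega>. pds \<alpha> f (X \<omega>) \<partial>M) - (\<integral>\<omega>. pds \<alpha> f (Y \<omega>) \<partial>M)\<bar> \<le>
     real CARD('d) ^ k * ((1 / \<delta>) ^ (k + length \<alpha>) * (kernel_norm \<phi> (k + length \<alpha>) * s)) * D + 2 * ?e" by linarith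
  also have "\<dots> = s * (real CARD('d) ^ k * kernel_norm \<phi> (k + length \<alpha>) * ((1 / \<delta>) ^ (k + length \<alpha>) * D) + 2 * (real CARD('d) ^ N * kernel_moment \<phi> N) * (\<delta> ^ N * b))"
    by (simp only: distrib_left mult_ac)
  finally show "\<bar>(\<integral>\<omega>. pds \<alpha> f (X \<omega>) \<partial>M) - (\<integral>\<omega>. pds \<alpha> f (Y \<omega>) \<partial>M)\<bar> \<le> s * (real CARD('d) ^ k * kernel_norm \<phi> (k + length \<alpha>) * ((1 / \<delta>) ^ (k + length \<alpha>) * D) + 2 * (real CARD('d) ^ N * kernel_moment \<phi> N) * (\<delta> ^ N * b))" .
qed

subsection \<open>Distances and characteristic functions\<close>

text \<open>Waves are test functions with derivatives of order \<open>k\<close> bounded by \<open>\<bar>\<theta>\<bar>\<^sup>k\<close>.\<close>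

lemma chf_difference_d_k:
  assumes X: "random_vector M X" and Y: "random_vector M (Y :: 'w \<Rightarrow> real^'d::finite)" and D: "d_k M k X Y \<le> ennreal D" "0 \<le> D"
  shows "\<bar>random_vector.chf M X \<theta> t - random_vector.chf M Y \<theta> t\<bar> \<le> (real CARD('d) ^ k * D) * (1 + norm \<theta>) ^ k"
proof -
  interpret X: random_vector M X by fact
  interpret Y: random_vector M Y by fact
  have "\<bar>(\<integral>\<omega>. cos (inner \<theta> (X \<omega>) + t) \<partial>M) - (\<integral>\<omega>. cos (inner \<theta> (Y \<omega>) + t) \<partial>M)\<bar> \<le> real CARD('d) ^ k * (1 + norm \<theta>) ^ k * D"
  proof (rule d_k_bound[OF D wave_C_b_infty])
    fix \<beta> :: "'d list" and x assume l: "length \<beta> = k"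
    have "\<bar>\<Prod>i\<leftarrow>\<beta>. \<theta>$i\<bar> \<le> (1 + norm \<theta>) ^ k"
      using abs_prod_component_le[of \<theta> \<beta>] power_mono[of "norm \<theta>" "1 + norm \<theta>" k] unfolding l by simp
    then have "\<bar>\<Prod>i\<leftarrow>\<beta>. \<theta>$i\<bar> * \<bar>cos (inner \<theta> x + (t + real (length \<beta>) * (pi/2)))\<bar> \<le> (1 + norm \<theta>) ^ k * 1"
      by (intro mult_mono) auto
    then show "\<bar>pds \<beta> (\<lambda>x. cos (inner \<theta> x + t)) x\<bar> \<le> (1 + norm \<theta>) ^ k" unfolding pds_wave by (simp only: abs_mult mult_1_right)
  qed
  then show ?thesis by (simp only: X.chf_def Y.chf_def mult_ac)
qed

lemma chf_eq_Re:
  assumes X: "random_vector M X"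
  shows "random_vector.chf M X \<theta> t = Re (cis t * (\<integral>\<omega>. exp (\<i> * complex_of_real (inner \<theta> (X \<omega>))) \<partial>M))"
    and "cmod (\<integral>\<omega>. exp (\<i> * complex_of_real (inner \<theta> (X \<omega>))) \<partial>M) \<le> 1"
proof -
  interpret X: random_vector M X by fact
  have i: "integrable M (\<lambda>\<omega>. exp (\<i> * complex_of_real (inner \<theta> (X \<omega>))))"
    by (rule X.integrable_const_bound[where B = 1]) auto
  have "Re (cis t * (\<integral>\<omega>. exp (\<i> * complex_of_real (inner \<theta> (X \<omega>))) \<partial>M)) = Re (\<integral>\<omega>. cis t * exp (\<i> * complex_of_real (inner \<theta> (X \<omega>))) \<partial>M)" by simp
  also have "\<dots> = (\<integral>\<omega>. Re (cis t * exp (\<i> * complex_of_real (inner \<theta> (X \<omega>)))) \<partial>M)"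
    by (rule integral_Re[symmetric]) (use i in simp)
  also have "\<dots> = (\<integral>\<omega>. cos (inner \<theta> (X \<omega>) + t) \<partial>M)"
    by (intro Bochner_Integration.integral_cong refl) (simp add: cis_conv_exp[symmetric] cis_mult add.commute)
  finally show "X.chf \<theta> t = Re (cis t * (\<integral>\<omega>. exp (\<i> * complex_of_real (inner \<theta> (X \<omega>))) \<partial>M))" by (simp add: X.chf_def)
  have "cmod (\<integral>\<omega>. exp (\<i> * complex_of_real (inner \<theta> (X \<omega>))) \<partial>M) \<le> (\<integral>\<omega>. cmod (exp (\<i> * complex_of_real (inner \<theta> (X \<omega>)))) \<partial>M)" by (rule integral_norm_bound)
  then show "cmod (\<integral>\<omega>. exp (\<i> * complex_of_real (inner \<theta> (X \<omega>))) \<partial>M) \<le> 1" by (simp add: X.prob_space)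
qed

lemma d_CF_finite:
  assumes X: "random_vector M X" and Y: "random_vector M Y"
  shows "d_CF M X Y \<le> ennreal 2"
  unfolding d_CF_def
proof (intro SUP_least ennreal_leI)
  fix \<theta>
  show "cmod ((\<integral>\<omega>. exp (\<i> * complex_of_real (inner \<theta> (X \<omega>))) \<partial>M) - (\<integral>\<omega>. exp (\<i> * complex_of_real (inner \<theta> (Y \<omega>))) \<partial>M)) \<le> 2"
    using norm_triangle_ineq4[of "\<integral>\<omega>. exp (\<i> * complex_of_real (inner \<theta> (X \<omega>))) \<partial>M" "\<integral>\<omega>. exp (\<i> * complex_of_real (inner \<theta> (Y \<omega>))) \<partial>M"]
      chf_eq_Re(2)[OF X, of \<theta>] chf_eq_Re(2)[OF Y, of \<theta>] by linarith
qed

lemma chf_difference_d_CF: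
  assumes X: "random_vector M X" and Y: "random_vector M Y" and a: "d_CF M X Y = ennreal a" "0 \<le> a"
  shows "\<bar>random_vector.chf M X \<theta> t - random_vector.chf M Y \<theta> t\<bar> \<le> a"
proof -
  let ?x = "\<integral>\<omega>. exp (\<i> * complex_of_real (inner \<theta> (X \<omega>))) \<partial>M" let ?y = "\<integral>\<omega>. exp (\<i> * complex_of_real (inner \<theta> (Y \<omega>))) \<partial>M"
  have "ennreal (cmod (?x - ?y)) \<le> d_CF M X Y" unfolding d_CF_def by (rule SUP_upper) simp
  then have le: "cmod (?x - ?y) \<le> a" using a by simp
  have "random_vector.chf M X \<theta> t - random_vector.chf M Y \<theta> t = Re (cis t * (?x - ?y))"
    unfolding chf_eq_Re(1)[OF X] chf_eq_Re(1)[OF Y] by (simp only: right_diff_distrib minus_complex.sel)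
  also have "\<bar>\<dots>\<bar> \<le> cmod (cis t * (?x - ?y))" by (rule abs_Re_le_cmod)
  also have "\<dots> = cmod (?x - ?y)" by (simp add: norm_mult)
  finally show ?thesis using le by linarith
qed

lemma chf_difference_decay:
  assumes X: "random_vector M X" and Y: "random_vector M (Y :: 'w \<Rightarrow> real^'d::finite)"
    and IX: "ibp_upto M X n b" and IY: "ibp_upto M Y n b" and N: "N \<le> n"
  shows "\<bar>random_vector.chf M X \<theta> t - random_vector.chf M Y \<theta> t\<bar> \<le> (2 * (real CARD('d) + 1) ^ (N + 1) * b) / (1 + norm \<theta>) ^ N"
  using random_vector.chf_decay[OF X IX N, of \<theta> t] random_vector.chf_decay[OF Y IY N, of \<theta> t] by (simp add: add_divide_distrib[symmetric])

subsection \<open>Total variation from the characteristic function distance\<close>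

lemma cball_content_le: "R > 0 \<Longrightarrow> measure lborel (cball (0 :: real^'d::finite) R) \<le> (2 * R) ^ CARD('d)"
proof -
  assume R: "R > 0"
  have "cball (0 :: real^'d) R \<subseteq> cbox (- (R *\<^sub>R One)) (R *\<^sub>R One)"
  proof
    fix x :: "real^'d" assume "x \<in> cball 0 R"
    then have "\<bar>x \<bullet> i\<bar> \<le> R" if "i \<in> Basis" for i using Basis_le_norm[OF that, of x] by simp
    then show "x \<in> cbox (- (R *\<^sub>R One)) (R *\<^sub>R One)" by (simp add: mem_box abs_le_iff minus_le_iff)
  qed
  then have "measure lborel (cball (0 :: real^'d) R) \<le> measure lborel (cbox (- (R *\<^sub>R One)) (R *\<^sub>R One :: real^'d))"
    by (intro measure_mono_fmeasurable) auto
  also have "\<dots> = (2 * R) ^ CARD('d)" using R by (subst content_cbox) (auto simp: inner_diff_left)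
  finally show ?thesis .
qed

text \<open>Inside the ball the laws are compared by their densities, outside by Markov's inequality.\<close>

lemma expectation_difference_density:
  fixes X Y :: "'w \<Rightarrow> real^'d::finite"
  assumes X: "random_vector M X" and Y: "random_vector M Y" and p: "smooth_density M X p" and p': "smooth_density M Y p'"
    and S: "\<And>x. \<bar>p x - p' x\<bar> \<le> S" and R: "R > 0"
    and iX: "integrable M (\<lambda>\<omega>. norm (X \<omega>) ^ r)" and iY: "integrable M (\<lambda>\<omega>. norm (Y \<omega>) ^ r)"
    and KX: "(\<integral>\<omega>. norm (X \<omega>) ^ r \<partial>M) \<le> K" and KY: "(\<integral>\<omega>. norm (Y \<omega>) ^ r \<partial>M) \<le> K"
    and f: "f \<in> borel_measurable borel" "\<And>x. \<bar>f x\<bar> \<le> 1"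
  shows "\<bar>(\<integral>\<omega>. f (X \<omega>) \<partial>M) - (\<integral>\<omega>. f (Y \<omega>) \<partial>M)\<bar> \<le> S * (2 * R) ^ CARD('d) + 2 * K / R ^ r"
proof -
  let ?U = "cball (0 :: real^'d) R"
  let ?g = "\<lambda>x. f x * indicator ?U x"
  have S0: "0 \<le> S" using S[of 0] by linarith
  note [measurable] = f(1)
  have gm: "?g \<in> borel_measurable lborel" unfolding measurable_lborel2
    by (rule borel_measurable_times[OF f(1) borel_measurable_indicator[OF borel_closed[OF closed_cball]]])
  have tail: "\<bar>(\<integral>\<omega>. f (Z \<omega>) \<partial>M) - (\<integral>\<omega>. ?g (Z \<omega>) \<partial>M)\<bar> \<le> K / R ^ r"
    if Z: "random_vector M Z" and iZ: "integrable M (\<lambda>\<omega>. norm (Z \<omega>) ^ r)" and KZ: "(\<integral>\<omega>. norm (Z \<omega>) ^ r \<partial>M) \<le> K" for Z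
  proof -
    interpret Z: random_vector M Z by fact
    have i1: "integrable M (\<lambda>\<omega>. f (Z \<omega>))" by (rule Z.integrable_const_bound[where B = 1]) (use f in auto)
    have i2: "integrable M (\<lambda>\<omega>. ?g (Z \<omega>))" by (rule Z.integrable_const_bound[where B = 1]) (use f in \<open>auto simp: indicator_def\<close>)
    have pt: "\<bar>f (Z \<omega>) - ?g (Z \<omega>)\<bar> \<le> norm (Z \<omega>) ^ r / R ^ r" for \<omega>
    proof (cases "Z \<omega> \<in> ?U")
      case False
      then have "1 \<le> norm (Z \<omega>) / R" using R by simp
      then have "1 \<le> (norm (Z \<omega>) / R) ^ r" by (rule one_le_power)
      then have "\<bar>f (Z \<omega>)\<bar> \<le> (norm (Z \<omega>) / R) ^ r" using f(2)[of "Z \<omega>"] by linarith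
      then show ?thesis using False by (simp add: power_divide)
    qed (use R in simp)
    have "\<bar>(\<integral>\<omega>. f (Z \<omega>) \<partial>M) - (\<integral>\<omega>. ?g (Z \<omega>) \<partial>M)\<bar> = \<bar>\<integral>\<omega>. f (Z \<omega>) - ?g (Z \<omega>) \<partial>M\<bar>"
      by (simp only: Bochner_Integration.integral_diff[OF i1 i2])
    also have "\<dots> \<le> (\<integral>\<omega>. \<bar>f (Z \<omega>) - ?g (Z \<omega>)\<bar> \<partial>M)" by (rule integral_abs_bound)
    also have "\<dots> \<le> (\<integral>\<omega>. norm (Z \<omega>) ^ r / R ^ r \<partial>M)"
      by (rule integral_mono[OF integrable_abs[OF Bochner_Integration.integrable_diff[OF i1 i2]] _ pt]) (use iZ in simp)
    also have "\<dots> \<le> K / R ^ r" using KZ R by (simp add: divide_right_mono)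
    finally show ?thesis .
  qed
  have dens: "(\<integral>\<omega>. ?g (Z \<omega>) \<partial>M) = (\<integral>x. q x * ?g x \<partial>lborel)" "integrable lborel (\<lambda>x. q x * ?g x)"
    if Z: "random_vector M Z" and q: "smooth_density M Z q" for Z q
  proof -
    interpret Z: random_vector M Z by fact
    have d: "distributed M lborel Z (\<lambda>x. ennreal (q x))" "\<And>x. 0 \<le> q x" using q by (auto simp: smooth_density_def)
    show "(\<integral>\<omega>. ?g (Z \<omega>) \<partial>M) = (\<integral>x. q x * ?g x \<partial>lborel)"
      by (rule distributed_integral[OF d(1) gm d(2), symmetric])
    have "integrable M (\<lambda>\<omega>. ?g (Z \<omega>))" by (rule Z.integrable_const_bound[where B = 1]) (use f in \<open>auto simp: indicator_def\<close>)
    then show "integrable lborel (\<lambda>x. q x * ?g x)"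
      by (simp only: distributed_integrable[OF d(1) gm d(2)])
  qed
  have fin: "emeasure lborel ?U < \<infinity>" using emeasure_bounded_finite[OF bounded_cball[of 0 R]] by simp
  have ptp: "\<bar>p x * ?g x - p' x * ?g x\<bar> \<le> S * indicator ?U x" for x
  proof -
    have "\<bar>p x * ?g x - p' x * ?g x\<bar> = \<bar>p x - p' x\<bar> * \<bar>?g x\<bar>" by (simp only: left_diff_distrib[symmetric] abs_mult)
    also have "\<dots> \<le> S * indicator ?U x" using S[of x] f(2)[of x] by (intro mult_mono) (auto simp: indicator_def)
    finally show ?thesis .
  qed
  have "(\<integral>\<omega>. ?g (X \<omega>) \<partial>M) - (\<integral>\<omega>. ?g (Y \<omega>) \<partial>M) = (\<integral>x. p x * ?g x - p' x * ?g x \<partial>lborel)"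
    by (simp only: dens(1)[OF X p] dens(1)[OF Y p'] Bochner_Integration.integral_diff[OF dens(2)[OF X p] dens(2)[OF Y p']])
  moreover have "\<bar>\<integral>x. p x * ?g x - p' x * ?g x \<partial>lborel\<bar> \<le> (\<integral>x. \<bar>p x * ?g x - p' x * ?g x\<bar> \<partial>lborel)" by (rule integral_abs_bound)
  moreover have "\<dots> \<le> (\<integral>x. S * indicator ?U x \<partial>lborel)"
    by (rule integral_mono[OF integrable_abs[OF Bochner_Integration.integrable_diff[OF dens(2)[OF X p] dens(2)[OF Y p']]] _ ptp]) (use fin in auto)
  moreover have "\<dots> = S * measure lborel ?U" by simp
  moreover have "\<dots> \<le> S * (2 * R) ^ CARD('d)" by (rule mult_left_mono[OF cball_content_le[OF R] S0])
  ultimately have "\<bar>(\<integral>\<omega>. ?g (X \<omega>) \<partial>M) - (\<integral>\<omega>. ?g (Y \<omega>) \<partial>M)\<bar> \<le> S * (2 * R) ^ CARD('d)" by linarith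
  moreover have "2 * K / R ^ r = K / R ^ r + K / R ^ r" by (simp add: add_divide_distrib[symmetric])
  ultimately show ?thesis using tail[OF X iX KX] tail[OF Y iY KY] by linarith
qed

text \<open>The optimal radius is \<open>B\<close> to the power \<open>- \<epsilon> / d\<close>. The cases \<open>B > 1\<close> and \<open>B = 0\<close> are the trivial bound and the
  limit \<open>R \<rightarrow> \<infinity>\<close>.\<close>

lemma radius_optimum:
  fixes T :: real
  assumes B: "0 \<le> B" and K: "0 \<le> K" and eps: "0 < \<epsilon>" "\<epsilon> < 1" and d: "1 \<le> d" and r: "1 \<le> r" "real d \<le> \<epsilon> * real r"
    and le: "\<And>R. R > 0 \<Longrightarrow> T \<le> B * (2 * R) ^ d + 2 * K / R ^ r" and trivial: "T \<le> 2"
  shows "T \<le> (2 ^ d + 2 * K + 2) * B powr (1 - \<epsilon>)"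
proof -
  consider "B = 0" | "B > 1" | "0 < B" "B \<le> 1" using B by linarith
  then show ?thesis
  proof cases
    case 1
    have "T \<le> 2 * K * (1 / real (Suc j)) ^ r" for j using le[of "real (Suc j)"] 1 by (simp add: power_one_over)
    moreover have "(\<lambda>j. 2 * K * (1 / real (Suc j)) ^ r) \<longlonglongrightarrow> 2 * K * 0 ^ r"
      by (intro tendsto_intros LIMSEQ_Suc[OF lim_const_over_n])
    ultimately have "T \<le> 2 * K * 0 ^ r" by (intro LIMSEQ_le_const) auto
    then show ?thesis using 1 r by (simp add: power_0_left)
  next
    case 2
    have "1 \<le> B powr (1 - \<epsilon>)" using 2 eps by (intro ge_one_powr_ge_zero) auto
    moreover have "0 \<le> (2 ^ d + 2 * K) * B powr (1 - \<epsilon>)" using K by simp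
    ultimately show ?thesis using trivial by (simp add: distrib_right)
  next
    case 3
    define R where "R = B powr (- (\<epsilon> / real d))"
    have R: "R > 0" using 3 by (simp add: R_def)
    have "R ^ d = B powr (- \<epsilon>)" using 3 d by (simp add: R_def powr_realpow[symmetric] powr_powr)
    then have "B * (2 * R) ^ d = 2 ^ d * (B * B powr (- \<epsilon>))" by (simp add: power_mult_distrib)
    moreover have "B powr (1 - \<epsilon>) = B * B powr (- \<epsilon>)" using 3 powr_add[of B 1 "- \<epsilon>"] by simp
    ultimately have 1: "B * (2 * R) ^ d = 2 ^ d * B powr (1 - \<epsilon>)" by simp
    have "R ^ r = B powr (- (real r * (\<epsilon> / real d)))" using 3 by (simp add: R_def powr_realpow[symmetric] powr_powr mult.commute)
    then have "1 / R ^ r = B powr (real r * (\<epsilon> / real d))" by (simp add: powr_minus_divide)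
    also have "\<dots> \<le> B powr (1 - \<epsilon>)"
    proof (rule powr_mono')
      have "1 \<le> (\<epsilon> * real r) / real d" using r d by simp
      then show "1 - \<epsilon> \<le> real r * (\<epsilon> / real d)" using eps by (simp add: mult.commute)
    qed (use 3 in auto)
    finally have "2 * K * (1 / R ^ r) \<le> 2 * K * B powr (1 - \<epsilon>)" using K by (intro mult_left_mono) auto
    then have "T \<le> 2 ^ d * B powr (1 - \<epsilon>) + 2 * K * B powr (1 - \<epsilon>)" using le[OF R] unfolding 1 by simp
    then show ?thesis by (simp add: distrib_right add_increasing2)
  qed
qed

text \<open>The exponent of \<open>a\<close> is lowered, which costs at most a factor \<open>2\<close> since \<open>a \<le> 2\<close>, and that of \<open>b\<close> is raised, which
  costs at most a factor \<open>1 / c\<close> since \<open>b \<ge> c\<close>.\<close>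

lemma powr_domination:
  fixes a b c \<epsilon> u v :: real
  assumes a: "0 \<le> a" "a \<le> 2" and c: "0 < c" "c \<le> 1" "c \<le> b" and eps: "0 < \<epsilon>" "\<epsilon> < 1"
    and u: "1 - \<epsilon> \<le> u" "u \<le> 1" and v: "0 \<le> v" "v \<le> \<epsilon>"
  shows "a powr u * b powr v \<le> (2 / c) * (a powr (1 - \<epsilon>) * b powr \<epsilon>)"
proof (cases "a = 0")
  case False
  have b: "0 < b" using c by linarith
  have a0: "0 < a" using a False by simp
  have "a powr (u - (1 - \<epsilon>)) \<le> 2 powr (u - (1 - \<epsilon>))" using a u by (intro powr_mono2) auto
  also have "\<dots> \<le> 2 powr 1" using u eps by (intro powr_mono) auto
  finally have 1: "a powr (u - (1 - \<epsilon>)) \<le> 2" by simp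
  have "b powr (v - \<epsilon>) \<le> c powr (v - \<epsilon>)" using c v by (intro powr_mono2') auto
  also have "\<dots> \<le> c powr (- 1)" using c v eps by (intro powr_mono') auto
  finally have 2: "b powr (v - \<epsilon>) \<le> 1 / c" using c by (simp add: powr_minus_divide)
  have "a powr u * b powr v = (a powr (u - (1 - \<epsilon>)) * b powr (v - \<epsilon>)) * (a powr (1 - \<epsilon>) * b powr \<epsilon>)"
    by (simp add: powr_diff a0 b)
  also have "\<dots> \<le> (2 * (1 / c)) * (a powr (1 - \<epsilon>) * b powr \<epsilon>)" using 1 2 by (intro mult_right_mono mult_mono) auto
  finally show ?thesis by simp
qed simp

section \<open>From the framework to integration by parts\<close>

definition ibp_order_upto :: "nat \<Rightarrow> nat \<Rightarrow> nat" where
  "ibp_order_upto d n = (\<Sum>j\<le>n. ibp_order d j)"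

text \<open>The summand \<open>1\<close> ensures that the lower bound for \<open>Q_l\<close> is inherited by its product with this constant.\<close>

definition ibp_const_upto :: "nat \<Rightarrow> nat \<Rightarrow> nat \<Rightarrow> real" where
  "ibp_const_upto d n q = 1 + (\<Sum>j\<le>n. ibp_const d j q)"

lemma ibp_const_nonneg: "0 \<le> ibp_const d j q"
  by (simp add: ibp_const_def)

lemma ibp_const_upto_ge_1: "1 \<le> ibp_const_upto d n q"
  by (simp add: ibp_const_upto_def sum_nonneg ibp_const_nonneg)

context malliavin_basis
begin

lemma rvec_random_vector: "(\<And>i. F i \<in> E) \<Longrightarrow> random_vector M (rvec F :: 'w \<Rightarrow> real^'d::finite)"
proof
  assume F: "\<And>i. F i \<in> E"
  have "rvec F = (\<lambda>\<omega>. \<Sum>i\<in>UNIV. F i \<omega> *\<^sub>R axis i 1 :: real^'d)"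
    by (rule ext) (simp add: rvec_def vec_eq_iff axis_def if_distrib cong: if_cong)
  moreover have "(\<lambda>\<omega>. \<Sum>i\<in>UNIV. F i \<omega> *\<^sub>R axis i 1 :: real^'d) \<in> borel_measurable M"
    by (intro borel_measurable_sum borel_measurable_scaleR E_measurable[OF F] borel_measurable_const)
  ultimately show "(rvec F :: 'w \<Rightarrow> real^'d) \<in> borel_measurable M" by simp
qed

lemma rvec_ibp_upto:
  fixes F :: "'d::finite \<Rightarrow> 'w \<Rightarrow> real"
  assumes F: "\<And>i. F i \<in> E" and q: "q \<ge> ibp_order_upto CARD('d) n" and Q: "Q_l M \<Gamma> L DD q F < \<infinity>"
    and le: "enn2real (Q_l M \<Gamma> L DD q F) \<le> Q"
  shows "ibp_upto M (rvec F) n (ibp_const_upto CARD('d) n q * Q)"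
  unfolding ibp_upto_def
proof (intro allI impI)
  fix \<alpha> :: "'d list" and f :: "real^'d \<Rightarrow> real" and s :: real
  assume l: "length \<alpha> \<le> n" and f: "f \<in> C_b_infty" and s: "\<forall>x. \<bar>f x\<bar> \<le> s"
  have s0: "0 \<le> s" using order_trans[OF abs_ge_zero s[rule_format, of 0]] .
  have "ibp_order CARD('d) (length \<alpha>) \<le> ibp_order_upto CARD('d) n"
    unfolding ibp_order_upto_def by (rule member_le_sum) (use l in auto)
  then have o: "q \<ge> ibp_order CARD('d) (length \<alpha>)" using q by simp
  have "ibp_const CARD('d) (length \<alpha>) q \<le> (\<Sum>j\<le>n. ibp_const CARD('d) j q)"
    by (rule member_le_sum) (use l ibp_const_nonneg in auto)
  then have c: "ibp_const CARD('d) (length \<alpha>) q \<le> ibp_const_upto CARD('d) n q" by (simp add: ibp_const_upto_def)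
  have "\<bar>\<integral>\<omega>. pds \<alpha> f (rvec F \<omega>) \<partial>M\<bar> \<le> s * (ibp_const CARD('d) (length \<alpha>) q * enn2real (Q_l M \<Gamma> L DD q F))"
    by (rule derivative_expectation_le[where F = F, OF F o Q f s[rule_format]])
  also have "\<dots> \<le> s * (ibp_const_upto CARD('d) n q * Q)"
    using s0 c le ibp_const_nonneg[of "CARD('d)" "length \<alpha>" q] by (intro mult_left_mono mult_mono) auto
  finally show "\<bar>\<integral>\<omega>. pds \<alpha> f (rvec F \<omega>) \<partial>M\<bar> \<le> s * (ibp_const_upto CARD('d) n q * Q)" .
qed

lemma rvec_moment_integrable:
  fixes F :: "'d::finite \<Rightarrow> 'w \<Rightarrow> real"
  assumes F: "\<And>i. F i \<in> E"
  shows "integrable M (\<lambda>\<omega>. norm (rvec F \<omega>) ^ r)"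
proof (rule Bochner_Integration.integrable_bound)
  interpret X: random_vector M "rvec F" by (rule rvec_random_vector[where F = F, OF F])
  let ?g = "\<lambda>\<omega>. (real CARD('d) + 1) ^ r * (1 + (\<Sum>i\<in>UNIV. 1 + F i \<omega> ^ (2 * r)))"
  have "integrable M (\<lambda>\<omega>. F i \<omega> ^ (2 * r))" for i
    using E_integrable[OF E_prod[of "{..<2 * r}" "\<lambda>_. F i"]] F by simp
  then show "integrable M ?g" by (intro integrable_mult_right Bochner_Integration.integrable_add integrable_sum integrable_const) auto
  show "(\<lambda>\<omega>. norm (rvec F \<omega>) ^ r) \<in> borel_measurable M" using X.X by simp
  have "norm (norm (rvec F \<omega>) ^ r) \<le> norm (?g \<omega>)" for \<omega>
  proof -
    have one: "\<bar>x\<bar> ^ r \<le> 1 + x ^ (2 * r)" for x :: real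
    proof -
      have "0 \<le> (\<bar>x\<bar> ^ r - 1)\<^sup>2" "0 \<le> \<bar>x\<bar> ^ r" by simp_all
      moreover have "(\<bar>x\<bar> ^ r)\<^sup>2 = x ^ (2 * r)" by (simp add: power_mult[symmetric] mult.commute[of r] power_even_abs)
      moreover have "(\<bar>x\<bar> ^ r - 1)\<^sup>2 = (\<bar>x\<bar> ^ r)\<^sup>2 - 2 * \<bar>x\<bar> ^ r + 1" by (simp add: power2_diff)
      ultimately show ?thesis by linarith
    qed
    have "norm (rvec F \<omega>) ^ r \<le> (1 + norm (rvec F \<omega>)) ^ r" by (intro power_mono) auto
    also have "\<dots> \<le> (real CARD('d) + 1) ^ r * (1 + (\<Sum>i\<in>UNIV. \<bar>rvec F \<omega> $ i\<bar> ^ r))" by (rule one_plus_norm_power_le)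
    also have "\<dots> \<le> ?g \<omega>" by (intro mult_left_mono add_left_mono sum_mono) (auto simp: rvec_def intro: one)
    finally show ?thesis by simp
  qed
  then show "AE \<omega> in M. norm (norm (rvec F \<omega>) ^ r) \<le> norm (?g \<omega>)" by simp
qed

end

text \<open>Everything that the rest of the proof uses of the abstract framework. The orthonormal sequence is
  hidden here.\<close>

lemma framework_random_vector:
  fixes F :: "'d::finite \<Rightarrow> 'w \<Rightarrow> real" and tens :: "'h::{real_inner, polish_space} list \<Rightarrow> 't::{real_inner, polish_space}"
  assumes fw: "malliavin_framework M E \<Gamma> L tens D DD" and F: "\<And>i. F i \<in> E" and Q: "\<And>l. Q_l M \<Gamma> L DD l F < \<infinity>"
  shows "smooth_random_vector M (rvec F)" and "integrable M (\<lambda>\<omega>. norm (rvec F \<omega>) ^ r)"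
    and "q \<ge> ibp_order_upto CARD('d) n \<Longrightarrow> enn2real (Q_l M \<Gamma> L DD q F) \<le> Q \<Longrightarrow> ibp_upto M (rvec F) n (ibp_const_upto CARD('d) n q * Q)"
    and "q \<ge> 1 \<Longrightarrow> (1 / fact CARD('d)) ^ q \<le> enn2real (Q_l M \<Gamma> L DD q F)"
proof -
  obtain e :: "nat \<Rightarrow> 'h" where e: "parseval_sequence e" using parseval_sequence_exists by blast
  interpret malliavin_basis M E \<Gamma> L tens D DD e by (intro malliavin_basis.intro malliavin_basis_axioms.intro fw e)
  interpret X: random_vector M "rvec F" by (rule rvec_random_vector[where F = F, OF F])
  show "smooth_random_vector M (rvec F)"
    using rvec_ibp_upto[where F = F, OF F order_refl Q order_refl] by (intro X.smooth_random_vectorI) blast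
  show "integrable M (\<lambda>\<omega>. norm (rvec F \<omega>) ^ r)" by (rule rvec_moment_integrable[where F = F, OF F])
  show "ibp_upto M (rvec F) n (ibp_const_upto CARD('d) n q * Q)" if "q \<ge> ibp_order_upto CARD('d) n" "enn2real (Q_l M \<Gamma> L DD q F) \<le> Q"
    by (rule rvec_ibp_upto[where F = F, OF F that(1) Q that(2)])
  show "(1 / fact CARD('d)) ^ q \<le> enn2real (Q_l M \<Gamma> L DD q F)" if "q \<ge> 1"
    using enn2real_mono[OF Q_ge[where F = F, OF F that Q]] Q[of q] by simp
qed

section \<open>The distance of characteristic functions\<close>

definition density_const :: "'d::finite itself \<Rightarrow> real" where
  "density_const d = (gauss0 TYPE(real^'d))\<^sup>2 * (\<integral>\<theta>. decay (\<theta> :: real^'d) \<partial>lborel)"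

lemma density_const_nonneg: "0 \<le> density_const d"
  by (simp add: density_const_def decay_nonneg)

definition decay_const :: "nat \<Rightarrow> nat \<Rightarrow> real" where
  "decay_const d N = 2 * (real d + 1) ^ (N + 1)"

lemma decay_const_pos: "0 < decay_const d N"
  by (simp add: decay_const_def)

lemma density_difference_d_k:
  fixes X Y :: "'w \<Rightarrow> real^'d::finite"
  assumes X: "smooth_random_vector M X" and Y: "smooth_random_vector M Y"
    and p: "smooth_density M X p" and p': "smooth_density M Y p'"
    and IX: "ibp_upto M X n b" and IY: "ibp_upto M Y n b" and b: "0 < b" and n: "N \<le> n"
    and eps: "0 < \<epsilon>" "\<epsilon> < 1" and N: "real (length \<alpha> + k + 2 * CARD('d)) \<le> \<epsilon> * real N"
    and D: "d_k M k X Y \<le> ennreal D" "0 \<le> D"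
  shows "\<bar>pds \<alpha> p x - pds \<alpha> p' x\<bar> \<le> density_const TYPE('d) * ((real CARD('d) ^ k * D) powr (1 - \<epsilon>) * (decay_const CARD('d) N * b) powr \<epsilon>)"
  unfolding density_const_def
proof (rule density_difference_le[OF X Y p p' eps _ _ _ _ N])
  note X' = smooth_random_vector.axioms(1)[OF X] and Y' = smooth_random_vector.axioms(1)[OF Y]
  show "0 \<le> real CARD('d) ^ k * D" using D(2) by simp
  show "0 \<le> decay_const CARD('d) N * b" using decay_const_pos[of "CARD('d)" N] b by simp
  show "\<bar>random_vector.chf M X \<theta> t - random_vector.chf M Y \<theta> t\<bar> \<le> (real CARD('d) ^ k * D) * (1 + norm \<theta>) ^ k" for \<theta> t
    by (rule chf_difference_d_k[OF X' Y' D])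
  show "\<bar>random_vector.chf M X \<theta> t - random_vector.chf M Y \<theta> t\<bar> \<le> (decay_const CARD('d) N * b) / (1 + norm \<theta>) ^ N" for \<theta> t
    unfolding decay_const_def by (rule chf_difference_decay[OF X' Y' IX IY n])
qed

lemma density_difference_d_CF:
  fixes X Y :: "'w \<Rightarrow> real^'d::finite"
  assumes X: "smooth_random_vector M X" and Y: "smooth_random_vector M Y"
    and p: "smooth_density M X p" and p': "smooth_density M Y p'"
    and IX: "ibp_upto M X n b" and IY: "ibp_upto M Y n b" and b: "0 < b" and n: "N \<le> n"
    and eps: "0 < \<epsilon>" "\<epsilon> < 1" and N: "real (length \<alpha> + 2 * CARD('d)) \<le> \<epsilon> * real N"
    and a: "d_CF M X Y = ennreal a" "0 \<le> a"
  shows "\<bar>pds \<alpha> p x - pds \<alpha> p' x\<bar> \<le> density_const TYPE('d) * (a powr (1 - \<epsilon>) * (decay_const CARD('d) N * b) powr \<epsilon>)"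
  unfolding density_const_def
proof (rule density_difference_le[OF X Y p p' eps a(2), where k = 0])
  note X' = smooth_random_vector.axioms(1)[OF X] and Y' = smooth_random_vector.axioms(1)[OF Y]
  show "0 \<le> decay_const CARD('d) N * b" using decay_const_pos[of "CARD('d)" N] b by simp
  show "\<bar>random_vector.chf M X \<theta> t - random_vector.chf M Y \<theta> t\<bar> \<le> a * (1 + norm \<theta>) ^ 0" for \<theta> t
    using chf_difference_d_CF[OF X' Y' a] by simp
  show "\<bar>random_vector.chf M X \<theta> t - random_vector.chf M Y \<theta> t\<bar> \<le> (decay_const CARD('d) N * b) / (1 + norm \<theta>) ^ N" for \<theta> t
    unfolding decay_const_def by (rule chf_difference_decay[OF X' Y' IX IY n])
  show "real (length \<alpha> + 0 + 2 * CARD('d)) \<le> \<epsilon> * real N" using N by simp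
qed

lemma supnorm_ge: "ennreal \<bar>f x\<bar> \<le> supnorm f"
  unfolding supnorm_def by (rule SUP_upper) simp

lemma test_functions_0:
  fixes f :: "real^'d::finite \<Rightarrow> real"
  assumes f: "f \<in> test_functions 0" shows "f \<in> borel_measurable borel" "\<bar>f x\<bar> \<le> 1"
proof -
  show "f \<in> borel_measurable borel" using f by (simp add: test_functions_def)
  have "{\<alpha> :: 'd list. length \<alpha> = 0} = {[]}" by auto
  then have "supnorm f \<le> 1" using f by (simp add: test_functions_def pds_def)
  then have "ennreal \<bar>f x\<bar> \<le> 1" by (rule order_trans[OF supnorm_ge])
  then show "\<bar>f x\<bar> \<le> 1" by (simp only: ennreal_le_1)
qed

text \<open>Bounded measurable test functions are controlled by uniform closeness of the densities and by moments.\<close>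

lemma d_0_le_density_difference:
  fixes X Y :: "'w \<Rightarrow> real^'d::finite"
  assumes X: "random_vector M X" and Y: "random_vector M Y" and p: "smooth_density M X p" and p': "smooth_density M Y p'"
    and S: "\<And>x. \<bar>p x - p' x\<bar> \<le> S"
    and iX: "integrable M (\<lambda>\<omega>. norm (X \<omega>) ^ r)" and iY: "integrable M (\<lambda>\<omega>. norm (Y \<omega>) ^ r)"
    and KX: "(\<integral>\<omega>. norm (X \<omega>) ^ r \<partial>M) \<le> K" and KY: "(\<integral>\<omega>. norm (Y \<omega>) ^ r \<partial>M) \<le> K"
    and eps: "0 < \<epsilon>" "\<epsilon> < 1" and r: "1 \<le> r" "real CARD('d) \<le> \<epsilon> * real r"
  shows "d_k M 0 X Y \<le> ennreal ((2 ^ CARD('d) + 2 * K + 2) * S powr (1 - \<epsilon>))"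
  unfolding d_k_def
proof (intro SUP_least ennreal_leI)
  fix f :: "real^'d \<Rightarrow> real" assume "f \<in> test_functions 0"
  note f = test_functions_0[OF this]
  note S0 = order_trans[OF abs_ge_zero S[of 0]]
  have K0: "0 \<le> K" by (rule order_trans[OF _ KX]) simp
  have one: "\<bar>\<integral>\<omega>. f (Z \<omega>) \<partial>M\<bar> \<le> 1" if Z: "random_vector M Z" for Z
  proof -
    interpret Z: random_vector M Z by fact
    have "\<bar>\<integral>\<omega>. f (Z \<omega>) \<partial>M\<bar> \<le> (\<integral>\<omega>. \<bar>f (Z \<omega>)\<bar> \<partial>M)" by (rule integral_abs_bound)
    also have "\<dots> \<le> (\<integral>\<omega>. 1 \<partial>M)" using f(2) by (intro integral_mono' ) auto
    finally show ?thesis by (simp add: Z.prob_space)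
  qed
  show "\<bar>(\<integral>\<omega>. f (X \<omega>) \<partial>M) - (\<integral>\<omega>. f (Y \<omega>) \<partial>M)\<bar> \<le> (2 ^ CARD('d) + 2 * K + 2) * S powr (1 - \<epsilon>)"
  proof (rule radius_optimum[OF S0 K0 eps _ r])
    show "1 \<le> CARD('d)" by (simp add: Suc_le_eq)
    show "\<bar>(\<integral>\<omega>. f (X \<omega>) \<partial>M) - (\<integral>\<omega>. f (Y \<omega>) \<partial>M)\<bar> \<le> S * (2 * R) ^ CARD('d) + 2 * K / R ^ r" if "R > 0" for R
      by (rule expectation_difference_density[OF X Y p p' S that iX iY KX KY f])
    show "\<bar>(\<integral>\<omega>. f (X \<omega>) \<partial>M) - (\<integral>\<omega>. f (Y \<omega>) \<partial>M)\<bar> \<le> 2" using one[OF X] one[OF Y] by linarith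
  qed
qed

text \<open>The constant that remains after the first two of the three steps.\<close>

definition moment_const :: "'d::finite itself \<Rightarrow> real \<Rightarrow> nat \<Rightarrow> real \<Rightarrow> real" where
  "moment_const d \<eta> N K = (2 ^ CARD('d) + 2 * K + 2) powr (1 - \<eta>) *
     (density_const TYPE('d) powr ((1 - \<eta>) * (1 - \<eta>)) * decay_const CARD('d) N powr (\<eta> * ((1 - \<eta>) * (1 - \<eta>))))"

text \<open>The densities are compared by \<open>density_difference_d_CF\<close>, the laws in total variation by
  \<open>d_0_le_density_difference\<close>, and the expectations by \<open>expectation_difference_le\<close> for \<open>k = 0\<close>, each with
  \<open>\<eta> = \<epsilon> / 3\<close>. The resulting exponent of \<open>d_CF\<close> is \<open>(1 - \<eta>)\<^sup>3 \<ge> 1 - \<epsilon>\<close>, and that of \<open>b\<close> is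
  \<open>\<eta> (1 - \<eta>)\<^sup>2 + \<eta> \<le> \<epsilon>\<close>; \<open>powr_domination\<close> replaces them by \<open>1 - \<epsilon>\<close> and \<open>\<epsilon>\<close>.\<close>

lemma expectation_difference_d_CF:
  fixes \<phi> f :: "real^'d::finite \<Rightarrow> real" and X Y :: "'w \<Rightarrow> real^'d" and \<alpha> :: "'d list"
  assumes \<phi>: "super_kernel \<phi>" and X: "smooth_random_vector M X" and Y: "smooth_random_vector M Y"
    and IX: "ibp_upto M X n b" and IY: "ibp_upto M Y n b" and n: "length \<alpha> + N \<le> n"
    and c: "0 < c" "c \<le> 1" "c \<le> b"
    and eps: "0 < \<epsilon>" "\<epsilon> < 1" and \<eta>: "\<eta> = \<epsilon> / 3" and N: "1 \<le> N" "real (length \<alpha> + 2 * CARD('d) + 1) \<le> \<eta> * real N"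
    and r: "1 \<le> r" "real CARD('d) \<le> \<eta> * real r"
    and iX: "integrable M (\<lambda>\<omega>. norm (X \<omega>) ^ r)" and iY: "integrable M (\<lambda>\<omega>. norm (Y \<omega>) ^ r)"
    and KX: "(\<integral>\<omega>. norm (X \<omega>) ^ r \<partial>M) \<le> K" and KY: "(\<integral>\<omega>. norm (Y \<omega>) ^ r \<partial>M) \<le> K"
    and a: "d_CF M X Y = ennreal a" "0 \<le> a" and f: "f \<in> C_b_infty" and s: "\<And>x. \<bar>f x\<bar> \<le> s"
  shows "\<bar>(\<integral>\<omega>. pds \<alpha> f (X \<omega>) \<partial>M) - (\<integral>\<omega>. pds \<alpha> f (Y \<omega>) \<partial>M)\<bar> \<le>
    s * ((interpolation_const \<phi> 0 (length \<alpha>) N * moment_const TYPE('d) \<eta> N K * (2 / c)) * (a powr (1 - \<epsilon>) * b powr \<epsilon>))"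
proof -
  note X' = smooth_random_vector.axioms(1)[OF X] and Y' = smooth_random_vector.axioms(1)[OF Y]
  have eta: "0 < \<eta>" "\<eta> < 1" using eps \<eta> by auto
  have b: "0 < b" using c by linarith
  have s0: "0 \<le> s" by (rule order_trans[OF abs_ge_zero s[of 0]])
  have K0: "0 \<le> K" by (rule order_trans[OF _ KX]) simp
  let ?G = "density_const TYPE('d)" let ?B = "decay_const CARD('d) N" let ?T = "2 ^ CARD('d) + 2 * K + 2"
  let ?S = "?G * (a powr (1 - \<eta>) * (?B * b) powr \<eta>)"
  let ?D = "?T * ?S powr (1 - \<eta>)"
  let ?u = "(1 - \<eta>) * ((1 - \<eta>) * (1 - \<eta>))" let ?v = "\<eta> * ((1 - \<eta>) * (1 - \<eta>)) + \<eta>"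
  have G0: "0 \<le> ?G" by (rule density_const_nonneg)
  have B0: "0 \<le> ?B" using decay_const_pos[of "CARD('d)" N] by linarith
  have T0: "0 \<le> ?T" using K0 by simp
  note p = smooth_random_vector.smooth_density_dens[OF X] and p' = smooth_random_vector.smooth_density_dens[OF Y]
  have S: "\<bar>smooth_random_vector.dens M X x - smooth_random_vector.dens M Y x\<bar> \<le> ?S" for x
    using density_difference_d_CF[OF X Y p p' IX IY b _ eta _ a, of N "[]" x] n N(2) by (simp add: pds_def)
  have D: "d_k M 0 X Y \<le> ennreal ?D" by (rule d_0_le_density_difference[OF X' Y' p p' S iX iY KX KY eta r])
  have D0: "0 \<le> ?D" using T0 by simp
  have "real (0 + length \<alpha> + 1) \<le> \<eta> * real N" using N(2) by simp
  then have main: "\<bar>(\<integral>\<omega>. pds \<alpha> f (X \<omega>) \<partial>M) - (\<integral>\<omega>. pds \<alpha> f (Y \<omega>) \<partial>M)\<bar> \<le> s * (interpolation_const \<phi> 0 (length \<alpha>) N * (?D powr (1 - \<eta>) * b powr \<eta>))"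
    by (rule expectation_difference_le[OF \<phi> X' Y' IX IY b n eta N(1) _ D D0 f s])
  have eq: "?D powr (1 - \<eta>) * b powr \<eta> = moment_const TYPE('d) \<eta> N K * (a powr ?u * b powr ?v)"
  proof -
    have "?S powr (1 - \<eta>) = ?G powr (1 - \<eta>) * (a powr ((1 - \<eta>) * (1 - \<eta>)) * (?B powr (\<eta> * (1 - \<eta>)) * b powr (\<eta> * (1 - \<eta>))))"
      using G0 B0 a(2) b by (simp add: powr_mult powr_powr)
    then have "(?S powr (1 - \<eta>)) powr (1 - \<eta>) = ?G powr ((1 - \<eta>) * (1 - \<eta>)) * (a powr ?u * (?B powr (\<eta> * ((1 - \<eta>) * (1 - \<eta>))) * b powr (\<eta> * ((1 - \<eta>) * (1 - \<eta>)))))"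
      using G0 B0 a(2) b by (simp add: powr_mult powr_powr mult.assoc)
    moreover have "?D powr (1 - \<eta>) = ?T powr (1 - \<eta>) * (?S powr (1 - \<eta>)) powr (1 - \<eta>)" using T0 by (simp only: powr_mult powr_ge_zero)
    ultimately show ?thesis by (simp only: moment_const_def powr_add mult_ac)
  qed
  have dom: "a powr ?u * b powr ?v \<le> (2 / c) * (a powr (1 - \<epsilon>) * b powr \<epsilon>)"
  proof (rule powr_domination[OF a(2) _ c eps])
    show "a \<le> 2" using d_CF_finite[OF X' Y'] unfolding a(1) by (subst (asm) ennreal_le_iff) auto
    have q: "0 \<le> (1 - \<eta>) * (1 - \<eta>)" "(1 - \<eta>) * (1 - \<eta>) \<le> 1" using eta by (auto intro: mult_le_one)
    have "?u = 1 - 3 * \<eta> + \<eta> * \<eta> * (3 - \<eta>)" by algebra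
    moreover have "0 \<le> \<eta> * \<eta> * (3 - \<eta>)" using eta by simp
    ultimately show "1 - \<epsilon> \<le> ?u" using \<eta> by linarith
    show "?u \<le> 1" using q eta by (intro mult_le_one) auto
    show "0 \<le> ?v" using q eta by simp
    have "\<eta> * ((1 - \<eta>) * (1 - \<eta>)) \<le> \<eta> * 1" using q eta by (intro mult_left_mono) auto
    moreover have "2 * \<eta> \<le> \<epsilon>" using \<eta> eps by simp
    ultimately show "?v \<le> \<epsilon>" by linarith
  qed
  have I0: "0 \<le> interpolation_const \<phi> 0 (length \<alpha>) N"
    using kernel_norm_pos[OF \<phi>, of "0 + length \<alpha>"] kernel_moment_nonneg[OF \<phi>, of N] by (simp add: interpolation_const_def)
  have M0: "0 \<le> moment_const TYPE('d) \<eta> N K" by (simp add: moment_const_def)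
  note main
  also have "s * (interpolation_const \<phi> 0 (length \<alpha>) N * (?D powr (1 - \<eta>) * b powr \<eta>)) \<le>
    s * (interpolation_const \<phi> 0 (length \<alpha>) N * (moment_const TYPE('d) \<eta> N K * ((2 / c) * (a powr (1 - \<epsilon>) * b powr \<epsilon>))))"
    unfolding eq by (intro mult_left_mono s0 I0 M0 dom)
  finally show ?thesis by (simp only: mult.assoc)
qed

section \<open>The estimates\<close>

lemma epowr_ennreal: "0 \<le> x \<Longrightarrow> epowr (ennreal x) e = ennreal (x powr e)"
  by (simp add: epowr_def)

lemma supnorm_finite:
  assumes f: "f \<in> C_b_infty"
  obtains s where "supnorm f = ennreal s" "0 \<le> s" "\<And>x. \<bar>f x\<bar> \<le> s"
proof -
  have "\<forall>\<alpha>. bounded (range (pds \<alpha> f))" using f by (simp add: C_b_infty_def)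
  from spec[OF this, of "[]"] have "bounded (range (pds [] f))" .
  then obtain B where B: "\<And>x. \<bar>f x\<bar> \<le> B" by (auto simp: bounded_iff pds_def)
  have "supnorm f \<le> ennreal B" unfolding supnorm_def by (intro SUP_least ennreal_leI B)
  then obtain s where s: "supnorm f = ennreal s" "0 \<le> s" by (cases "supnorm f") (auto simp: top_unique)
  show ?thesis
  proof
    show "\<bar>f x\<bar> \<le> s" for x using supnorm_ge[of f x] s by simp
  qed fact+
qed

lemma ennreal_estimate:
  assumes le: "\<delta> \<le> s * (C0 * (D powr e' * Q powr e))" and C: "C0 \<le> C" and s: "0 \<le> s" and D: "0 \<le> D" and Q: "0 \<le> Q"
  shows "ennreal \<delta> \<le> ennreal C * epowr (ennreal D) e' * ennreal s * epowr (ennreal Q) e"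
proof (cases "0 \<le> C")
  case True
  have "s * (C0 * (D powr e' * Q powr e)) \<le> s * (C * (D powr e' * Q powr e))" using s C by (intro mult_left_mono mult_right_mono) auto
  then have "ennreal \<delta> \<le> ennreal (C * (D powr e') * s * (Q powr e))" using le by (intro ennreal_leI) (simp add: mult_ac)
  then show ?thesis using True s D Q by (simp add: epowr_ennreal ennreal_mult)
next
  case False
  have "s * (C0 * (D powr e' * Q powr e)) \<le> s * (0 * (D powr e' * Q powr e))" using s C False by (intro mult_left_mono mult_right_mono) auto
  then show ?thesis using le by (simp add: ennreal_neg)
qed

theorem proposition3p14:
  fixes \<phi> :: "real^'d::finite \<Rightarrow> real" and k m :: nat and \<epsilon> :: real
  assumes "super_kernel \<phi>" and "0 < \<epsilon>" and "\<epsilon> < 1"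
  shows "\<exists>(C::real) (q::nat) (r::nat) (C'::real \<Rightarrow> real).
    \<forall>(M :: 'w measure) E \<Gamma> L
      (tens :: 'h::{real_inner, polish_space} list \<Rightarrow> 't::{real_inner, polish_space}) D DD.
    malliavin_framework M E \<Gamma> L tens D DD \<longrightarrow>
    (\<forall>(F :: 'd \<Rightarrow> 'w \<Rightarrow> real) G.
      (\<forall>i. F i \<in> E) \<longrightarrow> (\<forall>i. G i \<in> E) \<longrightarrow>
      (\<forall>l. Q_l M \<Gamma> L DD l F + Q_l M \<Gamma> L DD l G < \<infinity>) \<longrightarrow>
      (\<exists>p. smooth_density M (rvec F) p) \<and> (\<exists>p. smooth_density M (rvec G) p) \<and>
      (\<forall>\<alpha> :: 'd list. length \<alpha> = m \<longrightarrow>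
        (\<forall>f\<in>C_b_infty.
          ennreal \<bar>(\<integral>\<omega>. pds \<alpha> f (rvec F \<omega>) \<partial>M) - (\<integral>\<omega>. pds \<alpha> f (rvec G \<omega>) \<partial>M)\<bar>
            \<le> ennreal C * epowr (d_k M k (rvec F) (rvec G)) (1 - \<epsilon>) * supnorm f
                * epowr (Q_l M \<Gamma> L DD q F + Q_l M \<Gamma> L DD q G) \<epsilon>) \<and>
        (\<forall>pF pG x. smooth_density M (rvec F) pF \<longrightarrow> smooth_density M (rvec G) pG \<longrightarrow>
          ennreal \<bar>pds \<alpha> pF x - pds \<alpha> pG x\<bar>
            \<le> ennreal C * epowr (d_k M k (rvec F) (rvec G)) (1 - \<epsilon>)
                * epowr (Q_l M \<Gamma> L DD q F + Q_l M \<Gamma> L DD q G) \<epsilon>) \<and>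
        (\<forall>K. \<forall>f\<in>C_b_infty.
          (\<integral>\<omega>. norm (rvec F \<omega>) ^ r \<partial>M) \<le> K \<longrightarrow> (\<integral>\<omega>. norm (rvec G \<omega>) ^ r \<partial>M) \<le> K \<longrightarrow>
          ennreal \<bar>(\<integral>\<omega>. pds \<alpha> f (rvec F \<omega>) \<partial>M) - (\<integral>\<omega>. pds \<alpha> f (rvec G \<omega>) \<partial>M)\<bar>
            \<le> ennreal (C' K) * epowr (d_CF M (rvec F) (rvec G)) (1 - \<epsilon>) * supnorm f
                * epowr (Q_l M \<Gamma> L DD q F + Q_l M \<Gamma> L DD q G) \<epsilon>) \<and>
        (\<forall>pF pG x. smooth_density M (rvec F) pF \<longrightarrow> smooth_density M (rvec G) pG \<longrightarrow>
          ennreal \<bar>pds \<alpha> pF x - pds \<alpha> pG x\<bar>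
            \<le> ennreal C * epowr (d_CF M (rvec F) (rvec G)) (1 - \<epsilon>)
                * epowr (Q_l M \<Gamma> L DD q F + Q_l M \<Gamma> L DD q G) \<epsilon>)))"
proof -
  define d where "d = CARD('d)"
  define \<eta> where "\<eta> = \<epsilon> / 3"
  have eps: "0 < \<epsilon>" "\<epsilon> < 1" and \<phi>: "super_kernel \<phi>" by fact+
  have eta: "0 < \<eta>" "\<eta> \<le> \<epsilon>" using eps by (auto simp: \<eta>_def)
  obtain N0 where N0: "real (k + m + 2 * d + 1) / \<eta> \<le> real N0" using real_arch_simple by blast
  \<comment> \<open>one \<open>N\<close> for all four estimates: \<open>k + m + 1\<close> is needed for the expectations, \<open>k + m + 2 d\<close> for the densities\<close>
  define N where "N = Suc N0"
  have N: "real (k + m + 2 * d + 1) \<le> \<eta> * real N"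
  proof -
    have "real (k + m + 2 * d + 1) / \<eta> \<le> real N" using N0 by (simp add: N_def)
    then show ?thesis using eta by (simp add: pos_divide_le_eq mult.commute)
  qed
  have N\<epsilon>: "real (k + m + 2 * d + 1) \<le> \<epsilon> * real N"
    by (rule order_trans[OF N mult_right_mono[OF eta(2)]]) simp
  have N1: "1 \<le> N" by (simp add: N_def)
  obtain r0 where r0: "real d / \<eta> \<le> real r0" using real_arch_simple by blast
  define r where "r = Suc r0"
  have r: "1 \<le> r" "real d \<le> \<eta> * real r"
  proof -
    have "real d / \<eta> \<le> real r" using r0 by (simp add: r_def)
    then show "real d \<le> \<eta> * real r" using eta by (simp add: pos_divide_le_eq mult.commute)
  qed (simp add: r_def)
  \<comment> \<open>the expectations need \<open>N\<close> derivatives in addition to the \<open>m\<close> derivatives of \<open>\<partial>\<^sup>\<alpha> f\<close>\<close>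
  define n where "n = m + N"
  \<comment> \<open>one order that serves for all multi-indices of length at most \<open>n\<close>; the lower bound for \<open>Q_l\<close> needs \<open>q \<ge> 1\<close>\<close>
  define q where "q = Suc (ibp_order_upto d n)"
  have q: "q \<ge> ibp_order_upto d n" "q \<ge> 1" by (auto simp: q_def)
  define B where "B = ibp_const_upto d n q"
  have B: "1 \<le> B" unfolding B_def by (rule ibp_const_upto_ge_1)
  \<comment> \<open>a positive lower bound for \<open>Q_l\<close> at \<open>l = q\<close>\<close>
  define c :: real where "c = (1 / fact d) ^ q"
  have c: "0 < c" "c \<le> 1" by (auto simp: c_def fact_ge_1 intro!: power_le_one)
  let ?G = "density_const TYPE('d)"
  \<comment> \<open>in this order: expectations by \<open>d\<^sub>k\<close>, densities by \<open>d\<^sub>k\<close>, densities by \<open>d_CF\<close>, expectations by \<open>d_CF\<close>\<close>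
  define C1 where "C1 = interpolation_const \<phi> k m N * B powr \<epsilon>"
  define C2 where "C2 = ?G * ((real d ^ k) powr (1 - \<epsilon>) * (decay_const d N * B) powr \<epsilon>)"
  define C3 where "C3 = ?G * (decay_const d N * B) powr \<epsilon>"
  define C4 where "C4 = (\<lambda>K. interpolation_const \<phi> 0 m N * moment_const TYPE('d) \<eta> N K * (2 / c) * B powr \<epsilon>)"
  define C where "C = C1 + C2 + C3"
  have G0: "0 \<le> ?G" by (rule density_const_nonneg)
  have I: "2 \<le> interpolation_const \<phi> k m N"
    using kernel_norm_pos[OF \<phi>, of "k + m"] kernel_moment_nonneg[OF \<phi>, of N] by (simp add: interpolation_const_def)
  have C1: "0 < C1" unfolding C1_def by (rule mult_pos_pos) (use I B in auto)
  have C23: "0 \<le> C2" "0 \<le> C3" using G0 by (auto simp: C2_def C3_def)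
  have CC: "C1 \<le> C" "C2 \<le> C" "C3 \<le> C" "0 < C" using C1 C23 by (auto simp: C_def)
  show ?thesis
  proof (rule exI[of _ C], rule exI[of _ q], rule exI[of _ r], rule exI[of _ C4], intro allI impI)
    fix M :: "'w measure" and E \<Gamma> L and tens :: "'h::{real_inner, polish_space} list \<Rightarrow> 't::{real_inner, polish_space}" and D DD
      and F G :: "'d \<Rightarrow> 'w \<Rightarrow> real"
    assume fw: "malliavin_framework M E \<Gamma> L tens D DD" and F: "\<forall>i. F i \<in> E" and G: "\<forall>i. G i \<in> E"
      and Qfin: "\<forall>l. Q_l M \<Gamma> L DD l F + Q_l M \<Gamma> L DD l G < \<infinity>"
    let ?X = "rvec F" and ?Y = "rvec G"
    have QF: "Q_l M \<Gamma> L DD l F < \<infinity>" and QG: "Q_l M \<Gamma> L DD l G < \<infinity>" for l using Qfin[rule_format, of l] by auto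
    note fF = framework_random_vector[OF fw F[rule_format] QF] and fG = framework_random_vector[OF fw G[rule_format] QG]
    define Q where "Q = enn2real (Q_l M \<Gamma> L DD q F) + enn2real (Q_l M \<Gamma> L DD q G)"
    have Qeq: "Q_l M \<Gamma> L DD q F + Q_l M \<Gamma> L DD q G = ennreal Q"
      using QF[of q] QG[of q] by (simp add: Q_def ennreal_plus)
    have cQ: "c \<le> Q" using fF(4)[OF q(2)] by (simp add: Q_def c_def d_def add_increasing2)
    have Q: "0 < Q" using c cQ by linarith
    have b: "0 < B * Q" using B Q by simp
    have cb: "c \<le> B * Q" using cQ mult_right_mono[OF B, of Q] Q by linarith
    have IX: "ibp_upto M ?X n (B * Q)" and IY: "ibp_upto M ?Y n (B * Q)"
      unfolding B_def d_def by (rule fF(3) fG(3); use q in \<open>simp add: d_def Q_def\<close>)+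
    have X: "smooth_random_vector M ?X" and Y: "smooth_random_vector M ?Y" by (rule fF(1) fG(1))+
    note X' = smooth_random_vector.axioms(1)[OF X] and Y' = smooth_random_vector.axioms(1)[OF Y]
    have Bpow: "(B * Q) powr \<epsilon> = B powr \<epsilon> * Q powr \<epsilon>" using B Q by (simp add: powr_mult)
    have dBpow: "(decay_const d N * (B * Q)) powr \<epsilon> = (decay_const d N * B) powr \<epsilon> * Q powr \<epsilon>"
      using B Q decay_const_pos[of d N] by (simp add: powr_mult)
    obtain a where a: "d_CF M ?X ?Y = ennreal a" "0 \<le> a"
      using d_CF_finite[OF X' Y'] by (cases "d_CF M ?X ?Y") (auto simp: top_unique)
    have ex: "\<exists>p. smooth_density M ?X p" "\<exists>p. smooth_density M ?Y p"
      using smooth_random_vector.smooth_density_dens[OF X] smooth_random_vector.smooth_density_dens[OF Y] by blast+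
    have infinite: "ennreal C * \<infinity> = \<infinity>" "\<infinity> * epowr (ennreal Q) \<epsilon> = \<infinity>"
      using CC Q by (auto simp: epowr_ennreal ennreal_mult_top ennreal_top_mult)
    have expectation_d_k: "ennreal \<bar>(\<integral>\<omega>. pds \<alpha> f (?X \<omega>) \<partial>M) - (\<integral>\<omega>. pds \<alpha> f (?Y \<omega>) \<partial>M)\<bar>
        \<le> ennreal C * epowr (d_k M k ?X ?Y) (1 - \<epsilon>) * supnorm f * epowr (ennreal Q) \<epsilon>"
      if l: "length \<alpha> = m" and f: "f \<in> C_b_infty" for \<alpha> :: "'d list" and f
    proof -
      obtain s where s: "supnorm f = ennreal s" "0 \<le> s" "\<And>x. \<bar>f x\<bar> \<le> s" using supnorm_finite[OF f] by blast
      have ln: "length \<alpha> \<le> n" "length \<alpha> + N \<le> n" using l by (auto simp: n_def)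
      show ?thesis
      proof (cases "d_k M k ?X ?Y")
        case (real D)
        have "\<bar>(\<integral>\<omega>. pds \<alpha> f (?X \<omega>) \<partial>M) - (\<integral>\<omega>. pds \<alpha> f (?Y \<omega>) \<partial>M)\<bar> \<le>
          s * (interpolation_const \<phi> k (length \<alpha>) N * (D powr (1 - \<epsilon>) * (B * Q) powr \<epsilon>))"
          by (rule expectation_difference_le[OF \<phi> X' Y' IX IY b ln(2) eps N1 _ _ real(1) f s(3)]) (use real l N\<epsilon> in auto)
        also have "\<dots> = s * (C1 * (D powr (1 - \<epsilon>) * Q powr \<epsilon>))" unfolding Bpow C1_def l by (simp only: mult_ac)
        finally show ?thesis unfolding real(2) s(1) by (rule ennreal_estimate) (use CC s Q real in auto)
      next
        case top
        show ?thesis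
        proof (cases "s = 0")
          case True
          have "\<bar>\<integral>\<omega>. pds \<alpha> f (?X \<omega>) \<partial>M\<bar> \<le> s * (B * Q)" "\<bar>\<integral>\<omega>. pds \<alpha> f (?Y \<omega>) \<partial>M\<bar> \<le> s * (B * Q)"
            by (rule ibp_uptoD[OF IX ln(1) f s(3)] ibp_uptoD[OF IY ln(1) f s(3)])+
          then show ?thesis using True by simp
        next
          case False
          \<comment> \<open>all other factors are positive, so the product with \<open>\<infinity>\<close> is \<open>\<infinity>\<close>\<close>
          then have "ennreal C * epowr (d_k M k ?X ?Y) (1 - \<epsilon>) * supnorm f * epowr (ennreal Q) \<epsilon> = \<infinity>"
            using CC Q s by (simp add: top epowr_def ennreal_mult_top ennreal_top_mult)
          then show ?thesis by simp
        qed
      qed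
    qed
    have density_d_k: "ennreal \<bar>pds \<alpha> pF x - pds \<alpha> pG x\<bar> \<le> ennreal C * epowr (d_k M k ?X ?Y) (1 - \<epsilon>) * epowr (ennreal Q) \<epsilon>"
      if l: "length \<alpha> = m" and p: "smooth_density M ?X pF" "smooth_density M ?Y pG" for \<alpha> :: "'d list" and pF pG x
    proof (cases "d_k M k ?X ?Y")
      case (real D)
      have "\<bar>pds \<alpha> pF x - pds \<alpha> pG x\<bar> \<le> ?G * ((real d ^ k * D) powr (1 - \<epsilon>) * (decay_const d N * (B * Q)) powr \<epsilon>)"
        unfolding d_def by (rule density_difference_d_k[OF X Y p IX IY b _ eps _ _ real(1)]) (use real l N\<epsilon> in \<open>auto simp: n_def d_def\<close>)
      also have "\<dots> = 1 * (C2 * (D powr (1 - \<epsilon>) * Q powr \<epsilon>))"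
        using real(1) by (simp only: dBpow C2_def powr_mult zero_le_power of_nat_0_le_iff mult_ac mult_1)
      finally have "ennreal \<bar>pds \<alpha> pF x - pds \<alpha> pG x\<bar> \<le> ennreal C * epowr (ennreal D) (1 - \<epsilon>) * ennreal 1 * epowr (ennreal Q) \<epsilon>"
        by (rule ennreal_estimate) (use CC Q real in auto)
      then show ?thesis unfolding real(2) by simp
    next
      case top
      have "ennreal C * epowr (d_k M k ?X ?Y) (1 - \<epsilon>) * epowr (ennreal Q) \<epsilon> = \<infinity>"
        using CC Q by (simp add: top epowr_def ennreal_mult_top ennreal_top_mult)
      then show ?thesis by simp
    qed
    have expectation_d_CF: "ennreal \<bar>(\<integral>\<omega>. pds \<alpha> f (?X \<omega>) \<partial>M) - (\<integral>\<omega>. pds \<alpha> f (?Y \<omega>) \<partial>M)\<bar>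
        \<le> ennreal (C4 K) * epowr (d_CF M ?X ?Y) (1 - \<epsilon>) * supnorm f * epowr (ennreal Q) \<epsilon>"
      if l: "length \<alpha> = m" and f: "f \<in> C_b_infty" and K: "(\<integral>\<omega>. norm (?X \<omega>) ^ r \<partial>M) \<le> K" "(\<integral>\<omega>. norm (?Y \<omega>) ^ r \<partial>M) \<le> K"
      for \<alpha> :: "'d list" and f K
    proof -
      obtain s where s: "supnorm f = ennreal s" "0 \<le> s" "\<And>x. \<bar>f x\<bar> \<le> s" using supnorm_finite[OF f] by blast
      have "\<bar>(\<integral>\<omega>. pds \<alpha> f (?X \<omega>) \<partial>M) - (\<integral>\<omega>. pds \<alpha> f (?Y \<omega>) \<partial>M)\<bar> \<le>
        s * ((interpolation_const \<phi> 0 (length \<alpha>) N * moment_const TYPE('d) \<eta> N K * (2 / c)) * (a powr (1 - \<epsilon>) * (B * Q) powr \<epsilon>))"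
        by (rule expectation_difference_d_CF[OF \<phi> X Y IX IY _ c cb eps \<eta>_def N1 _ r(1) _ fF(2) fG(2) K a f s(3)])
          (use l N r in \<open>auto simp: n_def d_def\<close>)
      also have "\<dots> = s * (C4 K * (a powr (1 - \<epsilon>) * Q powr \<epsilon>))" unfolding Bpow C4_def l by (simp only: mult_ac)
      finally show ?thesis unfolding a(1) s(1) by (rule ennreal_estimate) (use s Q a in auto)
    qed
    have density_d_CF: "ennreal \<bar>pds \<alpha> pF x - pds \<alpha> pG x\<bar> \<le> ennreal C * epowr (d_CF M ?X ?Y) (1 - \<epsilon>) * epowr (ennreal Q) \<epsilon>"
      if l: "length \<alpha> = m" and p: "smooth_density M ?X pF" "smooth_density M ?Y pG" for \<alpha> :: "'d list" and pF pG x
    proof -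
      have "\<bar>pds \<alpha> pF x - pds \<alpha> pG x\<bar> \<le> ?G * (a powr (1 - \<epsilon>) * (decay_const d N * (B * Q)) powr \<epsilon>)"
        unfolding d_def by (rule density_difference_d_CF[OF X Y p IX IY b _ eps _ a]) (use l N\<epsilon> in \<open>auto simp: n_def d_def\<close>)
      also have "\<dots> = 1 * (C3 * (a powr (1 - \<epsilon>) * Q powr \<epsilon>))" unfolding dBpow C3_def by (simp only: mult_ac mult_1)
      finally have "ennreal \<bar>pds \<alpha> pF x - pds \<alpha> pG x\<bar> \<le> ennreal C * epowr (ennreal a) (1 - \<epsilon>) * ennreal 1 * epowr (ennreal Q) \<epsilon>"
        by (rule ennreal_estimate) (use CC Q a in auto)
      then show ?thesis unfolding a(1) by simp
    qed
    show "(\<exists>p. smooth_density M (rvec F) p) \<and> (\<exists>p. smooth_density M (rvec G) p) \<and>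
      (\<forall>\<alpha> :: 'd list. length \<alpha> = m \<longrightarrow>
        (\<forall>f\<in>C_b_infty.
          ennreal \<bar>(\<integral>\<omega>. pds \<alpha> f (rvec F \<omega>) \<partial>M) - (\<integral>\<omega>. pds \<alpha> f (rvec G \<omega>) \<partial>M)\<bar>
            \<le> ennreal C * epowr (d_k M k (rvec F) (rvec G)) (1 - \<epsilon>) * supnorm f
                * epowr (Q_l M \<Gamma> L DD q F + Q_l M \<Gamma> L DD q G) \<epsilon>) \<and>
        (\<forall>pF pG x. smooth_density M (rvec F) pF \<longrightarrow> smooth_density M (rvec G) pG \<longrightarrow>
          ennreal \<bar>pds \<alpha> pF x - pds \<alpha> pG x\<bar>
            \<le> ennreal C * epowr (d_k M k (rvec F) (rvec G)) (1 - \<epsilon>)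
                * epowr (Q_l M \<Gamma> L DD q F + Q_l M \<Gamma> L DD q G) \<epsilon>) \<and>
        (\<forall>K. \<forall>f\<in>C_b_infty.
          (\<integral>\<omega>. norm (rvec F \<omega>) ^ r \<partial>M) \<le> K \<longrightarrow> (\<integral>\<omega>. norm (rvec G \<omega>) ^ r \<partial>M) \<le> K \<longrightarrow>
          ennreal \<bar>(\<integral>\<omega>. pds \<alpha> f (rvec F \<omega>) \<partial>M) - (\<integral>\<omega>. pds \<alpha> f (rvec G \<omega>) \<partial>M)\<bar>
            \<le> ennreal (C4 K) * epowr (d_CF M (rvec F) (rvec G)) (1 - \<epsilon>) * supnorm f
                * epowr (Q_l M \<Gamma> L DD q F + Q_l M \<Gamma> L DD q G) \<epsilon>) \<and>
        (\<forall>pF pG x. smooth_density M (rvec F) pF \<longrightarrow> smooth_density M (rvec G) pG \<longrightarrow>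
          ennreal \<bar>pds \<alpha> pF x - pds \<alpha> pG x\<bar>
            \<le> ennreal C * epowr (d_CF M (rvec F) (rvec G)) (1 - \<epsilon>)
                * epowr (Q_l M \<Gamma> L DD q F + Q_l M \<Gamma> L DD q G) \<epsilon>))"
      unfolding Qeq
      by (intro conjI ex allI ballI impI expectation_d_k density_d_k expectation_d_CF density_d_CF)
  qed
qed

end
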